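(* Fix $\alpha\in(0,1)$. Assume that (A1) $n,p\to\infty$ with $p/n\to c\in(0,1)$; (A2) $0<\lim_{p\to\infty}a_i<\infty$ for $i=1,\dots,6$; (A3) $0<\lim n^{1/2}\Delta^2<\infty$, $0<\lim n^{1/2}\Delta_I^2<\infty$ and $0<\lim n^{1/2}\Delta_\Sigma^2<\infty$ (limits as $n,p\to\infty$); and that $(\mu,\Sigma)\in\Omega_0$, i.e. $\dfrac{\Delta^2}{\Delta_I^2}=\dfrac{1}{\sqrt{(1-c)a_2}}$. Let $\rho^\ast=\rho^\ast(c,a_1,a_2)$ and $\hat\rho^\ast=\rho^\ast(\hat c,\hat a_1,\hat a_2)$. Then $$\Pr\left(\frac{T(\hat\rho^\ast)}{\sigma(\hat\rho^\ast,\hat c,\hat a_1,\hat a_2)}\ge z(\alpha)\right)-\Phi\left(\frac{\sqrt{n(1-c)}\,\Delta^2}{\sqrt{c\left(a_1\sqrt{(1-c)/a_2}+1\right)}}-z(\alpha)\right)\to0 ,$$ and thus the power of the test based on $T(\hat\rho^\ast)$ is asymptotically equivalent to that of the test based on $T(\rho^\ast)$, i.e. $$\Pr\left(\frac{T(\hat\rho^\ast)}{\sigma(\hat\rho^\ast,\hat c,\hat a_1,\hat a_2)}\ge z(\alpha)\right)-\Pr\left(\frac{T(\rho^\ast)}{\sigma(\rho^\ast,\hat c,\hat a_1,\hat a_2)}\ge z(\alpha)\right)\to0 .$$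
   Context: For each $(N,p)$, $x_1,\dots,x_N$ are independent $p$-dimensional random vectors with distribution $\mathcal N_p(\mu,\Sigma)$, $\Sigma$ positive definite; $\mu_0\in\mathbb R^p$ is a given vector and one tests $H_0:\mu=\mu_0$ against $H_1:\mu\ne\mu_0$. Put $n=N-1$, $\hat c=p/n$, $\bar x=\frac1N\sum_{i=1}^N x_i$, $S=\frac1n\sum_{i=1}^N(x_i-\bar x)(x_i-\bar x)'$. The quantities $\mu,\mu_0,\Sigma$ may depend on $(n,p)$. Hotelling's statistic: $T^2=N(\bar x-\mu_0)'S^{-1}(\bar x-\mu_0)$. Dempster's statistic: $D_n=\dfrac{N(\bar x-\mu_0)'(\bar x-\mu_0)}{\operatorname{tr}S}$. For a weight $\rho\in[0,1]$ (possibly random): $T(\rho)=\rho\sqrt n\left(\frac{T^2}{n}-\frac{p}{N-p}\right)+(1-\rho)\sqrt n(D_n-1)$. $a_i=\operatorname{tr}\Sigma^i/p$; $\hat a_1=\operatorname{tr}S/p$, $\hat a_2=\frac{n^2}{p(n+2)(n-1)}\left\{\operatorname{tr}S^2-\frac{(\operatorname{tr}S)^2}{n}\right\}$. $\Delta^2=(\mu-\mu_0)'\Sigma^{-1}(\mu-\mu_0)$, $\Delta_I^2=(\mu-\mu_0)'(\mu-\mu_0)$, $\Delta_\Sigma^2=(\mu-\mu_0)'\Sigma(\mu-\mu_0)$. $\sigma(\rho,c,a_1,a_2)>0$ is given by $\sigma^2(\rho,c,a_1,a_2)=\rho^2\frac{2c}{(1-c)^3}+(1-\rho)^2\frac{2a_2}{ca_1^2}+2\rho(1-\rho)\frac{2}{1-c}$,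 and $$\rho^\ast(c,a_1,a_2)=\left(\frac{a_1c\sqrt{a_2(1-c)}}{a_2(1-c)^2}+1\right)^{-1}.$$ $\Phi$ is the standard normal distribution function and $z(\alpha)$ is the upper $100\alpha$ percentile of $\mathcal N(0,1)$. *)

theory Defs
  imports
    "HOL-Probability.Probability"
    "Jordan_Normal_Form.Determinant"
    "Jordan_Normal_Form.Gauss_Jordan_Elimination"
begin

text \<open>The dimension p varies along the asymptotic sequence, so vectors and matrices are those of
  Jordan_Normal_Form (carriers \<^term>\<open>carrier_vec p\<close> and \<^term>\<open>carrier_mat p p\<close>), not the
  type-indexed ones of HOL-Analysis, whose clashing notation is switched off here.\<close>

unbundle no vec_syntax
no_notation inner (infix \<open>\<bullet>\<close> 70)
hide_type (open) Finite_Cartesian_Product.vec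
hide_const (open) Finite_Cartesian_Product.vec Determinants.det Determinants.trace

text \<open>\<^const>\<open>mat_inverse\<close> returns an option; for singular A the value is unspecified.\<close>

definition mat_inv :: "real mat \<Rightarrow> real mat" where
  "mat_inv A = the (mat_inverse A)"

definition mat_tr :: "real mat \<Rightarrow> real" where
  "mat_tr A = (\<Sum>i<dim_row A. A $$ (i, i))"

definition quad_form :: "real mat \<Rightarrow> real vec \<Rightarrow> real" where
  "quad_form A v = v \<bullet> (A *\<^sub>v v)"

definition pos_def :: "nat \<Rightarrow> real mat \<Rightarrow> bool" where
  "pos_def p A \<longleftrightarrow> A \<in> carrier_mat p p \<and> transpose_mat A = A \<and>
     (\<forall>v \<in> carrier_vec p. v \<noteq> 0\<^sub>v p \<longrightarrow> 0 < quad_form A v)"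

text \<open>Random p-vectors are random elements of the product space over the coordinates
  \<^term>\<open>{..<p}\<close>; \<^term>\<open>vec p x\<close> is the vector with the coordinates of x.\<close>

abbreviation lborel_vec :: "nat \<Rightarrow> (nat \<Rightarrow> real) measure" where
  "lborel_vec p \<equiv> (\<Pi>\<^sub>M j\<in>{..<p}. lborel)"

definition mvn_density :: "nat \<Rightarrow> real vec \<Rightarrow> real mat \<Rightarrow> real vec \<Rightarrow> real" where
  "mvn_density p \<mu> \<Sigma> y =
     1 / sqrt ((2 * pi) ^ p * det \<Sigma>) * exp (- quad_form (mat_inv \<Sigma>) (y - \<mu>) / 2)"

definition mvn_distributed ::
  "'w measure \<Rightarrow> nat \<Rightarrow> real vec \<Rightarrow> real mat \<Rightarrow> ('w \<Rightarrow> nat \<Rightarrow> real) \<Rightarrow> bool" where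
  "mvn_distributed M p \<mu> \<Sigma> X \<longleftrightarrow>
     distributed M (lborel_vec p) X (\<lambda>x. ennreal (mvn_density p \<mu> \<Sigma> (vec p x)))"

definition Phi :: "real \<Rightarrow> real" where
  "Phi x = cdf std_normal_distribution x"

definition z_upper :: "real \<Rightarrow> real" where
  "z_upper \<alpha> = (THE z. measure std_normal_distribution {z..} = \<alpha>)"

definition sample_mean :: "nat \<Rightarrow> nat \<Rightarrow> (nat \<Rightarrow> real vec) \<Rightarrow> real vec" where
  "sample_mean N p x = vec p (\<lambda>j. (\<Sum>i=1..N. x i $ j) / real N)"

definition sample_cov :: "nat \<Rightarrow> nat \<Rightarrow> (nat \<Rightarrow> real vec) \<Rightarrow> real mat" where
  "sample_cov N p x = mat p p (\<lambda>(j, l).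
     (\<Sum>i=1..N. (x i - sample_mean N p x) $ j * (x i - sample_mean N p x) $ l) / (real N - 1))"

definition hotelling_T2 :: "nat \<Rightarrow> nat \<Rightarrow> real vec \<Rightarrow> (nat \<Rightarrow> real vec) \<Rightarrow> real" where
  "hotelling_T2 N p \<mu>0 x =
     real N * quad_form (mat_inv (sample_cov N p x)) (sample_mean N p x - \<mu>0)"

definition dempster_D :: "nat \<Rightarrow> nat \<Rightarrow> real vec \<Rightarrow> (nat \<Rightarrow> real vec) \<Rightarrow> real" where
  "dempster_D N p \<mu>0 x =
     real N * ((sample_mean N p x - \<mu>0) \<bullet> (sample_mean N p x - \<mu>0)) / mat_tr (sample_cov N p x)"

definition T_stat :: "nat \<Rightarrow> nat \<Rightarrow> real vec \<Rightarrow> real \<Rightarrow> (nat \<Rightarrow> real vec) \<Rightarrow> real" where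
  "T_stat N p \<mu>0 \<rho> x = (let n = real N - 1 in
     \<rho> * sqrt n * (hotelling_T2 N p \<mu>0 x / n - real p / (real N - real p)) +
     (1 - \<rho>) * sqrt n * (dempster_D N p \<mu>0 x - 1))"

definition a_hat1 :: "nat \<Rightarrow> nat \<Rightarrow> (nat \<Rightarrow> real vec) \<Rightarrow> real" where
  "a_hat1 N p x = mat_tr (sample_cov N p x) / real p"

definition a_hat2 :: "nat \<Rightarrow> nat \<Rightarrow> (nat \<Rightarrow> real vec) \<Rightarrow> real" where
  "a_hat2 N p x = (let n = real N - 1; S = sample_cov N p x in
     n\<^sup>2 / (real p * (n + 2) * (n - 1)) * (mat_tr (S ^\<^sub>m 2) - (mat_tr S)\<^sup>2 / n))"

definition a_moment :: "nat \<Rightarrow> nat \<Rightarrow> real mat \<Rightarrow> real" where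
  "a_moment i p \<Sigma> = mat_tr (\<Sigma> ^\<^sub>m i) / real p"

definition Delta_sq :: "real vec \<Rightarrow> real vec \<Rightarrow> real mat \<Rightarrow> real" where
  "Delta_sq \<mu> \<mu>0 \<Sigma> = quad_form (mat_inv \<Sigma>) (\<mu> - \<mu>0)"

definition Delta_I_sq :: "real vec \<Rightarrow> real vec \<Rightarrow> real" where
  "Delta_I_sq \<mu> \<mu>0 = (\<mu> - \<mu>0) \<bullet> (\<mu> - \<mu>0)"

definition Delta_Sigma_sq :: "real vec \<Rightarrow> real vec \<Rightarrow> real mat \<Rightarrow> real" where
  "Delta_Sigma_sq \<mu> \<mu>0 \<Sigma> = quad_form \<Sigma> (\<mu> - \<mu>0)"

definition sigma_T :: "real \<Rightarrow> real \<Rightarrow> real \<Rightarrow> real \<Rightarrow> real" where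
  "sigma_T \<rho> c a1 a2 = sqrt
     (\<rho>\<^sup>2 * (2 * c / (1 - c) ^ 3) + (1 - \<rho>)\<^sup>2 * (2 * a2 / (c * a1\<^sup>2)) +
      2 * \<rho> * (1 - \<rho>) * (2 / (1 - c)))"

definition rho_star :: "real \<Rightarrow> real \<Rightarrow> real \<Rightarrow> real" where
  "rho_star c a1 a2 = inverse (a1 * c * sqrt (a2 * (1 - c)) / (a2 * (1 - c)\<^sup>2) + 1)"

definition rho_hat :: "nat \<Rightarrow> nat \<Rightarrow> (nat \<Rightarrow> real vec) \<Rightarrow> real" where
  "rho_hat N p x = rho_star (real p / (real N - 1)) (a_hat1 N p x) (a_hat2 N p x)"

definition Omega0 :: "nat \<Rightarrow> real \<Rightarrow> real vec \<Rightarrow> (real vec \<times> real mat) set" where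
  "Omega0 p c \<mu>0 = {(\<mu>, \<Sigma>).
     Delta_sq \<mu> \<mu>0 \<Sigma> / Delta_I_sq \<mu> \<mu>0 = 1 / sqrt ((1 - c) * a_moment 2 p \<Sigma>)}"

text \<open>The standardized statistic with weight \<open>\<rho>\<close>; c, a1 and a2 in the standard deviation are
  always replaced by their estimators.\<close>

definition T_standardized :: "nat \<Rightarrow> nat \<Rightarrow> real vec \<Rightarrow> real \<Rightarrow> (nat \<Rightarrow> real vec) \<Rightarrow> real" where
  "T_standardized N p \<mu>0 \<rho> x =
     T_stat N p \<mu>0 \<rho> x / sigma_T \<rho> (real p / (real N - 1)) (a_hat1 N p x) (a_hat2 N p x)"

end

theory Submission
  imports Defs "Jordan_Normal_Form.Spectral_Radius"
begin

text \<open>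
  The distribution of the data is first made explicit. With a square root of \<open>\<Sigma>\<close> and an
  orthogonal change of the observation index that maps the constant vector to the last coordinate,
  the sample becomes an array h of independent standard normal variables in which row n carries the
  sample mean and the rows below n carry the residuals (\<open>nn_integral_data\<close>). Row n, shifted by a
  multiple of the whitened mean difference, is the vector z. In these coordinates Hotelling's
  statistic is a multiple of the quadratic form in z given by the inverse of the Gram matrix of
  the residual rows, and |z|^2 divided by this form is a chi-square variable V with
  n - p + 1 degrees of freedom that is independent of z (\<open>schur_chi_joint_law\<close>): by rotation
  invariance z may be put on an axis, and V is then the squared distance of one column of
  residuals to the span of the others.

  Up to errors that vanish in mean square, both quadratic statistics are therefore deterministic
  shifts plus linear combinations of three weighted sums of independent centred chi-squares: U1 and U2
  from row n, with weights 1 and the eigenvalues of \<open>\<Sigma>\<close>, and U3 from V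
  (\<open>T_stat_decomposition\<close>). The characteristic function of such a combination is an explicit
  product and converges to the Gaussian one as soon as the cubes of the weights are negligible
  (\<open>chisq_cf_prod_tendsto\<close>, \<open>clt\<close>). The trace estimators of the
  covariance moments are consistent (\<open>a_hat1_limit\<close>, \<open>a_hat2_limit\<close>). A weight
  that converges in probability enters only as a factor of variables that are bounded in probability,
  so it may be replaced by its limit; the standard deviation in the denominator is exactly the one
  of the limit (\<open>variance_identity\<close>). Hence the power with any consistent weight
  converges, and the limit depends on the weight only through its own limit (\<open>power_limit\<close>).

  The estimated optimal weight and the optimal weight formed from the true moments have the same limit,
  which gives the equivalence of the two tests. On \<open>Omega0\<close> the two shifts are
  proportional, and the optimal weight balances them so that the standardized shift collapses to the
  closed form in the first claim (\<open>optimal_weight\<close>).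
\<close>

section \<open>Convergence and boundedness in probability\<close>

text \<open>The exceptional events only have to contain the large deviations, which makes the notion usable
  for statistics whose measurability has not been established.\<close>

definition tends_in_prob ::
  "(nat \<Rightarrow> 'a measure) \<Rightarrow> (nat \<Rightarrow> 'a \<Rightarrow> 'b::metric_space) \<Rightarrow> 'b \<Rightarrow> bool" where
  "tends_in_prob M Y y \<longleftrightarrow> (\<forall>e>0. \<forall>\<^sub>F k in sequentially. \<exists>A\<in>sets (M k).
     emeasure (M k) A \<le> ennreal e \<and> (\<forall>\<omega>\<in>space (M k) - A. dist (Y k \<omega>) y < e))"

definition bounded_in_prob :: "(nat \<Rightarrow> 'a measure) \<Rightarrow> (nat \<Rightarrow> 'a \<Rightarrow> real) \<Rightarrow> bool" where
  "bounded_in_prob M Y \<longleftrightarrow> (\<forall>e>0. \<exists>B. \<forall>\<^sub>F k in sequentially. \<exists>A\<in>sets (M k).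
     emeasure (M k) A \<le> ennreal e \<and> (\<forall>\<omega>\<in>space (M k) - A. \<bar>Y k \<omega>\<bar> \<le> B))"

lemma tends_in_prob_const:
  assumes "c \<longlonglongrightarrow> y"
  shows "tends_in_prob M (\<lambda>k \<omega>. c k) y"
  unfolding tends_in_prob_def
proof (intro allI impI)
  fix e :: real assume "e > 0"
  with assms have "\<forall>\<^sub>F k in sequentially. dist (c k) y < e" by (simp add: tendstoD)
  then show "\<forall>\<^sub>F k in sequentially. \<exists>A\<in>sets (M k).
     emeasure (M k) A \<le> ennreal e \<and> (\<forall>\<omega>\<in>space (M k) - A. dist (c k) y < e)"
    by eventually_elim (auto intro!: bexI[of _ "{}"])
qed

lemma tends_in_prob_Pair:
  assumes "tends_in_prob M Y y" "tends_in_prob M Z z"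
  shows "tends_in_prob M (\<lambda>k \<omega>. (Y k \<omega>, Z k \<omega>)) (y, z)"
  unfolding tends_in_prob_def
proof (intro allI impI)
  fix e :: real assume "e > 0"
  hence e: "e / 2 > 0" by simp
  have "\<forall>\<^sub>F k in sequentially. \<exists>A\<in>sets (M k). emeasure (M k) A \<le> ennreal (e/2) \<and>
      (\<forall>\<omega>\<in>space (M k) - A. dist (Y k \<omega>) y < e/2)"
    using assms(1) e unfolding tends_in_prob_def by blast
  moreover have "\<forall>\<^sub>F k in sequentially. \<exists>A\<in>sets (M k). emeasure (M k) A \<le> ennreal (e/2) \<and>
      (\<forall>\<omega>\<in>space (M k) - A. dist (Z k \<omega>) z < e/2)"
    using assms(2) e unfolding tends_in_prob_def by blast
  ultimately show "\<forall>\<^sub>F k in sequentially. \<exists>A\<in>sets (M k). emeasure (M k) A \<le> ennreal e \<and>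
      (\<forall>\<omega>\<in>space (M k) - A. dist (Y k \<omega>, Z k \<omega>) (y, z) < e)"
  proof eventually_elim
    case (elim k)
    then obtain A B where A: "A \<in> sets (M k)" "emeasure (M k) A \<le> ennreal (e/2)"
        "\<And>\<omega>. \<omega>\<in>space (M k) - A \<Longrightarrow> dist (Y k \<omega>) y < e/2"
      and B: "B \<in> sets (M k)" "emeasure (M k) B \<le> ennreal (e/2)"
        "\<And>\<omega>. \<omega>\<in>space (M k) - B \<Longrightarrow> dist (Z k \<omega>) z < e/2" by blast
    have "emeasure (M k) (A \<union> B) \<le> emeasure (M k) A + emeasure (M k) B"
      using A B by (intro emeasure_subadditive) auto
    also have "\<dots> \<le> ennreal (e/2) + ennreal (e/2)" using A B by (intro add_mono) auto
    also have "\<dots> = ennreal e" using e by (subst ennreal_plus[symmetric]) auto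
    finally have 1: "emeasure (M k) (A \<union> B) \<le> ennreal e" .
    have "dist (Y k \<omega>, Z k \<omega>) (y, z) < e" if "\<omega> \<in> space (M k) - (A \<union> B)" for \<omega>
    proof -
      have "dist (Y k \<omega>, Z k \<omega>) (y, z) \<le> dist (Y k \<omega>) y + dist (Z k \<omega>) z"
        unfolding dist_Pair_Pair by (intro sqrt_sum_squares_le_sum) auto
      also have "\<dots> < e/2 + e/2" using A(3)[of \<omega>] B(3)[of \<omega>] that by (intro add_strict_mono) auto
      finally show ?thesis by simp
    qed
    with 1 A(1) B(1) show ?case by (intro bexI[of _ "A \<union> B"]) auto
  qed
qed

lemma tends_in_prob_isCont:
  assumes "tends_in_prob M Y y" "isCont f y"
  shows "tends_in_prob M (\<lambda>k \<omega>. f (Y k \<omega>)) (f y)"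
  unfolding tends_in_prob_def
proof (intro allI impI)
  fix e :: real assume e: "e > 0"
  obtain d where d: "d > 0" "\<And>x. dist x y < d \<Longrightarrow> dist (f x) (f y) < e"
    using assms(2) e unfolding continuous_at_eps_delta by blast
  have "min d e > 0" using d e by simp
  with assms(1) have "\<forall>\<^sub>F k in sequentially. \<exists>A\<in>sets (M k). emeasure (M k) A \<le> ennreal (min d e) \<and>
      (\<forall>\<omega>\<in>space (M k) - A. dist (Y k \<omega>) y < min d e)"
    unfolding tends_in_prob_def by blast
  then show "\<forall>\<^sub>F k in sequentially. \<exists>A\<in>sets (M k). emeasure (M k) A \<le> ennreal e \<and>
      (\<forall>\<omega>\<in>space (M k) - A. dist (f (Y k \<omega>)) (f y) < e)"
  proof eventually_elim
    case (elim k)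
    then obtain A where A: "A \<in> sets (M k)" "emeasure (M k) A \<le> ennreal (min d e)"
        "\<And>\<omega>. \<omega>\<in>space (M k) - A \<Longrightarrow> dist (Y k \<omega>) y < min d e" by blast
    have "ennreal (min d e) \<le> ennreal e" by (intro ennreal_leI) auto
    with A d show ?case by (intro bexI[of _ A]) (auto intro: order_trans)
  qed
qed

lemma tends_in_prob_compose2:
  assumes "tends_in_prob M Y y" "tends_in_prob M Z z" "isCont (\<lambda>u. f (fst u) (snd u)) (y, z)"
  shows "tends_in_prob M (\<lambda>k \<omega>. f (Y k \<omega>) (Z k \<omega>)) (f y z)"
  using tends_in_prob_isCont[OF tends_in_prob_Pair[OF assms(1,2)] assms(3)] by simp

lemma tends_in_prob_add:
  fixes y :: "'b :: real_normed_vector"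
  assumes "tends_in_prob M Y y" "tends_in_prob M Z z"
  shows "tends_in_prob M (\<lambda>k \<omega>. Y k \<omega> + Z k \<omega>) (y + z)"
  by (rule tends_in_prob_compose2[OF assms]) (intro continuous_intros)

lemma tends_in_prob_diff:
  fixes y :: "'b :: real_normed_vector"
  assumes "tends_in_prob M Y y" "tends_in_prob M Z z"
  shows "tends_in_prob M (\<lambda>k \<omega>. Y k \<omega> - Z k \<omega>) (y - z)"
  by (rule tends_in_prob_compose2[OF assms]) (intro continuous_intros)

lemma tends_in_prob_mult:
  fixes y :: real
  assumes "tends_in_prob M Y y" "tends_in_prob M Z z"
  shows "tends_in_prob M (\<lambda>k \<omega>. Y k \<omega> * Z k \<omega>) (y * z)"
  by (rule tends_in_prob_compose2[OF assms]) (intro continuous_intros)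

lemma tends_in_prob_divide:
  fixes y :: real
  assumes "tends_in_prob M Y y" "tends_in_prob M Z z" "z \<noteq> 0"
  shows "tends_in_prob M (\<lambda>k \<omega>. Y k \<omega> / Z k \<omega>) (y / z)"
  by (rule tends_in_prob_compose2[OF assms(1,2)])
     (use assms(3) in \<open>auto intro!: continuous_intros\<close>)

text \<open>The decompositions of the statistics hold only off the null set of degenerate samples.\<close>

lemma tends_in_prob_AE_cong:
  assumes "tends_in_prob M Y y" "\<forall>\<^sub>F k in sequentially. AE \<omega> in M k. Y k \<omega> = Z k \<omega>"
  shows "tends_in_prob M Z y"
  unfolding tends_in_prob_def
proof (intro allI impI)
  fix e :: real assume e: "e > 0"
  from assms(1) e have "\<forall>\<^sub>F k in sequentially. \<exists>A\<in>sets (M k). emeasure (M k) A \<le> ennreal e \<and>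
      (\<forall>\<omega>\<in>space (M k) - A. dist (Y k \<omega>) y < e)" unfolding tends_in_prob_def by blast
  with assms(2) show "\<forall>\<^sub>F k in sequentially. \<exists>A\<in>sets (M k). emeasure (M k) A \<le> ennreal e \<and>
      (\<forall>\<omega>\<in>space (M k) - A. dist (Z k \<omega>) y < e)"
  proof eventually_elim
    case (elim k)
    then obtain A where A: "A \<in> sets (M k)" "emeasure (M k) A \<le> ennreal e"
        "\<And>\<omega>. \<omega>\<in>space (M k) - A \<Longrightarrow> dist (Y k \<omega>) y < e" by blast
    obtain B where B: "{\<omega>\<in>space (M k). \<not> Y k \<omega> = Z k \<omega>} \<subseteq> B" "emeasure (M k) B = 0" "B \<in> sets (M k)"
      using AE_E[OF elim(1)] by blast
    have "emeasure (M k) (A \<union> B) \<le> emeasure (M k) A + emeasure (M k) B"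
      using A B by (intro emeasure_subadditive) auto
    also have "\<dots> \<le> ennreal e" using A B by simp
    finally have "emeasure (M k) (A \<union> B) \<le> ennreal e" .
    moreover have "dist (Z k \<omega>) y < e" if "\<omega> \<in> space (M k) - (A \<union> B)" for \<omega>
    proof -
      from that B(1) have "Y k \<omega> = Z k \<omega>" by auto
      with A(3)[of \<omega>] that show ?thesis by auto
    qed
    ultimately show ?case using A(1) B(3) by (intro bexI[of _ "A \<union> B"]) auto
  qed
qed

text \<open>This is how an estimated coefficient is replaced by its limit: the difference of the two tends
  to zero and multiplies a tight sequence.\<close>

lemma tends_in_prob_bounded_mult:
  assumes "tends_in_prob M Y (0::real)" "bounded_in_prob M Z"
  shows "tends_in_prob M (\<lambda>k \<omega>. Y k \<omega> * Z k \<omega>) 0"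
  unfolding tends_in_prob_def
proof (intro allI impI)
  fix e :: real assume "e > 0"
  hence e: "e / 2 > 0" by simp
  obtain B0 where B0: "\<forall>\<^sub>F k in sequentially. \<exists>A\<in>sets (M k).
     emeasure (M k) A \<le> ennreal (e/2) \<and> (\<forall>\<omega>\<in>space (M k) - A. \<bar>Z k \<omega>\<bar> \<le> B0)"
    using assms(2) e unfolding bounded_in_prob_def by blast
  define B where "B = max 1 B0"
  have B: "B > 0" "B0 \<le> B" by (auto simp: B_def)
  define d where "d = min (e/2) (e / (2*B))"
  have d: "d > 0" "d \<le> e/2" "d * B \<le> e/2" using e B
    by (auto simp: d_def min_def field_simps)
  from assms(1) d have "\<forall>\<^sub>F k in sequentially. \<exists>A\<in>sets (M k). emeasure (M k) A \<le> ennreal d \<and>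
      (\<forall>\<omega>\<in>space (M k) - A. dist (Y k \<omega>) 0 < d)" unfolding tends_in_prob_def by blast
  with B0 show "\<forall>\<^sub>F k in sequentially. \<exists>A\<in>sets (M k). emeasure (M k) A \<le> ennreal e \<and>
      (\<forall>\<omega>\<in>space (M k) - A. dist (Y k \<omega> * Z k \<omega>) 0 < e)"
  proof eventually_elim
    case (elim k)
    then obtain A C where A: "A \<in> sets (M k)" "emeasure (M k) A \<le> ennreal (e/2)"
        "\<And>\<omega>. \<omega>\<in>space (M k) - A \<Longrightarrow> \<bar>Z k \<omega>\<bar> \<le> B0"
      and C: "C \<in> sets (M k)" "emeasure (M k) C \<le> ennreal d"
        "\<And>\<omega>. \<omega>\<in>space (M k) - C \<Longrightarrow> \<bar>Y k \<omega>\<bar> < d" by (auto simp: dist_real_def)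
    have "emeasure (M k) (A \<union> C) \<le> emeasure (M k) A + emeasure (M k) C"
      using A C by (intro emeasure_subadditive) auto
    also have "\<dots> \<le> ennreal (e/2) + ennreal (e/2)"
      using A C d by (intro add_mono) (auto intro: order_trans[OF _ ennreal_leI])
    also have "\<dots> = ennreal e" using e by (subst ennreal_plus[symmetric]) auto
    finally have 1: "emeasure (M k) (A \<union> C) \<le> ennreal e" .
    have "dist (Y k \<omega> * Z k \<omega>) 0 < e" if "\<omega> \<in> space (M k) - (A \<union> C)" for \<omega>
    proof -
      have "\<bar>Y k \<omega> * Z k \<omega>\<bar> \<le> d * B" unfolding abs_mult
        using A(3)[of \<omega>] C(3)[of \<omega>] that d B by (intro mult_mono) auto
      also have "\<dots> < e" using d e by simp
      finally show ?thesis by (simp add: dist_real_def)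
    qed
    with 1 A(1) C(1) show ?case by (intro bexI[of _ "A \<union> C"]) auto
  qed
qed

lemma emeasure_sq_tail:
  assumes [measurable]: "Y \<in> borel_measurable M" and B: "B > 0"
    and le: "(\<integral>\<^sup>+\<omega>. ennreal ((Y \<omega>)\<^sup>2) \<partial>M) \<le> ennreal b"
  shows "emeasure M {\<omega>\<in>space M. \<bar>Y \<omega>\<bar> \<ge> B} \<le> ennreal (b / B\<^sup>2)"
proof -
  have "emeasure M {\<omega>\<in>space M. \<bar>Y \<omega>\<bar> \<ge> B} = emeasure M ({\<omega>\<in>space M. 1 \<le> ennreal (1 / B\<^sup>2) * ennreal ((Y \<omega>)\<^sup>2)})"
  proof (intro arg_cong[where f="emeasure M"] Collect_cong conj_cong refl)
    fix \<omega>
    have "1 \<le> ennreal (1 / B\<^sup>2) * ennreal ((Y \<omega>)\<^sup>2) \<longleftrightarrow> ennreal 1 \<le> ennreal ((Y \<omega>)\<^sup>2 / B\<^sup>2)"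
      by (subst ennreal_mult[symmetric]) auto
    also have "\<dots> \<longleftrightarrow> B\<^sup>2 \<le> (Y \<omega>)\<^sup>2" using B by (subst ennreal_le_iff) (auto simp: field_simps)
    also have "\<dots> \<longleftrightarrow> B \<le> \<bar>Y \<omega>\<bar>" using B by (simp add: abs_le_square_iff[symmetric])
    finally show "(B \<le> \<bar>Y \<omega>\<bar>) = (1 \<le> ennreal (1 / B\<^sup>2) * ennreal ((Y \<omega>)\<^sup>2))" ..
  qed
  also have "\<dots> \<le> ennreal (1 / B\<^sup>2) * (\<integral>\<^sup>+\<omega>. ennreal ((Y \<omega>)\<^sup>2) * indicator (space M) \<omega> \<partial>M)"
    using nn_integral_Markov_inequality[of "\<lambda>\<omega>. ennreal ((Y \<omega>)\<^sup>2)" "space M" M "ennreal (1 / B\<^sup>2)"] by simp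
  also have "(\<integral>\<^sup>+\<omega>. ennreal ((Y \<omega>)\<^sup>2) * indicator (space M) \<omega> \<partial>M) = (\<integral>\<^sup>+\<omega>. ennreal ((Y \<omega>)\<^sup>2) \<partial>M)"
    by (intro nn_integral_cong) auto
  also have "ennreal (1 / B\<^sup>2) * \<dots> \<le> ennreal (1 / B\<^sup>2) * ennreal b" by (intro mult_left_mono le) auto
  also have "\<dots> = ennreal (b / B\<^sup>2)"
    by (subst ennreal_mult'[symmetric]) auto
  finally show ?thesis .
qed

text \<open>Chebyshev's inequality. Second moments are written with the nonnegative integral, so that no
  integrability has to be shown beforehand.\<close>

lemma tends_in_prob_L2:
  assumes "\<forall>\<^sub>F k in sequentially. Y k \<in> borel_measurable (M k) \<and>
       (\<integral>\<^sup>+\<omega>. ennreal ((Y k \<omega>)\<^sup>2) \<partial>M k) \<le> ennreal (b k)"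
    and b: "b \<longlonglongrightarrow> (0::real)"
  shows "tends_in_prob M Y (0::real)"
  unfolding tends_in_prob_def
proof (intro allI impI)
  fix e :: real assume e: "e > 0"
  have "\<forall>\<^sub>F k in sequentially. b k < e * e\<^sup>2" using b e by (intro order_tendstoD) auto
  with assms(1) show "\<forall>\<^sub>F k in sequentially. \<exists>A\<in>sets (M k). emeasure (M k) A \<le> ennreal e \<and>
      (\<forall>\<omega>\<in>space (M k) - A. dist (Y k \<omega>) 0 < e)"
  proof eventually_elim
    case (elim k)
    then have [measurable]: "Y k \<in> borel_measurable (M k)" by simp
    have "emeasure (M k) {\<omega>\<in>space (M k). \<bar>Y k \<omega>\<bar> \<ge> e} \<le> ennreal (b k / e\<^sup>2)"
      using elim e by (intro emeasure_sq_tail) auto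
    also have "\<dots> \<le> ennreal e" using elim e by (intro ennreal_leI) (simp add: field_simps)
    finally show ?case
      by (intro bexI[of _ "{\<omega>\<in>space (M k). \<bar>Y k \<omega>\<bar> \<ge> e}"]) (auto simp: dist_real_def)
  qed
qed

lemma bounded_in_prob_L2:
  assumes "\<forall>\<^sub>F k in sequentially. Y k \<in> borel_measurable (M k) \<and>
       (\<integral>\<^sup>+\<omega>. ennreal ((Y k \<omega>)\<^sup>2) \<partial>M k) \<le> ennreal b"
  shows "bounded_in_prob M Y"
  unfolding bounded_in_prob_def
proof (intro allI impI)
  fix e :: real assume e: "e > 0"
  define B where "B = sqrt (\<bar>b\<bar> / e) + 1"
  have B: "B > 0" unfolding B_def using e by (intro add_nonneg_pos) auto
  have "\<bar>b\<bar> / e = (sqrt (\<bar>b\<bar> / e))\<^sup>2" using e by simp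
  also have "\<dots> \<le> B\<^sup>2" unfolding B_def using e by (intro power_mono) auto
  finally have Bb: "b / B\<^sup>2 \<le> e" using e B by (simp add: field_simps)
  show "\<exists>B. \<forall>\<^sub>F k in sequentially. \<exists>A\<in>sets (M k). emeasure (M k) A \<le> ennreal e \<and>
      (\<forall>\<omega>\<in>space (M k) - A. \<bar>Y k \<omega>\<bar> \<le> B)"
    using assms(1)
  proof (intro exI[of _ B], eventually_elim)
    case (elim k)
    then have [measurable]: "Y k \<in> borel_measurable (M k)" by simp
    have "emeasure (M k) {\<omega>\<in>space (M k). \<bar>Y k \<omega>\<bar> \<ge> B} \<le> ennreal (b / B\<^sup>2)"
      using elim B by (intro emeasure_sq_tail) auto
    also have "\<dots> \<le> ennreal e" using Bb by (intro ennreal_leI)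
    finally show ?case
      by (intro bexI[of _ "{\<omega>\<in>space (M k). \<bar>Y k \<omega>\<bar> \<ge> B}"]) auto
  qed
qed

section \<open>Slutsky argument and characteristic functions of centred chi-squares\<close>

lemma isCont_Phi: "isCont Phi x"
proof -
  interpret real_distribution std_normal_distribution by (rule real_dist_normal_dist)
  have "AE y in lborel. y \<in> {x} \<longrightarrow> ennreal (std_normal_density y) = 0"
    by (rule AE_I[of _ _ "{x}"]) auto
  then have "{x} \<in> null_sets std_normal_distribution"
    by (subst null_sets_density_iff) auto
  then have "measure std_normal_distribution {x} = 0"
    by (auto simp: measure_def null_sets_def)
  then show ?thesis
    unfolding Phi_def[abs_def] isCont_cdf .
qed

lemma Phi_uminus: "Phi (- x) = 1 - Phi x"
proof -
  interpret real_distribution std_normal_distribution by (rule real_dist_normal_dist)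
  have "emeasure std_normal_distribution {..- x}
      = (\<integral>\<^sup>+y. ennreal (std_normal_density y) * indicator {..-x} y \<partial>lborel)"
    by (simp add: emeasure_density)
  also have "\<dots> = (\<integral>\<^sup>+y. ennreal (std_normal_density y) * indicator {x..} y \<partial>lborel)"
    by (subst nn_integral_real_affine[of _ "-1" 0])
       (auto simp: indicator_def std_normal_density_def intro!: nn_integral_cong)
  also have "\<dots> = emeasure std_normal_distribution {x..}"
    by (simp add: emeasure_density)
  finally have "measure std_normal_distribution {..- x} = measure std_normal_distribution {x..}"
    by (simp add: measure_def)
  moreover have "measure std_normal_distribution {x..} = 1 - measure std_normal_distribution {..<x}"
    using prob_compl[of "{..<x}"] by (simp add: Compl_eq_Diff_UNIV[symmetric])
  moreover have "measure std_normal_distribution {..x} =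
      measure std_normal_distribution {..<x} + measure std_normal_distribution {x}"
    by (subst finite_measure_Union[symmetric]) (auto simp: ivl_disj_un(2)[symmetric])
  moreover have "measure std_normal_distribution {x} = 0"
    using isCont_Phi[of x] unfolding Phi_def[abs_def] isCont_cdf .
  ultimately show ?thesis by (simp add: Phi_def cdf_def)
qed

text \<open>Off an event of small probability, T differs from Z + b by little, so its upper tail lies between
  two upper tails of Z with nearby levels; continuity of \<open>Phi\<close> lets these levels merge.\<close>

lemma slutsky_upper_tail:
  assumes P: "\<And>k. prob_space (M k)"
    and Z: "\<forall>\<^sub>F k in sequentially. Z k \<in> borel_measurable (M k)"
    and cdf: "\<And>x. (\<lambda>k. measure (M k) {\<omega>\<in>space (M k). Z k \<omega> \<le> x}) \<longlonglongrightarrow> Phi x"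
    and T: "tends_in_prob M (\<lambda>k \<omega>. T k \<omega> - Z k \<omega>) b"
    and meas: "\<forall>\<^sub>F k in sequentially. {\<omega>\<in>space (M k). z \<le> T k \<omega>} \<in> sets (M k)"
  shows "(\<lambda>k. measure (M k) {\<omega>\<in>space (M k). z \<le> T k \<omega>}) \<longlonglongrightarrow> Phi (b - z)"
proof -
  define F where "F k x = measure (M k) {\<omega>\<in>space (M k). Z k \<omega> \<le> x}" for k x
  define Q where "Q k = measure (M k) {\<omega>\<in>space (M k). z \<le> T k \<omega>}" for k
  have bnd: "\<forall>\<^sub>F k in sequentially. 1 - F k (z - b + e) - e \<le> Q k \<and> Q k \<le> 1 - F k (z - b - e) + e"
    if e: "e > 0" for e
  proof -
    from T e have "\<forall>\<^sub>F k in sequentially. \<exists>A\<in>sets (M k). emeasure (M k) A \<le> ennreal e \<and>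
      (\<forall>\<omega>\<in>space (M k) - A. dist (T k \<omega> - Z k \<omega>) b < e)" unfolding tends_in_prob_def by blast
    with Z meas show ?thesis
    proof eventually_elim
      case (elim k)
      interpret prob_space "M k" by (rule P)
      have [measurable]: "Z k \<in> borel_measurable (M k)" using elim by simp
      have [measurable]: "{\<omega>\<in>space (M k). z \<le> T k \<omega>} \<in> sets (M k)" using elim by simp
      from elim obtain A where A[measurable]: "A \<in> sets (M k)" and A2: "emeasure (M k) A \<le> ennreal e"
        and A3: "\<And>\<omega>. \<omega>\<in>space (M k) - A \<Longrightarrow> dist (T k \<omega> - Z k \<omega>) b < e" by blast
      have mA: "measure (M k) A \<le> e" using A2 e by (simp add: emeasure_eq_measure)
      have F: "1 - F k x = measure (M k) {\<omega>\<in>space (M k). x < Z k \<omega>}" for x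
      proof -
        have "{\<omega>\<in>space (M k). x < Z k \<omega>} = space (M k) - {\<omega>\<in>space (M k). Z k \<omega> \<le> x}" by auto
        then show ?thesis unfolding F_def by (simp add: prob_compl)
      qed
      have "1 - F k (z - b + e) \<le> measure (M k) ({\<omega>\<in>space (M k). z \<le> T k \<omega>} \<union> A)"
        unfolding F
      proof (intro finite_measure_mono subsetI)
        fix \<omega> assume "\<omega> \<in> {\<omega> \<in> space (M k). z - b + e < Z k \<omega>}"
        then show "\<omega> \<in> {\<omega>\<in>space (M k). z \<le> T k \<omega>} \<union> A"
          using A3[of \<omega>] by (cases "\<omega> \<in> A") (auto simp: dist_real_def)
      qed auto
      also have "\<dots> \<le> Q k + measure (M k) A" unfolding Q_def
        by (intro measure_subadditive) (auto simp: emeasure_eq_measure)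
      finally have 1: "1 - F k (z - b + e) - e \<le> Q k" using mA by simp
      have "Q k \<le> measure (M k) ({\<omega>\<in>space (M k). z - b - e < Z k \<omega>} \<union> A)"
        unfolding Q_def
      proof (intro finite_measure_mono subsetI)
        fix \<omega> assume "\<omega> \<in> {\<omega> \<in> space (M k). z \<le> T k \<omega>}"
        then show "\<omega> \<in> {\<omega>\<in>space (M k). z - b - e < Z k \<omega>} \<union> A"
          using A3[of \<omega>] by (cases "\<omega> \<in> A") (auto simp: dist_real_def)
      qed auto
      also have "\<dots> \<le> (1 - F k (z - b - e)) + measure (M k) A" unfolding F
        by (intro measure_subadditive) (auto simp: emeasure_eq_measure)
      finally show ?case using 1 mA by simp
    qed
  qed
  have "(\<lambda>k. Q k) \<longlonglongrightarrow> Phi (b - z)"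
  proof (rule LIMSEQ_I)
    fix r :: real assume r: "r > 0"
    have eq: "Phi (b - z) = 1 - Phi (z - b)" using Phi_uminus[of "z - b"] by simp
    obtain d where d: "d > 0" "\<And>x. dist x (z - b) < d \<Longrightarrow> dist (Phi x) (Phi (z - b)) < r / 4"
      using isCont_Phi[of "z - b"] r unfolding continuous_at_eps_delta
      by (metis zero_less_divide_iff zero_less_numeral)
    define e where "e = min (d/2) (r/4)"
    have e: "e > 0" "e < d" "e \<le> r/4" using d r by (auto simp: e_def min_def)
    have p1: "\<bar>Phi (z - b + e) - Phi (z - b)\<bar> < r/4" "\<bar>Phi (z - b - e) - Phi (z - b)\<bar> < r/4"
      using d(2)[of "z - b + e"] d(2)[of "z - b - e"] e by (auto simp: dist_real_def)
    have c1: "\<forall>\<^sub>F k in sequentially. \<bar>F k (z - b + e) - Phi (z - b + e)\<bar> < r/4"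
      using tendstoD[OF cdf, of "r/4" "z - b + e"] r by (simp add: F_def dist_real_def)
    have c2: "\<forall>\<^sub>F k in sequentially. \<bar>F k (z - b - e) - Phi (z - b - e)\<bar> < r/4"
      using tendstoD[OF cdf, of "r/4" "z - b - e"] r by (simp add: F_def dist_real_def)
    from c1 c2 bnd[OF e(1)]
    have "\<forall>\<^sub>F k in sequentially. norm (Q k - Phi (b - z)) < r"
    proof eventually_elim
      case (elim k)
      then have "\<bar>Q k - (1 - Phi (z - b))\<bar> < r"
        using p1 e by (simp only: abs_less_iff) linarith
      then show ?case unfolding eq by simp
    qed
    then show "\<exists>no. \<forall>n\<ge>no. norm (Q n - Phi (b - z)) < r" by (simp add: eventually_sequentially)
  qed
  then show ?thesis by (simp add: Q_def)
qed

definition gauss :: "'i set \<Rightarrow> ('i \<Rightarrow> real) measure" where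
  "gauss I = (\<Pi>\<^sub>M i\<in>I. std_normal_distribution)"

interpretation std_normal: real_distribution std_normal_distribution
  by (rule real_dist_normal_dist)

interpretation gauss: product_prob_space "\<lambda>_. std_normal_distribution" I for I
  by unfold_locales

lemma prob_space_gauss: "prob_space (gauss I)"
  unfolding gauss_def by (intro prob_space_PiM) unfold_locales

lemma sets_gauss[measurable_cong]: "sets (gauss I) = sets (\<Pi>\<^sub>M i\<in>I. borel)"
  unfolding gauss_def by (intro sets_PiM_cong) auto

lemma space_gauss: "space (gauss I) = (\<Pi>\<^sub>E i\<in>I. UNIV)"
  unfolding gauss_def by (simp add: space_PiM)

text \<open>Characteristic function of a centred chi-square variable with one degree of freedom.\<close>

definition chisq_cf :: "real \<Rightarrow> complex" where
  "chisq_cf s = (CLINT g|std_normal_distribution. iexp (s * (g\<^sup>2 - 1)))"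

lemma chisq_cf_char: "chisq_cf = char (distr std_normal_distribution borel (\<lambda>g. g\<^sup>2 - 1))"
  by (auto simp: chisq_cf_def char_def integral_distr)

lemma norm_chisq_cf_le_1: "norm (chisq_cf s) \<le> 1"
proof -
  interpret D: real_distribution "distr std_normal_distribution borel (\<lambda>g. g\<^sup>2 - 1)"
    by (intro std_normal.real_distribution_distr) auto
  show ?thesis unfolding chisq_cf_char by (rule D.cmod_char_le_1)
qed

lemma std_normal_moments:
  "integrable std_normal_distribution (\<lambda>x. x ^ k)"
  "(LINT x|std_normal_distribution. x\<^sup>2) = 1"
  "(LINT x|std_normal_distribution. x ^ 4) = 3"
  using std_normal_distribution_even_moments(1)[of 1] std_normal_distribution_even_moments(1)[of 2]
  by (auto simp: integrable_std_normal_distribution_moment eval_nat_numeral)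

lemma std_normal_chisq:
  "integrable std_normal_distribution (\<lambda>x. x\<^sup>2 - 1)"
  "integrable std_normal_distribution (\<lambda>x. (x\<^sup>2 - 1)\<^sup>2)"
  "(LINT x|std_normal_distribution. x\<^sup>2 - 1) = 0"
  "(LINT x|std_normal_distribution. (x\<^sup>2 - 1)\<^sup>2) = 2"
proof -
  have eq: "(x\<^sup>2 - 1)\<^sup>2 = x ^ 4 - 2 * x\<^sup>2 + 1" for x :: real
    by (simp add: power2_eq_square eval_nat_numeral algebra_simps)
  note [simp] = std_normal_moments std_normal.prob_space[simplified]
  show "integrable std_normal_distribution (\<lambda>x. x\<^sup>2 - 1)"
    by (intro Bochner_Integration.integrable_diff) auto
  show "integrable std_normal_distribution (\<lambda>x. (x\<^sup>2 - 1)\<^sup>2)"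
    unfolding eq by (intro Bochner_Integration.integrable_diff Bochner_Integration.integrable_add integrable_mult_right) auto
  show "(LINT x|std_normal_distribution. x\<^sup>2 - 1) = 0"
    by (subst Bochner_Integration.integral_diff) auto
  show "(LINT x|std_normal_distribution. (x\<^sup>2 - 1)\<^sup>2) = 2"
    unfolding eq by (subst Bochner_Integration.integral_add Bochner_Integration.integral_diff; simp)+
qed

text \<open>The variable has mean 0 and variance 2, and a finite third absolute moment bounds the Taylor
  remainder of its characteristic function.\<close>

lemma chisq_cf_approx: "\<exists>C. \<forall>s. norm (chisq_cf s - of_real (exp (- s\<^sup>2))) \<le> C * \<bar>s\<bar> ^ 3"
proof -
  define \<kappa> where "\<kappa> = (LINT g|std_normal_distribution. \<bar>g\<^sup>2 - 1\<bar> ^ 3)"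
  have int3: "integrable std_normal_distribution (\<lambda>g. \<bar>g\<^sup>2 - 1\<bar> ^ 3)"
  proof (rule Bochner_Integration.integrable_bound[of _ "\<lambda>g. 4 * (g ^ 6 + 1)"])
    show "integrable std_normal_distribution (\<lambda>g. 4 * (g ^ 6 + 1))"
      using std_normal_moments(1)[of 6] by auto
    have "\<bar>g\<^sup>2 - 1\<bar> ^ 3 \<le> 4 * (g ^ 6 + 1)" for g :: real
    proof -
      define u where "u = g\<^sup>2"
      have u: "u \<ge> 0" by (simp add: u_def)
      have "\<bar>u - 1\<bar> ^ 3 \<le> (u + 1) ^ 3" using u by (intro power_mono) auto
      also have "\<dots> \<le> 4 * (u ^ 3 + 1)"
      proof -
        have "4 * (u ^ 3 + 1) - (u + 1) ^ 3 = 3 * (u + 1) * (u - 1)\<^sup>2"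
          by (simp add: power2_eq_square power3_eq_cube algebra_simps)
        also have "\<dots> \<ge> 0" using u by simp
        finally show ?thesis by simp
      qed
      finally show ?thesis by (simp add: u_def power_mult[symmetric])
    qed
    then show "AE g in std_normal_distribution. norm (\<bar>g\<^sup>2 - 1\<bar> ^ 3) \<le> norm (4 * (g ^ 6 + 1))"
      by (intro AE_I2) (auto intro: order_trans[OF _ abs_ge_self])
  qed simp
  have \<kappa>: "\<kappa> \<ge> 0" unfolding \<kappa>_def by (intro integral_nonneg_AE) auto
  have bound: "norm (chisq_cf s - of_real (exp (- s\<^sup>2))) \<le> (\<kappa>/6 + 2) * \<bar>s\<bar> ^ 3" for s
  proof (cases "\<bar>s\<bar> \<le> 1")
    case True
    have "norm (chisq_cf s - (1 - s\<^sup>2 * 2 / 2)) \<le>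
       (s\<^sup>2 / 6) * (LINT g|std_normal_distribution. min (6 * (g\<^sup>2 - 1)\<^sup>2) (\<bar>s\<bar> * \<bar>g\<^sup>2 - 1\<bar>^3))"
      unfolding chisq_cf_char
      by (rule order_trans[OF _ std_normal.char_approx3'[of "\<lambda>g. g\<^sup>2 - 1" 2]])
         (auto simp: std_normal_chisq)
    also have "\<dots> \<le> (s\<^sup>2 / 6) * (LINT g|std_normal_distribution. \<bar>s\<bar> * \<bar>g\<^sup>2 - 1\<bar>^3)"
      using int3 by (intro mult_left_mono integral_mono integrable_min integrable_mult_right std_normal_chisq) auto
    also have "\<dots> = \<kappa>/6 * \<bar>s\<bar> ^ 3"
      by (simp add: \<kappa>_def power2_eq_square power3_eq_cube abs_mult_self_eq)
    finally have 1: "norm (chisq_cf s - of_real (1 - s\<^sup>2)) \<le> \<kappa>/6 * \<bar>s\<bar> ^ 3" by simp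
    define u where "u = s\<^sup>2"
    have u: "0 \<le> u" by (simp add: u_def)
    have "1 - u \<le> exp (-u)" using exp_ge_add_one_self[of "-u"] by simp
    moreover have "exp (-u) \<le> 1 - u + u\<^sup>2"
    proof -
      have "exp (-u) = 1 / exp u" by (simp add: exp_minus field_simps)
      also have "\<dots> \<le> 1 / (1 + u)" using u exp_ge_add_one_self[of u] by (intro divide_left_mono) auto
      also have "\<dots> \<le> 1 - u + u\<^sup>2"
      proof -
        have "(1 - u + u\<^sup>2) * (1 + u) = 1 + u ^ 3"
          by (simp add: power2_eq_square power3_eq_cube algebra_simps)
        then have "1 \<le> (1 - u + u\<^sup>2) * (1 + u)" using u by simp
        then show ?thesis using u by (simp add: pos_divide_le_eq)
      qed
      finally show ?thesis .
    qed
    ultimately have "\<bar>(1 - u) - exp (-u)\<bar> \<le> u\<^sup>2" by auto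
    then have 2: "norm (complex_of_real (1 - s\<^sup>2) - of_real (exp (- s\<^sup>2))) \<le> u\<^sup>2"
      unfolding u_def by (metis norm_of_real of_real_diff real_norm_def)
    have "u\<^sup>2 = \<bar>s\<bar> ^ 3 * \<bar>s\<bar>" by (simp add: u_def power_mult[symmetric] flip: power_Suc2)
    also have "\<dots> \<le> \<bar>s\<bar> ^ 3 * 1" using True by (intro mult_left_mono) auto
    finally have 3: "u\<^sup>2 \<le> \<bar>s\<bar>^3" by simp
    have "norm (chisq_cf s - of_real (exp (- s\<^sup>2))) \<le> \<kappa>/6 * \<bar>s\<bar> ^ 3 + u\<^sup>2"
      using norm_triangle_mono[OF 1 2] by simp
    also have "\<dots> \<le> (\<kappa>/6 + 2) * \<bar>s\<bar> ^ 3" using order_trans[OF 3, of "2 * \<bar>s\<bar> ^ 3"]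
      by (simp add: algebra_simps)
    finally show ?thesis .
  next
    case False
    have "norm (chisq_cf s - of_real (exp (- s\<^sup>2))) \<le> norm (chisq_cf s) + norm (complex_of_real (exp (- s\<^sup>2)))"
      by (rule norm_triangle_ineq4)
    also have "\<dots> \<le> 1 + 1" by (intro add_mono norm_chisq_cf_le_1) auto
    also have "\<dots> \<le> 2 * \<bar>s\<bar> ^ 3" using False one_le_power[of "\<bar>s\<bar>" 3] by simp
    also have "\<dots> \<le> (\<kappa>/6 + 2) * \<bar>s\<bar> ^ 3" using \<kappa> by (intro mult_right_mono) auto
    finally show ?thesis .
  qed
  show ?thesis by (rule exI[of _ "\<kappa>/6 + 2"]) (use bound in blast)
qed

text \<open>The limit theorem for weighted sums of centred chi-squares. Factors of modulus at most one allow
  the product to be compared with the Gaussian one term by term, at a total cost of the sum of the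
  cubed weights; this plays the role of Lyapunov's condition.\<close>

lemma chisq_cf_prod_tendsto:
  assumes fin: "\<And>k. finite (J k)"
    and w2: "(\<lambda>k. \<Sum>i\<in>J k. (w k i)\<^sup>2) \<longlonglongrightarrow> s"
    and w3: "(\<lambda>k. \<Sum>i\<in>J k. \<bar>w k i\<bar> ^ 3) \<longlonglongrightarrow> 0"
  shows "(\<lambda>k. \<Prod>i\<in>J k. chisq_cf (t * w k i)) \<longlonglongrightarrow> of_real (exp (- t\<^sup>2 * s))"
proof -
  obtain C where C: "\<And>s. norm (chisq_cf s - of_real (exp (- s\<^sup>2))) \<le> C * \<bar>s\<bar> ^ 3"
    using chisq_cf_approx by blast
  define E where "E k = (\<Prod>i\<in>J k. complex_of_real (exp (- (t * w k i)\<^sup>2)))" for k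
  have E: "E k = of_real (exp (- t\<^sup>2 * (\<Sum>i\<in>J k. (w k i)\<^sup>2)))" for k
    unfolding E_def of_real_prod[symmetric] exp_sum[OF fin, symmetric]
    by (simp add: power_mult_distrib sum_distrib_left sum_negf)
  have "E \<longlonglongrightarrow> of_real (exp (- t\<^sup>2 * s))"
    unfolding E by (intro tendsto_intros w2)
  moreover have "(\<lambda>k. (\<Prod>i\<in>J k. chisq_cf (t * w k i)) - E k) \<longlonglongrightarrow> 0"
  proof (rule Lim_null_comparison)
    show "(\<lambda>k. C * \<bar>t\<bar> ^ 3 * (\<Sum>i\<in>J k. \<bar>w k i\<bar> ^ 3)) \<longlonglongrightarrow> 0"
      using tendsto_mult_left[OF w3, of "C * \<bar>t\<bar> ^ 3"] by simp
    have "norm ((\<Prod>i\<in>J k. chisq_cf (t * w k i)) - E k) \<le> C * \<bar>t\<bar> ^ 3 * (\<Sum>i\<in>J k. \<bar>w k i\<bar> ^ 3)" for k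
    proof -
      have "norm ((\<Prod>i\<in>J k. chisq_cf (t * w k i)) - E k) \<le>
          (\<Sum>i\<in>J k. norm (chisq_cf (t * w k i) - complex_of_real (exp (- (t * w k i)\<^sup>2))))"
        unfolding E_def by (intro norm_prod_diff norm_chisq_cf_le_1) auto
      also have "\<dots> \<le> (\<Sum>i\<in>J k. C * \<bar>t * w k i\<bar> ^ 3)" by (intro sum_mono C)
      also have "\<dots> = C * \<bar>t\<bar> ^ 3 * (\<Sum>i\<in>J k. \<bar>w k i\<bar> ^ 3)"
        by (simp add: sum_distrib_left abs_mult power_mult_distrib mult.assoc)
      finally show ?thesis .
    qed
    then show "\<forall>\<^sub>F k in sequentially. norm ((\<Prod>i\<in>J k. chisq_cf (t * w k i)) - E k) \<le>
        C * \<bar>t\<bar> ^ 3 * (\<Sum>i\<in>J k. \<bar>w k i\<bar> ^ 3)" by simp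
  qed
  ultimately show ?thesis using tendsto_add[of E] by fastforce
qed

lemma gauss_weighted_chisq_cf:
  assumes [simp]: "finite J"
  shows "(CLINT g|gauss J. iexp (\<Sum>i\<in>J. w i * ((g i)\<^sup>2 - 1))) = (\<Prod>i\<in>J. chisq_cf (w i))"
proof -
  have "(CLINT g|gauss J. iexp (\<Sum>i\<in>J. w i * ((g i)\<^sup>2 - 1))) =
     (CLINT g|gauss J. (\<Prod>i\<in>J. iexp (w i * ((g i)\<^sup>2 - 1))))"
    by (simp add: exp_sum[symmetric] sum_distrib_left)
  also have "\<dots> = (\<Prod>i\<in>J. chisq_cf (w i))"
    unfolding gauss_def chisq_cf_def
    by (intro gauss.product_integral_prod std_normal.integrable_const_bound[of _ 1]) auto
  finally show ?thesis .
qed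

lemma normal_limit_from_cf:
  assumes "\<And>k. prob_space (M k)" "\<And>k. Z k \<in> borel_measurable (M k)"
    and cf: "\<And>t. (\<lambda>k. CLINT \<omega>|M k. iexp (t * Z k \<omega>)) \<longlonglongrightarrow> of_real (exp (- t\<^sup>2 / 2))"
  shows "(\<lambda>k. measure (M k) {\<omega>\<in>space (M k). Z k \<omega> \<le> x}) \<longlonglongrightarrow> Phi x"
proof -
  have rd: "real_distribution (distr (M k) borel (Z k))" for k
  proof -
    interpret prob_space "M k" by fact
    show ?thesis using assms(2) by (intro real_distribution_distr)
  qed
  have "weak_conv_m (\<lambda>k. distr (M k) borel (Z k)) std_normal_distribution"
  proof (rule levy_continuity[OF rd real_dist_normal_dist])
    fix t
    have "char (distr (M k) borel (Z k)) t = (CLINT \<omega>|M k. iexp (t * Z k \<omega>))" for k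
      using assms(2) unfolding char_def by (subst integral_distr) auto
    then show "(\<lambda>k. char (distr (M k) borel (Z k)) t) \<longlonglongrightarrow> char std_normal_distribution t"
      using cf[of t] by (simp add: char_std_normal_distribution)
  qed
  then have "(\<lambda>k. cdf (distr (M k) borel (Z k)) x) \<longlonglongrightarrow> cdf std_normal_distribution x"
    unfolding weak_conv_m_def weak_conv_def using isCont_Phi[of x] by (simp add: Phi_def[abs_def])
  moreover have "cdf (distr (M k) borel (Z k)) x = measure (M k) {\<omega>\<in>space (M k). Z k \<omega> \<le> x}" for k
    unfolding cdf_def using assms(2) by (subst measure_distr) (auto intro!: arg_cong[where f="measure _"])
  ultimately show ?thesis by (simp add: Phi_def)
qed

section \<open>Orthogonal invariance of the standard Gaussian law\<close>

definition lin_on :: "'i set \<Rightarrow> ('i \<Rightarrow> 'i \<Rightarrow> real) \<Rightarrow> ('i \<Rightarrow> real) \<Rightarrow> 'i \<Rightarrow> real" where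
  "lin_on I B x = (\<lambda>i\<in>I. \<Sum>j\<in>I. B i j * x j)"

text \<open>Both products with the transpose are required, which spares the inversion of finite square
  matrices over an arbitrary index set.\<close>

definition orth_on :: "'i set \<Rightarrow> ('i \<Rightarrow> 'i \<Rightarrow> real) \<Rightarrow> bool" where
  "orth_on I B \<longleftrightarrow>
     (\<forall>i\<in>I. \<forall>j\<in>I. (\<Sum>k\<in>I. B i k * B j k) = of_bool (i = j)) \<and>
     (\<forall>i\<in>I. \<forall>j\<in>I. (\<Sum>k\<in>I. B k i * B k j) = of_bool (i = j))"

definition lborel_on :: "'i set \<Rightarrow> ('i \<Rightarrow> real) measure" where
  "lborel_on I = (\<Pi>\<^sub>M i\<in>I. lborel)"

text \<open>The change of variables formula with an unspecified constant Jacobian. The constant need not be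
  known: densities have integral one, which fixes it afterwards.\<close>

definition scales_lborel :: "'i set \<Rightarrow> (('i \<Rightarrow> real) \<Rightarrow> 'i \<Rightarrow> real) \<Rightarrow> bool" where
  "scales_lborel I T \<longleftrightarrow> T \<in> lborel_on I \<rightarrow>\<^sub>M lborel_on I \<and>
     (\<exists>C>0. \<forall>f\<in>borel_measurable (lborel_on I).
        (\<integral>\<^sup>+x. f (T x) \<partial>lborel_on I) = ennreal C * (\<integral>\<^sup>+x. f x \<partial>lborel_on I))"

lemma sets_lborel_on[measurable_cong]: "sets (lborel_on I) = sets (\<Pi>\<^sub>M i\<in>I. borel)"
  unfolding lborel_on_def by (intro sets_PiM_cong) auto

lemma space_lborel_on: "space (lborel_on I) = (\<Pi>\<^sub>E i\<in>I. UNIV)"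
  by (simp add: lborel_on_def space_PiM)

lemma lin_on_measurable[measurable]:
  "lin_on I B \<in> (\<Pi>\<^sub>M i\<in>I. (borel :: real measure)) \<rightarrow>\<^sub>M (\<Pi>\<^sub>M i\<in>I. borel)"
  unfolding lin_on_def by (intro measurable_restrict) measurable

lemma scales_lborel_comp:
  assumes "scales_lborel I T" "scales_lborel I U"
  shows "scales_lborel I (\<lambda>x. T (U x))"
proof -
  let ?L = "lborel_on I"
  from assms(1) obtain C where C: "C > 0" "\<And>f. f \<in> borel_measurable ?L \<Longrightarrow>
      (\<integral>\<^sup>+x. f (T x) \<partial>?L) = ennreal C * (\<integral>\<^sup>+x. f x \<partial>?L)" and [measurable]: "T \<in> ?L \<rightarrow>\<^sub>M ?L"
    unfolding scales_lborel_def by blast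
  from assms(2) obtain D where D: "D > 0" "\<And>f. f \<in> borel_measurable ?L \<Longrightarrow>
      (\<integral>\<^sup>+x. f (U x) \<partial>?L) = ennreal D * (\<integral>\<^sup>+x. f x \<partial>?L)" and [measurable]: "U \<in> ?L \<rightarrow>\<^sub>M ?L"
    unfolding scales_lborel_def by blast
  show ?thesis unfolding scales_lborel_def
  proof (intro conjI exI[of _ "D * C"] ballI)
    fix f :: "('a \<Rightarrow> real) \<Rightarrow> ennreal" assume [measurable]: "f \<in> borel_measurable ?L"
    have "(\<integral>\<^sup>+x. f (T (U x)) \<partial>?L) = ennreal D * (\<integral>\<^sup>+x. f (T x) \<partial>?L)"
      by (rule D(2)) measurable
    also have "\<dots> = ennreal (D * C) * (\<integral>\<^sup>+x. f x \<partial>?L)"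
      using C D by (subst C(2)) (auto simp: ennreal_mult mult.assoc)
    finally show "(\<integral>\<^sup>+x. f (T (U x)) \<partial>?L) = ennreal (D * C) * (\<integral>\<^sup>+x. f x \<partial>?L)" .
  qed (use C D in auto)
qed

lemma scales_lborel_cong:
  assumes "scales_lborel I T" "\<And>x. x \<in> space (lborel_on I) \<Longrightarrow> T x = U x"
  shows "scales_lborel I U"
proof -
  have "(\<integral>\<^sup>+x. f (U x) \<partial>lborel_on I) = (\<integral>\<^sup>+x. f (T x) \<partial>lborel_on I)"
    for f :: "('a \<Rightarrow> real) \<Rightarrow> ennreal" by (intro nn_integral_cong) (simp add: assms(2))
  with assms show ?thesis unfolding scales_lborel_def
    by (auto cong: measurable_cong)
qed

interpretation lborel_prod: product_sigma_finite "\<lambda>_. lborel :: real measure"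
  by standard

text \<open>The elementary step: with all other coordinates fixed, one coordinate undergoes an affine map of
  the line with nonzero slope, and Fubini's theorem applies.\<close>

lemma scales_lborel_update:
  assumes fin: "finite I" and k: "k \<in> I" and w: "w k \<noteq> 0"
  shows "scales_lborel I (\<lambda>x. x(k := (\<Sum>j\<in>I. w j * x j) + d))"
proof -
  let ?L = "lborel_on"
  define J where "J = I - {k}"
  have I: "I = insert k J" "k \<notin> J" "finite J" using k fin by (auto simp: J_def)
  define T where "T = (\<lambda>x. x(k := (\<Sum>j\<in>I. w j * x j) + d))"
  have "T \<in> ?L I \<rightarrow>\<^sub>M (\<Pi>\<^sub>M i\<in>I. borel)"
  proof (rule measurable_PiM_single')
    fix i assume i: "i \<in> I"
    show "(\<lambda>x. T x i) \<in> ?L I \<rightarrow>\<^sub>M borel"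
      using i by (cases "i = k") (auto simp: T_def)
  next
    show "T \<in> space (?L I) \<rightarrow> (\<Pi>\<^sub>E i\<in>I. space borel)"
      using k by (auto simp: space_lborel_on PiE_iff extensional_def T_def)
  qed
  then have meas: "(\<lambda>x. x(k := (\<Sum>j\<in>I. w j * x j) + d)) \<in> ?L I \<rightarrow>\<^sub>M ?L I"
    unfolding T_def by (simp add: measurable_cong_sets[OF refl sets_lborel_on])
  have eq: "(\<integral>\<^sup>+x. f (x(k := (\<Sum>j\<in>I. w j * x j) + d)) \<partial>?L I) = ennreal (1 / \<bar>w k\<bar>) * (\<integral>\<^sup>+x. f x \<partial>?L I)"
    if f[measurable]: "f \<in> borel_measurable (?L I)" for f
  proof -
    have f'[measurable]: "f \<in> borel_measurable (?L (insert k J))" using f I by simp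
    have "(\<integral>\<^sup>+x. f (x(k := (\<Sum>j\<in>I. w j * x j) + d)) \<partial>?L I) =
        (\<integral>\<^sup>+x. (\<integral>\<^sup>+y. f ((x(k := y))(k := (\<Sum>j\<in>I. w j * (x(k := y)) j) + d)) \<partial>lborel) \<partial>?L J)"
      unfolding I(1) lborel_on_def
      by (rule lborel_prod.product_nn_integral_insert[OF I(3,2)])
         (use measurable_compose[OF meas f] I in \<open>simp add: lborel_on_def\<close>)
    also have "\<dots> = (\<integral>\<^sup>+x. ennreal (1 / \<bar>w k\<bar>) * (\<integral>\<^sup>+y. f (x(k := y)) \<partial>lborel) \<partial>?L J)"
    proof (intro nn_integral_cong)
      fix x assume x: "x \<in> space (?L J)"
      have mx: "(\<lambda>y. f (x(k := y))) \<in> borel_measurable borel"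
        using measurable_comp[OF measurable_component_update[OF x[unfolded lborel_on_def] I(2)] f'[unfolded lborel_on_def]] by (simp add: comp_def)
      have s: "(\<Sum>j\<in>I. w j * (x(k := y)) j) = w k * y + (\<Sum>j\<in>J. w j * x j)" for y
        using I by (auto intro!: sum.cong)
      have "(\<integral>\<^sup>+y. f (x(k := y)) \<partial>lborel) =
          ennreal \<bar>w k\<bar> * (\<integral>\<^sup>+y. f (x(k := ((\<Sum>j\<in>J. w j * x j) + d) + w k * y)) \<partial>lborel)"
        using mx w by (subst nn_integral_real_affine[where c="w k" and t="(\<Sum>j\<in>J. w j * x j) + d"]) auto
      then have "ennreal (1 / \<bar>w k\<bar>) * (\<integral>\<^sup>+y. f (x(k := y)) \<partial>lborel) =
          (ennreal (1 / \<bar>w k\<bar>) * ennreal \<bar>w k\<bar>) * (\<integral>\<^sup>+y. f (x(k := ((\<Sum>j\<in>J. w j * x j) + d) + w k * y)) \<partial>lborel)"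
        by (simp add: mult.assoc)
      also have "ennreal (1 / \<bar>w k\<bar>) * ennreal \<bar>w k\<bar> = 1"
        using w by (subst ennreal_mult[symmetric]) auto
      finally show "(\<integral>\<^sup>+y. f ((x(k := y))(k := (\<Sum>j\<in>I. w j * (x(k := y)) j) + d)) \<partial>lborel) =
         ennreal (1 / \<bar>w k\<bar>) * (\<integral>\<^sup>+y. f (x(k := y)) \<partial>lborel)"
        unfolding s by (simp add: add_ac fun_upd_def cong: if_cong)
    qed
    also have "\<dots> = ennreal (1 / \<bar>w k\<bar>) * (\<integral>\<^sup>+x. (\<integral>\<^sup>+y. f (x(k := y)) \<partial>lborel) \<partial>?L J)"
    proof (intro nn_integral_cmult)
      have [measurable]: "(\<lambda>(x, y). f (x(k := y))) \<in> borel_measurable (?L J \<Otimes>\<^sub>M lborel)"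
        using measurable_comp[OF measurable_add_dim[of k J "\<lambda>_. lborel"] f'[unfolded lborel_on_def]]
        by (simp add: comp_def case_prod_beta' lborel_on_def)
      show "(\<lambda>x. \<integral>\<^sup>+ y. f (x(k := y)) \<partial>lborel) \<in> borel_measurable (?L J)"
        by measurable
    qed
    also have "\<dots> = ennreal (1 / \<bar>w k\<bar>) * (\<integral>\<^sup>+x. f x \<partial>?L I)"
      unfolding I(1) lborel_on_def
      using lborel_prod.product_nn_integral_insert[OF I(3,2) f'[unfolded lborel_on_def]] by simp
    finally show ?thesis .
  qed
  show ?thesis unfolding scales_lborel_def using meas eq w
    by (intro conjI exI[of _ "1 / \<bar>w k\<bar>"]) auto
qed

text \<open>An invertible matrix is built up by replacing one coordinate at a time by a linear form in all of
  them. The rows in D are still those of the identity; each step removes an index from the complement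
  of D, after a pivot has been found.\<close>

lemma scales_lborel_lin_aux:
  assumes fin: "finite I"
  shows "D \<subseteq> I \<Longrightarrow> \<forall>i\<in>I. \<forall>l\<in>I. (\<Sum>j\<in>I. B i j * R j l) = of_bool (i = l) \<Longrightarrow>
    \<forall>i\<in>D. \<forall>j\<in>I. B i j = of_bool (i = j) \<Longrightarrow> scales_lborel I (lin_on I B)"
proof (induction "card (I - D)" arbitrary: D B R)
  case 0
  then have D: "D = I" using fin by auto
  have "scales_lborel I (\<lambda>x. x)" unfolding scales_lborel_def
    by (intro conjI exI[of _ 1]) auto
  then show ?case
  proof (rule scales_lborel_cong)
    fix x assume "x \<in> space (lborel_on I)"
    then have "x \<in> extensional I" by (auto simp: space_lborel_on PiE_def)
    moreover have "(\<Sum>j\<in>I. B i j * x j) = x i" if "i \<in> I" for i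
    proof -
      have "(\<Sum>j\<in>I. B i j * x j) = (\<Sum>j\<in>I. if i = j then x j else 0)"
        using 0(4) D that by (intro sum.cong) auto
      then show ?thesis using fin that by simp
    qed
    ultimately show "x = lin_on I B x" by (auto simp: lin_on_def extensional_def)
  qed
next
  case (Suc n)
  then obtain k where k: "k \<in> I" "k \<notin> D" by (cases "I - D = {}") auto
  have n: "n = card (I - insert k D)"
    using Suc(2) k by (metis Diff_iff Diff_insert card_Diff_singleton diff_Suc_1)
  have main: "scales_lborel I (lin_on I B)"
    if BR: "\<forall>i\<in>I. \<forall>l\<in>I. (\<Sum>j\<in>I. B i j * R j l) = of_bool (i = l)"
      and BD: "\<forall>i\<in>D. \<forall>j\<in>I. B i j = of_bool (i = j)" and kk: "B k k \<noteq> 0" for B R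
  proof -
    define B' where "B' i j = (if j = k then B i k / B k k else B i j - B i k / B k k * B k j)" for i j
    define R' where "R' j l = (if j = k then of_bool (k = l) else R j l)" for j l
    have split: "(\<Sum>j\<in>I. F j) = F k + (\<Sum>j\<in>I-{k}. F j)" for F :: "_ \<Rightarrow> real"
      using fin k by (simp add: sum.remove)
    have "scales_lborel I (lin_on I B')"
    proof (rule Suc(1)[OF n, of B' R'])
      show "\<forall>i\<in>I. \<forall>l\<in>I. (\<Sum>j\<in>I. B' i j * R' j l) = of_bool (i = l)"
      proof (intro ballI)
        fix i l assume il: "i \<in> I" "l \<in> I"
        have 1: "(\<Sum>j\<in>I-{k}. B i j * R j l) = of_bool (i = l) - B i k * R k l"
          if "i \<in> I" for i
          using BR that il(2) split[of "\<lambda>j. B i j * R j l"] by auto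
        have "(\<Sum>j\<in>I. B' i j * R' j l) = B i k / B k k * of_bool (k = l) +
            (\<Sum>j\<in>I-{k}. (B i j - B i k / B k k * B k j) * R j l)"
          unfolding split[of "\<lambda>j. B' i j * R' j l"] by (auto simp: B'_def R'_def intro!: sum.cong)
        also have "(\<Sum>j\<in>I-{k}. (B i j - B i k / B k k * B k j) * R j l) =
            (\<Sum>j\<in>I-{k}. B i j * R j l) - B i k / B k k * (\<Sum>j\<in>I-{k}. B k j * R j l)"
          by (simp add: algebra_simps sum_subtractf sum_distrib_left)
        finally show "(\<Sum>j\<in>I. B' i j * R' j l) = of_bool (i = l)"
          unfolding 1[OF il(1)] 1[OF k(1)] using kk by (auto simp: field_simps)
      qed
      show "\<forall>i\<in>insert k D. \<forall>j\<in>I. B' i j = of_bool (i = j)"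
        using BD k kk by (auto simp: B'_def)
    qed (use Suc k in auto)
    then have "scales_lborel I (\<lambda>x. lin_on I B' (x(k := (\<Sum>j\<in>I. B k j * x j) + 0)))"
      by (rule scales_lborel_comp) (intro scales_lborel_update fin k kk)
    then show ?thesis
    proof (rule scales_lborel_cong)
      fix x
      have "(\<Sum>j\<in>I. B' i j * (x(k := (\<Sum>j\<in>I. B k j * x j) + 0)) j) = (\<Sum>j\<in>I. B i j * x j)" for i
      proof -
        have "(\<Sum>j\<in>I. B' i j * (x(k := (\<Sum>j\<in>I. B k j * x j) + 0)) j) =
           B i k / B k k * (\<Sum>j\<in>I. B k j * x j) + (\<Sum>j\<in>I-{k}. (B i j - B i k / B k k * B k j) * x j)"
          by (subst split) (auto simp: B'_def intro!: sum.cong)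
        also have "(\<Sum>j\<in>I-{k}. (B i j - B i k / B k k * B k j) * x j) =
            (\<Sum>j\<in>I-{k}. B i j * x j) - B i k / B k k * (\<Sum>j\<in>I-{k}. B k j * x j)"
          by (simp add: algebra_simps sum_subtractf sum_distrib_left)
        also have "(\<Sum>j\<in>I-{k}. B k j * x j) = (\<Sum>j\<in>I. B k j * x j) - B k k * x k"
          using split[of "\<lambda>j. B k j * x j"] by simp
        also have "B i k / B k k * (\<Sum>j\<in>I. B k j * x j) + ((\<Sum>j\<in>I-{k}. B i j * x j) -
            B i k / B k k * ((\<Sum>j\<in>I. B k j * x j) - B k k * x k)) = (\<Sum>j\<in>I-{k}. B i j * x j) + B i k * x k"
          using kk by (simp add: right_diff_distrib)
        finally show ?thesis unfolding split[of "\<lambda>j. B i j * x j"] by simp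
      qed
      then show "lin_on I B' (x(k := (\<Sum>j\<in>I. B k j * x j) + 0)) = lin_on I B x"
        unfolding lin_on_def by simp
    qed
  qed
  show ?case
  proof (cases "B k k = 0")
    case False
    then show ?thesis using main[OF Suc(4,5)] by simp
  next
    case True
    have "\<exists>j\<in>I - D. B k j \<noteq> 0"
    proof (rule ccontr)
      assume neg: "\<not> (\<exists>j\<in>I - D. B k j \<noteq> 0)"
      have "(\<Sum>j\<in>I. B k j * R j k) = 0"
      proof (intro sum.neutral ballI)
        fix j assume j: "j \<in> I"
        show "B k j * R j k = 0"
        proof (cases "j \<in> D")
          case True
          have "(\<Sum>l\<in>I. B j l * R l k) = (\<Sum>l\<in>I. if j = l then R l k else 0)"
            using Suc(5) True by (intro sum.cong) auto
          also have "\<dots> = R j k" using fin j by simp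
          finally have "R j k = of_bool (j = k)" using Suc(4) j k by auto
          then show ?thesis using True k by auto
        qed (use neg j in auto)
      qed
      then show False using Suc(4) k by auto
    qed
    then obtain j where j: "j \<in> I" "j \<notin> D" "B k j \<noteq> 0" by auto
    with True have jk: "j \<noteq> k" by auto
    define B' where "B' i l = (if l = k then B i k + B i j else B i l)" for i l
    define R' where "R' l m = (if l = j then R j m - R k m else R l m)" for l m
    have split: "(\<Sum>l\<in>I. F l) = F k + F j + (\<Sum>l\<in>I-{k}-{j}. F l)" for F :: "_ \<Rightarrow> real"
      using fin k j jk by (simp add: sum.remove[of I k] sum.remove[of "I-{k}" j])
    have "scales_lborel I (lin_on I B')"
    proof (rule main[of B' R'])
      show "\<forall>i\<in>I. \<forall>l\<in>I. (\<Sum>m\<in>I. B' i m * R' m l) = of_bool (i = l)"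
      proof (intro ballI)
        fix i l assume il: "i \<in> I" "l \<in> I"
        have "(\<Sum>m\<in>I-{k}-{j}. B' i m * R' m l) = (\<Sum>m\<in>I-{k}-{j}. B i m * R m l)"
          by (intro sum.cong) (auto simp: B'_def R'_def)
        then have "(\<Sum>m\<in>I. B' i m * R' m l) = (\<Sum>m\<in>I. B i m * R m l)"
          unfolding split using jk by (simp add: B'_def R'_def algebra_simps)
        then show "(\<Sum>m\<in>I. B' i m * R' m l) = of_bool (i = l)" using Suc(4) il by simp
      qed
      show "\<forall>i\<in>D. \<forall>l\<in>I. B' i l = of_bool (i = l)"
        using Suc(5) k j by (auto simp: B'_def)
      show "B' k k \<noteq> 0" using True j by (simp add: B'_def)
    qed
    then have "scales_lborel I (\<lambda>x. lin_on I B' (x(j := (\<Sum>l\<in>I. (of_bool (l = j) - of_bool (l = k)) * x l) + 0)))"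
      by (rule scales_lborel_comp) (intro scales_lborel_update fin j, use jk in auto)
    then show ?thesis
    proof (rule scales_lborel_cong)
      fix x :: "'a \<Rightarrow> real"
      have s: "(\<Sum>l\<in>I. (of_bool (l = j) - of_bool (l = k)) * x l) = x j - x k"
        unfolding split using jk by (simp add: sum.neutral)
      have "(\<Sum>l\<in>I. B' i l * (x(j := x j - x k)) l) = (\<Sum>l\<in>I. B i l * x l)" for i
      proof -
        have "(\<Sum>l\<in>I-{k}-{j}. B' i l * (x(j := x j - x k)) l) = (\<Sum>l\<in>I-{k}-{j}. B i l * x l)"
          by (intro sum.cong) (auto simp: B'_def)
        then show ?thesis unfolding split using jk by (simp add: B'_def algebra_simps)
      qed
      then show "lin_on I B' (x(j := (\<Sum>l\<in>I. (of_bool (l = j) - of_bool (l = k)) * x l) + 0)) = lin_on I B x"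
        unfolding lin_on_def s by simp
    qed
  qed
qed

lemma scales_lborel_lin:
  assumes "finite I" "\<forall>i\<in>I. \<forall>l\<in>I. (\<Sum>j\<in>I. B i j * R j l) = of_bool (i = l)"
  shows "scales_lborel I (lin_on I B)"
  by (rule scales_lborel_lin_aux[of I "{}" B R]) (use assms in auto)

lemma scales_lborel_affine:
  assumes fin: "finite I" and BR: "\<forall>i\<in>I. \<forall>l\<in>I. (\<Sum>j\<in>I. B i j * R j l) = of_bool (i = l)"
  shows "scales_lborel I (\<lambda>x. \<lambda>i\<in>I. m i + (\<Sum>j\<in>I. B i j * x j))"
proof -
  have "D \<subseteq> I \<Longrightarrow> scales_lborel I (\<lambda>x i. if i \<in> D then m i + x i else x i)" if "finite D" for D
    using that
  proof induction
    case empty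
    show ?case unfolding scales_lborel_def by (intro conjI exI[of _ 1]) auto
  next
    case (insert k D)
    have "scales_lborel I (\<lambda>x. (\<lambda>i. if i \<in> D then m i + (x(k := (\<Sum>j\<in>I. of_bool (j = k) * x j) + m k)) i
        else (x(k := (\<Sum>j\<in>I. of_bool (j = k) * x j) + m k)) i))"
      using insert fin by (intro scales_lborel_comp[OF _ scales_lborel_update]) auto
    then show ?case
    proof (rule scales_lborel_cong)
      fix x :: "'a \<Rightarrow> real"
      have "(\<Sum>j\<in>I. of_bool (j = k) * x j) = (\<Sum>j\<in>I. if j = k then x j else 0)"
        by (intro sum.cong) auto
      also have "\<dots> = x k" using insert fin by simp
      finally show "(\<lambda>i. if i \<in> D then m i + (x(k := (\<Sum>j\<in>I. of_bool (j = k) * x j) + m k)) i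
        else (x(k := (\<Sum>j\<in>I. of_bool (j = k) * x j) + m k)) i) =
        (\<lambda>i. if i \<in> insert k D then m i + x i else x i)"
        using insert by (auto simp: fun_eq_iff)
    qed
  qed
  from scales_lborel_comp[OF this[OF fin subset_refl] scales_lborel_lin[OF fin BR]]
  show ?thesis by (rule scales_lborel_cong) (auto simp: lin_on_def fun_eq_iff)
qed

definition gauss_density :: "'i set \<Rightarrow> ('i \<Rightarrow> real) \<Rightarrow> real" where
  "gauss_density I x = (1 / sqrt (2 * pi)) ^ card I * exp (- (\<Sum>i\<in>I. (x i)\<^sup>2) / 2)"

lemma gauss_density_pos: "gauss_density I x > 0"
  unfolding gauss_density_def by (intro mult_pos_pos zero_less_power) auto

lemma gauss_density_measurable[measurable]:
  "gauss_density I \<in> borel_measurable (\<Pi>\<^sub>M i\<in>I. (borel :: real measure))"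
  unfolding gauss_density_def[abs_def] by measurable

lemma gauss_eq_density:
  assumes fin: "finite I"
  shows "gauss I = density (lborel_on I) (\<lambda>x. ennreal (gauss_density I x))"
  unfolding gauss_def
proof (rule gauss.PiM_eqI[symmetric, OF fin])
  show "sets (density (lborel_on I) (\<lambda>x. ennreal (gauss_density I x))) = sets (Pi\<^sub>M I (\<lambda>_. std_normal_distribution))"
    unfolding sets_density sets_lborel_on by (intro sets_PiM_cong) auto
  fix A :: "'a \<Rightarrow> real set" assume A: "\<And>i. i \<in> I \<Longrightarrow> A i \<in> sets std_normal_distribution"
  have [measurable]: "Pi\<^sub>E I A \<in> sets (\<Pi>\<^sub>M i\<in>I. (borel :: real measure))"
    using A fin by (intro sets_PiM_I_finite) auto
  have "emeasure (density (lborel_on I) (\<lambda>x. ennreal (gauss_density I x))) (Pi\<^sub>E I A) =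
     (\<integral>\<^sup>+x. ennreal (gauss_density I x) * indicator (Pi\<^sub>E I A) x \<partial>lborel_on I)"
    by (subst emeasure_density) auto
  also have "\<dots> = (\<integral>\<^sup>+x. (\<Prod>i\<in>I. ennreal (std_normal_density (x i)) * indicator (A i) (x i)) \<partial>lborel_on I)"
  proof (intro nn_integral_cong)
    fix x assume "x \<in> space (lborel_on I)"
    then have x: "x \<in> extensional I" by (auto simp: space_lborel_on PiE_def)
    have "indicator (Pi\<^sub>E I A) x = (\<Prod>i\<in>I. indicator (A i) (x i) :: ennreal)"
    proof (cases "x \<in> Pi\<^sub>E I A")
      case False
      then obtain i where "i \<in> I" "x i \<notin> A i" using x by (auto simp: PiE_def)
      then have "(\<Prod>i\<in>I. indicator (A i) (x i) :: ennreal) = 0"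
        using fin by (intro prod_zero bexI[of _ i]) auto
      then show ?thesis using False by simp
    qed (auto simp: indicator_def PiE_def Pi_def intro!: prod.neutral)
    moreover have "gauss_density I x = (\<Prod>i\<in>I. std_normal_density (x i))"
      using fin by (simp add: gauss_density_def std_normal_density_def prod_dividef exp_sum[symmetric]
        sum_negf sum_divide_distrib power_one_over power_divide)
    ultimately show "ennreal (gauss_density I x) * indicator (Pi\<^sub>E I A) x =
        (\<Prod>i\<in>I. ennreal (std_normal_density (x i)) * indicator (A i) (x i))"
      by (simp add: prod.distrib prod_ennreal)
  qed
  also have "\<dots> = (\<Prod>i\<in>I. emeasure std_normal_distribution (A i))"
    using A fin unfolding lborel_on_def by (subst lborel_prod.product_nn_integral_prod) (auto simp: emeasure_density intro!: prod.cong)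
  finally show "emeasure (density (lborel_on I) (\<lambda>x. ennreal (gauss_density I x))) (Pi\<^sub>E I A) =
     (\<Prod>i\<in>I. emeasure std_normal_distribution (A i))" .
qed

text \<open>If a density composed with T is proportional to the Gaussian one, then the unknown Jacobian of T and
  the factor of proportionality cancel, because both sides have total mass one.\<close>

lemma distr_gauss_scaling:
  assumes fin: "finite I" and T: "scales_lborel I T"
    and D[measurable]: "D \<in> borel_measurable (\<Pi>\<^sub>M i\<in>I. (borel :: real measure))"
    and int: "(\<integral>\<^sup>+x. ennreal (D x) \<partial>lborel_on I) = 1"
    and c: "c > 0" "\<And>x. x \<in> space (lborel_on I) \<Longrightarrow> D (T x) = c * gauss_density I x"
  shows "distr (gauss I) (lborel_on I) T = density (lborel_on I) (\<lambda>x. ennreal (D x))"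
proof -
  let ?L = "lborel_on I"
  from T obtain C where C: "C > 0" "\<And>f. f \<in> borel_measurable ?L \<Longrightarrow>
      (\<integral>\<^sup>+x. f (T x) \<partial>?L) = ennreal C * (\<integral>\<^sup>+x. f x \<partial>?L)" and [measurable]: "T \<in> ?L \<rightarrow>\<^sub>M ?L"
    unfolding scales_lborel_def by blast
  have T'[measurable]: "T \<in> (\<Pi>\<^sub>M i\<in>I. borel) \<rightarrow>\<^sub>M (\<Pi>\<^sub>M i\<in>I. borel)"
    using \<open>T \<in> ?L \<rightarrow>\<^sub>M ?L\<close> by (simp add: measurable_cong_sets[OF sets_lborel_on sets_lborel_on])
  have mT[measurable]: "T \<in> gauss I \<rightarrow>\<^sub>M ?L"
    by (subst measurable_cong_sets[of "gauss I" ?L]) (auto simp: gauss_eq_density[OF fin])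
  have key: "(\<integral>\<^sup>+x. f (T x) \<partial>gauss I) = ennreal (C / c) * (\<integral>\<^sup>+x. ennreal (D x) * f x \<partial>?L)"
    if f: "f \<in> borel_measurable ?L" for f
  proof -
    note f[measurable]
    have [measurable]: "(\<lambda>x. f (T x)) \<in> borel_measurable ?L" by measurable
    have "(\<integral>\<^sup>+x. f (T x) \<partial>gauss I) = (\<integral>\<^sup>+x. ennreal (gauss_density I x) * f (T x) \<partial>?L)"
      unfolding gauss_eq_density[OF fin] by (subst nn_integral_density) auto
    also have "\<dots> = (\<integral>\<^sup>+x. ennreal (1/c) * (ennreal (D (T x)) * f (T x)) \<partial>?L)"
      using c gauss_density_pos[of I]
      by (intro nn_integral_cong) (simp add: mult.assoc[symmetric] ennreal_mult[symmetric] less_imp_le)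
    also have "\<dots> = ennreal (1/c) * (\<integral>\<^sup>+x. ennreal (D (T x)) * f (T x) \<partial>?L)"
      by (intro nn_integral_cmult) measurable
    also have "\<dots> = ennreal (1/c) * (ennreal C * (\<integral>\<^sup>+x. ennreal (D x) * f x \<partial>?L))"
      by (subst C(2)) auto
    finally show ?thesis using c C by (simp add: mult.assoc[symmetric] ennreal_mult[symmetric] less_imp_le)
  qed
  have "(\<integral>\<^sup>+x. 1 \<partial>gauss I) = ennreal (C / c) * 1" using key[of "\<lambda>_. 1"] int by simp
  then have Cc: "ennreal (C / c) = 1"
    using prob_space.emeasure_space_1[OF prob_space_gauss, of I] by simp
  show ?thesis
  proof (rule measure_eqI)
    fix A assume "A \<in> sets (distr (gauss I) ?L T)"
    then have [measurable]: "A \<in> sets ?L" by simp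
    have "emeasure (distr (gauss I) ?L T) A = (\<integral>\<^sup>+x. indicator A x \<partial>distr (gauss I) ?L T)" by simp
    also have "\<dots> = (\<integral>\<^sup>+x. indicator A (T x) \<partial>gauss I)" by (subst nn_integral_distr) auto
    also have "\<dots> = (\<integral>\<^sup>+x. ennreal (D x) * indicator A x \<partial>?L)" by (subst key) (auto simp: Cc)
    also have "\<dots> = emeasure (density ?L (\<lambda>x. ennreal (D x))) A" by (subst emeasure_density) auto
    finally show "emeasure (distr (gauss I) ?L T) A = emeasure (density ?L (\<lambda>x. ennreal (D x))) A" .
  qed simp
qed

lemma orth_on_norm:
  assumes "finite I" "orth_on I B"
  shows "(\<Sum>i\<in>I. (\<Sum>j\<in>I. B i j * x j) * (\<Sum>j\<in>I. B i j * y j)) = (\<Sum>j\<in>I. x j * y j)"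
proof -
  have "(\<Sum>i\<in>I. (\<Sum>j\<in>I. B i j * x j) * (\<Sum>j\<in>I. B i j * y j)) =
      (\<Sum>i\<in>I. \<Sum>j\<in>I. \<Sum>l\<in>I. B i j * x j * (B i l * y l))"
    by (simp add: sum_product)
  also have "\<dots> = (\<Sum>j\<in>I. \<Sum>l\<in>I. \<Sum>i\<in>I. B i j * x j * (B i l * y l))"
    by (subst sum.swap, rule sum.cong[OF refl], subst sum.swap) simp
  also have "\<dots> = (\<Sum>j\<in>I. \<Sum>l\<in>I. (x j * y l) * (\<Sum>i\<in>I. B i j * B i l))"
    by (simp add: sum_distrib_left mult_ac)
  also have "\<dots> = (\<Sum>j\<in>I. \<Sum>l\<in>I. if j = l then x j * y l else 0)"
    using assms by (intro sum.cong) (auto simp: orth_on_def)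
  also have "\<dots> = (\<Sum>j\<in>I. x j * y j)" using assms by simp
  finally show ?thesis .
qed

theorem gauss_orth_invariant:
  assumes fin: "finite I" and orth: "orth_on I B"
  shows "distr (gauss I) (gauss I) (lin_on I B) = gauss I"
proof -
  have "distr (gauss I) (lborel_on I) (lin_on I B) =
      density (lborel_on I) (\<lambda>x. ennreal (gauss_density I x))"
  proof (rule distr_gauss_scaling[OF fin])
    show "scales_lborel I (lin_on I B)"
      using orth by (intro scales_lborel_lin[OF fin, where R="\<lambda>i j. B j i"]) (auto simp: orth_on_def)
    have "emeasure (gauss I) (space (lborel_on I)) = (\<integral>\<^sup>+x. ennreal (gauss_density I x) \<partial>lborel_on I)"
      unfolding gauss_eq_density[OF fin]
      by (subst emeasure_density) (auto intro!: nn_integral_cong)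
    then show "(\<integral>\<^sup>+x. ennreal (gauss_density I x) \<partial>lborel_on I) = 1"
      using prob_space.emeasure_space_1[OF prob_space_gauss, of I]
      by (simp add: space_lborel_on space_gauss)
    show "gauss_density I (lin_on I B x) = 1 * gauss_density I x" for x
      using orth_on_norm[OF fin orth, of x x]
      by (simp add: gauss_density_def lin_on_def power2_eq_square)
  qed auto
  moreover have "distr (gauss I) (gauss I) (lin_on I B) = distr (gauss I) (lborel_on I) (lin_on I B)"
    by (intro distr_cong) (auto simp: sets_gauss sets_lborel_on)
  ultimately show ?thesis
    by (simp add: gauss_eq_density[OF fin, symmetric])
qed

section \<open>Reflections and the spectral theorem\<close>

lemma sum_bilinear_swap:
  fixes p :: "'a \<Rightarrow> real"
  shows "(\<Sum>k\<in>K. (\<Sum>s\<in>S. p s * R s k) * (\<Sum>t\<in>T. q t * b k t)) =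
    (\<Sum>s\<in>S. \<Sum>t\<in>T. p s * q t * (\<Sum>k\<in>K. R s k * b k t))"
proof -
  have "(\<Sum>k\<in>K. (\<Sum>s\<in>S. p s * R s k) * (\<Sum>t\<in>T. q t * b k t)) =
    (\<Sum>k\<in>K. \<Sum>s\<in>S. \<Sum>t\<in>T. p s * q t * (R s k * b k t))"
    by (simp add: sum_product mult_ac)
  also have "\<dots> = (\<Sum>s\<in>S. \<Sum>t\<in>T. \<Sum>k\<in>K. p s * q t * (R s k * b k t))"
    by (subst sum.swap, rule sum.cong[OF refl], subst sum.swap) simp
  finally show ?thesis by (simp add: sum_distrib_left)
qed

lemma sum_of_bool_mult:
  fixes f :: "'a \<Rightarrow> real"
  assumes "finite I" "i \<in> I"
  shows "(\<Sum>j\<in>I. of_bool (i = j) * f j) = f i" "(\<Sum>j\<in>I. of_bool (j = i) * f j) = f i"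
    "(\<Sum>j\<in>I. f j * of_bool (i = j)) = f i" "(\<Sum>j\<in>I. f j * of_bool (j = i)) = f i"
proof -
  have "(\<Sum>j\<in>I. if j = i then f j else 0) = f i" using assms by simp
  moreover have "(\<Sum>j\<in>I. of_bool (i = j) * f j) = (\<Sum>j\<in>I. if j = i then f j else 0)"
    "(\<Sum>j\<in>I. of_bool (j = i) * f j) = (\<Sum>j\<in>I. if j = i then f j else 0)"
    "(\<Sum>j\<in>I. f j * of_bool (i = j)) = (\<Sum>j\<in>I. if j = i then f j else 0)"
    "(\<Sum>j\<in>I. f j * of_bool (j = i)) = (\<Sum>j\<in>I. if j = i then f j else 0)"
    by (intro sum.cong; auto)+
  ultimately show "(\<Sum>j\<in>I. of_bool (i = j) * f j) = f i" "(\<Sum>j\<in>I. of_bool (j = i) * f j) = f i"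
    "(\<Sum>j\<in>I. f j * of_bool (i = j)) = f i" "(\<Sum>j\<in>I. f j * of_bool (j = i)) = f i"
    by simp_all
qed

text \<open>The reflection in the hyperplane orthogonal to u - v exchanges two vectors of equal length.\<close>

lemma householder:
  assumes fin: "finite I" and uv: "(\<Sum>i\<in>I. (u i)\<^sup>2) = (\<Sum>i\<in>I. (v i :: real)\<^sup>2)"
  obtains R where "orth_on I R" "\<And>i j. R i j = R j i"
    "\<And>i. i \<in> I \<Longrightarrow> (\<Sum>j\<in>I. R i j * u j) = v i" "\<And>i. i \<in> I \<Longrightarrow> (\<Sum>j\<in>I. R i j * v j) = u i"
proof -
  define d where "d i = u i - v i" for i
  define s where "s = (\<Sum>i\<in>I. (d i)\<^sup>2)"
  define c where "c = 2 / s"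
  \<comment> \<open>If u = v, then c = 2 / 0 = 0 and the reflection degenerates to the identity.\<close>
  define R where "R i j = of_bool (i = j) - c * d i * d j" for i j
  have sym: "R i j = R j i" for i j by (auto simp: R_def)
  have c: "c * c * s = 2 * c" by (simp add: c_def)
  have Rx: "(\<Sum>j\<in>I. R i j * x j) = x i - c * d i * (\<Sum>j\<in>I. d j * x j)" if "i \<in> I" for i x
  proof -
    have "(\<Sum>j\<in>I. R i j * x j) = (\<Sum>j\<in>I. of_bool (i = j) * x j) - c * d i * (\<Sum>j\<in>I. d j * x j)"
      by (simp add: R_def algebra_simps sum_subtractf sum_distrib_left)
    then show ?thesis using sum_of_bool_mult(1)[OF fin that] by simp
  qed
  have RR: "(\<Sum>k\<in>I. R i k * R j k) = of_bool (i = j)" if "i \<in> I" "j \<in> I" for i j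
  proof -
    have "(\<Sum>k\<in>I. d k * R j k) = (\<Sum>k\<in>I. R j k * d k)" by (simp add: mult.commute)
    also have "\<dots> = d j - c * d j * s" unfolding Rx[OF that(2)] by (simp add: s_def power2_eq_square)
    finally have dR: "(\<Sum>k\<in>I. d k * R j k) = d j - c * d j * s" .
    have "(\<Sum>k\<in>I. R i k * R j k) = R j i - c * d i * (d j - c * d j * s)"
      unfolding Rx[OF that(1), of "\<lambda>k. R j k"] dR ..
    also have "\<dots> = of_bool (i = j) + d i * d j * (c * c * s - 2 * c)"
      by (auto simp: R_def algebra_simps)
    finally show ?thesis using c by simp
  qed
  have orth: "orth_on I R" unfolding orth_on_def
    using RR sym by (auto intro!: RR cong: sum.cong)
  have dd: "(\<Sum>j\<in>I. d j * u j) = s / 2" "(\<Sum>j\<in>I. d j * v j) = - s / 2"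
  proof -
    have "s = (\<Sum>i\<in>I. (u i)\<^sup>2) - 2 * (\<Sum>i\<in>I. u i * v i) + (\<Sum>i\<in>I. (v i)\<^sup>2)"
      by (simp add: s_def d_def power2_diff sum.distrib sum_subtractf sum_distrib_left mult_ac)
    moreover have "(\<Sum>j\<in>I. d j * u j) = (\<Sum>i\<in>I. (u i)\<^sup>2) - (\<Sum>i\<in>I. u i * v i)"
      "(\<Sum>j\<in>I. d j * v j) = (\<Sum>i\<in>I. u i * v i) - (\<Sum>i\<in>I. (v i)\<^sup>2)"
      by (simp_all add: d_def algebra_simps sum_subtractf power2_eq_square)
    ultimately show "(\<Sum>j\<in>I. d j * u j) = s / 2" "(\<Sum>j\<in>I. d j * v j) = - s / 2" using uv by auto
  qed
  have cs: "c * d i * (s / 2) = d i" if "i \<in> I" for i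
  proof (cases "s = 0")
    case True
    then have "d i = 0" using fin that unfolding s_def by (subst (asm) sum_nonneg_eq_0_iff) auto
    then show ?thesis by simp
  qed (simp add: c_def)
  show ?thesis
  proof (rule that[OF orth sym])
    fix i assume i: "i \<in> I"
    show "(\<Sum>j\<in>I. R i j * u j) = v i" unfolding Rx[OF i] dd cs[OF i] by (simp add: d_def)
    have "c * d i * (- s / 2) = - d i" using cs[OF i] by (simp only: mult_minus_right minus_divide_left[symmetric])
    then show "(\<Sum>j\<in>I. R i j * v j) = u i" unfolding Rx[OF i] dd by (simp add: d_def)
  qed
qed

text \<open>A complex eigenvalue exists; for a symmetric real matrix the Rayleigh quotient shows that it is
  real, so the real or the imaginary part of the eigenvector is a real eigenvector.\<close>

lemma symmetric_eigenvector:
  fixes a :: "nat \<Rightarrow> nat \<Rightarrow> real"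
  assumes m: "m > 0" and sym: "\<And>i j. i < m \<Longrightarrow> j < m \<Longrightarrow> a i j = a j i"
  obtains e v where "\<And>i. i < m \<Longrightarrow> (\<Sum>j<m. a i j * v j) = e * v i" "(\<Sum>i<m. (v i)\<^sup>2) = 1"
proof -
  define A where "A = mat m m (\<lambda>(i,j). complex_of_real (a i j))"
  have A: "A \<in> carrier_mat m m" by (simp add: A_def)
  obtain lam where "eigenvalue A lam"
    using spectrum_non_empty[OF A] m unfolding spectrum_def by auto
  then obtain w where w: "w \<in> carrier_vec m" "w \<noteq> 0\<^sub>v m" "A *\<^sub>v w = lam \<cdot>\<^sub>v w"
    using A unfolding eigenvalue_def eigenvector_def by auto
  have ev: "(\<Sum>j<m. of_real (a i j) * (w $ j)) = lam * w $ i" if i: "i < m" for i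
  proof -
    have "(A *\<^sub>v w) $ i = (\<Sum>j<m. of_real (a i j) * (w $ j))"
      using i w(1) unfolding A_def by (simp add: scalar_prod_def lessThan_atLeast0)
    then show ?thesis using w i by simp
  qed
  define z where "z = (\<Sum>i<m. cnj (w $ i) * (\<Sum>j<m. of_real (a i j) * (w $ j)))"
  have "cnj z = (\<Sum>i<m. \<Sum>j<m. w $ i * of_real (a i j) * cnj (w $ j))"
    by (simp add: z_def sum_distrib_left mult_ac)
  also have "\<dots> = (\<Sum>j<m. \<Sum>i<m. w $ i * of_real (a i j) * cnj (w $ j))" by (rule sum.swap)
  also have "\<dots> = z" unfolding z_def
    by (simp add: sum_distrib_left mult_ac) (intro sum.cong refl, simp add: sym mult_ac)
  finally have zr: "cnj z = z" .
  define r where "r = (\<Sum>i<m. (cmod (w $ i))\<^sup>2)"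
  have "z = (\<Sum>i<m. cnj (w $ i) * (lam * w $ i))" unfolding z_def using ev by simp
  also have "\<dots> = lam * of_real r"
    unfolding r_def of_real_sum sum_distrib_left
    by (intro sum.cong refl) (simp add: complex_norm_square mult_ac del: of_real_power)
  finally have zl: "z = lam * of_real r" .
  obtain i0 where i0: "i0 < m" "w $ i0 \<noteq> 0" using w(1,2) by (metis carrier_vecD eq_vecI index_zero_vec)
  have "r > 0" unfolding r_def using i0 by (intro sum_pos2[of _ i0]) auto
  with zr zl have "cnj lam = lam" by simp
  from arg_cong[OF this, of Im] have lam: "Im lam = 0" by simp
  have "\<exists>v. (\<forall>i<m. (\<Sum>j<m. a i j * v j) = Re lam * v i) \<and> v i0 \<noteq> 0"
  proof (cases "Re (w $ i0) = 0")
    case False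
    have "(\<Sum>j<m. a i j * Re (w $ j)) = Re lam * Re (w $ i)" if "i < m" for i
      using arg_cong[OF ev[OF that], of Re] lam by simp
    then show ?thesis using False by (intro exI[of _ "\<lambda>j. Re (w $ j)"]) auto
  next
    case True
    then have "Im (w $ i0) \<noteq> 0" using i0 by (auto simp: complex_eq_iff)
    moreover have "(\<Sum>j<m. a i j * Im (w $ j)) = Re lam * Im (w $ i)" if "i < m" for i
      using arg_cong[OF ev[OF that], of Im] lam by simp
    ultimately show ?thesis by (intro exI[of _ "\<lambda>j. Im (w $ j)"]) auto
  qed
  then obtain v where v: "\<And>i. i < m \<Longrightarrow> (\<Sum>j<m. a i j * v j) = Re lam * v i" "v i0 \<noteq> 0" by auto
  define q where "q = sqrt (\<Sum>i<m. (v i)\<^sup>2)"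
  have s: "(\<Sum>i<m. (v i)\<^sup>2) > 0" using i0 v by (intro sum_pos2[of _ i0]) auto
  then have q: "q > 0" "q\<^sup>2 = (\<Sum>i<m. (v i)\<^sup>2)" by (auto simp: q_def)
  show ?thesis
  proof (rule that[of "\<lambda>i. v i / q" "Re lam"])
    show "(\<Sum>j<m. a i j * (v j / q)) = Re lam * (v i / q)" if "i < m" for i
      using v(1)[OF that] by (simp add: sum_divide_distrib[symmetric])
    show "(\<Sum>i<m. (v i / q)\<^sup>2) = 1"
      using s by (simp add: power_divide sum_divide_distrib[symmetric] q(2))
  qed
qed

lemma orth_on_compose:
  assumes fin: "finite I" and A: "orth_on I A" and B: "orth_on I B"
  shows "orth_on I (\<lambda>i k. \<Sum>j\<in>I. A i j * B j k)"
  unfolding orth_on_def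
proof (intro conjI ballI)
  fix i j assume ij: "i \<in> I" "j \<in> I"
  have "(\<Sum>k\<in>I. (\<Sum>s\<in>I. A i s * B s k) * (\<Sum>t\<in>I. A j t * B t k)) =
    (\<Sum>s\<in>I. \<Sum>t\<in>I. A i s * A j t * (\<Sum>k\<in>I. B s k * B t k))"
    by (rule sum_bilinear_swap)
  also have "\<dots> = (\<Sum>s\<in>I. \<Sum>t\<in>I. A i s * A j t * of_bool (s = t))"
    using B by (intro sum.cong refl) (auto simp: orth_on_def)
  also have "\<dots> = (\<Sum>s\<in>I. A i s * A j s)"
    by (intro sum.cong refl sum_of_bool_mult(3) fin)
  also have "\<dots> = of_bool (i = j)" using A ij by (auto simp: orth_on_def)
  finally show "(\<Sum>k\<in>I. (\<Sum>s\<in>I. A i s * B s k) * (\<Sum>t\<in>I. A j t * B t k)) = of_bool (i = j)" .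
  have "(\<Sum>k\<in>I. (\<Sum>s\<in>I. A k s * B s i) * (\<Sum>t\<in>I. A k t * B t j)) =
     (\<Sum>k\<in>I. (\<Sum>s\<in>I. B s i * A k s) * (\<Sum>t\<in>I. B t j * A k t))" by (simp add: mult.commute)
  also have "\<dots> = (\<Sum>s\<in>I. \<Sum>t\<in>I. B s i * B t j * (\<Sum>k\<in>I. A k s * A k t))"
    by (rule sum_bilinear_swap)
  also have "\<dots> = (\<Sum>s\<in>I. \<Sum>t\<in>I. B s i * B t j * of_bool (s = t))"
    using A by (intro sum.cong refl) (auto simp: orth_on_def)
  also have "\<dots> = (\<Sum>s\<in>I. B s i * B s j)"
    by (intro sum.cong refl sum_of_bool_mult(3) fin)
  also have "\<dots> = of_bool (i = j)" using B ij by (auto simp: orth_on_def)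
  finally show "(\<Sum>k\<in>I. (\<Sum>s\<in>I. A k s * B s i) * (\<Sum>t\<in>I. A k t * B t j)) = of_bool (i = j)" .
qed

text \<open>A reflection moves a unit eigenvector to the last axis. The rotated matrix then splits off its last
  row and column, and the induction hypothesis diagonalizes the remaining block.\<close>

theorem symmetric_spectral:
  fixes a :: "nat \<Rightarrow> nat \<Rightarrow> real"
  assumes "\<And>i j. i < m \<Longrightarrow> j < m \<Longrightarrow> a i j = a j i"
  shows "\<exists>Q lam. orth_on {..<m} Q \<and>
    (\<forall>i<m. \<forall>j<m. (\<Sum>k<m. Q i k * (\<Sum>l<m. Q j l * a k l)) = of_bool (i = j) * lam i)"
  using assms
proof (induction m arbitrary: a)
  case 0
  then show ?case by (auto simp: orth_on_def)
next
  case (Suc m)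
  let ?I = "{..<Suc m}"
  note sum.lessThan_Suc[simp del]
  obtain e v where ev: "\<And>i. i < Suc m \<Longrightarrow> (\<Sum>j<Suc m. a i j * v j) = e * v i" "(\<Sum>i<Suc m. (v i)\<^sup>2) = 1"
    by (rule symmetric_eigenvector[of "Suc m" a]) (use Suc(2) in auto)
  define u :: "nat \<Rightarrow> real" where "u i = of_bool (i = m)" for i
  have "(\<Sum>i\<in>?I. (u i)\<^sup>2) = (\<Sum>i\<in>?I. of_bool (i = m) * (1::real))"
    by (intro sum.cong) (auto simp: u_def)
  also have "\<dots> = 1" by (rule sum_of_bool_mult) auto
  finally have "(\<Sum>i\<in>?I. (u i)\<^sup>2) = (\<Sum>i\<in>?I. (v i)\<^sup>2)" using ev(2) by simp
  from householder[OF finite_lessThan this]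
  obtain R where R: "orth_on ?I R" "\<And>i j. R i j = R j i"
    "\<And>i. i \<in> ?I \<Longrightarrow> (\<Sum>j\<in>?I. R i j * u j) = v i" "\<And>i. i \<in> ?I \<Longrightarrow> (\<Sum>j\<in>?I. R i j * v j) = u i"
    by blast
  have Rm: "R i m = v i" if "i < Suc m" for i
    using R(3)[of i] that sum_of_bool_mult(4)[of ?I m "R i"] unfolding u_def by simp
  define a' where "a' i j = (\<Sum>k<Suc m. R i k * (\<Sum>l<Suc m. R j l * a k l))" for i j
  have a'sym: "a' i j = a' j i" if "i < Suc m" "j < Suc m" for i j
  proof -
    have "a' i j = (\<Sum>k<Suc m. \<Sum>l<Suc m. R i k * R j l * a k l)"
      by (simp add: a'_def sum_distrib_left mult_ac)
    also have "\<dots> = (\<Sum>l<Suc m. \<Sum>k<Suc m. R i k * R j l * a k l)" by (rule sum.swap)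
    also have "\<dots> = (\<Sum>l<Suc m. \<Sum>k<Suc m. R j l * (R i k * a l k))"
      using Suc(2) by (intro sum.cong refl) (auto simp: mult_ac)
    finally show ?thesis by (simp add: a'_def sum_distrib_left)
  qed
  have a'm: "a' i m = e * of_bool (i = m)" if "i < Suc m" for i
  proof -
    have "(\<Sum>l<Suc m. R m l * a k l) = e * v k" if k: "k < Suc m" for k
    proof -
      have "(\<Sum>l<Suc m. R m l * a k l) = (\<Sum>l<Suc m. a k l * v l)"
        using Rm R(2) by (intro sum.cong refl) (auto simp: mult.commute)
      then show ?thesis using ev(1)[OF k] by simp
    qed
    then have "a' i m = (\<Sum>k<Suc m. R i k * (e * v k))"
      unfolding a'_def by (intro sum.cong) auto
    also have "\<dots> = e * (\<Sum>k<Suc m. R i k * v k)" by (simp add: sum_distrib_left mult_ac)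
    also have "\<dots> = e * u i" using R(4)[of i] that by simp
    finally show ?thesis by (simp add: u_def)
  qed
  obtain Q' lam' where Q': "orth_on {..<m} Q'" and
    Q'a: "\<forall>i<m. \<forall>j<m. (\<Sum>k<m. Q' i k * (\<Sum>l<m. Q' j l * a' k l)) = of_bool (i = j) * lam' i"
    using Suc(1)[of a'] a'sym by force
  define P where "P i j = (if i = m \<or> j = m then of_bool (i = j) else Q' i j)" for i j
  have P: "orth_on ?I P"
    unfolding orth_on_def
  proof (intro conjI ballI)
    fix i j assume ij: "i \<in> ?I" "j \<in> ?I"
    have "(\<Sum>k<m. P i k * P j k) = (if i = m \<or> j = m then 0 else of_bool (i = j))"
      using Q' ij unfolding orth_on_def by (auto simp: P_def intro!: sum.neutral)
    then show "(\<Sum>k\<in>?I. P i k * P j k) = of_bool (i = j)" using ij by (auto simp: P_def sum.lessThan_Suc)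
    have "(\<Sum>k<m. P k i * P k j) = (if i = m \<or> j = m then 0 else of_bool (i = j))"
      using Q' ij unfolding orth_on_def by (auto simp: P_def intro!: sum.neutral)
    then show "(\<Sum>k\<in>?I. P k i * P k j) = of_bool (i = j)" using ij by (auto simp: P_def sum.lessThan_Suc)
  qed
  define Q where "Q i k = (\<Sum>j\<in>?I. P i j * R j k)" for i k
  have "orth_on ?I Q" unfolding Q_def[abs_def] by (rule orth_on_compose[OF _ P R(1)]) simp
  moreover have "(\<Sum>k<Suc m. Q i k * (\<Sum>l<Suc m. Q j l * a k l)) = of_bool (i = j) * (if i = m then e else lam' i)"
    if ij: "i < Suc m" "j < Suc m" for i j
  proof -
    have "(\<Sum>l<Suc m. Q j l * a k l) = (\<Sum>t<Suc m. P j t * (\<Sum>l<Suc m. R t l * a k l))" for k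
    proof -
      have "(\<Sum>l<Suc m. Q j l * a k l) = (\<Sum>l<Suc m. \<Sum>t<Suc m. P j t * (R t l * a k l))"
        by (simp add: Q_def sum_distrib_right sum_distrib_left mult_ac)
      also have "\<dots> = (\<Sum>t<Suc m. \<Sum>l<Suc m. P j t * (R t l * a k l))" by (rule sum.swap)
      finally show ?thesis by (simp add: sum_distrib_left)
    qed
    then have "(\<Sum>k<Suc m. Q i k * (\<Sum>l<Suc m. Q j l * a k l)) =
      (\<Sum>k<Suc m. (\<Sum>s<Suc m. P i s * R s k) * (\<Sum>t<Suc m. P j t * (\<Sum>l<Suc m. R t l * a k l)))"
      by (simp add: Q_def)
    also have "\<dots> = (\<Sum>s<Suc m. \<Sum>t<Suc m. P i s * P j t * a' s t)"
      unfolding a'_def by (rule sum_bilinear_swap)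
    finally have eq: "(\<Sum>k<Suc m. Q i k * (\<Sum>l<Suc m. Q j l * a k l)) =
       (\<Sum>s<Suc m. \<Sum>t<Suc m. P i s * P j t * a' s t)" .
    have inner: "(\<Sum>t<Suc m. P i s * P j t * a' s t) =
       (if s = m then P i m * P j m * e else P i s * (\<Sum>t<m. P j t * a' s t))" if s: "s < Suc m" for s
    proof (cases "s = m")
      case True
      have "(\<Sum>t<m. P i s * P j t * a' s t) = 0"
        using a'm a'sym[of m] True by (intro sum.neutral) auto
      then show ?thesis using True a'm[of m] by (simp add: sum.lessThan_Suc)
    next
      case False
      then show ?thesis using a'm[OF s] by (simp add: sum.lessThan_Suc sum_distrib_left mult_ac)
    qed
    have "(\<Sum>s<Suc m. \<Sum>t<Suc m. P i s * P j t * a' s t) =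
      P i m * P j m * e + (\<Sum>s<m. P i s * (\<Sum>t<m. P j t * a' s t))"
      using inner by (subst sum.lessThan_Suc) (simp)
    also have "(\<Sum>s<m. P i s * (\<Sum>t<m. P j t * a' s t)) =
       (if i = m \<or> j = m then 0 else \<Sum>s<m. Q' i s * (\<Sum>t<m. Q' j t * a' s t))"
      by (auto simp: P_def intro!: sum.neutral sum.cong)
    finally show ?thesis unfolding eq using Q'a ij by (auto simp: P_def less_Suc_eq)
  qed
  ultimately show ?case by (intro exI[of _ Q] exI[of _ "\<lambda>i. if i = m then e else lam' i"]) auto
qed

section \<open>Inverse matrices and measurability of the statistics\<close>

text \<open>The adjugate formula expresses the inverse by rational functions of the entries, which yields
  measurability of quadratic forms in an inverse random matrix.\<close>

lemma mat_inv_works: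
  assumes A: "A \<in> carrier_mat n n" and d: "det A \<noteq> 0"
  shows "mat_inv A \<in> carrier_mat n n" "A * mat_inv A = 1\<^sub>m n" "mat_inv A * A = 1\<^sub>m n"
    "mat_inv A = (1 / det A) \<cdot>\<^sub>m adj_mat A"
proof -
  obtain B where B: "mat_inverse A = Some B"
    using mat_inverse(1)[OF A, of "()"] det_non_zero_imp_unit[OF A d, of "()"]
    by (cases "mat_inverse A") auto
  note * = mat_inverse(2)[OF A B]
  have eq: "mat_inv A = B" by (simp add: mat_inv_def B)
  show 1: "mat_inv A \<in> carrier_mat n n" "A * mat_inv A = 1\<^sub>m n" "mat_inv A * A = 1\<^sub>m n"
    unfolding eq using * by auto
  note adj = adj_mat[OF A]
  have "A * ((1 / det A) \<cdot>\<^sub>m adj_mat A) = (1 / det A) \<cdot>\<^sub>m (A * adj_mat A)"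
    using A adj(1) by (simp add: mult_smult_distrib)
  also have "\<dots> = 1\<^sub>m n" unfolding adj(2) using d by (auto intro!: eq_matI)
  finally have A2: "A * ((1 / det A) \<cdot>\<^sub>m adj_mat A) = 1\<^sub>m n" .
  have c: "(1 / det A) \<cdot>\<^sub>m adj_mat A \<in> carrier_mat n n" using adj(1) by simp
  have "mat_inv A = mat_inv A * (A * ((1 / det A) \<cdot>\<^sub>m adj_mat A))" unfolding A2 using 1(1) by simp
  also have "\<dots> = (mat_inv A * A) * ((1 / det A) \<cdot>\<^sub>m adj_mat A)"
    by (rule assoc_mult_mat[symmetric, OF 1(1) A c])
  also have "\<dots> = (1 / det A) \<cdot>\<^sub>m adj_mat A" unfolding 1(3) by (rule left_mult_one_mat[OF c])
  finally show "mat_inv A = (1 / det A) \<cdot>\<^sub>m adj_mat A" .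
qed

lemma quad_form_mat_inv_solve:
  assumes A: "A \<in> carrier_mat n n" and d: "det A \<noteq> 0" and b: "b \<in> carrier_vec n" and y: "A *\<^sub>v b = y"
  shows "quad_form (mat_inv A) y = y \<bullet> b"
proof -
  note inv = mat_inv_works[OF A d]
  have "mat_inv A *\<^sub>v y = (mat_inv A * A) *\<^sub>v b"
    unfolding y[symmetric] by (rule assoc_mult_mat_vec[symmetric, OF inv(1) A b])
  also have "\<dots> = b" using b by (simp add: inv(3))
  finally show ?thesis by (simp add: quad_form_def)
qed

lemma det_measurable:
  assumes "\<And>\<omega>. A \<omega> \<in> carrier_mat n n"
    and "\<And>i j. i < n \<Longrightarrow> j < n \<Longrightarrow> (\<lambda>\<omega>. A \<omega> $$ (i, j)) \<in> borel_measurable M"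
  shows "(\<lambda>\<omega>. det (A \<omega>) :: real) \<in> borel_measurable M"
proof -
  have "det (A \<omega>) = (\<Sum> p \<in> {p. p permutes {0 ..< n}}. signof p * (\<Prod> i = 0 ..< n. A \<omega> $$ (i, p i)))" for \<omega>
    by (rule det_def'[OF assms(1)])
  then show ?thesis
    by (auto intro!: borel_measurable_sum borel_measurable_times borel_measurable_prod assms(2)
        simp: permutes_in_image)
qed

lemma adj_mat_measurable:
  assumes A: "\<And>\<omega>. A \<omega> \<in> carrier_mat n n"
    and m: "\<And>i j. i < n \<Longrightarrow> j < n \<Longrightarrow> (\<lambda>\<omega>. A \<omega> $$ (i, j) :: real) \<in> borel_measurable M"
    and ij: "i < n" "j < n"
  shows "(\<lambda>\<omega>. adj_mat (A \<omega>) $$ (i, j)) \<in> borel_measurable M"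
proof -
  have dims: "dim_row (A \<omega>) = n" "dim_col (A \<omega>) = n" for \<omega> using A[of \<omega>] by auto
  have eq: "adj_mat (A \<omega>) $$ (i, j) = (- 1) ^ (j + i) * det (mat_delete (A \<omega>) j i)" for \<omega>
    using ij dims by (simp add: adj_mat_def cofactor_def)
  have "(\<lambda>\<omega>. det (mat_delete (A \<omega>) j i)) \<in> borel_measurable M"
  proof (rule det_measurable[of _ "n - 1"])
    show "mat_delete (A \<omega>) j i \<in> carrier_mat (n - 1) (n - 1)" for \<omega>
      by (rule mat_delete_carrier[OF A])
    fix i' j' assume "i' < n - 1" "j' < n - 1"
    then show "(\<lambda>\<omega>. mat_delete (A \<omega>) j i $$ (i', j')) \<in> borel_measurable M"
      unfolding mat_delete_def dims by (auto intro!: m)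
  qed
  then show ?thesis unfolding eq by (intro borel_measurable_times) auto
qed

lemma quad_form_mat_inv_measurable:
  assumes A: "\<And>\<omega>. A \<omega> \<in> carrier_mat n n"
    and m: "\<And>i j. i < n \<Longrightarrow> j < n \<Longrightarrow> (\<lambda>\<omega>. A \<omega> $$ (i, j) :: real) \<in> borel_measurable M"
    and dy: "\<And>\<omega>. dim_vec (y \<omega>) = n"
    and my: "\<And>i. (\<lambda>\<omega>. y \<omega> $ i) \<in> borel_measurable M"
  shows "(\<lambda>\<omega>. quad_form (mat_inv (A \<omega>)) (y \<omega>)) \<in> borel_measurable M"
proof -
  \<comment> \<open>The inverse has the same unspecified value at all singular matrices, so it is measurable there, too.\<close>
  define S where "S = (the None :: real mat)"
  have none: "mat_inv (A \<omega>) = S" if "det (A \<omega>) = 0" for \<omega>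
  proof -
    have "mat_inverse (A \<omega>) = None"
    proof (rule ccontr)
      assume "mat_inverse (A \<omega>) \<noteq> None"
      then obtain B where "mat_inverse (A \<omega>) = Some B" by auto
      from mat_inverse(2)[OF A this] have "A \<omega> * B = 1\<^sub>m n" "B \<in> carrier_mat n n" by auto
      then have "det (A \<omega>) * det B = 1" using det_mult[OF A] by (metis det_one)
      then show False using that by simp
    qed
    then show ?thesis by (simp add: mat_inv_def S_def)
  qed
  have qf: "quad_form B (y \<omega>) = (\<Sum>i<dim_row B. y \<omega> $ i * (\<Sum>j<n. row B i $ j * y \<omega> $ j))" for B \<omega>
    using dy by (simp add: quad_form_def scalar_prod_def mult_mat_vec_def lessThan_atLeast0)
  have eq: "quad_form (mat_inv (A \<omega>)) (y \<omega>) = (if det (A \<omega>) = 0 then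
      (\<Sum>i<dim_row S. y \<omega> $ i * (\<Sum>j<n. row S i $ j * y \<omega> $ j))
      else (\<Sum>i<n. y \<omega> $ i * (\<Sum>j<n. (1 / det (A \<omega>) * adj_mat (A \<omega>) $$ (i, j)) * y \<omega> $ j)))" for \<omega>
  proof (cases "det (A \<omega>) = 0")
    case True
    then show ?thesis by (simp add: none qf)
  next
    case False
    note adj = adj_mat(1)[OF A[of \<omega>]]
    have "dim_row (mat_inv (A \<omega>)) = n" using mat_inv_works(1)[OF A False] by auto
    moreover have "row (mat_inv (A \<omega>)) i $ j = 1 / det (A \<omega>) * adj_mat (A \<omega>) $$ (i, j)" if "i < n" "j < n" for i j
      unfolding mat_inv_works(4)[OF A False] using adj that by (auto simp: carrier_matD)
    ultimately show ?thesis using False by (simp add: qf)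
  qed
  note [measurable] = det_measurable[OF A m] my
  have [measurable]: "(\<lambda>\<omega>. adj_mat (A \<omega>) $$ (i, j)) \<in> borel_measurable M" if "i < n" "j < n" for i j
    by (rule adj_mat_measurable[OF A m that])
  show ?thesis unfolding eq
    by (intro measurable_If borel_measurable_sum borel_measurable_times my borel_measurable_divide
        borel_measurable_const) (auto intro!: borel_measurable_sum borel_measurable_times my)
qed

lemma index_vec_any: "vec n f $ i = (if i < n then f i else undef_vec (i - n))"
  by (transfer, auto simp: mk_vec_def)

lemma vec_index_measurable:
  assumes "\<And>j. j < n \<Longrightarrow> (\<lambda>\<omega>. f \<omega> j :: real) \<in> borel_measurable M"
  shows "(\<lambda>\<omega>. vec n (f \<omega>) $ i) \<in> borel_measurable M"
  using assms by (cases "i < n") (auto simp: index_vec_any)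

lemma mat_tr_square:
  assumes "A \<in> carrier_mat p p"
  shows "mat_tr (A ^\<^sub>m 2) = (\<Sum>i<p. \<Sum>j<p. A $$ (i, j) * A $$ (j, i))"
proof -
  have "A ^\<^sub>m 2 = A * A" using assms by (simp add: numeral_2_eq_2)
  then show ?thesis using assms
    by (auto simp: mat_tr_def scalar_prod_def lessThan_atLeast0 intro!: sum.cong)
qed

locale measurable_sample =
  fixes Q :: "'w measure" and N p :: nat and x :: "'w \<Rightarrow> nat \<Rightarrow> real vec"
  assumes x_meas: "\<And>i j. i \<in> {1..N} \<Longrightarrow> j < p \<Longrightarrow> (\<lambda>\<omega>. x \<omega> i $ j) \<in> borel_measurable Q"
begin

lemma sample_mean_measurable: "j < p \<Longrightarrow> (\<lambda>\<omega>. sample_mean N p (x \<omega>) $ j) \<in> borel_measurable Q"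
  unfolding sample_mean_def using x_meas by simp

lemma sample_cov_measurable:
  "j < p \<Longrightarrow> l < p \<Longrightarrow> (\<lambda>\<omega>. sample_cov N p (x \<omega>) $$ (j, l)) \<in> borel_measurable Q"
proof -
  assume jl: "j < p" "l < p"
  have d: "dim_vec (sample_mean N p (x \<omega>)) = p" for \<omega> by (simp add: sample_mean_def)
  have "(\<lambda>\<omega>. \<Sum>i=1..N. (x \<omega> i $ j - sample_mean N p (x \<omega>) $ j) * (x \<omega> i $ l - sample_mean N p (x \<omega>) $ l))
     \<in> borel_measurable Q"
    using jl by (intro borel_measurable_sum borel_measurable_times borel_measurable_diff x_meas sample_mean_measurable) auto
  then show ?thesis unfolding sample_cov_def using jl by (simp add: d)
qed

lemma sample_cov_carrier: "sample_cov N p (x \<omega>) \<in> carrier_mat p p"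
  by (simp add: sample_cov_def)

lemma mat_tr_sample_cov_measurable: "(\<lambda>\<omega>. mat_tr (sample_cov N p (x \<omega>))) \<in> borel_measurable Q"
  using sample_cov_carrier unfolding mat_tr_def by (auto intro!: borel_measurable_sum sample_cov_measurable simp: carrier_matD[OF sample_cov_carrier])

lemma a_hat1_measurable: "(\<lambda>\<omega>. a_hat1 N p (x \<omega>)) \<in> borel_measurable Q"
  unfolding a_hat1_def using mat_tr_sample_cov_measurable by simp

lemma a_hat2_measurable: "(\<lambda>\<omega>. a_hat2 N p (x \<omega>)) \<in> borel_measurable Q"
  unfolding a_hat2_def Let_def mat_tr_square[OF sample_cov_carrier]
  using mat_tr_sample_cov_measurable
  by (intro borel_measurable_times borel_measurable_const borel_measurable_diff borel_measurable_sum
      sample_cov_measurable borel_measurable_divide borel_measurable_power) auto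

lemma rho_hat_measurable: "(\<lambda>\<omega>. rho_hat N p (x \<omega>)) \<in> borel_measurable Q"
proof -
  note [measurable] = a_hat1_measurable a_hat2_measurable
  show ?thesis unfolding rho_hat_def rho_star_def by measurable
qed

lemma T_standardized_measurable:
  assumes mu: "\<mu>0 \<in> carrier_vec p" and \<rho>[measurable]: "\<rho> \<in> borel_measurable Q"
  shows "(\<lambda>\<omega>. T_standardized N p \<mu>0 (\<rho> \<omega>) (x \<omega>)) \<in> borel_measurable Q"
proof -
  have y: "sample_mean N p (x \<omega>) - \<mu>0 = vec p (\<lambda>j. sample_mean N p (x \<omega>) $ j - \<mu>0 $ j)" for \<omega>
    using mu by (auto simp: sample_mean_def)
  have my: "(\<lambda>\<omega>. (sample_mean N p (x \<omega>) - \<mu>0) $ i) \<in> borel_measurable Q" for i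
    unfolding y by (intro vec_index_measurable borel_measurable_diff sample_mean_measurable) auto
  have [measurable]: "(\<lambda>\<omega>. quad_form (mat_inv (sample_cov N p (x \<omega>))) (sample_mean N p (x \<omega>) - \<mu>0)) \<in> borel_measurable Q"
    using mu by (intro quad_form_mat_inv_measurable[of _ p] sample_cov_carrier sample_cov_measurable my) auto
  have [measurable]: "(\<lambda>\<omega>. (sample_mean N p (x \<omega>) - \<mu>0) \<bullet> (sample_mean N p (x \<omega>) - \<mu>0)) \<in> borel_measurable Q"
  proof -
    have d: "dim_vec (sample_mean N p (x \<omega>) - \<mu>0) = p" for \<omega> using mu by simp
    show ?thesis unfolding scalar_prod_def d by (intro borel_measurable_sum borel_measurable_times my)
  qed
  note [measurable] = a_hat1_measurable a_hat2_measurable mat_tr_sample_cov_measurable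
  show ?thesis
    unfolding T_standardized_def T_stat_def sigma_T_def hotelling_T2_def dempster_D_def Let_def
    by measurable
qed

end

section \<open>Inverse Gram matrices and distances to column spans\<close>

definition gram :: "nat \<Rightarrow> nat \<Rightarrow> (nat \<times> nat \<Rightarrow> real) \<Rightarrow> real mat" where
  "gram n p h = mat p p (\<lambda>(j, l). \<Sum>i<n. h (i, j) * h (i, l))"

definition indep_cols :: "nat \<Rightarrow> nat \<Rightarrow> (nat \<times> nat \<Rightarrow> real) \<Rightarrow> bool" where
  "indep_cols n p h \<longleftrightarrow> (\<forall>b. (\<forall>i<n. (\<Sum>j<p. h (i, j) * b j) = 0) \<longrightarrow> (\<forall>j<p. b j = 0))"

text \<open>For z on the last axis this is the Schur complement of the last diagonal entry in the Gram matrix,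
  that is, the squared distance of the last column to the span of the others.\<close>

definition schur_chi :: "nat \<Rightarrow> nat \<Rightarrow> (nat \<Rightarrow> real) \<Rightarrow> (nat \<times> nat \<Rightarrow> real) \<Rightarrow> real" where
  "schur_chi n p z h = (\<Sum>j<p. (z j)\<^sup>2) / quad_form (mat_inv (gram n p h)) (vec p z)"

lemma gram_carrier: "gram n p h \<in> carrier_mat p p"
  by (simp add: gram_def)

lemma dim_gram[simp]: "dim_row (gram n p h) = p" "dim_col (gram n p h) = p"
  by (simp_all add: gram_def)

lemma gram_mult_vec:
  assumes "j < p"
  shows "(gram n p h *\<^sub>v vec p b) $ j = (\<Sum>i<n. h (i, j) * (\<Sum>l<p. h (i, l) * b l))"
proof -
  have "(gram n p h *\<^sub>v vec p b) $ j = (\<Sum>l<p. (\<Sum>i<n. h (i, j) * h (i, l)) * b l)"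
    using assms by (simp add: gram_def scalar_prod_def lessThan_atLeast0)
  also have "\<dots> = (\<Sum>l<p. \<Sum>i<n. h (i, j) * (h (i, l) * b l))"
    by (simp add: sum_distrib_right sum_distrib_left mult_ac)
  also have "\<dots> = (\<Sum>i<n. \<Sum>l<p. h (i, j) * (h (i, l) * b l))" by (rule sum.swap)
  finally show ?thesis by (simp add: sum_distrib_left)
qed

lemma vec_vec_index: "v \<in> carrier_vec n \<Longrightarrow> vec n (\<lambda>i. v $ i) = v"
  by auto

lemma det_gram_nonzero_iff: "det (gram n p h) \<noteq> 0 \<longleftrightarrow> indep_cols n p h"
proof
  assume d: "det (gram n p h) \<noteq> 0"
  show "indep_cols n p h" unfolding indep_cols_def
  proof (intro allI impI)
    fix b j assume b: "\<forall>i<n. (\<Sum>j<p. h (i, j) * b j) = 0" and j: "j < p"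
    have "gram n p h *\<^sub>v vec p b = 0\<^sub>v p"
      using b by (intro eq_vecI) (auto simp: gram_mult_vec simp del: index_mult_mat_vec)
    then have "vec p b = 0\<^sub>v p"
      using d det_0_iff_vec_prod_zero[OF gram_carrier, of n p h] by (metis vec_carrier)
    then show "b j = 0" using j by (metis index_vec index_zero_vec(1))
  qed
next
  assume ind: "indep_cols n p h"
  show "det (gram n p h) \<noteq> 0"
  proof
    assume "det (gram n p h) = 0"
    then obtain v where v: "v \<in> carrier_vec p" "v \<noteq> 0\<^sub>v p" "gram n p h *\<^sub>v v = 0\<^sub>v p"
      using det_0_iff_vec_prod_zero[OF gram_carrier] by blast
    define b where "b = ($) v"
    have vb: "v = vec p b" using v(1) by (auto simp: b_def)
    have 0: "(\<Sum>i<n. h (i, j) * (\<Sum>l<p. h (i, l) * b l)) = 0" if "j < p" for j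
      using gram_mult_vec[OF that, of n h b] v(3) that by (simp add: vb del: index_mult_mat_vec)
    have "(\<Sum>i<n. (\<Sum>l<p. h (i, l) * b l)\<^sup>2) = (\<Sum>i<n. (\<Sum>j<p. b j * h (i, j)) * (\<Sum>l<p. h (i, l) * b l))"
      by (simp add: power2_eq_square mult.commute)
    also have "\<dots> = (\<Sum>i<n. \<Sum>j<p. b j * (h (i, j) * (\<Sum>l<p. h (i, l) * b l)))"
      by (subst sum_distrib_right) (simp add: mult.assoc)
    also have "\<dots> = (\<Sum>j<p. b j * (\<Sum>i<n. h (i, j) * (\<Sum>l<p. h (i, l) * b l)))"
      by (subst sum.swap) (simp add: sum_distrib_left)
    also have "\<dots> = 0" using 0 by simp
    finally have "\<forall>i<n. (\<Sum>l<p. h (i, l) * b l) = 0"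
      by (subst (asm) sum_nonneg_eq_0_iff) auto
    then have "\<forall>j<p. b j = 0" using ind by (auto simp: indep_cols_def)
    then have "v = 0\<^sub>v p" by (auto simp: vb)
    then show False using v by simp
  qed
qed

text \<open>Quadratic forms in the inverse are always evaluated through a solution of the normal equations, so
  that the inverse itself is never computed with.\<close>

lemma quad_form_gram_solve:
  assumes "indep_cols n p h" "\<And>j. j < p \<Longrightarrow> (\<Sum>i<n. h (i, j) * (\<Sum>l<p. h (i, l) * b l)) = z j"
  shows "quad_form (mat_inv (gram n p h)) (vec p z) = (\<Sum>j<p. z j * b j)"
proof -
  have "gram n p h *\<^sub>v vec p b = vec p z"
    using assms(2) by (intro eq_vecI) (auto simp: gram_mult_vec simp del: index_mult_mat_vec)
  then have "quad_form (mat_inv (gram n p h)) (vec p z) = vec p z \<bullet> vec p b"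
    using assms(1) by (intro quad_form_mat_inv_solve[OF gram_carrier]) (auto simp: det_gram_nonzero_iff)
  then show ?thesis by (simp add: scalar_prod_def lessThan_atLeast0)
qed

lemma gram_solvable:
  assumes "indep_cols n p h"
  obtains b where "\<And>j. j < p \<Longrightarrow> (\<Sum>i<n. h (i, j) * (\<Sum>l<p. h (i, l) * b l)) = z j"
proof -
  have d: "det (gram n p h) \<noteq> 0" using assms by (simp add: det_gram_nonzero_iff)
  note inv = mat_inv_works[OF gram_carrier d]
  define v where "v = mat_inv (gram n p h) *\<^sub>v vec p z"
  have v: "v \<in> carrier_vec p" using inv(1) by (simp add: v_def)
  have "gram n p h *\<^sub>v v = (gram n p h * mat_inv (gram n p h)) *\<^sub>v vec p z"
    unfolding v_def by (rule assoc_mult_mat_vec[symmetric, OF gram_carrier inv(1)]) simp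
  also have "\<dots> = vec p z" by (simp add: inv(2))
  finally have "gram n p h *\<^sub>v vec p (($) v) = vec p z" using v by (simp add: vec_vec_index)
  then have "(\<Sum>i<n. h (i, j) * (\<Sum>l<p. h (i, l) * v $ l)) = z j" if "j < p" for j
    using gram_mult_vec[OF that, of n h "($) v"] that by (simp del: index_mult_mat_vec)
  then show ?thesis by (rule that)
qed

lemma orth_on_extend:
  assumes fin: "finite I" and J: "J \<subseteq> I" and R: "orth_on J R"
  shows "orth_on I (\<lambda>i j. if i \<in> J \<and> j \<in> J then R i j else of_bool (i = j))"
proof -
  define P where "P = (\<lambda>i j. if i \<in> J \<and> j \<in> J then R i j else of_bool (i = j))"
  have finJ: "finite J" using fin J finite_subset by auto
  have split: "(\<Sum>k\<in>I. F k) = (\<Sum>k\<in>J. F k) + (\<Sum>k\<in>I-J. F k)" for F :: "_ \<Rightarrow> real"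
    using fin J by (metis sum.subset_diff add.commute)
  have out: "(\<Sum>k\<in>I-J. of_bool (i = k) * of_bool (j = k)) = (of_bool (i = j) * of_bool (i \<notin> J) :: real)"
    "(\<Sum>k\<in>I-J. of_bool (k = i) * of_bool (k = j)) = (of_bool (i = j) * of_bool (i \<notin> J) :: real)"
    if "i \<in> I" for i j
  proof -
    show 1: "(\<Sum>k\<in>I-J. of_bool (i = k) * of_bool (j = k)) = (of_bool (i = j) * of_bool (i \<notin> J) :: real)"
    proof (cases "i \<in> J")
      case True
      then show ?thesis by (intro trans[OF sum.neutral]) auto
    next
      case False
      then have "(\<Sum>k\<in>I-J. of_bool (i = k) * of_bool (j = k)) = (of_bool (j = i) :: real)"
        using fin that by (intro sum_of_bool_mult(1)) auto
      then show ?thesis using False by (cases "i = j") simp_all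
    qed
    have "(\<Sum>k\<in>I-J. of_bool (k = i) * of_bool (k = j)) = (\<Sum>k\<in>I-J. of_bool (i = k) * of_bool (j = k) :: real)"
      by (intro sum.cong) auto
    then show "(\<Sum>k\<in>I-J. of_bool (k = i) * of_bool (k = j)) = (of_bool (i = j) * of_bool (i \<notin> J) :: real)"
      using 1 by simp
  qed
  have out': "(\<Sum>k\<in>I-J. P i k * P j k) = of_bool (i = j) * of_bool (i \<notin> J)"
    "(\<Sum>k\<in>I-J. P k i * P k j) = of_bool (i = j) * of_bool (i \<notin> J)" if "i \<in> I" for i j
    unfolding out[OF that, symmetric] by (intro sum.cong; simp add: P_def)+
  have inn: "(\<Sum>k\<in>J. P i k * P j k) = of_bool (i = j) * of_bool (i \<in> J)"
    "(\<Sum>k\<in>J. P k i * P k j) = of_bool (i = j) * of_bool (i \<in> J)" if "i \<in> I" "j \<in> I" for i j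
  proof -
    consider "i \<in> J" "j \<in> J" | "i \<notin> J" | "i \<in> J" "j \<notin> J" by auto
    then show "(\<Sum>k\<in>J. P i k * P j k) = of_bool (i = j) * of_bool (i \<in> J)"
      by cases (use R in \<open>auto simp: P_def orth_on_def intro!: sum.neutral\<close>)
    consider "i \<in> J" "j \<in> J" | "i \<notin> J" | "i \<in> J" "j \<notin> J" by auto
    then show "(\<Sum>k\<in>J. P k i * P k j) = of_bool (i = j) * of_bool (i \<in> J)"
      by cases (use R in \<open>auto simp: P_def orth_on_def intro!: sum.neutral\<close>)
  qed
  have "orth_on I P" unfolding orth_on_def split using inn out' by auto
  then show ?thesis by (simp add: P_def)
qed

text \<open>A triangularization by successive reflections: the rotated columns below q vanish from row q on.
  The rotation depends only on the first q columns, and is hence independent of the following one.\<close>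

lemma orth_annihilates_columns:
  fixes K :: "nat \<times> nat \<Rightarrow> real"
  shows "\<exists>Q. orth_on {..<n} Q \<and> (\<forall>j<q. \<forall>i. q \<le> i \<and> i < n \<longrightarrow> (\<Sum>k<n. Q i k * K (k, j)) = 0)"
proof (induction q)
  case 0
  have "orth_on {..<n} (\<lambda>i j. of_bool (i = j))"
    using orth_on_extend[of "{..<n}" "{}" undefined] by (simp add: orth_on_def)
  then show ?case by (intro exI[of _ "\<lambda>i j. of_bool (i = j)"]) simp
next
  case (Suc q)
  then obtain Q where Q: "orth_on {..<n} Q"
    and 0: "\<And>i j. j < q \<Longrightarrow> q \<le> i \<Longrightarrow> i < n \<Longrightarrow> (\<Sum>k<n. Q i k * K (k, j)) = 0" by blast
  show ?case
  proof (cases "q < n")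
    case False
    then show ?thesis using Q by (intro exI[of _ Q]) auto
  next
    case True
    define x where "x i = (\<Sum>k<n. Q i k * K (k, q))" for i
    define y where "y i = of_bool (q = i) * sqrt (\<Sum>i\<in>{q..<n}. (x i)\<^sup>2)" for i
    have "(\<Sum>i\<in>{q..<n}. (y i)\<^sup>2) = (\<Sum>i\<in>{q..<n}. of_bool (q = i) * (\<Sum>i\<in>{q..<n}. (x i)\<^sup>2))"
      by (intro sum.cong refl) (auto simp: y_def power_mult_distrib sum_nonneg)
    also have "\<dots> = (\<Sum>i\<in>{q..<n}. (x i)\<^sup>2)" using True by (intro sum_of_bool_mult(1)) auto
    finally have "(\<Sum>i\<in>{q..<n}. (x i)\<^sup>2) = (\<Sum>i\<in>{q..<n}. (y i)\<^sup>2)" by simp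
    from householder[OF finite_atLeastLessThan this]
    obtain R where R: "orth_on {q..<n} R" "\<And>i j. R i j = R j i"
      "\<And>i. i \<in> {q..<n} \<Longrightarrow> (\<Sum>j\<in>{q..<n}. R i j * x j) = y i"
      "\<And>i. i \<in> {q..<n} \<Longrightarrow> (\<Sum>j\<in>{q..<n}. R i j * y j) = x i" by blast
    define P where "P = (\<lambda>i j. if i \<in> {q..<n} \<and> j \<in> {q..<n} then R i j else of_bool (i = j))"
    have P: "orth_on {..<n} P" unfolding P_def using R(1) by (intro orth_on_extend) auto
    define Q' where "Q' = (\<lambda>i k. \<Sum>j<n. P i j * Q j k)"
    have Q': "orth_on {..<n} Q'" unfolding Q'_def by (intro orth_on_compose P Q) auto
    have zero: "(\<Sum>k<n. Q' i k * K (k, j)) = 0" if j: "j < Suc q" and i: "Suc q \<le> i" "i < n" for i j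
    proof -
      have "(\<Sum>k<n. Q' i k * K (k, j)) = (\<Sum>k<n. \<Sum>s<n. P i s * (Q s k * K (k, j)))"
        by (simp add: Q'_def sum_distrib_right mult.assoc)
      also have "\<dots> = (\<Sum>s<n. P i s * (\<Sum>k<n. Q s k * K (k, j)))"
        by (subst sum.swap) (simp add: sum_distrib_left)
      also have "\<dots> = (\<Sum>s\<in>{q..<n}. R i s * (\<Sum>k<n. Q s k * K (k, j)))"
        using i by (intro sum.mono_neutral_cong_right) (auto simp: P_def)
      also have "\<dots> = 0"
      proof (cases "j = q")
        case True
        then have "(\<Sum>s\<in>{q..<n}. R i s * (\<Sum>k<n. Q s k * K (k, j))) = y i"
          using R(3)[of i] i by (simp add: x_def)
        then show ?thesis using i by (simp add: y_def)
      next
        case False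
        then show ?thesis using j 0 by (intro sum.neutral) auto
      qed
      finally show ?thesis .
    qed
    show ?thesis using Q' zero by (intro exI[of _ Q'] conjI allI impI) auto
  qed
qed

text \<open>Rotating z and the columns by the same reflection leaves the form unchanged, and by invariance of
  the Gaussian law it leaves the law of the columns unchanged, too.\<close>

lemma quad_form_gram_rotate:
  assumes ind: "indep_cols n p h" and R: "orth_on {..<p} R" and sym: "\<And>i j. R i j = R j i"
    and w: "\<And>j. j < p \<Longrightarrow> (\<Sum>l<p. R j l * z l) = w j"
    and h': "\<And>i j. i < n \<Longrightarrow> j < p \<Longrightarrow> h' (i, j) = (\<Sum>l<p. R j l * h (i, l))"
  shows "quad_form (mat_inv (gram n p h')) (vec p w) = quad_form (mat_inv (gram n p h)) (vec p z)"
proof -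
  obtain b where b: "\<And>j. j < p \<Longrightarrow> (\<Sum>i<n. h (i, j) * (\<Sum>l<p. h (i, l) * b l)) = z j"
    using gram_solvable[OF ind] by blast
  define b' where "b' j = (\<Sum>l<p. R j l * b l)" for j
  have Hb: "(\<Sum>l<p. h' (i, l) * b' l) = (\<Sum>l<p. h (i, l) * b l)" if "i < n" for i
    using orth_on_norm[OF finite_lessThan R, of "\<lambda>l. h (i, l)" b] that by (simp add: h' b'_def)
  have ind': "indep_cols n p h'" unfolding indep_cols_def
  proof (intro allI impI)
    fix c j assume c: "\<forall>i<n. (\<Sum>j<p. h' (i, j) * c j) = 0" and j: "j < p"
    define d where "d l = (\<Sum>j<p. R l j * c j)" for l
    have "(\<Sum>l<p. h (i, l) * d l) = 0" if i: "i < n" for i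
    proof -
      have "(\<Sum>l<p. h (i, l) * d l) = (\<Sum>l<p. \<Sum>j<p. c j * (R l j * h (i, l)))"
        by (simp add: d_def sum_distrib_left mult_ac)
      also have "\<dots> = (\<Sum>j<p. \<Sum>l<p. c j * (R l j * h (i, l)))" by (rule sum.swap)
      also have "\<dots> = (\<Sum>j<p. c j * (\<Sum>l<p. R j l * h (i, l)))"
        by (simp add: sum_distrib_left sym)
      also have "\<dots> = (\<Sum>j<p. h' (i, j) * c j)" using i by (intro sum.cong) (auto simp: h')
      finally show ?thesis using c i by simp
    qed
    then have d0: "\<forall>l<p. d l = 0" using ind by (auto simp: indep_cols_def)
    have "(\<Sum>j<p. c j * c j) = (\<Sum>l<p. d l * d l)"
      unfolding d_def using orth_on_norm[OF finite_lessThan R, of c c] by simp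
    also have "\<dots> = 0" using d0 by simp
    finally show "c j = 0" using j by (subst (asm) sum_nonneg_eq_0_iff) auto
  qed
  have "quad_form (mat_inv (gram n p h')) (vec p w) = (\<Sum>j<p. w j * b' j)"
  proof (rule quad_form_gram_solve[OF ind'])
    fix j assume j: "j < p"
    have "(\<Sum>i<n. h' (i, j) * (\<Sum>l<p. h' (i, l) * b' l)) = (\<Sum>i<n. \<Sum>l<p. R j l * (h (i, l) * (\<Sum>l<p. h (i, l) * b l)))"
      using Hb h' j by (intro sum.cong refl) (simp add: sum_distrib_right mult.assoc)
    also have "\<dots> = (\<Sum>l<p. R j l * (\<Sum>i<n. h (i, l) * (\<Sum>l<p. h (i, l) * b l)))"
      by (subst sum.swap) (simp add: sum_distrib_left)
    also have "\<dots> = w j" using b w[OF j] by simp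
    finally show "(\<Sum>i<n. h' (i, j) * (\<Sum>l<p. h' (i, l) * b' l)) = w j" .
  qed
  also have "\<dots> = (\<Sum>j<p. (\<Sum>l<p. R j l * z l) * (\<Sum>l<p. R j l * b l))"
    using w by (simp add: b'_def)
  also have "\<dots> = (\<Sum>j<p. z j * b j)" by (rule orth_on_norm[OF finite_lessThan R])
  also have "\<dots> = quad_form (mat_inv (gram n p h)) (vec p z)"
    by (rule quad_form_gram_solve[OF ind, symmetric]) (use b in auto)
  finally show ?thesis .
qed

context
  fixes n q :: nat and h :: "nat \<times> nat \<Rightarrow> real" and Q :: "nat \<Rightarrow> nat \<Rightarrow> real" and s :: "nat \<Rightarrow> real"
  assumes Q: "orth_on {..<n} Q"
    and ann: "\<And>i j. j < q \<Longrightarrow> q \<le> i \<Longrightarrow> i < n \<Longrightarrow> (\<Sum>k<n. Q i k * h (k, j)) = 0"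
    and s: "\<And>i. s i = (\<Sum>k<n. Q i k * h (k, q))"
begin

lemma rotated_combination:
  "(\<Sum>k<n. Q i k * (\<Sum>j<m. h (k, j) * b j)) = (\<Sum>j<m. (\<Sum>k<n. Q i k * h (k, j)) * b j)"
proof -
  have "(\<Sum>k<n. Q i k * (\<Sum>j<m. h (k, j) * b j)) = (\<Sum>k<n. \<Sum>j<m. Q i k * h (k, j) * b j)"
    by (simp add: sum_distrib_left mult.assoc)
  also have "\<dots> = (\<Sum>j<m. \<Sum>k<n. Q i k * h (k, j) * b j)" by (rule sum.swap)
  finally show ?thesis by (simp add: sum_distrib_right)
qed

lemma indep_cols_Suc:
  assumes ind: "indep_cols n q h" and q: "q < n" "s q \<noteq> 0"
  shows "indep_cols n (Suc q) h"
  unfolding indep_cols_def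
proof (intro allI impI)
  fix b j assume b: "\<forall>i<n. (\<Sum>j<Suc q. h (i, j) * b j) = 0" and j: "j < Suc q"
  have "0 = (\<Sum>k<n. Q q k * (\<Sum>j<Suc q. h (k, j) * b j))" using b by simp
  also have "\<dots> = (\<Sum>j<Suc q. (\<Sum>k<n. Q q k * h (k, j)) * b j)" by (rule rotated_combination)
  also have "\<dots> = s q * b q" using ann q by (simp add: s)
  finally have bq: "b q = 0" using q by simp
  then have "\<forall>i<n. (\<Sum>j<q. h (i, j) * b j) = 0" using b by simp
  then have "\<forall>j<q. b j = 0" using ind by (simp add: indep_cols_def)
  then show "b j = 0" using bq j by (auto simp: less_Suc_eq)
qed

text \<open>After the triangularization, the span of the first q columns is the space of the first q coordinates;
  the squared distance of column q to it is the sum of its squares over the other coordinates.\<close>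

lemma schur_chi_last:
  assumes ind: "indep_cols n (Suc q) h" and qn: "q \<le> n" and c: "c \<noteq> 0"
  shows "schur_chi n (Suc q) (\<lambda>j. of_bool (q = j) * c) h = (\<Sum>i\<in>{q..<n}. (s i)\<^sup>2)"
proof -
  define S where "S = (\<Sum>i\<in>{q..<n}. (s i)\<^sup>2)"
  define T where "T i j = (\<Sum>k<n. Q i k * h (k, j))" for i j
  have Tq: "T i q = s i" for i by (simp add: T_def s)
  have ndet: "det (mat q q (\<lambda>(i,j). T i j)) \<noteq> 0"
  proof
    assume "det (mat q q (\<lambda>(i,j). T i j)) = 0"
    then obtain v where v: "v \<in> carrier_vec q" "v \<noteq> 0\<^sub>v q" "mat q q (\<lambda>(i,j). T i j) *\<^sub>v v = 0\<^sub>v q"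
      using det_0_iff_vec_prod_zero[of "mat q q (\<lambda>(i,j). T i j)" q] by auto
    define b where "b j = (if j < q then v $ j else 0)" for j
    have "(\<Sum>j<q. T i j * b j) = 0" if i: "i < q" for i
      using arg_cong[OF v(3), of "\<lambda>u. u $ i"] i v(1)
      by (simp add: scalar_prod_def lessThan_atLeast0 b_def)
    then have "(\<Sum>j<Suc q. T i j * b j) = 0" if "i < n" for i
      using ann that by (cases "i < q") (auto simp: b_def T_def intro!: sum.neutral)
    then have *: "(\<Sum>k<n. Q i k * (\<Sum>j<Suc q. h (k, j) * b j)) = 0" if "i < n" for i
      unfolding rotated_combination T_def[symmetric] using that by blast
    have "(\<Sum>k<n. (\<Sum>j<Suc q. h (k, j) * b j) * (\<Sum>j<Suc q. h (k, j) * b j)) = 0"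
      by (subst orth_on_norm[OF finite_lessThan Q, symmetric]) (intro sum.neutral ballI, simp only: * lessThan_iff mult_zero_left)
    then have "\<forall>k<n. (\<Sum>j<Suc q. h (k, j) * b j) = 0"
      by (subst (asm) sum_nonneg_eq_0_iff) auto
    then have "\<forall>j<Suc q. b j = 0" using ind by (simp add: indep_cols_def)
    then have "v = 0\<^sub>v q" using v(1) by (intro eq_vecI) (auto simp: b_def split: if_splits)
    then show False using v(2) by simp
  qed
  define x where "x = mat_inv (mat q q (\<lambda>(i,j). T i j)) *\<^sub>v vec q s"
  note inv = mat_inv_works[OF mat_carrier ndet]
  have x: "x \<in> carrier_vec q" using inv(1) by (simp add: x_def)
  have "mat q q (\<lambda>(i,j). T i j) *\<^sub>v x = (mat q q (\<lambda>(i,j). T i j) * mat_inv (mat q q (\<lambda>(i,j). T i j))) *\<^sub>v vec q s"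
    unfolding x_def by (rule assoc_mult_mat_vec[symmetric, OF mat_carrier inv(1)]) simp
  also have "\<dots> = vec q s" by (simp add: inv(2))
  finally have Tx': "mat q q (\<lambda>(i,j). T i j) *\<^sub>v x = vec q s" .
  have Tx: "(\<Sum>j<q. T i j * x $ j) = s i" if i: "i < q" for i
    using arg_cong[OF Tx', of "\<lambda>u. u $ i"] i x by (simp add: scalar_prod_def lessThan_atLeast0)
  define d where "d j = (if j = q then 1 else - x $ j)" for j
  have Td: "(\<Sum>k<n. Q i k * (\<Sum>j<Suc q. h (k, j) * d j)) = (if i < q then 0 else s i)" if i: "i < n" for i
  proof -
    have "(\<Sum>k<n. Q i k * (\<Sum>j<Suc q. h (k, j) * d j)) = (\<Sum>j<q. T i j * d j) + s i"
      unfolding rotated_combination T_def[symmetric] by (simp add: d_def Tq)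
    also have "(\<Sum>j<q. T i j * d j) = - (\<Sum>j<q. T i j * x $ j)"
      by (simp add: d_def sum_negf[symmetric])
    also have "\<dots> = (if i < q then - s i else 0)"
      using Tx ann i by (auto simp: T_def intro!: sum.neutral)
    finally show ?thesis by simp
  qed
  have S: "S \<noteq> 0"
  proof
    assume "S = 0"
    then have "s i = 0" if "i \<in> {q..<n}" for i
      using that unfolding S_def by (subst (asm) sum_nonneg_eq_0_iff) auto
    then have *: "(\<Sum>k<n. Q i k * (\<Sum>j<Suc q. h (k, j) * d j)) = 0" if "i < n" for i
      using Td[OF that] that by auto
    have "(\<Sum>k<n. (\<Sum>j<Suc q. h (k, j) * d j) * (\<Sum>j<Suc q. h (k, j) * d j)) = 0"
      by (subst orth_on_norm[OF finite_lessThan Q, symmetric]) (intro sum.neutral ballI, simp only: * lessThan_iff mult_zero_left)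
    then have "\<forall>k<n. (\<Sum>j<Suc q. h (k, j) * d j) = 0"
      by (subst (asm) sum_nonneg_eq_0_iff) auto
    then have "d q = 0" using ind unfolding indep_cols_def by blast
    then show False by (simp add: d_def)
  qed
  define b where "b j = d j * (c / S)" for j
  have hb: "(\<Sum>l<Suc q. h (i, l) * b l) = (\<Sum>l<Suc q. h (i, l) * d l) * (c / S)" for i
    unfolding b_def sum_distrib_right by (simp add: mult.assoc)
  have "quad_form (mat_inv (gram n (Suc q) h)) (vec (Suc q) (\<lambda>j. of_bool (q = j) * c)) =
      (\<Sum>j<Suc q. (of_bool (q = j) * c) * b j)"
  proof (rule quad_form_gram_solve[OF ind])
    fix j assume j: "j < Suc q"
    have "(\<Sum>i<n. h (i, j) * (\<Sum>l<Suc q. h (i, l) * b l)) =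
        (\<Sum>i<n. h (i, j) * (\<Sum>l<Suc q. h (i, l) * d l)) * (c / S)"
      by (subst sum_distrib_right) (simp only: hb mult.assoc)
    also have "(\<Sum>i<n. h (i, j) * (\<Sum>l<Suc q. h (i, l) * d l)) =
        (\<Sum>i<n. T i j * (if i < q then 0 else s i))"
      unfolding T_def by (subst orth_on_norm[OF finite_lessThan Q, symmetric]) (intro sum.cong refl, simp only: Td lessThan_iff)
    also have "\<dots> = (\<Sum>i\<in>{q..<n}. T i j * s i)"
      using qn by (intro sum.mono_neutral_cong_right) auto
    also have "\<dots> = of_bool (q = j) * S"
    proof (cases "j = q")
      case True
      then show ?thesis by (simp add: Tq S_def power2_eq_square)
    next
      case False
      then show ?thesis using j ann by (auto simp: T_def intro!: sum.neutral)
    qed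
    finally show "(\<Sum>i<n. h (i, j) * (\<Sum>l<Suc q. h (i, l) * b l)) = of_bool (q = j) * c"
      using S by simp
  qed
  also have "\<dots> = (\<Sum>j<Suc q. of_bool (q = j) * (c * b j))" by (simp add: mult.assoc)
  also have "\<dots> = c * b q" by (rule sum_of_bool_mult) auto
  also have "\<dots> = c\<^sup>2 / S" by (simp add: b_def d_def power2_eq_square)
  finally have quad: "quad_form (mat_inv (gram n (Suc q) h)) (vec (Suc q) (\<lambda>j. of_bool (q = j) * c)) = c\<^sup>2 / S" .
  have "(\<Sum>j<Suc q. (of_bool (q = j) * c)\<^sup>2) = (\<Sum>j<Suc q. of_bool (q = j) * c\<^sup>2)"
    by (intro sum.cong) auto
  also have "\<dots> = c\<^sup>2" by (rule sum_of_bool_mult) auto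
  finally show ?thesis using c S by (simp add: schur_chi_def quad S_def)
qed

end

section \<open>The chi-square law behind Hotelling's statistic\<close>

lemma nn_integral_gauss_fold:
  assumes "I \<inter> J = {}" "finite I" "finite J"
    and f: "f \<in> borel_measurable (\<Pi>\<^sub>M i\<in>I \<union> J. (borel :: real measure))"
  shows "(\<integral>\<^sup>+h. f h \<partial>gauss (I \<union> J)) = (\<integral>\<^sup>+x. \<integral>\<^sup>+y. f (merge I J (x, y)) \<partial>gauss J \<partial>gauss I)"
proof -
  have "f \<in> borel_measurable (gauss (I \<union> J))" using f by (simp add: measurable_cong_sets[OF sets_gauss refl])
  then show ?thesis unfolding gauss_def by (intro gauss.product_nn_integral_fold assms)
qed

lemma nn_integral_gauss_lin:
  assumes "finite I" "orth_on I B" and f: "f \<in> borel_measurable (\<Pi>\<^sub>M i\<in>I. (borel :: real measure))"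
  shows "(\<integral>\<^sup>+h. f (lin_on I B h) \<partial>gauss I) = (\<integral>\<^sup>+h. f h \<partial>gauss I)"
proof -
  have [measurable]: "f \<in> borel_measurable (gauss I)" using f by (simp add: measurable_cong_sets[OF sets_gauss refl])
  have m: "lin_on I B \<in> gauss I \<rightarrow>\<^sub>M gauss I"
    using lin_on_measurable by (simp add: measurable_cong_sets[OF sets_gauss sets_gauss])
  have "(\<integral>\<^sup>+h. f h \<partial>gauss I) = (\<integral>\<^sup>+h. f h \<partial>distr (gauss I) (gauss I) (lin_on I B))"
    using gauss_orth_invariant[OF assms(1,2)] by simp
  also have "\<dots> = (\<integral>\<^sup>+h. f (lin_on I B h) \<partial>gauss I)"
    using m by (subst nn_integral_distr) auto
  finally show ?thesis ..
qed

lemma nn_integral_gauss_reindex: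
  assumes "inj_on t J" "t \<in> J \<rightarrow> I" and f: "f \<in> borel_measurable (\<Pi>\<^sub>M i\<in>J. (borel :: real measure))"
  shows "(\<integral>\<^sup>+h. f (\<lambda>j\<in>J. h (t j)) \<partial>gauss I) = (\<integral>\<^sup>+h. f h \<partial>gauss J)"
proof -
  have [measurable]: "f \<in> borel_measurable (gauss J)" using f by (simp add: measurable_cong_sets[OF sets_gauss refl])
  have d: "distr (gauss I) (gauss J) (\<lambda>h. \<lambda>j\<in>J. h (t j)) = gauss J"
    using distr_PiM_reindex[of I "\<lambda>_. std_normal_distribution" t J] assms(1,2) std_normal.prob_space_axioms
    by (simp add: gauss_def)
  have m: "(\<lambda>h. \<lambda>j\<in>J. h (t j)) \<in> gauss I \<rightarrow>\<^sub>M gauss J"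
    unfolding gauss_def using assms(2) by (intro measurable_restrict measurable_component_singleton) auto
  have "(\<integral>\<^sup>+h. f h \<partial>gauss J) = (\<integral>\<^sup>+h. f h \<partial>distr (gauss I) (gauss J) (\<lambda>h. \<lambda>j\<in>J. h (t j)))"
    by (simp add: d)
  also have "\<dots> = (\<integral>\<^sup>+h. f (\<lambda>j\<in>J. h (t j)) \<partial>gauss I)"
    using m by (subst nn_integral_distr) auto
  finally show ?thesis ..
qed

lemma AE_std_normal_neq: "AE x in std_normal_distribution. x \<noteq> c"
proof -
  have "AE x in lborel. x \<noteq> c" by (rule AE_lborel_singleton)
  then show ?thesis by (subst AE_density) auto
qed

lemma AE_gauss_neq:
  assumes "i \<in> I" shows "AE x in gauss I. x i \<noteq> c"
  unfolding gauss_def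
  by (rule AE_PiM_component[OF std_normal.prob_space_axioms assms AE_std_normal_neq])

lemma orth_on_left_factor:
  assumes "finite I" "orth_on I Q"
  shows "orth_on (I \<times> {q}) (\<lambda>a b. Q (fst a) (fst b))"
  using assms(2) unfolding orth_on_def by (auto simp: sum.cartesian_product')

lemma orth_on_right_factor:
  assumes "finite I" "finite J" "orth_on J R"
  shows "orth_on (I \<times> J) (\<lambda>a b. of_bool (fst a = fst b) * R (snd a) (snd b))"
proof -
  have 1: "(\<Sum>k\<in>I \<times> J. of_bool (i = fst k) * F (snd k) * (of_bool (i' = fst k) * F' (snd k))) =
     of_bool (i = i') * (\<Sum>l\<in>J. F l * F' l)" if "i \<in> I" for i i' and F F' :: "'b \<Rightarrow> real"
  proof -
    have "(\<Sum>k\<in>I \<times> J. of_bool (i = fst k) * F (snd k) * (of_bool (i' = fst k) * F' (snd k))) =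
       (\<Sum>k\<in>I. of_bool (i = k) * (of_bool (i' = k) * (\<Sum>l\<in>J. F l * F' l)))"
      by (simp add: sum.cartesian_product' sum_distrib_left mult_ac)
    also have "\<dots> = of_bool (i' = i) * (\<Sum>l\<in>J. F l * F' l)"
      by (rule sum_of_bool_mult(1)[OF assms(1) that])
    finally show ?thesis by (cases "i = i'") simp_all
  qed
  have 2: "(\<Sum>k\<in>I \<times> J. of_bool (fst k = i) * F (snd k) * (of_bool (fst k = i') * F' (snd k))) =
     of_bool (i = i') * (\<Sum>l\<in>J. F l * F' l)" if "i \<in> I" for i i' and F F' :: "'b \<Rightarrow> real"
    unfolding 1[OF that, symmetric] by (intro sum.cong) auto
  show ?thesis unfolding orth_on_def
  proof (intro conjI ballI)
    fix a b assume "a \<in> I \<times> J" "b \<in> I \<times> J"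
    then have ab: "fst a \<in> I" "snd a \<in> J" "snd b \<in> J" by auto
    have eq: "(of_bool (a = b) :: real) = of_bool (fst a = fst b) * of_bool (snd a = snd b)"
      by (auto simp: prod_eq_iff)
    show "(\<Sum>k\<in>I \<times> J. of_bool (fst a = fst k) * R (snd a) (snd k) * (of_bool (fst b = fst k) * R (snd b) (snd k))) = of_bool (a = b)"
      unfolding 1[OF ab(1)] eq using assms(3) ab by (simp add: orth_on_def)
    show "(\<Sum>k\<in>I \<times> J. of_bool (fst k = fst a) * R (snd k) (snd a) * (of_bool (fst k = fst b) * R (snd k) (snd b))) = of_bool (a = b)"
      unfolding 2[OF ab(1), of "\<lambda>l. R l (snd a)" "fst b" "\<lambda>l. R l (snd b)"] eq using assms(3) ab by (simp add: orth_on_def)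
  qed
qed

lemma gram_measurable:
  assumes "\<And>i j. i < n \<Longrightarrow> j < p \<Longrightarrow> (\<lambda>\<omega>. H \<omega> (i, j)) \<in> borel_measurable M"
    and "j < p" "l < p"
  shows "(\<lambda>\<omega>. gram n p (H \<omega>) $$ (j, l)) \<in> borel_measurable M"
  using assms by (auto simp: gram_def intro!: borel_measurable_sum borel_measurable_times)

lemma schur_chi_measurable:
  assumes H: "\<And>i j. i < n \<Longrightarrow> j < p \<Longrightarrow> (\<lambda>\<omega>. H \<omega> (i, j)) \<in> borel_measurable M"
    and z: "\<And>j. j < p \<Longrightarrow> (\<lambda>\<omega>. z \<omega> j) \<in> borel_measurable M"
  shows "(\<lambda>\<omega>. schur_chi n p (z \<omega>) (H \<omega>)) \<in> borel_measurable M"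
  unfolding schur_chi_def
  by (intro borel_measurable_divide borel_measurable_sum borel_measurable_power z
      quad_form_mat_inv_measurable[of _ p] gram_carrier gram_measurable H vec_index_measurable) auto

lemma indep_cols_measurable:
  assumes H: "\<And>i j. i < n \<Longrightarrow> j < p \<Longrightarrow> (\<lambda>\<omega>. H \<omega> (i, j)) \<in> borel_measurable M"
  shows "Measurable.pred M (\<lambda>\<omega>. indep_cols n p (H \<omega>))"
proof -
  have [measurable]: "(\<lambda>\<omega>. det (gram n p (H \<omega>))) \<in> borel_measurable M"
    by (intro det_measurable[of _ p] gram_carrier gram_measurable H)
  show ?thesis unfolding det_gram_nonzero_iff[symmetric] by measurable
qed

lemma indep_cols_cong:
  assumes "\<And>i j. i < n \<Longrightarrow> j < p \<Longrightarrow> h (i, j) = h' (i, j)"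
  shows "indep_cols n p h = indep_cols n p h'"
proof -
  have "(\<Sum>j<p. h (i, j) * b j) = (\<Sum>j<p. h' (i, j) * b j)" if "i < n" for i b
    using assms that by simp
  then show ?thesis unfolding indep_cols_def by simp
qed

lemma schur_chi_cong:
  assumes "\<And>i j. i < n \<Longrightarrow> j < p \<Longrightarrow> h (i, j) = h' (i, j)" "\<And>j. j < p \<Longrightarrow> z j = z' j"
  shows "schur_chi n p z h = schur_chi n p z' h'"
proof -
  have "gram n p h = gram n p h'" unfolding gram_def using assms by (intro cong_mat) auto
  moreover have "vec p z = vec p z'" using assms by auto
  ultimately show ?thesis using assms by (simp add: schur_chi_def)
qed

lemma prod_Suc_cols: "{..<n} \<times> {..<Suc q} = ({..<n} \<times> {..<q}) \<union> ({..<n} \<times> {q})"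
  by auto

text \<open>The new column, rotated so that the old ones occupy the first q coordinates, is again Gaussian, and
  its coordinate q is almost surely nonzero.\<close>

lemma AE_indep_cols_add_column:
  assumes x: "indep_cols n q x" and q: "q < n"
  shows "AE y in gauss ({..<n} \<times> {q}). indep_cols n (Suc q) (merge ({..<n} \<times> {..<q}) ({..<n} \<times> {q}) (x, y))"
proof -
  let ?A = "{..<n} \<times> {..<q}" and ?B = "{..<n} \<times> {q}"
  obtain Q where Q: "orth_on {..<n} Q"
    and ann: "\<forall>j<q. \<forall>i. q \<le> i \<and> i < n \<longrightarrow> (\<Sum>k<n. Q i k * x (k, j)) = 0"
    using orth_annihilates_columns[of n q x] by auto
  let ?L = "lin_on ?B (\<lambda>a b. Q (fst a) (fst b))"
  have d: "distr (gauss ?B) (gauss ?B) ?L = gauss ?B"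
    by (intro gauss_orth_invariant orth_on_left_factor Q) auto
  have "AE y in distr (gauss ?B) (gauss ?B) ?L. y (q, q) \<noteq> 0"
    unfolding d using q by (intro AE_gauss_neq) auto
  then have "AE y in gauss ?B. ?L y (q, q) \<noteq> 0"
    by (rule AE_distrD[rotated]) (simp add: measurable_cong_sets[OF sets_gauss sets_gauss])
  then show ?thesis
  proof (rule AE_mp, intro AE_I2 impI)
    fix y assume y: "?L y (q, q) \<noteq> 0"
    have "(\<Sum>k<n. Q q k * merge ?A ?B (x, y) (k, q)) \<noteq> 0"
      using y q by (simp add: lin_on_def merge_def sum.cartesian_product')
    moreover have "indep_cols n q (merge ?A ?B (x, y))"
      using x by (subst indep_cols_cong[of n q _ x]) (auto simp: merge_def)
    moreover have "(\<Sum>k<n. Q i k * merge ?A ?B (x, y) (k, j)) = 0" if "j < q" "q \<le> i" "i < n" for i j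
      using ann that by (auto simp: merge_def)
    ultimately show "indep_cols n (Suc q) (merge ?A ?B (x, y))"
      using q by (intro indep_cols_Suc[OF Q, of q _ "\<lambda>i. \<Sum>k<n. Q i k * merge ?A ?B (x, y) (k, q)"]) auto
  qed
qed

lemma AE_indep_cols:
  "p \<le> n \<Longrightarrow> AE h in gauss ({..<n} \<times> {..<p}). indep_cols n p h"
proof (induction p)
  case 0
  then show ?case by (simp add: indep_cols_def)
next
  case (Suc q)
  let ?A = "{..<n} \<times> {..<q}" and ?B = "{..<n} \<times> {q}"
  define f :: "(nat \<times> nat \<Rightarrow> real) \<Rightarrow> ennreal" where "f h = (if indep_cols n (Suc q) h then 0 else 1)" for h
  have pm: "Measurable.pred (\<Pi>\<^sub>M i\<in>?A \<union> ?B. (borel :: real measure)) (\<lambda>h. indep_cols n (Suc q) h)"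
    by (intro indep_cols_measurable measurable_component_singleton) auto
  then have f[measurable]: "f \<in> borel_measurable (\<Pi>\<^sub>M i\<in>?A \<union> ?B. (borel :: real measure))"
    unfolding f_def[abs_def] by measurable
  have "(\<integral>\<^sup>+h. f h \<partial>gauss (?A \<union> ?B)) = (\<integral>\<^sup>+x. \<integral>\<^sup>+y. f (merge ?A ?B (x, y)) \<partial>gauss ?B \<partial>gauss ?A)"
    by (intro nn_integral_gauss_fold f) auto
  also have "\<dots> = (\<integral>\<^sup>+x. 0 \<partial>gauss ?A)"
  proof (rule nn_integral_cong_AE)
    have "AE x in gauss ?A. indep_cols n q x" using Suc by simp
    then show "AE x in gauss ?A. (\<integral>\<^sup>+y. f (merge ?A ?B (x, y)) \<partial>gauss ?B) = 0"
    proof (rule AE_mp, intro AE_I2 impI)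
      fix x assume x: "indep_cols n q x"
      have "AE y in gauss ?B. f (merge ?A ?B (x, y)) = 0"
        using AE_indep_cols_add_column[OF x] Suc(2) by (auto simp: f_def)
      then have "(\<integral>\<^sup>+y. f (merge ?A ?B (x, y)) \<partial>gauss ?B) = (\<integral>\<^sup>+y. 0 \<partial>gauss ?B)"
        by (rule nn_integral_cong_AE)
      then show "(\<integral>\<^sup>+y. f (merge ?A ?B (x, y)) \<partial>gauss ?B) = 0" by simp
    qed
  qed
  finally have "(\<integral>\<^sup>+h. f h \<partial>gauss (?A \<union> ?B)) = 0" by simp
  then have "AE h in gauss (?A \<union> ?B). f h = 0"
    by (subst (asm) nn_integral_0_iff_AE) (auto simp: measurable_cong_sets[OF sets_gauss refl])
  then show ?case unfolding prod_Suc_cols by (auto simp: f_def split: if_splits)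
qed

text \<open>Given the first q columns, the rotation that triangularizes them is fixed and the last column
  remains Gaussian, so n - q independent squares are left.\<close>

lemma schur_chi_law_axis:
  assumes q: "q < n" and c: "c \<noteq> 0" and f[measurable]: "f \<in> borel_measurable borel"
  shows "(\<integral>\<^sup>+h. f (schur_chi n (Suc q) (\<lambda>j. of_bool (q = j) * c) h) \<partial>gauss ({..<n} \<times> {..<Suc q})) =
    (\<integral>\<^sup>+g. f (\<Sum>i<n - q. (g i)\<^sup>2) \<partial>gauss {..<n - q})"
proof -
  let ?A = "{..<n} \<times> {..<q}" and ?B = "{..<n} \<times> {q}"
  let ?z = "\<lambda>j. of_bool (q = j) * c"
  let ?R = "\<integral>\<^sup>+g. f (\<Sum>i<n - q. (g i)\<^sup>2) \<partial>gauss {..<n - q}"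
  have [measurable]: "(\<lambda>h. schur_chi n (Suc q) ?z h) \<in> borel_measurable (\<Pi>\<^sub>M i\<in>?A \<union> ?B. (borel :: real measure))"
    by (intro schur_chi_measurable measurable_component_singleton) auto
  have "(\<integral>\<^sup>+h. f (schur_chi n (Suc q) ?z h) \<partial>gauss (?A \<union> ?B)) =
     (\<integral>\<^sup>+x. \<integral>\<^sup>+y. f (schur_chi n (Suc q) ?z (merge ?A ?B (x, y))) \<partial>gauss ?B \<partial>gauss ?A)"
    by (rule nn_integral_gauss_fold[where f="\<lambda>h. f (schur_chi n (Suc q) ?z h)"]) auto
  also have "\<dots> = (\<integral>\<^sup>+x. ?R \<partial>gauss ?A)"
  proof (rule nn_integral_cong_AE)
    have "AE x in gauss ?A. indep_cols n q x" using q by (intro AE_indep_cols) simp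
    then show "AE x in gauss ?A. (\<integral>\<^sup>+y. f (schur_chi n (Suc q) ?z (merge ?A ?B (x, y))) \<partial>gauss ?B) = ?R"
    proof (rule AE_mp, intro AE_I2 impI)
      fix x assume x: "indep_cols n q x"
      obtain Q where Q: "orth_on {..<n} Q"
        and ann: "\<forall>j<q. \<forall>i. q \<le> i \<and> i < n \<longrightarrow> (\<Sum>k<n. Q i k * x (k, j)) = 0"
        using orth_annihilates_columns[of n q x] by auto
      let ?L = "lin_on ?B (\<lambda>a b. Q (fst a) (fst b))"
      have "AE y in gauss ?B. schur_chi n (Suc q) ?z (merge ?A ?B (x, y)) = (\<Sum>i\<in>{q..<n}. (?L y (i, q))\<^sup>2)"
        using AE_indep_cols_add_column[OF x q]
      proof (rule AE_mp, intro AE_I2 impI)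
        fix y assume ind: "indep_cols n (Suc q) (merge ?A ?B (x, y))"
        have a: "(\<Sum>k<n. Q i k * merge ?A ?B (x, y) (k, j)) = 0" if "j < q" "q \<le> i" "i < n" for i j
          using ann that by (auto simp: merge_def)
        have "schur_chi n (Suc q) ?z (merge ?A ?B (x, y)) =
           (\<Sum>i\<in>{q..<n}. (\<Sum>k<n. Q i k * merge ?A ?B (x, y) (k, q))\<^sup>2)"
          by (rule schur_chi_last[OF Q a refl ind _ c]) (use q in auto)
        also have "\<dots> = (\<Sum>i\<in>{q..<n}. (?L y (i, q))\<^sup>2)"
          by (intro sum.cong refl) (auto simp: lin_on_def merge_def sum.cartesian_product')
        finally show "schur_chi n (Suc q) ?z (merge ?A ?B (x, y)) = (\<Sum>i\<in>{q..<n}. (?L y (i, q))\<^sup>2)" .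
      qed
      then have "(\<integral>\<^sup>+y. f (schur_chi n (Suc q) ?z (merge ?A ?B (x, y))) \<partial>gauss ?B) =
          (\<integral>\<^sup>+y. f (\<Sum>i\<in>{q..<n}. (?L y (i, q))\<^sup>2) \<partial>gauss ?B)"
        by (intro nn_integral_cong_AE) auto
      also have "\<dots> = (\<integral>\<^sup>+y. f (\<Sum>i\<in>{q..<n}. (y (i, q))\<^sup>2) \<partial>gauss ?B)"
        by (rule nn_integral_gauss_lin[where f="\<lambda>y. f (\<Sum>i\<in>{q..<n}. (y (i, q))\<^sup>2)"])
           (auto intro!: orth_on_left_factor Q measurable_compose[OF _ f] borel_measurable_sum borel_measurable_power)
      also have "\<dots> = (\<integral>\<^sup>+y. f (\<Sum>i<n - q. ((\<lambda>i\<in>{..<n - q}. y (q + i, q)) i)\<^sup>2) \<partial>gauss ?B)"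
      proof (intro nn_integral_cong arg_cong[where f=f])
        fix y :: "nat \<times> nat \<Rightarrow> real"
        have "(\<Sum>i\<in>{q..<n}. (y (i, q))\<^sup>2) = (\<Sum>i<n - q. (y (q + i, q))\<^sup>2)"
          using q by (intro sum.reindex_bij_witness[of _ "\<lambda>i. q + i" "\<lambda>i. i - q"]) auto
        then show "(\<Sum>i\<in>{q..<n}. (y (i, q))\<^sup>2) = (\<Sum>i<n - q. ((\<lambda>i\<in>{..<n - q}. y (q + i, q)) i)\<^sup>2)"
          by simp
      qed
      also have "\<dots> = ?R"
        by (rule nn_integral_gauss_reindex[where f="\<lambda>g. f (\<Sum>i<n - q. (g i)\<^sup>2)"])
           (auto simp: inj_on_def)
      finally show "(\<integral>\<^sup>+y. f (schur_chi n (Suc q) ?z (merge ?A ?B (x, y))) \<partial>gauss ?B) = ?R" .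
    qed
  qed
  also have "\<dots> = ?R" using prob_space.emeasure_space_1[OF prob_space_gauss, of ?A] by simp
  finally show ?thesis unfolding prod_Suc_cols .
qed

lemma schur_chi_law:
  assumes p: "0 < p" "p \<le> n" and z: "\<exists>j<p. z j \<noteq> 0" and f[measurable]: "f \<in> borel_measurable borel"
  shows "(\<integral>\<^sup>+h. f (schur_chi n p z h) \<partial>gauss ({..<n} \<times> {..<p})) =
    (\<integral>\<^sup>+g. f (\<Sum>i<Suc n - p. (g i)\<^sup>2) \<partial>gauss {..<Suc n - p})"
proof -
  obtain q where q: "p = Suc q" using p by (cases p) auto
  let ?I = "{..<n} \<times> {..<p}"
  define c where "c = sqrt (\<Sum>j<p. (z j)\<^sup>2)"
  have "(\<Sum>j<p. (z j)\<^sup>2) > 0" using z by (auto intro!: sum_pos2)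
  then have c: "c \<noteq> 0" "c\<^sup>2 = (\<Sum>j<p. (z j)\<^sup>2)" by (auto simp: c_def)
  define w where "w j = of_bool (q = j) * c" for j
  have "(\<Sum>j<p. (w j)\<^sup>2) = (\<Sum>j<p. of_bool (q = j) * c\<^sup>2)"
    by (intro sum.cong) (auto simp: w_def)
  also have "\<dots> = c\<^sup>2" using q by (intro sum_of_bool_mult(1)) auto
  finally have zw: "(\<Sum>j<p. (z j)\<^sup>2) = (\<Sum>j<p. (w j)\<^sup>2)" using c by simp
  from householder[OF finite_lessThan this]
  obtain R where R: "orth_on {..<p} R" "\<And>i j. R i j = R j i"
    "\<And>i. i \<in> {..<p} \<Longrightarrow> (\<Sum>j\<in>{..<p}. R i j * z j) = w i" "\<And>i. i \<in> {..<p} \<Longrightarrow> (\<Sum>j\<in>{..<p}. R i j * w j) = z i"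
    by blast
  let ?L = "lin_on ?I (\<lambda>a b. of_bool (fst a = fst b) * R (snd a) (snd b))"
  have L: "?L h (i, j) = (\<Sum>l<p. R j l * h (i, l))" if "i < n" "j < p" for h i j
  proof -
    have "?L h (i, j) = (\<Sum>k<n. of_bool (i = k) * (\<Sum>l<p. R j l * h (k, l)))"
      using that by (simp add: lin_on_def sum.cartesian_product' sum_distrib_left mult.assoc)
    also have "\<dots> = (\<Sum>l<p. R j l * h (i, l))" using that by (intro sum_of_bool_mult(1)) auto
    finally show ?thesis .
  qed
  have "AE h in gauss ?I. schur_chi n p z h = schur_chi n p w (?L h)"
    using AE_indep_cols[OF p(2)]
  proof (rule AE_mp, intro AE_I2 impI)
    fix h assume h: "indep_cols n p h"
    have "quad_form (mat_inv (gram n p (?L h))) (vec p w) = quad_form (mat_inv (gram n p h)) (vec p z)"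
      by (rule quad_form_gram_rotate[OF h R(1,2)]) (use R(3) L in auto)
    then show "schur_chi n p z h = schur_chi n p w (?L h)" by (simp add: schur_chi_def zw)
  qed
  then have "(\<integral>\<^sup>+h. f (schur_chi n p z h) \<partial>gauss ?I) = (\<integral>\<^sup>+h. f (schur_chi n p w (?L h)) \<partial>gauss ?I)"
    by (intro nn_integral_cong_AE) auto
  also have "\<dots> = (\<integral>\<^sup>+h. f (schur_chi n p w h) \<partial>gauss ?I)"
    by (rule nn_integral_gauss_lin[where f="\<lambda>h. f (schur_chi n p w h)"])
       (auto intro!: orth_on_right_factor R measurable_compose[OF _ f] schur_chi_measurable measurable_component_singleton)
  also have "\<dots> = (\<integral>\<^sup>+g. f (\<Sum>i<n - q. (g i)\<^sup>2) \<partial>gauss {..<n - q})"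
    unfolding q w_def using schur_chi_law_axis[of q n c f] c p q by simp
  finally show ?thesis by (simp add: q)
qed

text \<open>The conditional law of the ratio given row n does not depend on that row, hence the two are
  independent; a deterministic shift m of the row does not matter.\<close>

lemma schur_chi_joint_law:
  assumes p: "0 < p" "p \<le> n"
    and F[measurable]: "F \<in> borel_measurable ((\<Pi>\<^sub>M j\<in>{..<p}. borel) \<Otimes>\<^sub>M borel)"
  shows "(\<integral>\<^sup>+h. F (\<lambda>j\<in>{..<p}. h (n, j), schur_chi n p (\<lambda>j. m j + h (n, j)) h) \<partial>gauss ({..<Suc n} \<times> {..<p})) =
    (\<integral>\<^sup>+z. \<integral>\<^sup>+g. F (z, \<Sum>i<Suc n - p. (g i)\<^sup>2) \<partial>gauss {..<Suc n - p} \<partial>gauss {..<p})"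
proof -
  let ?A = "{n} \<times> {..<p}" and ?B = "{..<n} \<times> {..<p}"
  let ?G = "\<lambda>z. \<integral>\<^sup>+g. F (z, \<Sum>i<Suc n - p. (g i)\<^sup>2) \<partial>gauss {..<Suc n - p}"
  have un: "{..<Suc n} \<times> {..<p} = ?A \<union> ?B" by auto
  define r where "r h = (\<lambda>j\<in>{..<p}. h (n, j))" for h :: "nat \<times> nat \<Rightarrow> real"
  have r: "r \<in> (\<Pi>\<^sub>M i\<in>?A \<union> ?B. borel) \<rightarrow>\<^sub>M (\<Pi>\<^sub>M j\<in>{..<p}. borel)"
    unfolding r_def by (intro measurable_restrict measurable_component_singleton) auto
  have sc: "(\<lambda>h. schur_chi n p (\<lambda>j. m j + h (n, j)) h) \<in> borel_measurable (\<Pi>\<^sub>M i\<in>?A \<union> ?B. (borel :: real measure))"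
    by (intro schur_chi_measurable measurable_component_singleton borel_measurable_add) auto
  have "(\<integral>\<^sup>+h. F (r h, schur_chi n p (\<lambda>j. m j + h (n, j)) h) \<partial>gauss (?A \<union> ?B)) =
     (\<integral>\<^sup>+x. \<integral>\<^sup>+y. F (r (merge ?A ?B (x, y)), schur_chi n p (\<lambda>j. m j + merge ?A ?B (x, y) (n, j)) (merge ?A ?B (x, y))) \<partial>gauss ?B \<partial>gauss ?A)"
    by (rule nn_integral_gauss_fold[where f="\<lambda>h. F (r h, schur_chi n p (\<lambda>j. m j + h (n, j)) h)"])
       (auto intro!: measurable_compose[OF _ F] measurable_Pair r sc)
  also have "\<dots> = (\<integral>\<^sup>+x. ?G (\<lambda>j\<in>{..<p}. x (n, j)) \<partial>gauss ?A)"
  proof (rule nn_integral_cong_AE)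
    have "AE x in gauss ?A. x (n, 0) \<noteq> - m 0" using p by (intro AE_gauss_neq) auto
    then show "AE x in gauss ?A. (\<integral>\<^sup>+y. F (r (merge ?A ?B (x, y)), schur_chi n p (\<lambda>j. m j + merge ?A ?B (x, y) (n, j)) (merge ?A ?B (x, y))) \<partial>gauss ?B) =
       ?G (\<lambda>j\<in>{..<p}. x (n, j))"
    proof (rule AE_mp, intro AE_I2 impI)
      fix x :: "nat \<times> nat \<Rightarrow> real" assume x: "x (n, 0) \<noteq> - m 0"
      let ?r = "\<lambda>j\<in>{..<p}. x (n, j)"
      have r1: "r (merge ?A ?B (x, y)) = ?r" for y by (auto simp: r_def merge_def)
      have s1: "schur_chi n p (\<lambda>j. m j + merge ?A ?B (x, y) (n, j)) (merge ?A ?B (x, y)) = schur_chi n p (\<lambda>j. m j + x (n, j)) y" for y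
        by (intro schur_chi_cong) (auto simp: merge_def)
      have [measurable]: "(\<lambda>v. F (?r, v)) \<in> borel_measurable borel"
        by (intro measurable_compose[OF _ F] measurable_Pair) (auto simp: space_PiM)
      show "(\<integral>\<^sup>+y. F (r (merge ?A ?B (x, y)), schur_chi n p (\<lambda>j. m j + merge ?A ?B (x, y) (n, j)) (merge ?A ?B (x, y))) \<partial>gauss ?B) = ?G ?r"
        unfolding r1 s1
        by (rule schur_chi_law[where f="\<lambda>v. F (?r, v)"]) (use p x in \<open>auto intro!: exI[of _ 0]\<close>)
    qed
  qed
  also have "\<dots> = (\<integral>\<^sup>+z. ?G z \<partial>gauss {..<p})"
  proof (rule nn_integral_gauss_reindex[where f="?G"])
    interpret gp: prob_space "gauss {..<Suc n - p}" by (rule prob_space_gauss)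
    have "(\<lambda>u. F (fst u, \<Sum>i<Suc n - p. (snd u i)\<^sup>2)) \<in>
        borel_measurable ((\<Pi>\<^sub>M j\<in>{..<p}. borel) \<Otimes>\<^sub>M gauss {..<Suc n - p})"
      by (intro measurable_compose[OF _ F] measurable_Pair measurable_fst borel_measurable_sum borel_measurable_power
          measurable_compose[OF measurable_snd]) (auto simp: gauss_def)
    from gp.borel_measurable_nn_integral_fst[OF this]
    show "?G \<in> borel_measurable (\<Pi>\<^sub>M j\<in>{..<p}. borel)" by simp
  qed (auto simp: inj_on_def)
  finally show ?thesis unfolding un r_def .
qed

section \<open>Second moments of quadratic Gaussian sums\<close>

lemma gauss_cross_moment:
  assumes fin: "finite I" and ij: "i \<in> I" "j \<in> I"
    and f: "\<And>i. i \<in> I \<Longrightarrow> integrable std_normal_distribution (f i)"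
      "\<And>i. i \<in> I \<Longrightarrow> integrable std_normal_distribution (\<lambda>x. (f i x)\<^sup>2)"
      "\<And>i. i \<in> I \<Longrightarrow> (LINT x|std_normal_distribution. f i x) = (0::real)"
  shows "integrable (gauss I) (\<lambda>x. f i (x i) * f j (x j))"
    "(LINT x|gauss I. f i (x i) * f j (x j)) =
       (if i = j then (LINT x|std_normal_distribution. (f i x)\<^sup>2) else 0)"
proof -
  define F where "F l x = (if l = i then f i x else 1) * (if l = j then f j x else (1::real))" for l x
  have eq: "(\<Prod>l\<in>I. F l (x l)) = f i (x i) * f j (x j)" for x
  proof -
    have "(\<Prod>l\<in>I. F l (x l)) = (\<Prod>l\<in>I. if l = i then f l (x l) else 1) * (\<Prod>l\<in>I. if l = j then f l (x l) else 1)"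
      unfolding F_def prod.distrib by (intro arg_cong2[where f="(*)"] prod.cong) auto
    then show ?thesis using fin ij by simp
  qed
  have int: "integrable std_normal_distribution (F l)" if "l \<in> I" for l
    using f ij unfolding F_def[abs_def] by (cases "l = i"; cases "l = j") (auto simp: power2_eq_square)
  have "integrable (gauss I) (\<lambda>x. \<Prod>l\<in>I. F l (x l))"
    unfolding gauss_def by (intro gauss.product_integrable_prod fin int)
  then show "integrable (gauss I) (\<lambda>x. f i (x i) * f j (x j))" unfolding eq .
  have "(LINT x|gauss I. (\<Prod>l\<in>I. F l (x l))) = (\<Prod>l\<in>I. integral\<^sup>L std_normal_distribution (F l))"
    unfolding gauss_def by (intro gauss.product_integral_prod fin int)
  also have "\<dots> = (if i = j then (LINT x|std_normal_distribution. (f i x)\<^sup>2) else 0)"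
  proof (cases "i = j")
    case True
    have "(\<Prod>l\<in>I. integral\<^sup>L std_normal_distribution (F l)) =
       (\<Prod>l\<in>I. if l = i then (LINT x|std_normal_distribution. (f l x)\<^sup>2) else 1)"
      using True std_normal.prob_space by (intro prod.cong refl) (auto simp: F_def[abs_def] power2_eq_square)
    then show ?thesis using True fin ij by simp
  next
    case False
    have "integral\<^sup>L std_normal_distribution (F i) = 0" using False f(3)[OF ij(1)] by (simp add: F_def[abs_def])
    then show ?thesis using False fin ij by (simp, intro bexI[of _ i]) auto
  qed
  finally show "(LINT x|gauss I. f i (x i) * f j (x j)) =
       (if i = j then (LINT x|std_normal_distribution. (f i x)\<^sup>2) else 0)" unfolding eq .
qed

lemma gauss_sum_square:
  assumes fin: "finite I"
    and f: "\<And>i. i \<in> I \<Longrightarrow> integrable std_normal_distribution (f i)"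
      "\<And>i. i \<in> I \<Longrightarrow> integrable std_normal_distribution (\<lambda>x. (f i x)\<^sup>2)"
      "\<And>i. i \<in> I \<Longrightarrow> (LINT x|std_normal_distribution. f i x) = (0::real)"
  shows "(\<integral>\<^sup>+x. ennreal ((\<Sum>i\<in>I. f i (x i))\<^sup>2) \<partial>gauss I) =
    ennreal (\<Sum>i\<in>I. LINT x|std_normal_distribution. (f i x)\<^sup>2)"
proof -
  have cm1: "integrable (gauss I) (\<lambda>x. f i (x i) * f j (x j))" if "i \<in> I" "j \<in> I" for i j
    by (rule gauss_cross_moment(1)[OF fin that]) (use f in auto)
  have cm2: "(LINT x|gauss I. f i (x i) * f j (x j)) =
       (if i = j then (LINT x|std_normal_distribution. (f i x)\<^sup>2) else 0)" if "i \<in> I" "j \<in> I" for i j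
    by (rule gauss_cross_moment(2)[OF fin that]) (use f in auto)
  have eq: "(\<Sum>i\<in>I. f i (x i))\<^sup>2 = (\<Sum>i\<in>I. \<Sum>j\<in>I. f i (x i) * f j (x j))" for x
    by (simp add: power2_eq_square sum_product)
  have "(\<integral>\<^sup>+x. ennreal ((\<Sum>i\<in>I. f i (x i))\<^sup>2) \<partial>gauss I) = ennreal (LINT x|gauss I. (\<Sum>i\<in>I. f i (x i))\<^sup>2)"
    unfolding eq using cm1
    by (intro nn_integral_eq_integral Bochner_Integration.integrable_sum) (auto simp: eq[symmetric])
  also have "(LINT x|gauss I. (\<Sum>i\<in>I. f i (x i))\<^sup>2) = (\<Sum>i\<in>I. \<Sum>j\<in>I. LINT x|gauss I. f i (x i) * f j (x j))"
    unfolding eq by (simp add: cm1 Bochner_Integration.integral_sum)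
  also have "\<dots> = (\<Sum>i\<in>I. LINT x|std_normal_distribution. (f i x)\<^sup>2)"
    using fin by (intro sum.cong refl) (simp add: cm2)
  finally show ?thesis .
qed

lemma gauss_weighted_chisq_L2:
  assumes "finite I"
  shows "(\<integral>\<^sup>+g. ennreal ((\<Sum>i\<in>I. w i * ((g i)\<^sup>2 - 1))\<^sup>2) \<partial>gauss I) = ennreal (2 * (\<Sum>i\<in>I. (w i)\<^sup>2))"
proof -
  have "(\<integral>\<^sup>+g. ennreal ((\<Sum>i\<in>I. w i * ((g i)\<^sup>2 - 1))\<^sup>2) \<partial>gauss I) =
     ennreal (\<Sum>i\<in>I. LINT x|std_normal_distribution. (w i * (x\<^sup>2 - 1))\<^sup>2)"
    using std_normal_chisq assms
    by (intro gauss_sum_square[where f="\<lambda>i x. w i * (x\<^sup>2 - 1)"]) (auto simp: power_mult_distrib)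
  then show ?thesis using std_normal_chisq by (simp add: power_mult_distrib sum_distrib_left mult.commute)
qed

lemma gauss_linear_L2:
  assumes "finite I"
  shows "(\<integral>\<^sup>+g. ennreal ((\<Sum>i\<in>I. w i * g i)\<^sup>2) \<partial>gauss I) = ennreal (\<Sum>i\<in>I. (w i)\<^sup>2)"
proof -
  have 1: "integrable std_normal_distribution (\<lambda>x. x)" "(LINT x|std_normal_distribution. x) = 0"
    using std_normal_moments(1)[of 1] integral_std_normal_distribution_moment_odd[of 1] by auto
  have "(\<integral>\<^sup>+g. ennreal ((\<Sum>i\<in>I. w i * g i)\<^sup>2) \<partial>gauss I) =
     ennreal (\<Sum>i\<in>I. LINT x|std_normal_distribution. (w i * x)\<^sup>2)"
    using std_normal_moments 1 assms
    by (intro gauss_sum_square[where f="\<lambda>i x. w i * x"]) (auto simp: power_mult_distrib)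
  then show ?thesis using std_normal_moments by (simp add: power_mult_distrib)
qed

lemma sum_fourth_le_square:
  fixes a :: "'i \<Rightarrow> real"
  shows "(\<Sum>i\<in>I. (a i) ^ 4) \<le> (\<Sum>i\<in>I. (a i)\<^sup>2)\<^sup>2"
proof (induction I rule: infinite_finite_induct)
  case (insert i I)
  have "(\<Sum>i\<in>I. (a i)\<^sup>2) \<ge> 0" by (intro sum_nonneg) auto
  then have "0 \<le> 2 * (a i)\<^sup>2 * (\<Sum>i\<in>I. (a i)\<^sup>2)" by simp
  with insert show ?case by (simp add: power2_sum power_mult[symmetric])
qed auto

lemma nn_integral_square_le_add:
  assumes [measurable]: "f \<in> borel_measurable M"
    and le: "\<And>x. x \<in> space M \<Longrightarrow> (g x)\<^sup>2 \<le> a * (f x)\<^sup>2 + b"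
    and f: "(\<integral>\<^sup>+x. ennreal ((f x)\<^sup>2) \<partial>M) \<le> ennreal c" and ab: "a \<ge> 0" "b \<ge> 0" "c \<ge> 0"
    and M: "prob_space M"
  shows "(\<integral>\<^sup>+x. ennreal ((g x)\<^sup>2) \<partial>M) \<le> ennreal (a * c + b)"
proof -
  have "(\<integral>\<^sup>+x. ennreal ((g x)\<^sup>2) \<partial>M) \<le> (\<integral>\<^sup>+x. ennreal a * ennreal ((f x)\<^sup>2) + ennreal b \<partial>M)"
    using ab le by (intro nn_integral_mono) (simp add: ennreal_mult[symmetric] ennreal_plus[symmetric] ennreal_leI del: ennreal_plus)
  also have "\<dots> = ennreal a * (\<integral>\<^sup>+x. ennreal ((f x)\<^sup>2) \<partial>M) + ennreal b"
    using prob_space.emeasure_space_1[OF M] by (simp add: nn_integral_add nn_integral_cmult)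
  also have "\<dots> \<le> ennreal a * ennreal c + ennreal b"
    using f by (intro add_mono mult_left_mono) auto
  also have "\<dots> = ennreal (a * c + b)" using ab by (simp add: ennreal_mult[symmetric] ennreal_plus[symmetric] del: ennreal_plus)
  finally show ?thesis .
qed

lemma gauss_weighted_square_L2:
  assumes fin: "finite I"
  shows "(\<integral>\<^sup>+g. ennreal ((\<Sum>i\<in>I. (w i)\<^sup>2 * (g i)\<^sup>2)\<^sup>2) \<partial>gauss I) \<le> ennreal (6 * (\<Sum>i\<in>I. (w i)\<^sup>2)\<^sup>2)"
proof -
  have "(\<integral>\<^sup>+g. ennreal ((\<Sum>i\<in>I. (w i)\<^sup>2 * (g i)\<^sup>2)\<^sup>2) \<partial>gauss I) \<le>
    ennreal (2 * (2 * (\<Sum>i\<in>I. ((w i)\<^sup>2)\<^sup>2)) + 2 * (\<Sum>i\<in>I. (w i)\<^sup>2)\<^sup>2)"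
  proof (rule nn_integral_square_le_add[where f="\<lambda>g. \<Sum>i\<in>I. (w i)\<^sup>2 * ((g i)\<^sup>2 - 1)"])
    show "(\<Sum>i\<in>I. (w i)\<^sup>2 * (g i)\<^sup>2)\<^sup>2 \<le> 2 * (\<Sum>i\<in>I. (w i)\<^sup>2 * ((g i)\<^sup>2 - 1))\<^sup>2 + 2 * (\<Sum>i\<in>I. (w i)\<^sup>2)\<^sup>2" for g
    proof -
      define u v where "u = (\<Sum>i\<in>I. (w i)\<^sup>2 * ((g i)\<^sup>2 - 1))" and "v = (\<Sum>i\<in>I. (w i)\<^sup>2)"
      have "(\<Sum>i\<in>I. (w i)\<^sup>2 * (g i)\<^sup>2) = u + v" by (simp add: u_def v_def algebra_simps sum_subtractf)
      moreover have "(u + v)\<^sup>2 \<le> 2 * u\<^sup>2 + 2 * v\<^sup>2"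
        using sum_squares_bound[of u v] by (simp add: power2_sum)
      ultimately show ?thesis by (simp add: u_def v_def)
    qed
    show "(\<integral>\<^sup>+ x. ennreal ((\<Sum>i\<in>I. (w i)\<^sup>2 * ((x i)\<^sup>2 - 1))\<^sup>2) \<partial>gauss I) \<le> ennreal (2 * (\<Sum>i\<in>I. ((w i)\<^sup>2)\<^sup>2))"
      using gauss_weighted_chisq_L2[OF fin, of "\<lambda>i. (w i)\<^sup>2"] by simp
  qed (auto intro!: prob_space_gauss sum_nonneg borel_measurable_sum simp: measurable_cong_sets[OF sets_gauss refl])
  also have "\<dots> \<le> ennreal (6 * (\<Sum>i\<in>I. (w i)\<^sup>2)\<^sup>2)"
    using sum_fourth_le_square[of w I] by (intro ennreal_leI) (simp add: power_mult[symmetric])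
  finally show ?thesis .
qed

text \<open>Rows are paired with the eigenvalues as weights: these are the inner products of the residuals in the
  original coordinates.\<close>

definition row_inner :: "nat \<Rightarrow> (nat \<Rightarrow> real) \<Rightarrow> (nat \<times> nat \<Rightarrow> real) \<Rightarrow> nat \<Rightarrow> nat \<Rightarrow> real" where
  "row_inner p lam h j k = (\<Sum>i<p. lam i * h (j, i) * h (k, i))"

definition row_sq :: "nat \<Rightarrow> (nat \<Rightarrow> real) \<Rightarrow> (nat \<times> nat \<Rightarrow> real) \<Rightarrow> nat \<Rightarrow> real" where
  "row_sq p lam h j = (\<Sum>i<p. (lam i)\<^sup>2 * (h (j, i))\<^sup>2)"

text \<open>For fixed u the linear forms in the independent rows are centred normal with variance s; rotating u
  to an axis turns the sum into one of independent centred chi-squares.\<close>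

lemma row_inner_conditional_L2:
  fixes u :: "nat \<Rightarrow> real"
  assumes p: "0 < p" and K: "finite K" and s: "s = (\<Sum>i<p. (u i)\<^sup>2)"
  shows "(\<integral>\<^sup>+y. ennreal ((\<Sum>k\<in>K. (\<Sum>i<p. u i * y (k, i))\<^sup>2 - s)\<^sup>2) \<partial>gauss (K \<times> {..<p})) =
    ennreal (2 * real (card K) * s\<^sup>2)"
proof -
  let ?I = "K \<times> {..<p}"
  have s0: "s \<ge> 0" unfolding s by (intro sum_nonneg) auto
  define w where "w j = of_bool (0 = j) * sqrt s" for j :: nat
  have "(\<Sum>j<p. (w j)\<^sup>2) = (\<Sum>j<p. of_bool (0 = j) * s)"
    using s0 by (intro sum.cong) (auto simp: w_def)
  also have "\<dots> = s" using p by (intro sum_of_bool_mult(1)) auto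
  finally have "(\<Sum>j<p. (u j)\<^sup>2) = (\<Sum>j<p. (w j)\<^sup>2)" using s by simp
  from householder[OF finite_lessThan this]
  obtain R where R: "orth_on {..<p} R" "\<And>i j. R i j = R j i"
    "\<And>i. i \<in> {..<p} \<Longrightarrow> (\<Sum>j\<in>{..<p}. R i j * u j) = w i" "\<And>i. i \<in> {..<p} \<Longrightarrow> (\<Sum>j\<in>{..<p}. R i j * w j) = u i"
    by blast
  let ?L = "lin_on ?I (\<lambda>a b. of_bool (fst a = fst b) * R (snd a) (snd b))"
  have L: "?L h (i, j) = (\<Sum>l<p. R j l * h (i, l))" if "i \<in> K" "j < p" for h i j
  proof -
    have "?L h (i, j) = (\<Sum>k\<in>K. of_bool (i = k) * (\<Sum>l<p. R j l * h (k, l)))"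
      using that by (simp add: lin_on_def sum.cartesian_product' sum_distrib_left mult.assoc)
    also have "\<dots> = (\<Sum>l<p. R j l * h (i, l))" using that K by (intro sum_of_bool_mult(1)) auto
    finally show ?thesis .
  qed
  have uy: "(\<Sum>i<p. u i * y (k, i)) = sqrt s * ?L y (k, 0)" if k: "k \<in> K" for y k
  proof -
    have "(\<Sum>i<p. u i * y (k, i)) = (\<Sum>i<p. (\<Sum>j<p. R i j * u j) * (\<Sum>j<p. R i j * y (k, j)))"
      using orth_on_norm[OF finite_lessThan R(1), of u "\<lambda>i. y (k, i)"] by simp
    also have "\<dots> = (\<Sum>i<p. of_bool (0 = i) * (sqrt s * ?L y (k, i)))"
      using R(3) k L by (intro sum.cong refl) (simp add: w_def mult.assoc)
    also have "\<dots> = sqrt s * ?L y (k, 0)" using p by (intro sum_of_bool_mult(1)) auto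
    finally show ?thesis .
  qed
  have ss: "(\<Sum>k\<in>K. (\<Sum>i<p. u i * y (k, i))\<^sup>2 - s) = (\<Sum>a\<in>?I. of_bool (0 = snd a) * s * ((?L y a)\<^sup>2 - 1))" for y
  proof -
    have "(\<Sum>k\<in>K. (\<Sum>i<p. u i * y (k, i))\<^sup>2 - s) = (\<Sum>k\<in>K. s * ((?L y (k, 0))\<^sup>2 - 1))"
      using s0 by (intro sum.cong refl) (simp add: uy power_mult_distrib algebra_simps)
    also have "\<dots> = (\<Sum>k\<in>K. \<Sum>i<p. of_bool (0 = i) * (s * ((?L y (k, i))\<^sup>2 - 1)))"
      using p by (intro sum.cong refl sum_of_bool_mult(1)[symmetric]) auto
    finally show ?thesis by (simp add: sum.cartesian_product' mult.assoc)
  qed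
  have "(\<integral>\<^sup>+y. ennreal ((\<Sum>k\<in>K. (\<Sum>i<p. u i * y (k, i))\<^sup>2 - s)\<^sup>2) \<partial>gauss ?I) =
     (\<integral>\<^sup>+y. ennreal ((\<Sum>a\<in>?I. of_bool (0 = snd a) * s * ((?L y a)\<^sup>2 - 1))\<^sup>2) \<partial>gauss ?I)"
    unfolding ss ..
  also have "\<dots> = (\<integral>\<^sup>+y. ennreal ((\<Sum>a\<in>?I. of_bool (0 = snd a) * s * ((y a)\<^sup>2 - 1))\<^sup>2) \<partial>gauss ?I)"
    using K by (intro nn_integral_gauss_lin[where f="\<lambda>y. ennreal ((\<Sum>a\<in>?I. of_bool (0 = snd a) * s * ((y a)\<^sup>2 - 1))\<^sup>2)"]
      orth_on_right_factor R) auto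
  also have "\<dots> = ennreal (2 * (\<Sum>a\<in>?I. (of_bool (0 = snd a) * s)\<^sup>2))"
    using K by (intro gauss_weighted_chisq_L2) auto
  also have "(\<Sum>a\<in>?I. (of_bool (0 = snd a) * s)\<^sup>2) = (\<Sum>k\<in>K. \<Sum>i<p. of_bool (0 = i) * s\<^sup>2)"
    unfolding sum.cartesian_product' by (intro sum.cong refl) auto
  also have "\<dots> = (\<Sum>k\<in>K. s\<^sup>2)" using p by (intro sum.cong refl sum_of_bool_mult(1)) auto
  finally show ?thesis by (simp add: mult.assoc)
qed

text \<open>Conditioning on row j, the previous lemma applies to the remaining rows with u the weighted row j.\<close>

lemma row_inner_row_L2:
  assumes p: "0 < p" and j: "j < n"
  shows "(\<integral>\<^sup>+h. ennreal ((\<Sum>k\<in>{..<n} - {j}. (row_inner p lam h j k)\<^sup>2 - row_sq p lam h j)\<^sup>2)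
     \<partial>gauss ({..<n} \<times> {..<p})) \<le> ennreal (12 * real n * (\<Sum>i<p. (lam i)\<^sup>2)\<^sup>2)"
proof -
  let ?A = "{j} \<times> {..<p}" and ?B = "({..<n} - {j}) \<times> {..<p}"
  have un: "{..<n} \<times> {..<p} = ?A \<union> ?B" using j by auto
  define f where "f h = ennreal ((\<Sum>k\<in>{..<n} - {j}. (row_inner p lam h j k)\<^sup>2 - row_sq p lam h j)\<^sup>2)" for h
  have f: "f \<in> borel_measurable (\<Pi>\<^sub>M i\<in>?A \<union> ?B. (borel :: real measure))"
    unfolding f_def[abs_def] row_inner_def row_sq_def
    by (intro measurable_compose[OF _ measurable_ennreal] borel_measurable_power borel_measurable_sum
        borel_measurable_diff borel_measurable_times measurable_component_singleton borel_measurable_const) auto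
  have "(\<integral>\<^sup>+h. f h \<partial>gauss (?A \<union> ?B)) = (\<integral>\<^sup>+x. \<integral>\<^sup>+y. f (merge ?A ?B (x, y)) \<partial>gauss ?B \<partial>gauss ?A)"
    by (intro nn_integral_gauss_fold f) auto
  also have "\<dots> \<le> (\<integral>\<^sup>+x. ennreal (2 * real n) * ennreal ((\<Sum>a\<in>?A. (lam (snd a))\<^sup>2 * (x a)\<^sup>2)\<^sup>2) \<partial>gauss ?A)"
  proof (intro nn_integral_mono)
    fix x :: "nat \<times> nat \<Rightarrow> real"
    define s where "s = (\<Sum>i<p. (lam i * x (j, i))\<^sup>2)"
    have rs: "row_sq p lam (merge ?A ?B (x, y)) j = s" for y
      unfolding row_sq_def s_def by (intro sum.cong) (auto simp: merge_def power_mult_distrib)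
    have ri: "row_inner p lam (merge ?A ?B (x, y)) j k = (\<Sum>i<p. (lam i * x (j, i)) * y (k, i))"
      if "k \<in> {..<n} - {j}" for y k
      unfolding row_inner_def using that by (intro sum.cong) (auto simp: merge_def)
    have "(\<integral>\<^sup>+y. f (merge ?A ?B (x, y)) \<partial>gauss ?B) =
       (\<integral>\<^sup>+y. ennreal ((\<Sum>k\<in>{..<n} - {j}. (\<Sum>i<p. (lam i * x (j, i)) * y (k, i))\<^sup>2 - s)\<^sup>2) \<partial>gauss ?B)"
      unfolding f_def rs by (intro nn_integral_cong) (simp add: ri)
    also have "\<dots> = ennreal (2 * real (card ({..<n} - {j})) * s\<^sup>2)"
      by (rule row_inner_conditional_L2[OF p _ s_def]) auto
    also have "\<dots> \<le> ennreal (2 * real n * s\<^sup>2)"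
      by (intro ennreal_leI mult_right_mono) (auto simp: card_Diff_singleton_if)
    also have "\<dots> = ennreal (2 * real n) * ennreal ((\<Sum>a\<in>?A. (lam (snd a))\<^sup>2 * (x a)\<^sup>2)\<^sup>2)"
      by (simp add: s_def sum.cartesian_product' power_mult_distrib ennreal_mult'[symmetric])
    finally show "(\<integral>\<^sup>+y. f (merge ?A ?B (x, y)) \<partial>gauss ?B) \<le>
       ennreal (2 * real n) * ennreal ((\<Sum>a\<in>?A. (lam (snd a))\<^sup>2 * (x a)\<^sup>2)\<^sup>2)" .
  qed
  also have "\<dots> = ennreal (2 * real n) * (\<integral>\<^sup>+x. ennreal ((\<Sum>a\<in>?A. (lam (snd a))\<^sup>2 * (x a)\<^sup>2)\<^sup>2) \<partial>gauss ?A)"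
    by (intro nn_integral_cmult) (auto simp: measurable_cong_sets[OF sets_gauss refl])
  also have "\<dots> \<le> ennreal (2 * real n) * ennreal (6 * (\<Sum>a\<in>?A. (lam (snd a))\<^sup>2)\<^sup>2)"
    by (intro mult_left_mono gauss_weighted_square_L2) auto
  also have "\<dots> = ennreal (12 * real n * (\<Sum>i<p. (lam i)\<^sup>2)\<^sup>2)"
    by (subst ennreal_mult'[symmetric]) (auto simp: sum.cartesian_product')
  finally show ?thesis unfolding un f_def .
qed

text \<open>The Cauchy-Schwarz inequality over j loses a factor of the order n, which is harmless after division
  by the normalization of order n^2 p of the variance estimator.\<close>

lemma row_inner_total_L2:
  assumes p: "0 < p"
  shows "(\<integral>\<^sup>+h. ennreal ((\<Sum>j<n. \<Sum>k\<in>{..<n} - {j}. (row_inner p lam h j k)\<^sup>2 - row_sq p lam h j)\<^sup>2)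
     \<partial>gauss ({..<n} \<times> {..<p})) \<le> ennreal (12 * real n ^ 3 * (\<Sum>i<p. (lam i)\<^sup>2)\<^sup>2)"
proof -
  let ?I = "{..<n} \<times> {..<p}"
  define X where "X j h = (\<Sum>k\<in>{..<n} - {j}. (row_inner p lam h j k)\<^sup>2 - row_sq p lam h j)" for j h
  have X: "X j \<in> borel_measurable (gauss ?I)" if "j < n" for j
    unfolding X_def[abs_def] row_inner_def row_sq_def measurable_cong_sets[OF sets_gauss refl] using that
    by (intro borel_measurable_power borel_measurable_sum
        borel_measurable_diff borel_measurable_times measurable_component_singleton borel_measurable_const) auto
  have "(\<integral>\<^sup>+h. ennreal ((\<Sum>j<n. X j h)\<^sup>2) \<partial>gauss ?I) \<le> (\<integral>\<^sup>+h. ennreal (real n) * (\<Sum>j<n. ennreal ((X j h)\<^sup>2)) \<partial>gauss ?I)"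
  proof (intro nn_integral_mono)
    fix h
    have "(\<Sum>j<n. X j h * 1)\<^sup>2 \<le> (\<Sum>j<n. (X j h)\<^sup>2) * (\<Sum>j<n. 1\<^sup>2)" by (rule Cauchy_Schwarz_ineq_sum)
    then have "ennreal ((\<Sum>j<n. X j h)\<^sup>2) \<le> ennreal (real n * (\<Sum>j<n. (X j h)\<^sup>2))"
      by (intro ennreal_leI) (simp add: mult.commute)
    also have "\<dots> = ennreal (real n) * (\<Sum>j<n. ennreal ((X j h)\<^sup>2))"
      by (simp add: ennreal_mult' sum_ennreal)
    finally show "ennreal ((\<Sum>j<n. X j h)\<^sup>2) \<le> ennreal (real n) * (\<Sum>j<n. ennreal ((X j h)\<^sup>2))" .
  qed
  also have "\<dots> = ennreal (real n) * (\<Sum>j<n. \<integral>\<^sup>+h. ennreal ((X j h)\<^sup>2) \<partial>gauss ?I)"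
  proof -
    have "(\<integral>\<^sup>+h. (\<Sum>j<n. ennreal ((X j h)\<^sup>2)) \<partial>gauss ?I) = (\<Sum>j<n. \<integral>\<^sup>+h. ennreal ((X j h)\<^sup>2) \<partial>gauss ?I)"
      using X by (intro nn_integral_sum) auto
    then show ?thesis using X by (subst nn_integral_cmult) auto
  qed
  also have "\<dots> \<le> ennreal (real n) * (\<Sum>j<n. ennreal (12 * real n * (\<Sum>i<p. (lam i)\<^sup>2)\<^sup>2))"
    unfolding X_def by (intro mult_left_mono sum_mono row_inner_row_L2 p) auto
  also have "\<dots> = ennreal (12 * real n ^ 3 * (\<Sum>i<p. (lam i)\<^sup>2)\<^sup>2)"
    by (simp add: sum_ennreal ennreal_of_nat_eq_real_of_nat ennreal_mult'[symmetric] power3_eq_cube mult_ac)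
  finally show ?thesis by (simp add: X_def)
qed

section \<open>The square root of the covariance matrix\<close>

lemma orth_on_transpose: "orth_on I B \<Longrightarrow> orth_on I (\<lambda>i j. B j i)"
  by (auto simp: orth_on_def)

lemma symmetric_eigenbasis:
  fixes a :: "nat \<Rightarrow> nat \<Rightarrow> real"
  assumes sym: "\<And>i j. i < m \<Longrightarrow> j < m \<Longrightarrow> a i j = a j i"
  obtains Q lam where "orth_on {..<m} Q" "\<And>r k. r < m \<Longrightarrow> k < m \<Longrightarrow> (\<Sum>l<m. a k l * Q r l) = lam r * Q r k"
proof -
  obtain Q lam where Q: "orth_on {..<m} Q" and
    ql: "\<forall>i<m. \<forall>j<m. (\<Sum>k<m. Q i k * (\<Sum>l<m. Q j l * a k l)) = of_bool (i = j) * lam i"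
    using symmetric_spectral[of m a] sym by blast
  have "(\<Sum>l<m. a k l * Q r l) = lam r * Q r k" if rk: "r < m" "k < m" for r k
  proof -
    define y where "y k = (\<Sum>l<m. Q r l * a k l)" for k
    have "y k = (\<Sum>s<m. of_bool (k = s) * y s)" using rk by (intro sum_of_bool_mult(1)[symmetric]) auto
    also have "\<dots> = (\<Sum>s<m. (\<Sum>i<m. Q i k * Q i s) * y s)"
      using Q rk by (intro sum.cong refl) (auto simp: orth_on_def)
    also have "\<dots> = (\<Sum>s<m. \<Sum>i<m. Q i k * (Q i s * y s))" by (simp add: sum_distrib_right mult.assoc)
    also have "\<dots> = (\<Sum>i<m. Q i k * (\<Sum>s<m. Q i s * y s))" by (subst sum.swap) (simp add: sum_distrib_left)
    also have "\<dots> = (\<Sum>i<m. of_bool (i = r) * (lam i * Q i k))"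
      using ql rk unfolding y_def by (intro sum.cong refl) (simp add: mult_ac)
    also have "\<dots> = lam r * Q r k" using rk by (intro sum_of_bool_mult(2)) auto
    finally show ?thesis by (simp add: y_def mult.commute)
  qed
  with Q show ?thesis by (rule that)
qed

locale whitening =
  fixes p :: nat and \<Sigma> :: "real mat" and Q :: "nat \<Rightarrow> nat \<Rightarrow> real" and lam :: "nat \<Rightarrow> real"
  assumes orth: "orth_on {..<p} Q"
    and carr: "\<Sigma> \<in> carrier_mat p p"
    and eigen: "\<And>r k. r < p \<Longrightarrow> k < p \<Longrightarrow> (\<Sum>l<p. \<Sigma> $$ (k, l) * Q r l) = lam r * Q r k"
    and lam_pos: "\<And>r. r < p \<Longrightarrow> lam r > 0"
begin

text \<open>Column r of a square root of \<open>\<Sigma>\<close>, that is, of a matrix whose product with its transpose is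
  \<open>\<Sigma>\<close>; it need not be symmetric.\<close>

definition root :: "nat \<Rightarrow> nat \<Rightarrow> real" where
  "root j r = sqrt (lam r) * Q r j"

definition root_inv :: "nat \<Rightarrow> nat \<Rightarrow> real" where
  "root_inv j r = Q r j / sqrt (lam r)"

lemma orth_dot:
  "(\<Sum>j<p. (\<Sum>r<p. Q r j * x r) * (\<Sum>r<p. Q r j * y r)) = (\<Sum>r<p. x r * y r)"
  by (rule orth_on_norm[OF finite_lessThan orth_on_transpose[OF orth]])

lemma root_dot: "(\<Sum>j<p. (\<Sum>r<p. root j r * x r) * (\<Sum>r<p. root j r * y r)) = (\<Sum>r<p. lam r * x r * y r)"
proof -
  have "(\<Sum>r<p. root j r * x r) = (\<Sum>r<p. Q r j * (sqrt (lam r) * x r))" for j x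
    by (simp add: root_def mult_ac)
  then have "(\<Sum>j<p. (\<Sum>r<p. root j r * x r) * (\<Sum>r<p. root j r * y r)) =
     (\<Sum>r<p. (sqrt (lam r) * x r) * (sqrt (lam r) * y r))" by (simp add: orth_dot)
  also have "\<dots> = (\<Sum>r<p. (sqrt (lam r) * sqrt (lam r)) * x r * y r)" by (simp add: mult_ac)
  also have "\<dots> = (\<Sum>r<p. lam r * x r * y r)"
    using lam_pos by (intro sum.cong refl) (simp add: less_imp_le)
  finally show ?thesis .
qed

lemma root_inv_dot: "(\<Sum>j<p. (\<Sum>r<p. root j r * x r) * (\<Sum>r<p. root_inv j r * y r)) = (\<Sum>r<p. x r * y r)"
proof -
  have "(\<Sum>r<p. root j r * x r) = (\<Sum>r<p. Q r j * (sqrt (lam r) * x r))"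
    "(\<Sum>r<p. root_inv j r * y r) = (\<Sum>r<p. Q r j * (y r / sqrt (lam r)))" for j
    by (simp_all add: root_def root_inv_def mult_ac)
  then have "(\<Sum>j<p. (\<Sum>r<p. root j r * x r) * (\<Sum>r<p. root_inv j r * y r)) =
     (\<Sum>r<p. (sqrt (lam r) * x r) * (y r / sqrt (lam r)))" by (simp only: orth_dot)
  also have "\<dots> = (\<Sum>r<p. x r * y r)"
    using lam_pos by (intro sum.cong refl) (simp add: order_less_le)
  finally show ?thesis .
qed

lemma root_inv_left: "s < p \<Longrightarrow> (\<Sum>j<p. root j s * (\<Sum>r<p. root_inv j r * y r)) = y s"
  using root_inv_dot[of "\<lambda>r. of_bool (r = s)" y] sum_of_bool_mult(4)[of "{..<p}" s "root _"]
    sum_of_bool_mult(2)[of "{..<p}" s y] by simp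

lemma root_inv_right: "j < p \<Longrightarrow> (\<Sum>r<p. root j r * (\<Sum>l<p. root_inv l r * v l)) = v j"
proof -
  assume j: "j < p"
  have "(\<Sum>r<p. root j r * (\<Sum>l<p. root_inv l r * v l)) = (\<Sum>r<p. Q r j * (\<Sum>l<p. Q r l * v l))"
  proof (intro sum.cong refl)
    fix r assume "r \<in> {..<p}"
    then have "lam r > 0" using lam_pos by auto
    then show "root j r * (\<Sum>l<p. root_inv l r * v l) = Q r j * (\<Sum>l<p. Q r l * v l)"
      by (simp add: root_def root_inv_def sum_divide_distrib[symmetric])
  qed
  also have "\<dots> = (\<Sum>r<p. (\<Sum>l<p. Q r l * of_bool (l = j)) * (\<Sum>l<p. Q r l * v l))"
    using j by (intro sum.cong refl) (simp add: sum_of_bool_mult(4))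
  also have "\<dots> = (\<Sum>l<p. of_bool (l = j) * v l)" by (rule orth_on_norm[OF finite_lessThan orth])
  also have "\<dots> = v j" using j by (intro sum_of_bool_mult(2)) auto
  finally show ?thesis .
qed

lemma Sigma_root_inv:
  assumes k: "k < p"
  shows "(\<Sum>l<p. \<Sigma> $$ (k, l) * (\<Sum>r<p. root_inv l r * x r)) = (\<Sum>r<p. root k r * x r)"
proof -
  have "(\<Sum>l<p. \<Sigma> $$ (k, l) * (\<Sum>r<p. root_inv l r * x r)) =
     (\<Sum>l<p. \<Sum>r<p. \<Sigma> $$ (k, l) * Q r l * (x r / sqrt (lam r)))"
    by (simp add: sum_distrib_left root_inv_def mult_ac)
  also have "\<dots> = (\<Sum>r<p. (\<Sum>l<p. \<Sigma> $$ (k, l) * Q r l) * (x r / sqrt (lam r)))"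
    by (subst sum.swap) (simp add: sum_distrib_right sum_divide_distrib)
  also have "\<dots> = (\<Sum>r<p. root k r * x r)"
  proof (intro sum.cong refl)
    fix r assume r: "r \<in> {..<p}"
    then have "lam r / sqrt (lam r) = sqrt (lam r)" using lam_pos[of r] by (simp add: real_div_sqrt)
    then show "(\<Sum>l<p. \<Sigma> $$ (k, l) * Q r l) * (x r / sqrt (lam r)) = root k r * x r"
      using r k eigen[of r k] by (simp add: root_def) (metis mult.commute mult.left_commute times_divide_eq_right)
  qed
  finally show ?thesis .
qed

lemma Sigma_eq:
  assumes "k < p" "j < p"
  shows "\<Sigma> $$ (k, j) = (\<Sum>r<p. lam r * Q r k * Q r j)"
proof -
  have "\<Sigma> $$ (k, j) = (\<Sum>l<p. of_bool (j = l) * \<Sigma> $$ (k, l))"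
    using assms by (intro sum_of_bool_mult(1)[symmetric]) auto
  also have "\<dots> = (\<Sum>l<p. (\<Sum>r<p. Q r j * Q r l) * \<Sigma> $$ (k, l))"
    using orth assms by (intro sum.cong refl) (auto simp: orth_on_def)
  also have "\<dots> = (\<Sum>l<p. \<Sum>r<p. Q r j * (\<Sigma> $$ (k, l) * Q r l))"
    by (simp add: sum_distrib_left sum_distrib_right mult_ac)
  also have "\<dots> = (\<Sum>r<p. Q r j * (\<Sum>l<p. \<Sigma> $$ (k, l) * Q r l))"
    by (subst sum.swap) (simp add: sum_distrib_left)
  also have "\<dots> = (\<Sum>r<p. lam r * Q r k * Q r j)"
    using assms by (intro sum.cong refl, subst eigen) (auto simp: mult_ac)
  finally show ?thesis .
qed

text \<open>A vector in the kernel is written in terms of the inverse root, which \<open>\<Sigma>\<close> maps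
  to the injective root.\<close>

lemma det_Sigma: "det \<Sigma> \<noteq> 0"
proof
  assume "det \<Sigma> = 0"
  then obtain v where v: "v \<in> carrier_vec p" "v \<noteq> 0\<^sub>v p" "\<Sigma> *\<^sub>v v = 0\<^sub>v p"
    using det_0_iff_vec_prod_zero[OF carr] by blast
  define y where "y r = (\<Sum>l<p. root l r * v $ l)" for r
  have vl: "(\<Sum>r<p. root_inv l r * y r) = v $ l" if l: "l < p" for l
  proof -
    have "(\<Sum>r<p. root_inv l r * y r) = (\<Sum>r<p. Q r l * (\<Sum>k<p. Q r k * v $ k))"
    proof (intro sum.cong refl)
      fix r assume "r \<in> {..<p}"
      then have "lam r > 0" using lam_pos by auto
      then show "root_inv l r * y r = Q r l * (\<Sum>k<p. Q r k * v $ k)"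
        by (simp add: root_def root_inv_def y_def sum_distrib_left[symmetric] mult.assoc)
    qed
    also have "\<dots> = (\<Sum>r<p. (\<Sum>k<p. Q r k * of_bool (k = l)) * (\<Sum>k<p. Q r k * v $ k))"
      using l by (intro sum.cong refl) (simp add: sum_of_bool_mult(4))
    also have "\<dots> = (\<Sum>k<p. of_bool (k = l) * v $ k)" by (rule orth_on_norm[OF finite_lessThan orth])
    also have "\<dots> = v $ l" using l by (intro sum_of_bool_mult(2)) auto
    finally show ?thesis .
  qed
  have "(\<Sum>r<p. root k r * y r) = 0" if k: "k < p" for k
  proof -
    have "(\<Sum>r<p. root k r * y r) = (\<Sum>l<p. \<Sigma> $$ (k, l) * v $ l)"
      unfolding Sigma_root_inv[OF k, symmetric] using vl by simp
    also have "\<dots> = (\<Sigma> *\<^sub>v v) $ k" using k carr v(1) by (simp add: scalar_prod_def lessThan_atLeast0)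
    finally show ?thesis using v(3) k by simp
  qed
  then have "(\<Sum>r<p. y r * y r) = 0" unfolding root_inv_dot[of y y, symmetric] by (intro sum.neutral) auto
  then have "\<forall>r<p. y r = 0" by (subst (asm) sum_nonneg_eq_0_iff) auto
  then have "v $ l = 0" if "l < p" for l using vl[OF that] by simp
  then show False using v by (metis carrier_vecD eq_vecI index_zero_vec)
qed

lemma quad_form_Sigma_inv:
  "quad_form (mat_inv \<Sigma>) (vec p (\<lambda>j. \<Sum>r<p. root j r * x r)) = (\<Sum>r<p. (x r)\<^sup>2)"
proof -
  have "\<Sigma> *\<^sub>v vec p (\<lambda>l. \<Sum>r<p. root_inv l r * x r) = vec p (\<lambda>j. \<Sum>r<p. root j r * x r)"
  proof (rule eq_vecI)
    fix j assume "j < dim_vec (vec p (\<lambda>j. \<Sum>r<p. root j r * x r))"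
    then have j: "j < p" by simp
    have "(\<Sigma> *\<^sub>v vec p (\<lambda>l. \<Sum>r<p. root_inv l r * x r)) $ j = (\<Sum>l<p. \<Sigma> $$ (j, l) * (\<Sum>r<p. root_inv l r * x r))"
      using j carr by (simp add: scalar_prod_def lessThan_atLeast0)
    then show "(\<Sigma> *\<^sub>v vec p (\<lambda>l. \<Sum>r<p. root_inv l r * x r)) $ j = vec p (\<lambda>j. \<Sum>r<p. root j r * x r) $ j"
      using j by (simp add: Sigma_root_inv)
  qed (use carr in auto)
  then have "quad_form (mat_inv \<Sigma>) (vec p (\<lambda>j. \<Sum>r<p. root j r * x r)) =
     vec p (\<lambda>j. \<Sum>r<p. root j r * x r) \<bullet> vec p (\<lambda>l. \<Sum>r<p. root_inv l r * x r)"
    by (intro quad_form_mat_inv_solve[OF carr det_Sigma]) auto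
  also have "\<dots> = (\<Sum>j<p. (\<Sum>r<p. root j r * x r) * (\<Sum>r<p. root_inv j r * x r))"
    by (simp add: scalar_prod_def lessThan_atLeast0)
  finally show ?thesis by (simp add: root_inv_dot power2_eq_square)
qed

lemma mat_pow_eq:
  "i < p \<Longrightarrow> j < p \<Longrightarrow> (\<Sigma> ^\<^sub>m k) $$ (i, j) = (\<Sum>r<p. lam r ^ k * Q r i * Q r j)"
proof (induction k arbitrary: i j)
  case 0
  have "(\<Sum>r<p. Q r i * Q r j) = of_bool (i = j)" using orth 0 by (auto simp: orth_on_def)
  then show ?case using 0 carr by auto
next
  case (Suc k)
  have "(\<Sigma> ^\<^sub>m Suc k) $$ (i, j) = (\<Sum>l<p. (\<Sigma> ^\<^sub>m k) $$ (i, l) * \<Sigma> $$ (l, j))"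
    using Suc carr pow_carrier_mat[OF carr, of k] by (simp add: scalar_prod_def lessThan_atLeast0)
  also have "\<dots> = (\<Sum>l<p. (\<Sum>r<p. Q r l * (lam r ^ k * Q r i)) * (\<Sum>s<p. Q s l * (lam s * Q s j)))"
    using Suc by (intro sum.cong refl) (simp add: Sigma_eq mult_ac)
  also have "\<dots> = (\<Sum>r<p. (lam r ^ k * Q r i) * (lam r * Q r j))" by (rule orth_dot)
  finally show ?case by (simp add: mult_ac)
qed

lemma mat_tr_pow: "mat_tr (\<Sigma> ^\<^sub>m k) = (\<Sum>r<p. lam r ^ k)"
proof -
  have "mat_tr (\<Sigma> ^\<^sub>m k) = (\<Sum>i<p. \<Sum>r<p. lam r ^ k * Q r i * Q r i)"
    using mat_pow_eq carr pow_carrier_mat[OF carr, of k] by (auto simp: mat_tr_def)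
  also have "\<dots> = (\<Sum>r<p. lam r ^ k * (\<Sum>i<p. Q r i * Q r i))"
    by (subst sum.swap) (simp add: sum_distrib_left mult.assoc)
  also have "\<dots> = (\<Sum>r<p. lam r ^ k)" using orth by (intro sum.cong refl) (auto simp: orth_on_def)
  finally show ?thesis .
qed

end

lemma pos_def_whitening:
  assumes "pos_def p \<Sigma>"
  obtains Q lam where "whitening p \<Sigma> Q lam"
proof -
  have carr: "\<Sigma> \<in> carrier_mat p p" and sym: "transpose_mat \<Sigma> = \<Sigma>"
    and pos: "\<And>v. v \<in> carrier_vec p \<Longrightarrow> v \<noteq> 0\<^sub>v p \<Longrightarrow> 0 < quad_form \<Sigma> v"
    using assms by (auto simp: pos_def_def)
  have "\<Sigma> $$ (i, j) = \<Sigma> $$ (j, i)" if "i < p" "j < p" for i j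
    using that carr by (subst sym[symmetric]) auto
  from symmetric_eigenbasis[of p "\<lambda>i j. \<Sigma> $$ (i, j)", OF this]
  obtain Q lam where Q: "orth_on {..<p} Q"
    "\<And>r k. r < p \<Longrightarrow> k < p \<Longrightarrow> (\<Sum>l<p. \<Sigma> $$ (k, l) * Q r l) = lam r * Q r k" by blast
  have "lam r > 0" if r: "r < p" for r
  proof -
    define v where "v = vec p (Q r)"
    have n: "(\<Sum>k<p. Q r k * Q r k) = 1" using Q(1) r by (auto simp: orth_on_def)
    have "v \<noteq> 0\<^sub>v p"
    proof
      assume "v = 0\<^sub>v p"
      then have "Q r k = 0" if "k < p" for k using that unfolding v_def by (metis index_vec index_zero_vec(1))
      then show False using n by simp
    qed
    then have "0 < quad_form \<Sigma> v" by (intro pos) (auto simp: v_def)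
    also have "quad_form \<Sigma> v = (\<Sum>k<p. Q r k * (\<Sum>l<p. \<Sigma> $$ (k, l) * Q r l))"
      using carr by (simp add: quad_form_def v_def scalar_prod_def lessThan_atLeast0)
    also have "\<dots> = lam r * (\<Sum>k<p. Q r k * Q r k)"
      using Q(2) r by (simp add: sum_distrib_left mult_ac)
    finally show ?thesis using n by simp
  qed
  then show ?thesis using Q carr by (intro that[of Q lam]) (auto simp: whitening_def)
qed

section \<open>The sample in rotated Gaussian coordinates\<close>

text \<open>The orthogonal matrix R acts on the observation index; its last column is constant, so that row n of
  the rotated array is the scaled sample mean and the other rows are residuals.\<close>

locale gaussian_sample = whitening +
  fixes n :: nat and \<mu> \<mu>0 :: "real vec" and R :: "nat \<Rightarrow> nat \<Rightarrow> real"
  assumes n_pos: "0 < n"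
    and mu_carrier: "\<mu> \<in> carrier_vec p" "\<mu>0 \<in> carrier_vec p"
    and R_orth: "orth_on {..<Suc n} R"
    and R_mean: "\<And>l. l < Suc n \<Longrightarrow> (\<Sum>i<Suc n. R i l) = sqrt (real (Suc n)) * of_bool (l = n)"
begin

definition sqN :: real where "sqN = sqrt (real (Suc n))"

text \<open>The whitened mean difference.\<close>

definition shift :: "nat \<Rightarrow> real" where
  "shift r = (\<Sum>l<p. root_inv l r * (\<mu> $ l - \<mu>0 $ l))"

definition rot :: "(nat \<times> nat \<Rightarrow> real) \<Rightarrow> nat \<Rightarrow> nat \<Rightarrow> real" where
  "rot h i r = (\<Sum>l<Suc n. R i l * h (l, r))"

text \<open>The sample as a function of the Gaussian array; observations are numbered from 1, rows from 0.\<close>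

definition obs :: "(nat \<times> nat \<Rightarrow> real) \<Rightarrow> nat \<Rightarrow> real vec" where
  "obs h i = vec p (\<lambda>j. \<mu> $ j + (\<Sum>r<p. root j r * rot h (i - 1) r))"

definition zvec :: "(nat \<times> nat \<Rightarrow> real) \<Rightarrow> nat \<Rightarrow> real" where
  "zvec h r = sqN * shift r + h (n, r)"

text \<open>The residual rows in the original coordinates; for i < n their second moments make up the sample
  covariance matrix.\<close>

definition Y :: "(nat \<times> nat \<Rightarrow> real) \<Rightarrow> nat \<Rightarrow> nat \<Rightarrow> real" where
  "Y h i j = (\<Sum>r<p. root j r * h (i, r))"

lemma sqN_pos: "sqN > 0" "sqN * sqN = real (Suc n)"
  by (simp_all add: sqN_def)

lemma delta_eq: "j < p \<Longrightarrow> (\<Sum>r<p. root j r * shift r) = \<mu> $ j - \<mu>0 $ j"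
  unfolding shift_def by (rule root_inv_right)

lemma vec_delta: "\<mu> - \<mu>0 = vec p (\<lambda>j. \<Sum>r<p. root j r * shift r)"
  using mu_carrier by (auto simp: delta_eq)

lemma Delta_sq_eq: "Delta_sq \<mu> \<mu>0 \<Sigma> = (\<Sum>r<p. (shift r)\<^sup>2)"
  unfolding Delta_sq_def vec_delta by (rule quad_form_Sigma_inv)

lemma Delta_I_sq_eq: "Delta_I_sq \<mu> \<mu>0 = (\<Sum>r<p. lam r * (shift r)\<^sup>2)"
proof -
  have "Delta_I_sq \<mu> \<mu>0 = (\<Sum>j<p. (\<Sum>r<p. root j r * shift r) * (\<Sum>r<p. root j r * shift r))"
    unfolding Delta_I_sq_def vec_delta by (simp add: scalar_prod_def lessThan_atLeast0)
  then show ?thesis by (simp add: root_dot power2_eq_square mult.assoc)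
qed

lemma Delta_Sigma_sq_eq: "Delta_Sigma_sq \<mu> \<mu>0 \<Sigma> = (\<Sum>r<p. (lam r * shift r)\<^sup>2)"
proof -
  have eq: "(\<Sum>r<p. root j r * shift r) = (\<Sum>r<p. root_inv j r * (lam r * shift r))" for j
  proof (intro sum.cong refl)
    fix r assume "r \<in> {..<p}"
    then have "lam r / sqrt (lam r) = sqrt (lam r)" using lam_pos[of r] by (simp add: real_div_sqrt)
    then have "root_inv j r * (lam r * shift r) = sqrt (lam r) * (Q r j * shift r)"
      unfolding root_inv_def by (metis (no_types, opaque_lifting) mult.assoc mult.commute times_divide_eq_left)
    then show "root j r * shift r = root_inv j r * (lam r * shift r)" by (auto simp: root_def)
  qed
  have "Delta_Sigma_sq \<mu> \<mu>0 \<Sigma> = (\<Sum>j<p. (\<Sum>r<p. root j r * shift r) *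
      (\<Sum>l<p. \<Sigma> $$ (j, l) * (\<Sum>r<p. root l r * shift r)))"
    unfolding Delta_Sigma_sq_def vec_delta quad_form_def using carr
    by (simp add: scalar_prod_def lessThan_atLeast0)
  also have "\<dots> = (\<Sum>j<p. (\<Sum>r<p. root j r * shift r) *
      (\<Sum>l<p. \<Sigma> $$ (j, l) * (\<Sum>r<p. root_inv l r * (lam r * shift r))))"
    by (intro sum.cong refl arg_cong2[where f="(*)"] eq)
  also have "\<dots> = (\<Sum>j<p. (\<Sum>r<p. root j r * shift r) * (\<Sum>r<p. root j r * (lam r * shift r)))"
    by (intro sum.cong refl) (simp add: Sigma_root_inv)
  also have "\<dots> = (\<Sum>r<p. (lam r * shift r)\<^sup>2)"
    unfolding root_dot by (simp add: power2_eq_square mult_ac)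
  finally show ?thesis .
qed

lemma rot_sum: "(\<Sum>i<Suc n. rot h i r) = sqN * h (n, r)"
proof -
  have "(\<Sum>i<Suc n. rot h i r) = (\<Sum>l<Suc n. \<Sum>i<Suc n. R i l * h (l, r))"
    unfolding rot_def by (rule sum.swap)
  also have "\<dots> = (\<Sum>l<Suc n. of_bool (l = n) * (sqN * h (l, r)))"
    by (intro sum.cong refl, subst sum_distrib_right[symmetric], subst R_mean) (auto simp: sqN_def)
  also have "\<dots> = sqN * h (n, r)" by (rule sum_of_bool_mult) auto
  finally show ?thesis .
qed

lemma rot_cov:
  "(\<Sum>i<Suc n. (rot h i r - h (n, r) / sqN) * (rot h i s - h (n, s) / sqN)) = (\<Sum>i<n. h (i, r) * h (i, s))"
proof -
  have "(\<Sum>i<Suc n. (rot h i r - h (n, r) / sqN) * (rot h i s - h (n, s) / sqN)) =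
    (\<Sum>i<Suc n. rot h i r * rot h i s) - h (n, r) / sqN * (\<Sum>i<Suc n. rot h i s)
      - h (n, s) / sqN * (\<Sum>i<Suc n. rot h i r) + real (Suc n) * (h (n, r) / sqN * (h (n, s) / sqN))"
    by (simp add: algebra_simps sum.distrib sum_subtractf sum_distrib_left del: sum.lessThan_Suc)
  also have "h (n, r) / sqN * (\<Sum>i<Suc n. rot h i s) = h (n, r) * h (n, s)"
    unfolding rot_sum using sqN_pos by simp
  also have "h (n, s) / sqN * (\<Sum>i<Suc n. rot h i r) = h (n, r) * h (n, s)"
    unfolding rot_sum using sqN_pos by simp
  also have "real (Suc n) * (h (n, r) / sqN * (h (n, s) / sqN)) = h (n, r) * h (n, s)"
    unfolding sqN_pos(2)[symmetric] using sqN_pos(1) by (simp add: field_simps)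
  also have "(\<Sum>i<Suc n. rot h i r * rot h i s) = (\<Sum>l<Suc n. h (l, r) * h (l, s))"
    unfolding rot_def by (rule orth_on_norm[OF finite_lessThan R_orth])
  finally show ?thesis by simp
qed

lemma sample_mean_obs:
  "j < p \<Longrightarrow> sample_mean (Suc n) p (obs h) $ j = \<mu> $ j + (\<Sum>r<p. root j r * (h (n, r) / sqN))"
proof -
  assume j: "j < p"
  have "(\<Sum>i=1..Suc n. obs h i $ j) = (\<Sum>i<Suc n. \<mu> $ j + (\<Sum>r<p. root j r * rot h i r))"
    using j unfolding One_nat_def by (subst sum.atLeast1_atMost_eq) (simp add: obs_def del: sum.lessThan_Suc)
  also have "\<dots> = real (Suc n) * \<mu> $ j + (\<Sum>r<p. root j r * (\<Sum>i<Suc n. rot h i r))"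
    unfolding sum.distrib sum_distrib_left by (subst sum.swap) simp
  also have "\<dots> / real (Suc n) = \<mu> $ j + (\<Sum>r<p. root j r * (h (n, r) / sqN))"
  proof -
    have "(\<Sum>r<p. root j r * (sqN * h (n, r))) / real (Suc n) = (\<Sum>r<p. root j r * (h (n, r) / sqN))"
      unfolding sum_divide_distrib sqN_pos(2)[symmetric] using sqN_pos(1)
      by (intro sum.cong refl) (simp add: field_simps)
    then show ?thesis unfolding rot_sum add_divide_distrib by simp
  qed
  finally show ?thesis using j by (simp add: sample_mean_def)
qed

lemma sample_cov_obs:
  assumes jl: "j < p" "l < p"
  shows "sample_cov (Suc n) p (obs h) $$ (j, l) = (\<Sum>i<n. Y h i j * Y h i l) / real n"
proof -
  define d where "d i r = rot h i r - h (n, r) / sqN" for i r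
  have dv: "dim_vec (sample_mean (Suc n) p (obs h)) = p" by (simp add: sample_mean_def)
  have diff: "(obs h (Suc i) - sample_mean (Suc n) p (obs h)) $ j = (\<Sum>r<p. root j r * d i r)" if "j < p" for i j
    using that dv by (simp add: sample_mean_obs obs_def d_def algebra_simps sum_subtractf)
  have "(\<Sum>i=1..Suc n. (obs h i - sample_mean (Suc n) p (obs h)) $ j * (obs h i - sample_mean (Suc n) p (obs h)) $ l) =
     (\<Sum>i<Suc n. (\<Sum>r<p. root j r * d i r) * (\<Sum>s<p. root l s * d i s))"
    unfolding One_nat_def sum.atLeast1_atMost_eq diff[OF jl(1)] diff[OF jl(2)] ..
  also have "\<dots> = (\<Sum>r<p. \<Sum>s<p. root j r * root l s * (\<Sum>i<Suc n. d i r * d i s))"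
    by (rule sum_bilinear_swap)
  also have "\<dots> = (\<Sum>r<p. \<Sum>s<p. root j r * root l s * (\<Sum>i<n. h (i, r) * h (i, s)))"
    unfolding d_def rot_cov ..
  also have "\<dots> = (\<Sum>i<n. Y h i j * Y h i l)"
    unfolding Y_def by (rule sum_bilinear_swap[symmetric])
  finally show ?thesis using jl by (simp add: sample_cov_def del: sum.atLeast1_atMost_eq)
qed

lemma Y_dot: "(\<Sum>j<p. Y h i j * Y h k j) = row_inner p lam h i k"
  unfolding Y_def root_dot row_inner_def ..

lemma sample_cov_obs_carrier: "sample_cov (Suc n) p (obs h) \<in> carrier_mat p p"
  by (simp add: sample_cov_def)

lemma mat_tr_sample_cov: "mat_tr (sample_cov (Suc n) p (obs h)) = (\<Sum>i<n. row_inner p lam h i i) / real n"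
proof -
  have "mat_tr (sample_cov (Suc n) p (obs h)) = (\<Sum>j<p. (\<Sum>i<n. Y h i j * Y h i j) / real n)"
    using sample_cov_obs_carrier[of h] by (auto simp: mat_tr_def sample_cov_obs)
  also have "\<dots> = (\<Sum>i<n. \<Sum>j<p. Y h i j * Y h i j) / real n"
    by (subst sum_divide_distrib[symmetric], subst sum.swap) simp
  finally show ?thesis by (simp add: Y_dot)
qed

lemma mat_tr_sample_cov_square:
  "mat_tr (sample_cov (Suc n) p (obs h) ^\<^sub>m 2) = (\<Sum>i<n. \<Sum>k<n. (row_inner p lam h i k)\<^sup>2) / (real n)\<^sup>2"
proof -
  have "(\<Sum>j<p. \<Sum>l<p. (\<Sum>i<n. Y h i j * Y h i l) * (\<Sum>k<n. Y h k j * Y h k l)) =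
     (\<Sum>j<p. \<Sum>i<n. \<Sum>k<n. Y h i j * Y h k j * (\<Sum>l<p. Y h i l * Y h k l))"
    by (intro sum.cong refl sum_bilinear_swap)
  also have "\<dots> = (\<Sum>i<n. \<Sum>k<n. \<Sum>j<p. Y h i j * Y h k j * row_inner p lam h i k)"
    unfolding Y_dot by (subst sum.swap, rule sum.cong[OF refl], subst sum.swap) simp
  also have "\<dots> = (\<Sum>i<n. \<Sum>k<n. (row_inner p lam h i k)\<^sup>2)"
    unfolding sum_distrib_right[symmetric] Y_dot by (simp add: power2_eq_square)
  finally have eq: "(\<Sum>j<p. \<Sum>l<p. (\<Sum>i<n. Y h i j * Y h i l) * (\<Sum>k<n. Y h k j * Y h k l)) =
     (\<Sum>i<n. \<Sum>k<n. (row_inner p lam h i k)\<^sup>2)" .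
  have "mat_tr (sample_cov (Suc n) p (obs h) ^\<^sub>m 2) =
     (\<Sum>j<p. \<Sum>l<p. ((\<Sum>i<n. Y h i j * Y h i l) * (\<Sum>k<n. Y h k j * Y h k l)) / (real n)\<^sup>2)"
    unfolding mat_tr_square[OF sample_cov_obs_carrier]
    by (intro sum.cong refl) (simp add: sample_cov_obs power2_eq_square mult.commute)
  then show ?thesis unfolding sum_divide_distrib[symmetric] eq .
qed

lemma mean_diff: "sample_mean (Suc n) p (obs h) - \<mu>0 = vec p (\<lambda>j. \<Sum>r<p. root j r * (zvec h r / sqN))"
proof (rule eq_vecI)
  fix j assume "j < dim_vec (vec p (\<lambda>j. \<Sum>r<p. root j r * (zvec h r / sqN)))"
  then have j: "j < p" by simp
  have "(sample_mean (Suc n) p (obs h) - \<mu>0) $ j = (\<mu> $ j - \<mu>0 $ j) + (\<Sum>r<p. root j r * (h (n, r) / sqN))"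
    using j mu_carrier by (simp add: sample_mean_obs)
  also have "\<dots> = (\<Sum>r<p. root j r * (zvec h r / sqN))"
    unfolding delta_eq[OF j, symmetric] sum.distrib[symmetric] using sqN_pos(1)
    by (intro sum.cong refl) (simp add: zvec_def field_simps)
  finally show "(sample_mean (Suc n) p (obs h) - \<mu>0) $ j = vec p (\<lambda>j. \<Sum>r<p. root j r * (zvec h r / sqN)) $ j"
    using j by simp
qed (use mu_carrier in auto)

lemma mean_diff_sq:
  "real (Suc n) * ((sample_mean (Suc n) p (obs h) - \<mu>0) \<bullet> (sample_mean (Suc n) p (obs h) - \<mu>0)) =
    (\<Sum>r<p. lam r * (zvec h r)\<^sup>2)"
proof -
  have "(sample_mean (Suc n) p (obs h) - \<mu>0) \<bullet> (sample_mean (Suc n) p (obs h) - \<mu>0) =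
     (\<Sum>j<p. (\<Sum>r<p. root j r * (zvec h r / sqN)) * (\<Sum>r<p. root j r * (zvec h r / sqN)))"
    unfolding mean_diff by (simp add: scalar_prod_def lessThan_atLeast0)
  also have "\<dots> = (\<Sum>r<p. lam r * (zvec h r)\<^sup>2 / real (Suc n))"
    unfolding root_dot sqN_pos(2)[symmetric] by (intro sum.cong refl) (simp add: power2_eq_square)
  also have "\<dots> = (\<Sum>r<p. lam r * (zvec h r)\<^sup>2) / real (Suc n)" by (simp add: sum_divide_distrib)
  finally show ?thesis by simp
qed

text \<open>The square root of \<open>\<Sigma>\<close> cancels: Hotelling's statistic is invariant under linear
  maps.\<close>

lemma hotelling_obs:
  assumes ind: "indep_cols n p h"
  shows "hotelling_T2 (Suc n) p \<mu>0 (obs h) = real n * quad_form (mat_inv (gram n p h)) (vec p (zvec h))"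
proof -
  define S where "S = sample_cov (Suc n) p (obs h)"
  have S: "S \<in> carrier_mat p p" "\<And>j l. j < p \<Longrightarrow> l < p \<Longrightarrow> S $$ (j, l) = (\<Sum>i<n. Y h i j * Y h i l) / real n"
    by (auto simp: S_def sample_cov_obs sample_cov_obs_carrier)
  have Sv: "(\<Sum>l<p. S $$ (j, l) * v l) = (\<Sum>i<n. Y h i j * (\<Sum>s<p. h (i, s) * (\<Sum>l<p. root l s * v l))) / real n"
    if j: "j < p" for j v
  proof -
    have "(\<Sum>l<p. Y h i l * v l) = (\<Sum>s<p. h (i, s) * (\<Sum>l<p. root l s * v l))" for i
    proof -
      have "(\<Sum>l<p. Y h i l * v l) = (\<Sum>l<p. \<Sum>s<p. h (i, s) * (root l s * v l))"
        by (simp add: Y_def sum_distrib_right sum_distrib_left mult_ac)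
      then show ?thesis by (subst (asm) sum.swap) (simp add: sum_distrib_left)
    qed
    moreover have "(\<Sum>l<p. S $$ (j, l) * v l) = (\<Sum>i<n. Y h i j * (\<Sum>l<p. Y h i l * v l)) / real n"
    proof -
      have "(\<Sum>l<p. S $$ (j, l) * v l) = (\<Sum>l<p. \<Sum>i<n. Y h i j * (Y h i l * v l) / real n)"
        using S j by (simp add: sum_distrib_right sum_divide_distrib mult.assoc)
      also have "\<dots> = (\<Sum>i<n. \<Sum>l<p. Y h i j * (Y h i l * v l) / real n)" by (rule sum.swap)
      finally show ?thesis by (simp add: sum_distrib_left sum_divide_distrib)
    qed
    ultimately show ?thesis by simp
  qed
  have detS: "det S \<noteq> 0"
  proof
    assume "det S = 0"
    then obtain v where v: "v \<in> carrier_vec p" "v \<noteq> 0\<^sub>v p" "S *\<^sub>v v = 0\<^sub>v p"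
      using det_0_iff_vec_prod_zero[OF S(1)] by blast
    define u where "u s = (\<Sum>l<p. root l s * v $ l)" for s
    have "(\<Sum>l<p. S $$ (j, l) * v $ l) = 0" if "j < p" for j
      using arg_cong[OF v(3), of "\<lambda>w. w $ j"] that v(1) S(1) by (simp add: scalar_prod_def lessThan_atLeast0)
    then have 0: "(\<Sum>i<n. Y h i j * (\<Sum>s<p. h (i, s) * u s)) = 0" if "j < p" for j
      using Sv[OF that, of "($) v"] that n_pos by (simp add: u_def)
    have "(\<Sum>i<n. (\<Sum>s<p. h (i, s) * u s)\<^sup>2) = (\<Sum>i<n. (\<Sum>j<p. v $ j * Y h i j) * (\<Sum>s<p. h (i, s) * u s))"
    proof (intro sum.cong refl)
      fix i
      have "(\<Sum>j<p. v $ j * Y h i j) = (\<Sum>j<p. \<Sum>r<p. h (i, r) * (root j r * v $ j))"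
        by (simp add: Y_def sum_distrib_left mult_ac)
      also have "\<dots> = (\<Sum>r<p. h (i, r) * u r)"
        unfolding u_def by (subst sum.swap) (simp add: sum_distrib_left)
      finally show "(\<Sum>s<p. h (i, s) * u s)\<^sup>2 = (\<Sum>j<p. v $ j * Y h i j) * (\<Sum>s<p. h (i, s) * u s)"
        by (simp add: power2_eq_square)
    qed
    also have "\<dots> = (\<Sum>i<n. \<Sum>j<p. v $ j * (Y h i j * (\<Sum>s<p. h (i, s) * u s)))"
      by (subst sum_distrib_right) (simp add: mult.assoc)
    also have "\<dots> = (\<Sum>j<p. v $ j * (\<Sum>i<n. Y h i j * (\<Sum>s<p. h (i, s) * u s)))"
      by (subst sum.swap) (simp add: sum_distrib_left)
    also have "\<dots> = 0" using 0 by simp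
    finally have "\<forall>i<n. (\<Sum>s<p. h (i, s) * u s) = 0" by (subst (asm) sum_nonneg_eq_0_iff) auto
    then have u0: "\<forall>s<p. u s = 0" using ind by (auto simp: indep_cols_def)
    have "v $ j = 0" if j: "j < p" for j
    proof -
      define L where "L r = (\<Sum>l<p. root_inv l r * v $ l)" for r
      have "(\<Sum>k<p. v $ k * v $ k) = (\<Sum>k<p. (\<Sum>r<p. root k r * L r) * v $ k)"
        by (intro sum.cong refl) (simp add: root_inv_right L_def)
      also have "\<dots> = (\<Sum>k<p. \<Sum>r<p. L r * (root k r * v $ k))"
        by (simp add: sum_distrib_right sum_distrib_left mult_ac)
      also have "\<dots> = (\<Sum>r<p. L r * u r)"
        unfolding u_def by (subst sum.swap) (simp add: sum_distrib_left)
      also have "\<dots> = 0" using u0 by simp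
      finally show ?thesis using j by (subst (asm) sum_nonneg_eq_0_iff) auto
    qed
    then have "v = 0\<^sub>v p" using v(1) by (intro eq_vecI) auto
    then show False using v(2) by simp
  qed
  obtain b where b: "\<And>j. j < p \<Longrightarrow> (\<Sum>i<n. h (i, j) * (\<Sum>l<p. h (i, l) * b l)) = zvec h j"
    using gram_solvable[OF ind] by blast
  define w where "w l = real n / sqN * (\<Sum>s<p. root_inv l s * b s)" for l
  have rw: "(\<Sum>l<p. root l s * w l) = real n / sqN * b s" if "s < p" for s
  proof -
    have "(\<Sum>l<p. root l s * w l) = real n / sqN * (\<Sum>l<p. root l s * (\<Sum>s<p. root_inv l s * b s))"
      unfolding w_def by (simp only: sum_distrib_left mult.left_commute)
    then show ?thesis by (simp add: root_inv_left[OF that])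
  qed
  have "S *\<^sub>v vec p w = sample_mean (Suc n) p (obs h) - \<mu>0"
    unfolding mean_diff
  proof (rule eq_vecI)
    fix j assume "j < dim_vec (vec p (\<lambda>j. \<Sum>r<p. root j r * (zvec h r / sqN)))"
    then have j: "j < p" by simp
    have "(S *\<^sub>v vec p w) $ j = (\<Sum>l<p. S $$ (j, l) * w l)"
      using j S(1) by (simp add: scalar_prod_def lessThan_atLeast0)
    also have "\<dots> = (\<Sum>i<n. Y h i j * (\<Sum>s<p. h (i, s) * (real n / sqN * b s))) / real n"
      unfolding Sv[OF j] by (intro arg_cong2[where f="(/)"] sum.cong refl arg_cong2[where f="(*)"]) (auto simp: rw)
    also have "\<dots> = (\<Sum>i<n. Y h i j * (\<Sum>s<p. h (i, s) * b s)) / sqN"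
    proof -
      have "(\<Sum>s<p. h (i, s) * (real n / sqN * b s)) = real n / sqN * (\<Sum>s<p. h (i, s) * b s)" for i
        by (simp only: sum_distrib_left mult.left_commute)
      then have "(\<Sum>i<n. Y h i j * (\<Sum>s<p. h (i, s) * (real n / sqN * b s))) =
         real n / sqN * (\<Sum>i<n. Y h i j * (\<Sum>s<p. h (i, s) * b s))"
        by (simp only: sum_distrib_left mult.left_commute)
      then show ?thesis using n_pos by simp
    qed
    also have "(\<Sum>i<n. Y h i j * (\<Sum>s<p. h (i, s) * b s)) = (\<Sum>i<n. \<Sum>r<p. root j r * (h (i, r) * (\<Sum>s<p. h (i, s) * b s)))"
      by (simp add: Y_def sum_distrib_right mult.assoc)
    also have "\<dots> = (\<Sum>r<p. root j r * (\<Sum>i<n. h (i, r) * (\<Sum>s<p. h (i, s) * b s)))"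
      by (subst sum.swap) (simp add: sum_distrib_left)
    also have "\<dots> = (\<Sum>r<p. root j r * zvec h r)" by (intro sum.cong refl) (simp add: b)
    finally show "(S *\<^sub>v vec p w) $ j = vec p (\<lambda>j. \<Sum>r<p. root j r * (zvec h r / sqN)) $ j"
      using j by (simp add: sum_divide_distrib)
  qed (use S in auto)
  then have "quad_form (mat_inv S) (sample_mean (Suc n) p (obs h) - \<mu>0) =
     (sample_mean (Suc n) p (obs h) - \<mu>0) \<bullet> vec p w"
    by (intro quad_form_mat_inv_solve[OF S(1) detS]) auto
  also have "\<dots> = (\<Sum>j<p. (\<Sum>r<p. root j r * (zvec h r / sqN)) * (\<Sum>s<p. root_inv j s * (real n / sqN * b s)))"
  proof -
    have w2: "w l = (\<Sum>s<p. root_inv l s * (real n / sqN * b s))" for l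
      by (simp only: w_def sum_distrib_left mult.left_commute)
    have "vec p f \<bullet> vec p w = (\<Sum>j<p. f j * w j)" for f
      by (simp add: scalar_prod_def lessThan_atLeast0)
    then show ?thesis unfolding mean_diff by (simp only: w2)
  qed
  also have "\<dots> = (\<Sum>r<p. (zvec h r / sqN) * (real n / sqN * b r))" by (rule root_inv_dot)
  also have "\<dots> = (\<Sum>r<p. zvec h r * b r) * (real n / real (Suc n))"
    unfolding sum_distrib_right sqN_pos(2)[symmetric] by (intro sum.cong refl) (simp add: mult_ac)
  finally have q: "quad_form (mat_inv S) (sample_mean (Suc n) p (obs h) - \<mu>0) =
     (\<Sum>r<p. zvec h r * b r) * (real n / real (Suc n))" .
  have "hotelling_T2 (Suc n) p \<mu>0 (obs h) = real n * (\<Sum>r<p. zvec h r * b r)"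
    unfolding hotelling_T2_def S_def[symmetric] q by simp
  also have "(\<Sum>r<p. zvec h r * b r) = quad_form (mat_inv (gram n p h)) (vec p (zvec h))"
    by (rule quad_form_gram_solve[OF ind b, symmetric])
  finally show ?thesis .
qed

end

section \<open>Transfer from the data to Gaussian coordinates\<close>

lemma orth_on_left_factor_prod:
  assumes "finite I" "finite J" "orth_on I R"
  shows "orth_on (I \<times> J) (\<lambda>a b. R (fst a) (fst b) * of_bool (snd a = snd b))"
proof -
  have 1: "(\<Sum>k\<in>I \<times> J. F (fst k) * of_bool (j = snd k) * (F' (fst k) * of_bool (j' = snd k))) =
     of_bool (j = j') * (\<Sum>l\<in>I. F l * F' l)" if "j \<in> J" for j j' and F F' :: "'a \<Rightarrow> real"
  proof -
    have "(\<Sum>k\<in>I \<times> J. F (fst k) * of_bool (j = snd k) * (F' (fst k) * of_bool (j' = snd k))) =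
       (\<Sum>l\<in>I. \<Sum>k\<in>J. of_bool (j = k) * (of_bool (j' = k) * (F l * F' l)))"
      by (simp add: sum.cartesian_product' mult_ac)
    also have "\<dots> = (\<Sum>l\<in>I. of_bool (j' = j) * (F l * F' l))"
      by (intro sum.cong refl sum_of_bool_mult(1)[OF assms(2) that])
    finally show ?thesis by (cases "j = j'") simp_all
  qed
  have 2: "(\<Sum>k\<in>I \<times> J. F (fst k) * of_bool (snd k = j) * (F' (fst k) * of_bool (snd k = j'))) =
     of_bool (j = j') * (\<Sum>l\<in>I. F l * F' l)" if "j \<in> J" for j j' and F F' :: "'a \<Rightarrow> real"
    unfolding 1[OF that, symmetric] by (intro sum.cong) auto
  show ?thesis unfolding orth_on_def
  proof (intro conjI ballI)
    fix a b assume "a \<in> I \<times> J" "b \<in> I \<times> J"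
    then have ab: "snd a \<in> J" "fst a \<in> I" "fst b \<in> I" by auto
    have eq: "(of_bool (a = b) :: real) = of_bool (snd a = snd b) * of_bool (fst a = fst b)"
      by (auto simp: prod_eq_iff)
    show "(\<Sum>k\<in>I \<times> J. R (fst a) (fst k) * of_bool (snd a = snd k) * (R (fst b) (fst k) * of_bool (snd b = snd k))) = of_bool (a = b)"
      unfolding 1[OF ab(1)] eq using assms(3) ab by (simp add: orth_on_def)
    show "(\<Sum>k\<in>I \<times> J. R (fst k) (fst a) * of_bool (snd k = snd a) * (R (fst k) (fst b) * of_bool (snd k = snd b))) = of_bool (a = b)"
      unfolding 2[OF ab(1), where F="\<lambda>l. R l (fst a)" and j'="snd b" and F'="\<lambda>l. R l (fst b)"] eq using assms(3) ab by (simp add: orth_on_def)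
  qed
qed

lemma measurable_entry:
  "i \<in> A \<Longrightarrow> j \<in> B \<Longrightarrow> (\<lambda>r. r i j) \<in> (\<Pi>\<^sub>M i\<in>A. \<Pi>\<^sub>M j\<in>B. S) \<rightarrow>\<^sub>M S"
  by (rule measurable_compose[where f="\<lambda>r. r i" and g="\<lambda>x. x j" and N="\<Pi>\<^sub>M j\<in>B. S"]) auto

lemma distr_gauss_rows:
  fixes p N :: nat
  shows "distr (\<Pi>\<^sub>M i\<in>{1..N}. gauss {..<p}) (gauss ({..<N} \<times> {..<p})) (\<lambda>r. \<lambda>a\<in>{..<N} \<times> {..<p}. r (Suc (fst a)) (snd a))
     = gauss ({..<N} \<times> {..<p})"
proof -
  let ?I = "{..<N} \<times> {..<p}" and ?P = "\<Pi>\<^sub>M i\<in>{1..N}. gauss {..<p}"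
  let ?U = "\<lambda>r :: nat \<Rightarrow> nat \<Rightarrow> real. \<lambda>a\<in>?I. r (Suc (fst a)) (snd a)"
  interpret G: product_prob_space "\<lambda>i. gauss {..<p}" "{1..N}"
    using prob_space_gauss by (intro product_prob_spaceI) auto
  have mU: "?U \<in> ?P \<rightarrow>\<^sub>M gauss ?I"
    unfolding gauss_def
    by (intro measurable_restrict measurable_entry) auto
  show ?thesis
    unfolding gauss_def[of ?I]
  proof (rule gauss.PiM_eqI)
    fix A :: "nat \<times> nat \<Rightarrow> real set" assume A: "\<And>i. i \<in> ?I \<Longrightarrow> A i \<in> sets std_normal_distribution"
    have "Pi\<^sub>E ?I A \<in> sets (gauss ?I)" unfolding gauss_def using A by (intro sets_PiM_I_finite) auto
    then have "emeasure (distr ?P (gauss ?I) ?U) (Pi\<^sub>E ?I A) = emeasure ?P (?U -` (Pi\<^sub>E ?I A) \<inter> space ?P)"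
      using mU by (intro emeasure_distr)
    also have "?U -` (Pi\<^sub>E ?I A) \<inter> space ?P = (\<Pi>\<^sub>E i\<in>{1..N}. \<Pi>\<^sub>E j\<in>{..<p}. A (i - 1, j))"
    proof (rule Set.set_eqI, rule iffI)
      fix r assume r: "r \<in> ?U -` (Pi\<^sub>E ?I A) \<inter> space ?P"
      then have r1: "r (Suc i) j \<in> A (i, j)" if "i < N" "j < p" for i j
        using that by (auto simp: PiE_def Pi_def)
      have r2: "r \<in> extensional {1..N}" "\<And>i. i \<in> {1..N} \<Longrightarrow> r i \<in> extensional {..<p}"
        using r by (auto simp: space_PiM PiE_def space_gauss Pi_def)
      have "r i j \<in> A (i - 1, j)" if "i \<in> {1..N}" "j < p" for i j
        using r1[of "i - 1" j] that by auto
      with r2 show "r \<in> (\<Pi>\<^sub>E i\<in>{1..N}. \<Pi>\<^sub>E j\<in>{..<p}. A (i - 1, j))" by (auto simp: PiE_def)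
    next
      fix r assume r: "r \<in> (\<Pi>\<^sub>E i\<in>{1..N}. \<Pi>\<^sub>E j\<in>{..<p}. A (i - 1, j))"
      then have r1: "r i j \<in> A (i - 1, j)" if "i \<in> {1..N}" "j < p" for i j
        using that by (auto simp: PiE_def Pi_def)
      have r2: "r \<in> extensional {1..N}" "\<And>i. i \<in> {1..N} \<Longrightarrow> r i \<in> extensional {..<p}"
        using r by (auto simp: PiE_def Pi_def)
      have "r (Suc i) j \<in> A (i, j)" if "i < N" "j < p" for i j using r1[of "Suc i" j] that by auto
      with r2 show "r \<in> ?U -` (Pi\<^sub>E ?I A) \<inter> space ?P" by (auto simp: space_PiM PiE_def space_gauss)
    qed
    also have "emeasure ?P (\<Pi>\<^sub>E i\<in>{1..N}. \<Pi>\<^sub>E j\<in>{..<p}. A (i - 1, j)) =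
       (\<Prod>i\<in>{1..N}. emeasure (gauss {..<p}) (\<Pi>\<^sub>E j\<in>{..<p}. A (i - 1, j)))"
      using A by (intro G.emeasure_PiM) (auto simp: gauss_def intro!: sets_PiM_I_finite)
    also have "\<dots> = (\<Prod>i\<in>{1..N}. \<Prod>j\<in>{..<p}. emeasure std_normal_distribution (A (i - 1, j)))"
      unfolding gauss_def using A by (intro prod.cong refl gauss.emeasure_PiM) auto
    also have "\<dots> = (\<Prod>i\<in>{..<N}. \<Prod>j\<in>{..<p}. emeasure std_normal_distribution (A (i, j)))"
      by (rule prod.reindex_bij_witness[of _ Suc "\<lambda>i. i - 1"]) auto
    also have "\<dots> = (\<Prod>a\<in>?I. emeasure std_normal_distribution (A a))"
      by (simp add: prod.cartesian_product)
    finally show "emeasure (distr ?P (Pi\<^sub>M ?I (\<lambda>_. std_normal_distribution)) ?U) (Pi\<^sub>E ?I A) =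
       (\<Prod>a\<in>?I. emeasure std_normal_distribution (A a))" by (simp only: gauss_def)
  qed (auto simp: gauss_def)
qed

context gaussian_sample
begin

definition aff :: "(nat \<Rightarrow> real) \<Rightarrow> nat \<Rightarrow> real" where
  "aff x = (\<lambda>j\<in>{..<p}. \<mu> $ j + (\<Sum>r<p. root j r * x r))"

lemma scales_aff: "scales_lborel {..<p} aff"
proof -
  have "\<forall>i\<in>{..<p}. \<forall>l\<in>{..<p}. (\<Sum>j<p. root i j * root_inv l j) = of_bool (i = l)"
  proof (intro ballI)
    fix i l assume "i \<in> {..<p}" "l \<in> {..<p}"
    then have il: "i < p" "l < p" by auto
    have "(\<Sum>j<p. root i j * root_inv l j) = (\<Sum>j<p. root i j * (\<Sum>k<p. root_inv k j * of_bool (k = l)))"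
      using il by (intro sum.cong refl) (simp add: sum_of_bool_mult(4))
    then show "(\<Sum>j<p. root i j * root_inv l j) = of_bool (i = l)"
      using root_inv_right[OF il(1), of "\<lambda>k. of_bool (k = l)"] by simp
  qed
  from scales_lborel_affine[OF finite_lessThan this, of "\<lambda>j. \<mu> $ j"]
  show ?thesis by (simp add: aff_def[abs_def])
qed

lemma aff_measurable: "aff \<in> gauss {..<p} \<rightarrow>\<^sub>M lborel_on {..<p}"
  using scales_aff unfolding scales_lborel_def lborel_on_def[symmetric]
  by (simp add: measurable_cong_sets[OF sets_gauss sets_lborel_on] measurable_cong_sets[OF sets_lborel_on sets_lborel_on])

text \<open>The multivariate normal density composed with \<open>aff\<close> is proportional to the standard Gaussian
  one. Its normalizing constant is never evaluated.\<close>

lemma distr_aff_mvn: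
  assumes M: "prob_space M" and X: "mvn_distributed M p \<mu> \<Sigma> X"
  shows "distr (gauss {..<p}) (lborel_on {..<p}) aff = distr M (lborel_on {..<p}) X"
proof -
  let ?L = "lborel_on {..<p}"
  define D where "D x = mvn_density p \<mu> \<Sigma> (vec p x)" for x
  have dist: "distributed M ?L X (\<lambda>x. ennreal (D x))"
    using X by (simp add: mvn_distributed_def lborel_on_def D_def)
  note d = distributed_distr_eq_density[OF dist] distributed_measurable[OF dist] distributed_borel_measurable[OF dist]
  interpret M: prob_space M by fact
  have "emeasure (density ?L (\<lambda>x. ennreal (D x))) (space ?L) = 1"
    unfolding d(1)[symmetric] using d(2) by (subst emeasure_distr) (auto intro: M.emeasure_space_1 simp: measurable_space Int_absorb1 vimage_def subset_eq)
  then have int: "(\<integral>\<^sup>+x. ennreal (D x) \<partial>?L) = 1"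
    using d(3) by (subst (asm) emeasure_density) (auto cong: nn_integral_cong)
  define K where "K = 1 / sqrt ((2 * pi) ^ p * det \<Sigma>)"
  define G where "G = (1 / sqrt (2 * pi)) ^ p"
  have G: "G > 0" by (simp add: G_def)
  have Daff: "D (aff x) = (K / G) * gauss_density {..<p} x" for x
  proof -
    have "vec p (aff x) - \<mu> = vec p (\<lambda>j. \<Sum>r<p. root j r * x r)"
      using mu_carrier by (auto simp: aff_def)
    then have "D (aff x) = K * exp (- (\<Sum>r<p. (x r)\<^sup>2) / 2)"
      unfolding D_def mvn_density_def K_def by (simp add: quad_form_Sigma_inv)
    then show ?thesis using G by (simp add: gauss_density_def G_def)
  qed
  have mD: "D \<in> borel_measurable (\<Pi>\<^sub>M j\<in>{..<p}. (borel :: real measure))"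
  proof -
    have y: "vec p x - \<mu> = vec p (\<lambda>j. x j - \<mu> $ j)" for x using mu_carrier by auto
    have "(\<lambda>x. quad_form (mat_inv \<Sigma>) (vec p x - \<mu>)) \<in> borel_measurable (\<Pi>\<^sub>M j\<in>{..<p}. (borel :: real measure))"
      unfolding y using carr
      by (intro quad_form_mat_inv_measurable[of "\<lambda>_. \<Sigma>" p] vec_index_measurable borel_measurable_diff measurable_component_singleton) auto
    then show ?thesis unfolding D_def[abs_def] mvn_density_def by measurable
  qed
  \<comment> \<open>Positivity follows from the integral being one, without a sign of the determinant.\<close>
  have KG: "K / G > 0"
  proof (rule ccontr)
    assume "\<not> K / G > 0"
    then have "D (aff x) \<le> 0" for x
      unfolding Daff using gauss_density_pos[of "{..<p}" x] mult_nonpos_nonneg[of "K / G" "gauss_density {..<p} x"]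
      by linarith
    then have "(\<integral>\<^sup>+x. ennreal (D (aff x)) \<partial>?L) = 0" by (simp add: ennreal_neg)
    moreover obtain C where "C > 0" and C: "\<And>f. f \<in> borel_measurable ?L \<Longrightarrow> (\<integral>\<^sup>+x. f (aff x) \<partial>?L) = ennreal C * (\<integral>\<^sup>+x. f x \<partial>?L)"
      using scales_aff unfolding scales_lborel_def by blast
    ultimately show False using int C[OF d(3)] by simp
  qed
  have "distr (gauss {..<p}) ?L aff = density ?L (\<lambda>x. ennreal (D x))"
    by (rule distr_gauss_scaling[OF finite_lessThan scales_aff mD int KG Daff])
  then show ?thesis by (simp add: d(1))
qed

text \<open>Independence makes the joint law of the data a product of normal laws; each is the image of a
  standard Gaussian row, and the rotation R of the rows leaves their joint law invariant.\<close>

theorem nn_integral_data: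
  assumes M: "prob_space M"
    and indep: "prob_space.indep_vars M (\<lambda>_. lborel_vec p) X {1..Suc n}"
    and normal: "\<And>i. i \<in> {1..Suc n} \<Longrightarrow> mvn_distributed M p \<mu> \<Sigma> (X i)"
    and cong: "\<And>x x'. (\<And>i. i \<in> {1..Suc n} \<Longrightarrow> x i = x' i) \<Longrightarrow> F x = F x'"
    and F: "(\<lambda>u. F (\<lambda>i. vec p (u i))) \<in> borel_measurable (\<Pi>\<^sub>M i\<in>{1..Suc n}. lborel_on {..<p})"
  shows "(\<integral>\<^sup>+\<omega>. F (\<lambda>i. vec p (X i \<omega>)) \<partial>M) = (\<integral>\<^sup>+h. F (obs h) \<partial>gauss ({..<Suc n} \<times> {..<p}))"
proof -
  interpret M: prob_space M by fact
  let ?L = "lborel_on {..<p}" and ?J = "{1..Suc n}" and ?I = "{..<Suc n} \<times> {..<p}"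
  let ?PL = "\<Pi>\<^sub>M i\<in>?J. ?L"
  let ?nu = "distr (gauss {..<p}) ?L aff"
  define H where "H u = F (\<lambda>i. vec p (u i))" for u
  have H[measurable]: "H \<in> borel_measurable ?PL" using F by (simp add: H_def[abs_def])
  have Hcong: "H u = H u'" if "\<And>i j. i \<in> ?J \<Longrightarrow> j < p \<Longrightarrow> u i j = u' i j" for u u'
    unfolding H_def using that by (intro cong) auto
  have Xm: "X i \<in> M \<rightarrow>\<^sub>M ?L" if "i \<in> ?J" for i
    using normal[OF that] unfolding mvn_distributed_def lborel_on_def by (rule distributed_measurable)
  have Xr: "(\<lambda>\<omega>. \<lambda>i\<in>?J. X i \<omega>) \<in> M \<rightarrow>\<^sub>M ?PL" using Xm by (intro measurable_restrict)
  have "(\<integral>\<^sup>+\<omega>. F (\<lambda>i. vec p (X i \<omega>)) \<partial>M) = (\<integral>\<^sup>+\<omega>. H (\<lambda>i\<in>?J. X i \<omega>) \<partial>M)"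
    unfolding H_def by (intro nn_integral_cong cong) auto
  also have "\<dots> = (\<integral>\<^sup>+u. H u \<partial>distr M ?PL (\<lambda>\<omega>. \<lambda>i\<in>?J. X i \<omega>))"
    by (rule nn_integral_distr[OF Xr, symmetric]) (subst measurable_distr_eq1, rule H)
  also have "distr M ?PL (\<lambda>\<omega>. \<lambda>i\<in>?J. X i \<omega>) = (\<Pi>\<^sub>M i\<in>?J. distr M ?L (X i))"
    using indep unfolding lborel_on_def[symmetric]
    by (subst (asm) M.indep_vars_iff_distr_eq_PiM') (auto intro: Xm)
  also have "\<dots> = (\<Pi>\<^sub>M i\<in>?J. ?nu)"
    using distr_aff_mvn[OF M normal] by (intro PiM_cong) auto
  also have "\<dots> = distr (\<Pi>\<^sub>M i\<in>?J. gauss {..<p}) (\<Pi>\<^sub>M i\<in>?J. ?nu) (compose ?J aff)"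
  proof -
    have nu: "prob_space ?nu" by (intro prob_space.prob_space_distr prob_space_gauss aff_measurable)
    have "distr (\<Pi>\<^sub>M i\<in>?J. gauss {..<p}) (\<Pi>\<^sub>M i\<in>?J. ?nu) (compose ?J aff) =
       (\<Pi>\<^sub>M i\<in>?J. distr (gauss {..<p}) ?nu aff)"
      using aff_measurable nu by (intro distr_PiM_finite_prob_space') (auto intro: prob_space_gauss)
    also have "distr (gauss {..<p}) ?nu aff = ?nu" by (intro distr_cong) auto
    finally show ?thesis ..
  qed
  also have "(\<integral>\<^sup>+u. H u \<partial>\<dots>) = (\<integral>\<^sup>+r. H (compose ?J aff r) \<partial>(\<Pi>\<^sub>M i\<in>?J. gauss {..<p}))"
  proof -
    have e: "sets (\<Pi>\<^sub>M i\<in>?J. ?nu) = sets ?PL" by (intro sets_PiM_cong) auto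
    have 1: "H \<in> borel_measurable (distr (\<Pi>\<^sub>M i\<in>?J. gauss {..<p}) (\<Pi>\<^sub>M i\<in>?J. ?nu) (compose ?J aff))"
      unfolding measurable_distr_eq1 measurable_cong_sets[OF e refl] by (rule H)
    have 2: "compose ?J aff \<in> (\<Pi>\<^sub>M i\<in>?J. gauss {..<p}) \<rightarrow>\<^sub>M (\<Pi>\<^sub>M i\<in>?J. ?nu)"
      unfolding compose_def measurable_cong_sets[OF refl e]
      by (intro measurable_restrict measurable_compose[OF measurable_component_singleton[where M="\<lambda>_. gauss {..<p}"] aff_measurable]) auto
    show ?thesis by (rule nn_integral_distr[OF 2 1])
  qed
  also have "\<dots> = (\<integral>\<^sup>+r. H (\<lambda>i\<in>?J. aff (\<lambda>j\<in>{..<p}. (\<lambda>a\<in>?I. r (Suc (fst a)) (snd a)) (i - 1, j))) \<partial>(\<Pi>\<^sub>M i\<in>?J. gauss {..<p}))"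
    by (intro nn_integral_cong Hcong) (auto simp: compose_def aff_def intro!: sum.cong)
  also have "\<dots> = (\<integral>\<^sup>+g. H (\<lambda>i\<in>?J. aff (\<lambda>j\<in>{..<p}. g (i - 1, j))) \<partial>gauss ?I)"
  proof -
    have mi: "(\<lambda>g. \<lambda>i\<in>?J. aff (\<lambda>j\<in>{..<p}. g (i - 1, j))) \<in> gauss ?I \<rightarrow>\<^sub>M ?PL"
    proof (intro measurable_restrict)
      fix i assume i: "i \<in> ?J"
      have "(\<lambda>g. \<lambda>j\<in>{..<p}. g (i - 1, j)) \<in> gauss ?I \<rightarrow>\<^sub>M gauss {..<p}"
        unfolding gauss_def using i by (intro measurable_restrict measurable_component_singleton) auto
      then show "(\<lambda>g. aff (\<lambda>j\<in>{..<p}. g (i - 1, j))) \<in> gauss ?I \<rightarrow>\<^sub>M ?L"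
        by (rule measurable_compose[OF _ aff_measurable])
    qed
    have mU: "(\<lambda>r. \<lambda>a\<in>?I. r (Suc (fst a)) (snd a)) \<in> (\<Pi>\<^sub>M i\<in>?J. gauss {..<p}) \<rightarrow>\<^sub>M gauss ?I"
      unfolding gauss_def
      by (intro measurable_restrict measurable_entry) auto
    have "(\<integral>\<^sup>+g. H (\<lambda>i\<in>?J. aff (\<lambda>j\<in>{..<p}. g (i - 1, j))) \<partial>gauss ?I) =
      (\<integral>\<^sup>+g. H (\<lambda>i\<in>?J. aff (\<lambda>j\<in>{..<p}. g (i - 1, j))) \<partial>distr (\<Pi>\<^sub>M i\<in>?J. gauss {..<p}) (gauss ?I) (\<lambda>r. \<lambda>a\<in>?I. r (Suc (fst a)) (snd a)))"
      using distr_gauss_rows[of "Suc n" p] by simp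
    also have "\<dots> = (\<integral>\<^sup>+r. H (\<lambda>i\<in>?J. aff (\<lambda>j\<in>{..<p}. (\<lambda>a\<in>?I. r (Suc (fst a)) (snd a)) (i - 1, j))) \<partial>(\<Pi>\<^sub>M i\<in>?J. gauss {..<p}))"
      by (rule nn_integral_distr[OF mU]) (subst measurable_distr_eq1, rule measurable_compose[OF mi H])
    finally show ?thesis ..
  qed
  also have "\<dots> = (\<integral>\<^sup>+h. H (\<lambda>i\<in>?J. aff (\<lambda>j\<in>{..<p}.
      lin_on ?I (\<lambda>a b. R (fst a) (fst b) * of_bool (snd a = snd b)) h (i - 1, j))) \<partial>gauss ?I)"
  proof (rule nn_integral_gauss_lin[symmetric, where f="\<lambda>g. H (\<lambda>i\<in>?J. aff (\<lambda>j\<in>{..<p}. g (i - 1, j)))"])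
    show "(\<lambda>g. H (\<lambda>i\<in>?J. aff (\<lambda>j\<in>{..<p}. g (i - 1, j)))) \<in> borel_measurable (\<Pi>\<^sub>M i\<in>?I. borel)"
    proof (rule measurable_compose[OF _ H], intro measurable_restrict)
      fix i assume i: "i \<in> ?J"
      have "(\<lambda>g. \<lambda>j\<in>{..<p}. g (i - 1, j)) \<in> (\<Pi>\<^sub>M i\<in>?I. borel) \<rightarrow>\<^sub>M (\<Pi>\<^sub>M j\<in>{..<p}. (borel :: real measure))"
        using i by (intro measurable_restrict measurable_component_singleton) auto
      then have "(\<lambda>g. \<lambda>j\<in>{..<p}. g (i - 1, j)) \<in> (\<Pi>\<^sub>M i\<in>?I. borel) \<rightarrow>\<^sub>M gauss {..<p}"
        by (simp add: measurable_cong_sets[OF refl sets_gauss])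
      then show "(\<lambda>g. aff (\<lambda>j\<in>{..<p}. g (i - 1, j))) \<in> (\<Pi>\<^sub>M i\<in>?I. borel) \<rightarrow>\<^sub>M ?L"
        by (rule measurable_compose[OF _ aff_measurable])
    qed
  qed (auto intro!: orth_on_left_factor_prod R_orth)
  also have "\<dots> = (\<integral>\<^sup>+h. F (obs h) \<partial>gauss ?I)"
    unfolding H_def
  proof (intro nn_integral_cong cong)
    fix h i assume i: "i \<in> ?J"
    have L: "lin_on ?I (\<lambda>a b. R (fst a) (fst b) * of_bool (snd a = snd b)) h (i - 1, r) = rot h (i - 1) r" if r: "r < p" for r
    proof -
      have "lin_on ?I (\<lambda>a b. R (fst a) (fst b) * of_bool (snd a = snd b)) h (i - 1, r) =
         (\<Sum>l<Suc n. \<Sum>s<p. of_bool (r = s) * (R (i - 1) l * h (l, s)))"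
      proof -
        have "(i - 1, r) \<in> ?I" using i r by auto
        then show ?thesis unfolding lin_on_def sum.cartesian_product'
          by (simp add: mult_ac del: sum.lessThan_Suc)
      qed
      also have "\<dots> = rot h (i - 1) r"
        unfolding rot_def using r by (intro sum.cong refl sum_of_bool_mult(1)) auto
      finally show ?thesis .
    qed
    show "vec p ((\<lambda>i\<in>?J. aff (\<lambda>j\<in>{..<p}.
        lin_on ?I (\<lambda>a b. R (fst a) (fst b) * of_bool (snd a = snd b)) h (i - 1, j))) i) = obs h i"
      using i L by (auto simp: aff_def obs_def)
  qed
  finally show ?thesis .
qed

end

text \<open>The reflection that exchanges the constant unit vector and the last basis vector.\<close>

lemma helmert_exists:
  obtains R where "orth_on {..<Suc n} R"
    "\<And>l. l < Suc n \<Longrightarrow> (\<Sum>i<Suc n. R i l) = sqrt (real (Suc n)) * of_bool (l = n)"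
proof -
  let ?c = "1 / sqrt (real (Suc n))"
  define v :: "nat \<Rightarrow> real" where "v i = of_bool (i = n)" for i
  have "(\<Sum>i\<in>{..<Suc n}. ?c\<^sup>2) = (\<Sum>i\<in>{..<Suc n}. of_bool (i = n) * 1)"
    by (subst sum_of_bool_mult(2)) (auto simp: power_divide)
  also have "\<dots> = (\<Sum>i\<in>{..<Suc n}. (v i)\<^sup>2)" by (intro sum.cong) (auto simp: v_def)
  finally have "(\<Sum>i\<in>{..<Suc n}. ?c\<^sup>2) = (\<Sum>i\<in>{..<Suc n}. (v i)\<^sup>2)" .
  from householder[OF finite_lessThan this]
  obtain R where R: "orth_on {..<Suc n} R" "\<And>i j. R i j = R j i"
    "\<And>i. i \<in> {..<Suc n} \<Longrightarrow> (\<Sum>j\<in>{..<Suc n}. R i j * ?c) = v i"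
    "\<And>i. i \<in> {..<Suc n} \<Longrightarrow> (\<Sum>j\<in>{..<Suc n}. R i j * v j) = ?c" by blast
  have "(\<Sum>i<Suc n. R i l) = sqrt (real (Suc n)) * of_bool (l = n)" if l: "l < Suc n" for l
  proof -
    have "(\<Sum>i<Suc n. R i l) = (\<Sum>i<Suc n. R l i * ?c) * sqrt (real (Suc n))"
      unfolding sum_distrib_right by (intro sum.cong refl) (simp add: R(2)[of l])
    then show ?thesis using R(3)[of l] l by (simp add: v_def mult.commute del: sum.lessThan_Suc)
  qed
  with R(1) show ?thesis by (rule that)
qed

section \<open>Decomposition of the statistic\<close>

lemma schur_chi_pair_law:
  fixes m :: "nat \<Rightarrow> real"
  assumes p: "0 < p" "p \<le> n"
  defines "B \<equiv> (\<Pi>\<^sub>M j\<in>{..<p}. (borel :: real measure)) \<Otimes>\<^sub>M (borel :: real measure)"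
  defines "S \<equiv> \<lambda>h. (\<lambda>j\<in>{..<p}. h (n, j), schur_chi n p (\<lambda>j. m j + h (n, j)) h)"
  defines "W \<equiv> \<lambda>u :: (nat \<Rightarrow> real) \<times> (nat \<Rightarrow> real). (fst u, \<Sum>i<Suc n - p. (snd u i)\<^sup>2)"
  shows "S \<in> gauss ({..<Suc n} \<times> {..<p}) \<rightarrow>\<^sub>M B"
    "W \<in> gauss {..<p} \<Otimes>\<^sub>M gauss {..<Suc n - p} \<rightarrow>\<^sub>M B"
    "distr (gauss ({..<Suc n} \<times> {..<p})) B S = distr (gauss {..<p} \<Otimes>\<^sub>M gauss {..<Suc n - p}) B W"
proof -
  let ?G = "gauss ({..<Suc n} \<times> {..<p})" and ?H = "gauss {..<p} \<Otimes>\<^sub>M gauss {..<Suc n - p}"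
  interpret g2: prob_space "gauss {..<Suc n - p}" by (rule prob_space_gauss)
  have comp: "(\<lambda>h. h (i, j)) \<in> borel_measurable ?G" if "i < Suc n" "j < p" for i j
    unfolding measurable_cong_sets[OF sets_gauss refl] using that by (intro measurable_component_singleton) auto
  show S: "S \<in> ?G \<rightarrow>\<^sub>M B"
    unfolding S_def B_def
    by (intro measurable_Pair measurable_restrict schur_chi_measurable borel_measurable_add comp) (auto intro: comp)
  show W: "W \<in> ?H \<rightarrow>\<^sub>M B"
  proof -
    have 1: "fst \<in> ?H \<rightarrow>\<^sub>M (\<Pi>\<^sub>M j\<in>{..<p}. (borel :: real measure))"
      using measurable_fst[of "gauss {..<p}" "gauss {..<Suc n - p}"]
      by (simp add: measurable_cong_sets[OF refl sets_gauss])
    have 2: "(\<lambda>u. snd u i) \<in> borel_measurable ?H" if "i < Suc n - p" for i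
      by (rule measurable_compose[OF measurable_snd]) (use that in \<open>simp add: measurable_cong_sets[OF sets_gauss refl]\<close>)
    show ?thesis unfolding W_def B_def using 1 2
      by (intro measurable_Pair borel_measurable_sum borel_measurable_power) auto
  qed
  show "distr ?G B S = distr ?H B W"
  proof (rule measure_eqI)
    fix A assume "A \<in> sets (distr ?G B S)"
    then have A[measurable]: "A \<in> sets B" by simp
    have F: "indicator A \<in> borel_measurable B" by simp
    have "emeasure (distr ?G B S) A = (\<integral>\<^sup>+h. indicator A (S h) \<partial>?G)"
      using S by (simp add: nn_integral_indicator[symmetric] nn_integral_distr del: nn_integral_indicator)
    also have "\<dots> = (\<integral>\<^sup>+z. \<integral>\<^sup>+g. indicator A (z, \<Sum>i<Suc n - p. (g i)\<^sup>2) \<partial>gauss {..<Suc n - p} \<partial>gauss {..<p})"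
      unfolding S_def by (rule schur_chi_joint_law[OF p]) (use F in \<open>simp add: B_def\<close>)
    also have "\<dots> = (\<integral>\<^sup>+u. indicator A (W u) \<partial>?H)"
      using measurable_compose[OF W F] by (subst g2.nn_integral_fst[symmetric]) (simp_all add: W_def)
    also have "\<dots> = emeasure (distr ?H B W) A"
      using W by (simp add: nn_integral_indicator[symmetric] nn_integral_distr del: nn_integral_indicator)
    finally show "emeasure (distr ?G B S) A = emeasure (distr ?H B W) A" .
  qed simp
qed

text \<open>By independence and the chi-square law, the random variable is a weighted sum of independent centred
  chi-squares.\<close>

lemma schur_chi_cf:
  assumes p: "0 < p" "p \<le> n"
  shows "(CLINT h|gauss ({..<Suc n} \<times> {..<p}). iexp ((\<Sum>r<p. w r * ((h (n, r))\<^sup>2 - 1)) +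
        w' * (schur_chi n p (\<lambda>j. m j + h (n, j)) h - real (Suc n - p)))) =
     (\<Prod>r<p. chisq_cf (w r)) * (\<Prod>i<Suc n - p. chisq_cf w')"
proof -
  let ?G = "gauss ({..<Suc n} \<times> {..<p})" and ?H = "gauss {..<p} \<Otimes>\<^sub>M gauss {..<Suc n - p}"
  let ?B = "(\<Pi>\<^sub>M j\<in>{..<p}. (borel :: real measure)) \<Otimes>\<^sub>M (borel :: real measure)"
  let ?S = "\<lambda>h. (\<lambda>j\<in>{..<p}. h (n, j), schur_chi n p (\<lambda>j. m j + h (n, j)) h)"
  let ?W = "\<lambda>u :: (nat \<Rightarrow> real) \<times> (nat \<Rightarrow> real). (fst u, \<Sum>i<Suc n - p. (snd u i)\<^sup>2)"
  note law1 = schur_chi_pair_law(1)[OF p, of m] and law2 = schur_chi_pair_law(2)[OF p]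
    and law3 = schur_chi_pair_law(3)[OF p, of m]
  interpret g1: prob_space "gauss {..<p}" by (rule prob_space_gauss)
  interpret g2: prob_space "gauss {..<Suc n - p}" by (rule prob_space_gauss)
  interpret pair_prob_space "gauss {..<p}" "gauss {..<Suc n - p}" ..
  define f :: "(nat \<Rightarrow> real) \<times> real \<Rightarrow> complex" where
    "f u = iexp ((\<Sum>r<p. w r * ((fst u r)\<^sup>2 - 1)) + w' * (snd u - real (Suc n - p)))" for u
  have f: "f \<in> borel_measurable ?B"
  proof -
    have "(\<lambda>u. fst u r) \<in> borel_measurable ?B" if "r < p" for r
      using that by (intro measurable_compose[OF measurable_fst] measurable_component_singleton) auto
    then have "(\<lambda>u. (\<Sum>r<p. w r * ((fst u r)\<^sup>2 - 1)) + w' * (snd u - real (Suc n - p))) \<in> borel_measurable ?B"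
      by measurable
    then show ?thesis unfolding f_def[abs_def] by measurable
  qed
  have "(CLINT h|?G. iexp ((\<Sum>r<p. w r * ((h (n, r))\<^sup>2 - 1)) +
        w' * (schur_chi n p (\<lambda>j. m j + h (n, j)) h - real (Suc n - p)))) = (CLINT h|?G. f (?S h))"
    by (simp add: f_def)
  also have "\<dots> = (CLINT u|distr ?G ?B ?S. f u)"
    using law1 f by (subst integral_distr) auto
  also have "\<dots> = (CLINT u|?H. f (?W u))"
    unfolding law3 using law2 f by (subst integral_distr) auto
  also have "\<dots> = (CLINT z|gauss {..<p}. CLINT g|gauss {..<Suc n - p}. f (?W (z, g)))"
  proof -
    have "integrable ?H (\<lambda>u. f (?W u))"
      by (rule integrable_const_bound[of _ 1]) (auto simp: f_def intro!: measurable_compose[OF law2 f])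
    then have "integrable ?H (\<lambda>(z, g). f (?W (z, g)))" by (simp add: case_prod_beta')
    from integral_fst[OF this] show ?thesis by (simp add: case_prod_beta')
  qed
  also have "\<dots> = (CLINT z|gauss {..<p}. iexp (\<Sum>r<p. w r * ((z r)\<^sup>2 - 1)) *
      (CLINT g|gauss {..<Suc n - p}. iexp (\<Sum>i<Suc n - p. w' * ((g i)\<^sup>2 - 1))))"
  proof (intro Bochner_Integration.integral_cong refl)
    fix z
    have "f (?W (z, g)) = iexp (\<Sum>r<p. w r * ((z r)\<^sup>2 - 1)) * iexp (\<Sum>i<Suc n - p. w' * ((g i)\<^sup>2 - 1))" for g
    proof -
      have "w' * ((\<Sum>i<Suc n - p. (g i)\<^sup>2) - real (Suc n - p)) = (\<Sum>i<Suc n - p. w' * ((g i)\<^sup>2 - 1))"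
        by (simp add: sum_distrib_left[symmetric] sum_subtractf)
      then show ?thesis by (simp add: f_def exp_add[symmetric] distrib_left)
    qed
    then show "(CLINT g|gauss {..<Suc n - p}. f (?W (z, g))) = iexp (\<Sum>r<p. w r * ((z r)\<^sup>2 - 1)) *
      (CLINT g|gauss {..<Suc n - p}. iexp (\<Sum>i<Suc n - p. w' * ((g i)\<^sup>2 - 1)))" by simp
  qed
  also have "\<dots> = (CLINT z|gauss {..<p}. iexp (\<Sum>r<p. w r * ((z r)\<^sup>2 - 1))) * (\<Prod>i<Suc n - p. chisq_cf w')"
    by (simp add: gauss_weighted_chisq_cf del: of_real_sum)
  also have "(CLINT z|gauss {..<p}. iexp (\<Sum>r<p. w r * ((z r)\<^sup>2 - 1))) = (\<Prod>r<p. chisq_cf (w r))"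
    by (rule gauss_weighted_chisq_cf) simp
  finally show ?thesis .
qed

lemma schur_chi_centred_L2:
  assumes p: "0 < p" "p \<le> n"
  shows "(\<integral>\<^sup>+h. ennreal ((schur_chi n p (\<lambda>j. m j + h (n, j)) h - real (Suc n - p))\<^sup>2) \<partial>gauss ({..<Suc n} \<times> {..<p})) =
    ennreal (2 * real (Suc n - p))"
proof -
  have "(\<integral>\<^sup>+h. ennreal ((schur_chi n p (\<lambda>j. m j + h (n, j)) h - real (Suc n - p))\<^sup>2) \<partial>gauss ({..<Suc n} \<times> {..<p})) =
     (\<integral>\<^sup>+z. \<integral>\<^sup>+g. ennreal (((\<Sum>i<Suc n - p. (g i)\<^sup>2) - real (Suc n - p))\<^sup>2) \<partial>gauss {..<Suc n - p} \<partial>gauss {..<p})"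
    using schur_chi_joint_law[OF p, of "\<lambda>u. ennreal ((snd u - real (Suc n - p))\<^sup>2)" m] by simp
  also have "(\<integral>\<^sup>+g. ennreal (((\<Sum>i<Suc n - p. (g i)\<^sup>2) - real (Suc n - p))\<^sup>2) \<partial>gauss {..<Suc n - p}) =
     (\<integral>\<^sup>+g. ennreal ((\<Sum>i<Suc n - p. 1 * ((g i)\<^sup>2 - 1))\<^sup>2) \<partial>gauss {..<Suc n - p})"
    by (intro nn_integral_cong) (simp add: sum_subtractf)
  also have "\<dots> = ennreal (2 * real (Suc n - p))" by (subst gauss_weighted_chisq_L2) auto
  also have "(\<integral>\<^sup>+z. ennreal (2 * real (Suc n - p)) \<partial>gauss {..<p}) = ennreal (2 * real (Suc n - p))"
    using prob_space.emeasure_space_1[OF prob_space_gauss, of "{..<p}"] by simp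
  finally show ?thesis .
qed

lemma quad_form_gram_nonzero:
  assumes ind: "indep_cols n p h" and z: "j < p" "z j \<noteq> 0"
  shows "quad_form (mat_inv (gram n p h)) (vec p z) \<noteq> 0"
proof
  assume 0: "quad_form (mat_inv (gram n p h)) (vec p z) = 0"
  obtain b where b: "\<And>j. j < p \<Longrightarrow> (\<Sum>i<n. h (i, j) * (\<Sum>l<p. h (i, l) * b l)) = z j"
    using gram_solvable[OF ind] by blast
  have "0 = (\<Sum>j<p. z j * b j)" using quad_form_gram_solve[OF ind b] 0 by simp
  also have "\<dots> = (\<Sum>j<p. \<Sum>i<n. (h (i, j) * b j) * (\<Sum>l<p. h (i, l) * b l))"
    using b by (intro sum.cong refl) (simp add: sum_distrib_left sum_distrib_right mult_ac flip: b)
  also have "\<dots> = (\<Sum>i<n. \<Sum>j<p. (h (i, j) * b j) * (\<Sum>l<p. h (i, l) * b l))" by (rule sum.swap)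
  also have "\<dots> = (\<Sum>i<n. (\<Sum>l<p. h (i, l) * b l)\<^sup>2)"
    by (simp add: sum_distrib_right power2_eq_square)
  finally have "\<forall>i<n. (\<Sum>l<p. h (i, l) * b l) = 0"
    by (subst (asm) eq_commute, subst (asm) sum_nonneg_eq_0_iff) auto
  then have "z j = 0" using b[OF z(1)] by simp
  then show False using z by simp
qed

lemma ratio_expansion:
  fixes a b u D v N n' :: real
  assumes "a \<noteq> 0" "v \<noteq> 0" "n' \<noteq> 0"
  shows "a * ((b * b + b * u + N * D) / v - b * b / n') =
    1 / (v / (a * a)) * (N / (a * a) * (a * D) + b / a * u - b * b / n' * ((v - n') / a))"
proof -
  define k where "k = b * b / n'"
  have k: "k * n' = b * b" using assms by (simp add: k_def)
  have "N / (a * a) * (a * D) + b / a * u - k * ((v - n') / a) = (N * D + b * u - k * (v - n')) / a"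
    using assms by (simp add: add_divide_distrib diff_divide_distrib right_diff_distrib)
  also have "N * D + b * u - k * (v - n') = (b * b + b * u + N * D) - k * v"
    using k by (simp add: algebra_simps)
  finally have "1 / (v / (a * a)) * (N / (a * a) * (a * D) + b / a * u - k * ((v - n') / a)) =
      a * (((b * b + b * u + N * D) - k * v) / v)"
    using assms by simp
  also have "\<dots> = a * ((b * b + b * u + N * D) / v - k)"
    using assms by (simp add: diff_divide_distrib)
  finally show ?thesis by (simp add: k_def)
qed

lemma quotient_expansion:
  fixes a b u D t A N :: real
  assumes "b \<noteq> 0" "t \<noteq> 0"
  shows "a * ((A + b * u + N * D) / t - 1) =
    1 / (t / (b * b)) * (N / (b * b) * (a * D) + a / b * u - a * ((t - A) / (b * b)))"
proof -
  have "N / (b * b) * (a * D) + a / b * u - a * ((t - A) / (b * b)) = a * (N * D + b * u - (t - A)) / (b * b)"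
    using assms by (simp add: add_divide_distrib diff_divide_distrib distrib_left right_diff_distrib)
  also have "N * D + b * u - (t - A) = A + b * u + N * D - t" by simp
  finally have "1 / (t / (b * b)) * (N / (b * b) * (a * D) + a / b * u - a * ((t - A) / (b * b))) =
      a * ((A + b * u + N * D - t) / t)"
    using assms by simp
  also have "\<dots> = a * ((A + b * u + N * D) / t - 1)"
    using assms by (simp add: diff_divide_distrib)
  finally show ?thesis ..
qed

context gaussian_sample
begin

abbreviation G :: "(nat \<times> nat \<Rightarrow> real) measure" where
  "G \<equiv> gauss ({..<Suc n} \<times> {..<p})"

definition V :: "(nat \<times> nat \<Rightarrow> real) \<Rightarrow> real" where
  "V h = schur_chi n p (zvec h) h"

definition U1 :: "(nat \<times> nat \<Rightarrow> real) \<Rightarrow> real" where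
  "U1 h = (\<Sum>r<p. (h (n, r))\<^sup>2 - 1) / sqrt (real p)"

definition U2 :: "(nat \<times> nat \<Rightarrow> real) \<Rightarrow> real" where
  "U2 h = (\<Sum>r<p. lam r * ((h (n, r))\<^sup>2 - 1)) / sqrt (real p)"

definition U3 :: "(nat \<times> nat \<Rightarrow> real) \<Rightarrow> real" where
  "U3 h = (V h - real (Suc n - p)) / sqrt (real n)"

definition err1 :: "(nat \<times> nat \<Rightarrow> real) \<Rightarrow> real" where
  "err1 h = 2 * sqN * (\<Sum>r<p. shift r * h (n, r)) / sqrt (real p)"

definition err2 :: "(nat \<times> nat \<Rightarrow> real) \<Rightarrow> real" where
  "err2 h = 2 * sqN * (\<Sum>r<p. lam r * shift r * h (n, r)) / sqrt (real p)"

definition trS :: "(nat \<times> nat \<Rightarrow> real) \<Rightarrow> real" where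
  "trS h = mat_tr (sample_cov (Suc n) p (obs h))"

definition trErr :: "(nat \<times> nat \<Rightarrow> real) \<Rightarrow> real" where
  "trErr h = sqrt (real n) * ((trS h - (\<Sum>r<p. lam r)) / real p)"

lemma zvec_sq: "0 < p \<Longrightarrow> (\<Sum>r<p. (zvec h r)\<^sup>2) =
    real p + sqrt (real p) * (U1 h + err1 h) + real (Suc n) * (\<Sum>r<p. (shift r)\<^sup>2)"
proof -
  assume p: "0 < p"
  have "(\<Sum>r<p. (zvec h r)\<^sup>2) = (\<Sum>r<p. real (Suc n) * (shift r)\<^sup>2 + 2 * sqN * (shift r * h (n, r)) + (((h (n, r))\<^sup>2 - 1) + 1))"
    unfolding sqN_pos(2)[symmetric]
    by (intro sum.cong refl) (simp add: zvec_def power2_eq_square algebra_simps)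
  also have "\<dots> = real (Suc n) * (\<Sum>r<p. (shift r)\<^sup>2) + 2 * sqN * (\<Sum>r<p. shift r * h (n, r)) + ((\<Sum>r<p. (h (n, r))\<^sup>2 - 1) + real p)"
    unfolding sum.distrib sum_distrib_left[symmetric] by simp
  finally show ?thesis using p by (simp add: U1_def err1_def distrib_left)
qed

lemma lam_zvec_sq: "0 < p \<Longrightarrow> (\<Sum>r<p. lam r * (zvec h r)\<^sup>2) =
    (\<Sum>r<p. lam r) + sqrt (real p) * (U2 h + err2 h) + real (Suc n) * (\<Sum>r<p. lam r * (shift r)\<^sup>2)"
proof -
  assume p: "0 < p"
  have "(\<Sum>r<p. lam r * (zvec h r)\<^sup>2) = (\<Sum>r<p. real (Suc n) * (lam r * (shift r)\<^sup>2) +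
      2 * sqN * (lam r * shift r * h (n, r)) + (lam r * ((h (n, r))\<^sup>2 - 1) + lam r))"
    unfolding sqN_pos(2)[symmetric]
    by (intro sum.cong refl) (simp add: zvec_def power2_eq_square algebra_simps)
  also have "\<dots> = real (Suc n) * (\<Sum>r<p. lam r * (shift r)\<^sup>2) + 2 * sqN * (\<Sum>r<p. lam r * shift r * h (n, r))
      + ((\<Sum>r<p. lam r * ((h (n, r))\<^sup>2 - 1)) + (\<Sum>r<p. lam r))"
    unfolding sum.distrib sum_distrib_left[symmetric] by simp
  finally show ?thesis using p by (simp add: U2_def err2_def distrib_left)
qed

text \<open>The first summand is the Hotelling part and the second the Dempster part. Each numerator consists of the
  shift that produces the power, of the fluctuation of |z|^2 or of its weighted analogue, and of
  the fluctuation of the denominator.\<close>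

lemma T_stat_decomposition:
  assumes ind: "indep_cols n p h" and z: "zvec h 0 \<noteq> 0" and tr: "trS h \<noteq> 0" and p: "0 < p" "p \<le> n"
  shows "T_stat (Suc n) p \<mu>0 \<rho> (obs h) =
    \<rho> / (V h / real n) * (real (Suc n) / real n * (sqrt (real n) * (\<Sum>r<p. (shift r)\<^sup>2))
       + sqrt (real p / real n) * (U1 h + err1 h) - real p / real (Suc n - p) * U3 h) +
    (1 - \<rho>) / (trS h / real p) * (real (Suc n) / real p * (sqrt (real n) * (\<Sum>r<p. lam r * (shift r)\<^sup>2))
       + sqrt (real n / real p) * (U2 h + err2 h) - trErr h)"
proof -
  define q where "q = quad_form (mat_inv (gram n p h)) (vec p (zvec h))"
  define S where "S = (\<Sum>r<p. (zvec h r)\<^sup>2)"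
  define D where "D = (\<Sum>r<p. (shift r)\<^sup>2)"
  define DI where "DI = (\<Sum>r<p. lam r * (shift r)\<^sup>2)"
  define A where "A = (\<Sum>r<p. lam r)"
  define n' where "n' = real (Suc n - p)"
  have n'0: "n' \<noteq> 0" "real (Suc n) - real p = n'" using p by (auto simp: n'_def of_nat_diff)
  have q0: "q \<noteq> 0" unfolding q_def by (rule quad_form_gram_nonzero[OF ind, of 0]) (use z p in auto)
  have "S > 0" unfolding S_def using z p by (intro sum_pos2[of _ 0]) auto
  then have S0: "S \<noteq> 0" by simp
  have V: "V h = S / q" by (simp add: V_def schur_chi_def S_def q_def)
  then have V0: "V h \<noteq> 0" and qV: "q = S / V h" using q0 S0 by auto
  define a b where "a = sqrt (real n)" and "b = sqrt (real p)"
  have a: "a > 0" "real n = a * a" and b: "b > 0" "real p = b * b" using p by (auto simp: a_def b_def)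
  have S: "S = b * b + b * (U1 h + err1 h) + real (Suc n) * D"
    unfolding S_def D_def zvec_sq[OF p(1)] b_def[symmetric] by (simp only: b(2))
  have VU: "V h = n' + a * U3 h" unfolding U3_def n'_def a_def[symmetric] using a(1) by simp
  have Y: "(\<Sum>r<p. lam r * (zvec h r)\<^sup>2) = A + b * (U2 h + err2 h) + real (Suc n) * DI"
    unfolding A_def DI_def lam_zvec_sq[OF p(1)] b_def[symmetric] ..
  have te: "trErr h = a * ((trS h - A) / (b * b))" unfolding trErr_def A_def a_def b(2)[symmetric] ..
  have hot: "hotelling_T2 (Suc n) p \<mu>0 (obs h) / (real (Suc n) - 1) = S / V h"
    unfolding hotelling_obs[OF ind] q_def[symmetric] qV using n_pos by simp
  have dem: "dempster_D (Suc n) p \<mu>0 (obs h) = (A + b * (U2 h + err2 h) + real (Suc n) * DI) / trS h"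
    unfolding dempster_D_def mean_diff_sq Y trS_def ..
  have sq: "sqrt (real (Suc n) - 1) = a" by (simp add: a_def)
  have r: "sqrt (real p / real n) = b / a" "sqrt (real n / real p) = a / b"
    by (simp_all add: a_def b_def real_sqrt_divide)
  have e1: "a * (S / V h - b * b / n') = 1 / (V h / (a * a)) *
      (real (Suc n) / (a * a) * (a * D) + b / a * (U1 h + err1 h) - b * b / n' * U3 h)"
  proof -
    have u3: "U3 h = (V h - n') / a" unfolding VU using a(1) by simp
    show ?thesis unfolding u3 S using V0 n'0(1) a(1) by (intro ratio_expansion) auto
  qed
  have e2: "a * ((A + b * (U2 h + err2 h) + real (Suc n) * DI) / trS h - 1) = 1 / (trS h / (b * b)) *
      (real (Suc n) / (b * b) * (a * DI) + a / b * (U2 h + err2 h) - trErr h)"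
    unfolding te using tr b(1) by (intro quotient_expansion) auto
  have "T_stat (Suc n) p \<mu>0 \<rho> (obs h) = \<rho> * (a * (S / V h - b * b / n')) +
      (1 - \<rho>) * (a * ((A + b * (U2 h + err2 h) + real (Suc n) * DI) / trS h - 1))"
    unfolding T_stat_def Let_def hot dem sq n'0(2) b(2)[symmetric] by simp
  then show ?thesis
    unfolding e1 e2 r a_def[symmetric] D_def[symmetric] DI_def[symmetric] n'_def[symmetric]
    by (simp only: a(2) b(2) times_divide_eq_left times_divide_eq_right mult_1_left mult_1_right)
qed

text \<open>On these samples all denominators in the decomposition are nonzero; elsewhere the statistics have
  default values.\<close>

lemma AE_regular:
  assumes p: "0 < p" "p \<le> n"
  shows "AE h in G. indep_cols n p h \<and> zvec h 0 \<noteq> 0 \<and> trS h \<noteq> 0"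
proof -
  have "AE h in G. indep_cols n p h"
  proof -
    let ?A = "{..<n} \<times> {..<p}" and ?I = "{..<Suc n} \<times> {..<p}"
    have "id \<in> ?A \<rightarrow> ?I" by auto
    then have d: "distr (gauss ?I) (gauss ?A) (\<lambda>h. \<lambda>a\<in>?A. h a) = gauss ?A"
      using distr_PiM_reindex[of ?I "\<lambda>_. std_normal_distribution" id ?A] std_normal.prob_space_axioms
      by (simp add: gauss_def)
    have m: "(\<lambda>h. \<lambda>a\<in>?A. h a) \<in> gauss ?I \<rightarrow>\<^sub>M gauss ?A"
      unfolding gauss_def by (intro measurable_restrict measurable_component_singleton) auto
    have "AE h in distr (gauss ?I) (gauss ?A) (\<lambda>h. \<lambda>a\<in>?A. h a). indep_cols n p h"
      unfolding d by (rule AE_indep_cols[OF p(2)])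
    from AE_distrD[OF m this] show ?thesis
      by (rule AE_mp) (auto intro!: AE_I2 simp: indep_cols_cong[of n p "\<lambda>a\<in>?A. _ a"])
  qed
  moreover have "AE h in G. h (n, 0) \<noteq> - (sqN * shift 0)" using p by (intro AE_gauss_neq) auto
  moreover have "AE h in G. h (0, 0) \<noteq> 0" using p by (intro AE_gauss_neq) auto
  ultimately show ?thesis
  proof eventually_elim
    case (elim h)
    have "row_inner p lam h 0 0 > 0"
      unfolding row_inner_def using elim p lam_pos
      by (intro sum_pos2[of _ 0]) (auto simp: mult.assoc less_imp_le zero_less_mult_iff)
    moreover have "row_inner p lam h i i \<ge> 0" for i
      unfolding row_inner_def using lam_pos
      by (intro sum_nonneg) (auto simp: mult.assoc less_imp_le)
    ultimately have "(\<Sum>i<n. row_inner p lam h i i) > 0"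
      using n_pos by (intro sum_pos2[of _ 0]) auto
    then have "trS h \<noteq> 0" unfolding trS_def mat_tr_sample_cov using n_pos by simp
    then show ?case using elim by (simp add: zvec_def)
  qed
qed

end

section \<open>Second-moment bounds for the components\<close>

lemma gauss_entry_measurable[measurable (raw)]:
  "a \<in> I \<Longrightarrow> (\<lambda>h. h a) \<in> borel_measurable (gauss I)"
  unfolding measurable_cong_sets[OF sets_gauss refl] by (rule measurable_component_singleton)

lemma nn_integral_scaled_square:
  assumes Y: "Y \<in> borel_measurable M" and le: "(\<integral>\<^sup>+x. ennreal ((Y x)\<^sup>2) \<partial>M) \<le> ennreal b"
  shows "(\<integral>\<^sup>+x. ennreal ((c * Y x)\<^sup>2) \<partial>M) \<le> ennreal (c\<^sup>2 * b)"
proof -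
  have "(\<integral>\<^sup>+x. ennreal ((c * Y x)\<^sup>2) \<partial>M) = (\<integral>\<^sup>+x. ennreal (c\<^sup>2) * ennreal ((Y x)\<^sup>2) \<partial>M)"
    by (simp add: power_mult_distrib ennreal_mult)
  also have "\<dots> = ennreal (c\<^sup>2) * (\<integral>\<^sup>+x. ennreal ((Y x)\<^sup>2) \<partial>M)"
    using Y by (intro nn_integral_cmult) auto
  also have "\<dots> \<le> ennreal (c\<^sup>2) * ennreal b" by (intro mult_left_mono le) auto
  also have "\<dots> = ennreal (c\<^sup>2 * b)" by (simp add: ennreal_mult')
  finally show ?thesis .
qed

lemma row_sum_embed:
  fixes N p m :: nat and f :: "nat \<times> nat \<Rightarrow> real"
  assumes "m < N"
  shows "(\<Sum>r<p. w r * f (m, r)) = (\<Sum>a\<in>{..<N} \<times> {..<p}. (of_bool (m = fst a) * w (snd a)) * f a)"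
proof -
  have "(\<Sum>a\<in>{..<N} \<times> {..<p}. (of_bool (m = fst a) * w (snd a)) * f a) =
     (\<Sum>i<N. of_bool (m = i) * (\<Sum>r<p. w r * f (i, r)))"
    by (simp add: sum.cartesian_product' sum_distrib_left mult.assoc)
  also have "\<dots> = (\<Sum>r<p. w r * f (m, r))" using assms by (intro sum_of_bool_mult(1)) auto
  finally show ?thesis ..
qed

lemma row_weight_square:
  fixes N p m :: nat
  assumes "m < N"
  shows "(\<Sum>a\<in>{..<N} \<times> {..<p}. (of_bool (m = fst a) * w (snd a))\<^sup>2) = (\<Sum>r<p. (w r :: real)\<^sup>2)"
proof -
  have "(\<Sum>a\<in>{..<N} \<times> {..<p}. (of_bool (m = fst a) * w (snd a))\<^sup>2) =
     (\<Sum>a\<in>{..<N} \<times> {..<p}. (of_bool (m = fst a) * (w (snd a))\<^sup>2) * 1)"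
    by (intro sum.cong refl) auto
  also have "\<dots> = (\<Sum>r<p. (w r)\<^sup>2 * 1)"
    by (rule row_sum_embed[OF assms, where w="\<lambda>r. (w r)\<^sup>2" and f="\<lambda>_. 1", symmetric])
  finally show ?thesis by simp
qed

lemma row_chisq_L2:
  fixes N p m :: nat
  assumes "m < N"
  shows "(\<integral>\<^sup>+h. ennreal ((\<Sum>r<p. w r * ((h (m, r))\<^sup>2 - 1))\<^sup>2) \<partial>gauss ({..<N} \<times> {..<p})) =
    ennreal (2 * (\<Sum>r<p. (w r)\<^sup>2))"
  unfolding row_sum_embed[OF assms, where f="\<lambda>a. (_ a)\<^sup>2 - 1"] row_weight_square[OF assms, symmetric]
  by (rule gauss_weighted_chisq_L2) auto

lemma row_linear_L2:
  fixes N p m :: nat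
  assumes "m < N"
  shows "(\<integral>\<^sup>+h. ennreal ((\<Sum>r<p. w r * h (m, r))\<^sup>2) \<partial>gauss ({..<N} \<times> {..<p})) =
    ennreal (\<Sum>r<p. (w r)\<^sup>2)"
  unfolding row_sum_embed[OF assms, where f="\<lambda>a. _ a"] row_weight_square[OF assms, symmetric]
  by (rule gauss_linear_L2) auto

lemma block_chisq_L2:
  fixes N n p :: nat
  assumes "n \<le> N"
  shows "(\<integral>\<^sup>+h. ennreal ((\<Sum>i<n. \<Sum>r<p. w r * ((h (i, r))\<^sup>2 - 1))\<^sup>2) \<partial>gauss ({..<N} \<times> {..<p})) =
    ennreal (2 * (real n * (\<Sum>r<p. (w r)\<^sup>2)))"
proof -
  have 1: "(\<Sum>i<n. \<Sum>r<p. w r * f (i, r)) = (\<Sum>a\<in>{..<N} \<times> {..<p}. (of_bool (fst a < n) * w (snd a)) * f a)"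
    for w :: "nat \<Rightarrow> real" and f
  proof -
    have "(\<Sum>a\<in>{..<N} \<times> {..<p}. (of_bool (fst a < n) * w (snd a)) * f a) =
       (\<Sum>i<N. if i < n then (\<Sum>r<p. w r * f (i, r)) else 0)"
      unfolding sum.cartesian_product' by (intro sum.cong refl) auto
    also have "\<dots> = (\<Sum>i<n. \<Sum>r<p. w r * f (i, r))"
      using assms by (intro sum.mono_neutral_cong_right) auto
    finally show ?thesis ..
  qed
  have 2: "(\<Sum>a\<in>{..<N} \<times> {..<p}. (of_bool (fst a < n) * w (snd a))\<^sup>2) = real n * (\<Sum>r<p. (w r)\<^sup>2)"
  proof -
    have "(\<Sum>a\<in>{..<N} \<times> {..<p}. (of_bool (fst a < n) * w (snd a))\<^sup>2) =
       (\<Sum>a\<in>{..<N} \<times> {..<p}. (of_bool (fst a < n) * (w (snd a))\<^sup>2) * 1)"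
      by (intro sum.cong refl) auto
    also have "\<dots> = (\<Sum>i<n. \<Sum>r<p. (w r)\<^sup>2 * 1)"
      by (rule 1[of "\<lambda>r. (w r)\<^sup>2" "\<lambda>_. 1", symmetric])
    finally show ?thesis by simp
  qed
  show ?thesis
    unfolding 1[where f="\<lambda>a. (_ a)\<^sup>2 - 1"] 2[symmetric] by (rule gauss_weighted_chisq_L2) auto
qed

lemma nn_integral_gauss_subrows:
  fixes N n p :: nat
  assumes "n \<le> N" and f: "f \<in> borel_measurable (\<Pi>\<^sub>M i\<in>{..<n} \<times> {..<p}. (borel :: real measure))"
    and cong: "\<And>h h'. (\<And>i r. i < n \<Longrightarrow> r < p \<Longrightarrow> h (i, r) = h' (i, r)) \<Longrightarrow> f h = f h'"
  shows "(\<integral>\<^sup>+h. f h \<partial>gauss ({..<N} \<times> {..<p})) = (\<integral>\<^sup>+h. f h \<partial>gauss ({..<n} \<times> {..<p}))"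
proof -
  have "(\<integral>\<^sup>+h. f h \<partial>gauss ({..<N} \<times> {..<p})) = (\<integral>\<^sup>+h. f (\<lambda>a\<in>{..<n} \<times> {..<p}. h (id a)) \<partial>gauss ({..<N} \<times> {..<p}))"
    by (intro nn_integral_cong cong) auto
  also have "\<dots> = (\<integral>\<^sup>+h. f h \<partial>gauss ({..<n} \<times> {..<p}))"
    using assms(1) f by (intro nn_integral_gauss_reindex) auto
  finally show ?thesis .
qed

context gaussian_sample
begin

text \<open>Off-diagonal part of the squared Frobenius norm of the residual Gram matrix, centred row by row.\<close>

definition Dtot :: "(nat \<times> nat \<Rightarrow> real) \<Rightarrow> real" where
  "Dtot h = (\<Sum>j<n. \<Sum>k\<in>{..<n} - {j}. (row_inner p lam h j k)\<^sup>2 - row_sq p lam h j)"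

definition Etot :: "(nat \<times> nat \<Rightarrow> real) \<Rightarrow> real" where
  "Etot h = (\<Sum>j<n. \<Sum>r<p. (lam r)\<^sup>2 * ((h (j, r))\<^sup>2 - 1))"

definition dev :: "(nat \<times> nat \<Rightarrow> real) \<Rightarrow> nat \<Rightarrow> real" where
  "dev h j = (\<Sum>r<p. lam r * ((h (j, r))\<^sup>2 - 1))"

lemma U1_measurable[measurable]: "U1 \<in> borel_measurable G"
  unfolding U1_def[abs_def] by (intro borel_measurable_divide borel_measurable_sum borel_measurable_diff
    borel_measurable_power gauss_entry_measurable borel_measurable_const) auto

lemma U2_measurable[measurable]: "U2 \<in> borel_measurable G"
  unfolding U2_def[abs_def] by (intro borel_measurable_divide borel_measurable_sum borel_measurable_diff
    borel_measurable_times borel_measurable_power gauss_entry_measurable borel_measurable_const) auto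

lemma V_measurable[measurable]: "V \<in> borel_measurable G"
  unfolding V_def[abs_def] zvec_def[abs_def]
  by (intro schur_chi_measurable borel_measurable_add gauss_entry_measurable borel_measurable_const) auto

lemma U3_measurable[measurable]: "U3 \<in> borel_measurable G"
  unfolding U3_def[abs_def] by measurable

lemma err1_measurable[measurable]: "err1 \<in> borel_measurable G"
  unfolding err1_def[abs_def] by (intro borel_measurable_divide borel_measurable_sum
    borel_measurable_times gauss_entry_measurable borel_measurable_const) auto

lemma err2_measurable[measurable]: "err2 \<in> borel_measurable G"
  unfolding err2_def[abs_def] by (intro borel_measurable_divide borel_measurable_sum
    borel_measurable_times gauss_entry_measurable borel_measurable_const) auto

lemma dev_measurable: "j < Suc n \<Longrightarrow> (\<lambda>h. dev h j) \<in> borel_measurable G"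
  unfolding dev_def by (intro borel_measurable_sum borel_measurable_diff
    borel_measurable_times borel_measurable_power gauss_entry_measurable borel_measurable_const) auto

lemma Etot_measurable[measurable]: "Etot \<in> borel_measurable G"
  unfolding Etot_def[abs_def] by (intro borel_measurable_sum borel_measurable_diff
    borel_measurable_times borel_measurable_power gauss_entry_measurable borel_measurable_const) auto

lemma Dtot_measurable': "Dtot \<in> borel_measurable (\<Pi>\<^sub>M i\<in>{..<n} \<times> {..<p}. (borel :: real measure))"
  unfolding Dtot_def[abs_def] row_inner_def row_sq_def by (intro borel_measurable_sum borel_measurable_diff
    borel_measurable_times borel_measurable_power measurable_component_singleton borel_measurable_const) auto

lemma Dtot_measurable[measurable]: "Dtot \<in> borel_measurable G"
  unfolding Dtot_def[abs_def] row_inner_def row_sq_def by (intro borel_measurable_sum borel_measurable_diff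
    borel_measurable_times borel_measurable_power gauss_entry_measurable borel_measurable_const) auto

lemma U1_L2: "0 < p \<Longrightarrow> (\<integral>\<^sup>+h. ennreal ((U1 h)\<^sup>2) \<partial>G) \<le> ennreal 2"
proof -
  assume p: "0 < p"
  have eq: "U1 h = (\<Sum>r<p. (1 / sqrt (real p)) * ((h (n, r))\<^sup>2 - 1))" for h
    by (simp add: U1_def sum_divide_distrib)
  show ?thesis unfolding eq using p by (subst row_chisq_L2) (auto simp: power_divide)
qed

lemma U2_L2: "(\<integral>\<^sup>+h. ennreal ((U2 h)\<^sup>2) \<partial>G) \<le> ennreal (2 * ((\<Sum>r<p. (lam r)\<^sup>2) / real p))"
proof -
  have eq: "U2 h = (\<Sum>r<p. (lam r / sqrt (real p)) * ((h (n, r))\<^sup>2 - 1))" for h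
    by (simp add: U2_def sum_divide_distrib)
  show ?thesis unfolding eq
    by (subst row_chisq_L2) (auto simp: power_divide sum_divide_distrib)
qed

lemma U3_L2: "0 < p \<Longrightarrow> p \<le> n \<Longrightarrow> (\<integral>\<^sup>+h. ennreal ((U3 h)\<^sup>2) \<partial>G) \<le> ennreal 2"
proof -
  assume p: "0 < p" "p \<le> n"
  have eq: "U3 h = 1 / sqrt (real n) * (schur_chi n p (\<lambda>j. sqN * shift j + h (n, j)) h - real (Suc n - p))" for h
    by (simp add: U3_def V_def zvec_def[abs_def])
  have "(\<integral>\<^sup>+h. ennreal ((U3 h)\<^sup>2) \<partial>G) \<le> ennreal ((1 / sqrt (real n))\<^sup>2 * (2 * real (Suc n - p)))"
    unfolding eq
  proof (rule nn_integral_scaled_square)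
    show "(\<lambda>h. schur_chi n p (\<lambda>j. sqN * shift j + h (n, j)) h - real (Suc n - p)) \<in> borel_measurable G"
      using V_measurable by (simp add: V_def[abs_def] zvec_def[abs_def])
  qed (simp add: schur_chi_centred_L2[OF p])
  also have "\<dots> \<le> ennreal 2" using p by (intro ennreal_leI) (auto simp: power_divide field_simps)
  finally show ?thesis .
qed

lemma err1_L2: "0 < p \<Longrightarrow> (\<integral>\<^sup>+h. ennreal ((err1 h)\<^sup>2) \<partial>G) \<le>
    ennreal (4 * (real (Suc n) / real p * (\<Sum>r<p. (shift r)\<^sup>2)))"
proof -
  assume p: "0 < p"
  have eq: "err1 h = 2 * sqN / sqrt (real p) * (\<Sum>r<p. (shift r) * h (n, r))" for h
    by (simp add: err1_def)
  have "(\<integral>\<^sup>+h. ennreal ((err1 h)\<^sup>2) \<partial>G) \<le> ennreal ((2 * sqN / sqrt (real p))\<^sup>2 * (\<Sum>r<p. (shift r)\<^sup>2))"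
    unfolding eq
  proof (rule nn_integral_scaled_square)
    show "(\<lambda>h. \<Sum>r<p. (shift r) * h (n, r)) \<in> borel_measurable G"
      by (intro borel_measurable_sum borel_measurable_times gauss_entry_measurable borel_measurable_const) auto
  qed (subst row_linear_L2; simp)
  also have "(2 * sqN / sqrt (real p))\<^sup>2 = 4 * (real (Suc n) / real p)"
    using p unfolding sqN_pos(2)[symmetric] by (simp add: power_divide power_mult_distrib power2_eq_square)
  finally show ?thesis by (simp only: mult.assoc)
qed

lemma err2_L2: "0 < p \<Longrightarrow> (\<integral>\<^sup>+h. ennreal ((err2 h)\<^sup>2) \<partial>G) \<le>
    ennreal (4 * (real (Suc n) / real p * (\<Sum>r<p. (lam r * shift r)\<^sup>2)))"
proof -
  assume p: "0 < p"
  have eq: "err2 h = 2 * sqN / sqrt (real p) * (\<Sum>r<p. (lam r * shift r) * h (n, r))" for h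
    by (simp add: err2_def)
  have "(\<integral>\<^sup>+h. ennreal ((err2 h)\<^sup>2) \<partial>G) \<le> ennreal ((2 * sqN / sqrt (real p))\<^sup>2 * (\<Sum>r<p. (lam r * shift r)\<^sup>2))"
    unfolding eq
  proof (rule nn_integral_scaled_square)
    show "(\<lambda>h. \<Sum>r<p. (lam r * shift r) * h (n, r)) \<in> borel_measurable G"
      by (intro borel_measurable_sum borel_measurable_times gauss_entry_measurable borel_measurable_const) auto
  qed (subst row_linear_L2; simp)
  also have "(2 * sqN / sqrt (real p))\<^sup>2 = 4 * (real (Suc n) / real p)"
    using p unfolding sqN_pos(2)[symmetric] by (simp add: power_divide power_mult_distrib power2_eq_square)
  finally show ?thesis by (simp only: mult.assoc)
qed

lemma trS_eq: "trS h = (\<Sum>r<p. lam r) + (\<Sum>j<n. dev h j) / real n"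
proof -
  have "row_inner p lam h j j = dev h j + (\<Sum>r<p. lam r)" for j
    unfolding row_inner_def dev_def sum.distrib[symmetric]
    by (intro sum.cong refl) (simp add: power2_eq_square algebra_simps)
  then have "(\<Sum>j<n. row_inner p lam h j j) = (\<Sum>j<n. dev h j) + real n * (\<Sum>r<p. lam r)"
    by (simp add: sum.distrib)
  then show ?thesis unfolding trS_def mat_tr_sample_cov using n_pos by (simp add: add_divide_distrib)
qed

lemma sum_dev_L2: "(\<integral>\<^sup>+h. ennreal ((\<Sum>j<n. dev h j)\<^sup>2) \<partial>G) = ennreal (2 * (real n * (\<Sum>r<p. (lam r)\<^sup>2)))"
  unfolding dev_def by (rule block_chisq_L2) simp

lemma sum_dev_measurable[measurable]: "(\<lambda>h. \<Sum>j<n. dev h j) \<in> borel_measurable G"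
  by (intro borel_measurable_sum dev_measurable) auto

lemma trErr_measurable[measurable]: "trErr \<in> borel_measurable G"
  unfolding trErr_def[abs_def] trS_eq by measurable

lemma trErr_L2: "0 < p \<Longrightarrow> (\<integral>\<^sup>+h. ennreal ((trErr h)\<^sup>2) \<partial>G) \<le> ennreal (2 * ((\<Sum>r<p. (lam r)\<^sup>2) / real p) / real p)"
proof -
  assume p: "0 < p"
  have eq: "trErr h = (sqrt (real n) / (real n * real p)) * (\<Sum>j<n. dev h j)" for h
    by (simp add: trErr_def trS_eq)
  have "(\<integral>\<^sup>+h. ennreal ((trErr h)\<^sup>2) \<partial>G) \<le>
     ennreal ((sqrt (real n) / (real n * real p))\<^sup>2 * (2 * (real n * (\<Sum>r<p. (lam r)\<^sup>2))))"
    unfolding eq by (rule nn_integral_scaled_square) (simp_all add: sum_dev_L2)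
  also have "(sqrt (real n) / (real n * real p))\<^sup>2 * (2 * (real n * (\<Sum>r<p. (lam r)\<^sup>2))) =
     2 * ((\<Sum>r<p. (lam r)\<^sup>2) / real p) / real p"
    using n_pos p by (simp add: power_divide power_mult_distrib power2_eq_square)
  finally show ?thesis .
qed

lemma Dtot_L2: "0 < p \<Longrightarrow> (\<integral>\<^sup>+h. ennreal ((Dtot h)\<^sup>2) \<partial>G) \<le> ennreal (12 * real n ^ 3 * (\<Sum>r<p. (lam r)\<^sup>2)\<^sup>2)"
proof -
  assume p: "0 < p"
  have "(\<integral>\<^sup>+h. ennreal ((Dtot h)\<^sup>2) \<partial>G) = (\<integral>\<^sup>+h. ennreal ((Dtot h)\<^sup>2) \<partial>gauss ({..<n} \<times> {..<p}))"
  proof (rule nn_integral_gauss_subrows)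
    show "(\<lambda>h. ennreal ((Dtot h)\<^sup>2)) \<in> borel_measurable (\<Pi>\<^sub>M i\<in>{..<n} \<times> {..<p}. borel)"
      using Dtot_measurable' by measurable
    show "ennreal ((Dtot h)\<^sup>2) = ennreal ((Dtot h')\<^sup>2)"
      if "\<And>i r. i < n \<Longrightarrow> r < p \<Longrightarrow> h (i, r) = h' (i, r)" for h h'
      unfolding Dtot_def row_inner_def row_sq_def using that
      by (intro arg_cong[where f="\<lambda>x. ennreal (x\<^sup>2)"] sum.cong refl arg_cong2[where f="(-)"] arg_cong[where f="\<lambda>x. x\<^sup>2"]) auto
  qed simp
  also have "\<dots> \<le> ennreal (12 * real n ^ 3 * (\<Sum>r<p. (lam r)\<^sup>2)\<^sup>2)"
    unfolding Dtot_def by (rule row_inner_total_L2[OF p])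
  finally show ?thesis .
qed

lemma Etot_L2: "(\<integral>\<^sup>+h. ennreal ((Etot h)\<^sup>2) \<partial>G) = ennreal (2 * (real n * (\<Sum>r<p. (lam r) ^ 4)))"
  unfolding Etot_def by (subst block_chisq_L2) (auto simp: power_mult[symmetric])

text \<open>The square root turns the first moment of a nonnegative variable into a second moment, so that the
  mean square criterion covers this term as well.\<close>

lemma sqrt_dev_L2: "(\<integral>\<^sup>+h. ennreal ((sqrt (\<Sum>j<n. (dev h j)\<^sup>2))\<^sup>2) \<partial>G) = ennreal (2 * (real n * (\<Sum>r<p. (lam r)\<^sup>2)))"
proof -
  have "(\<integral>\<^sup>+h. ennreal ((sqrt (\<Sum>j<n. (dev h j)\<^sup>2))\<^sup>2) \<partial>G) = (\<integral>\<^sup>+h. (\<Sum>j<n. ennreal ((dev h j)\<^sup>2)) \<partial>G)"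
    by (intro nn_integral_cong) (simp add: sum_nonneg sum_ennreal)
  also have "\<dots> = (\<Sum>j<n. \<integral>\<^sup>+h. ennreal ((dev h j)\<^sup>2) \<partial>G)"
    using dev_measurable by (intro nn_integral_sum) auto
  also have "\<dots> = (\<Sum>j<n. ennreal (2 * (\<Sum>r<p. (lam r)\<^sup>2)))"
    unfolding dev_def by (intro sum.cong refl row_chisq_L2) auto
  also have "\<dots> = ennreal (2 * (real n * (\<Sum>r<p. (lam r)\<^sup>2)))"
    by (subst sum_ennreal) (auto intro!: sum_nonneg simp: mult_ac)
  finally show ?thesis .
qed

text \<open>The traces are expanded into diagonal and off-diagonal inner products of the residual rows. Subtracting
  the squared trace cancels the dominant diagonal terms exactly. The four random terms that remain
  are controlled by their second moments.\<close>

lemma a_hat2_decomposition: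
  assumes n: "2 \<le> n" and p: "0 < p"
  defines "\<kappa> \<equiv> real p * (real n + 2) * (real n - 1)"
  shows "a_hat2 (Suc n) p (obs h) = Dtot h / \<kappa> + Etot h / (real p * (real n + 2)) +
    real n / (real n + 2) * ((\<Sum>r<p. (lam r)\<^sup>2) / real p) +
    ((sqrt (\<Sum>j<n. (dev h j)\<^sup>2) / sqrt \<kappa>)\<^sup>2 - ((\<Sum>j<n. dev h j) / sqrt (real n * \<kappa>))\<^sup>2)"
proof -
  define A1 where "A1 = (\<Sum>r<p. lam r)"
  define A2 where "A2 = (\<Sum>r<p. (lam r)\<^sup>2)"
  define x where "x = real n"
  have x: "x \<ge> 2" using n by (simp add: x_def)
  have \<kappa>: "\<kappa> > 0" "\<kappa> = real p * (x + 2) * (x - 1)" unfolding \<kappa>_def x_def[symmetric] using x p by auto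
  define S1 where "S1 = (\<Sum>j<n. dev h j)"
  define S2 where "S2 = (\<Sum>j<n. (dev h j)\<^sup>2)"
  have S2: "S2 \<ge> 0" unfolding S2_def by (intro sum_nonneg) auto
  have ii: "row_inner p lam h j j = dev h j + A1" for j
    unfolding row_inner_def dev_def A1_def sum.distrib[symmetric]
    by (intro sum.cong refl) (simp add: power2_eq_square algebra_simps)
  have s: "(\<Sum>j<n. row_sq p lam h j) = Etot h + x * A2"
  proof -
    have "row_sq p lam h j = (\<Sum>r<p. (lam r)\<^sup>2 * ((h (j, r))\<^sup>2 - 1)) + A2" for j
      unfolding row_sq_def A2_def sum.distrib[symmetric] by (intro sum.cong refl) (simp add: algebra_simps)
    then show ?thesis unfolding Etot_def by (simp add: sum.distrib x_def)
  qed
  have sq1: "(\<Sum>j<n. row_inner p lam h j j) = S1 + x * A1" by (simp add: ii S1_def sum.distrib x_def)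
  have sq2: "(\<Sum>j<n. (row_inner p lam h j j)\<^sup>2) = S2 + 2 * A1 * S1 + x * A1\<^sup>2"
    by (simp add: ii S1_def S2_def power2_sum sum.distrib x_def sum_distrib_left mult_ac)
  have tot: "(\<Sum>j<n. \<Sum>k<n. (row_inner p lam h j k)\<^sup>2) =
     S2 + 2 * A1 * S1 + x * A1\<^sup>2 + Dtot h + (x - 1) * (Etot h + x * A2)"
  proof -
    have "(\<Sum>k<n. (row_inner p lam h j k)\<^sup>2) = (row_inner p lam h j j)\<^sup>2 +
        (\<Sum>k\<in>{..<n} - {j}. (row_inner p lam h j k)\<^sup>2 - row_sq p lam h j) + (x - 1) * row_sq p lam h j"
      if "j < n" for j
    proof -
      have "(\<Sum>k\<in>{..<n} - {j}. (row_inner p lam h j k)\<^sup>2 - row_sq p lam h j) =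
         (\<Sum>k\<in>{..<n} - {j}. (row_inner p lam h j k)\<^sup>2) - (x - 1) * row_sq p lam h j"
        using that n by (simp add: sum_subtractf x_def of_nat_diff)
      then show ?thesis using that by (simp add: sum.remove[of "{..<n}" j])
    qed
    then have "(\<Sum>j<n. \<Sum>k<n. (row_inner p lam h j k)\<^sup>2) = (\<Sum>j<n. (row_inner p lam h j j)\<^sup>2) + Dtot h
        + (x - 1) * (\<Sum>j<n. row_sq p lam h j)"
      by (simp add: Dtot_def sum.distrib sum_distrib_left)
    then show ?thesis by (simp add: sq2 s)
  qed
  have "a_hat2 (Suc n) p (obs h) = x\<^sup>2 / \<kappa> * ((S2 + 2 * A1 * S1 + x * A1\<^sup>2 + Dtot h + (x - 1) * (Etot h + x * A2)) / x\<^sup>2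
      - ((S1 + x * A1) / x)\<^sup>2 / x)"
    unfolding a_hat2_def Let_def mat_tr_sample_cov_square mat_tr_sample_cov tot sq1
    by (simp add: \<kappa>(2) x_def)
  also have "\<dots> = (S2 + 2 * A1 * S1 + x * A1\<^sup>2 + Dtot h + (x - 1) * (Etot h + x * A2) - (S1 + x * A1)\<^sup>2 / x) / \<kappa>"
  proof -
    have "x\<^sup>2 * (((S1 + x * A1) / x)\<^sup>2 / x) = (S1 + x * A1)\<^sup>2 / x" using x by (simp add: power_divide)
    then show ?thesis using x
      by (simp add: right_diff_distrib diff_divide_distrib)
  qed
  also have "(S1 + x * A1)\<^sup>2 / x = S1\<^sup>2 / x + 2 * A1 * S1 + x * A1\<^sup>2"
    using x by (simp add: power2_eq_square field_simps)
  also have "(S2 + 2 * A1 * S1 + x * A1\<^sup>2 + Dtot h + (x - 1) * (Etot h + x * A2) - (S1\<^sup>2 / x + 2 * A1 * S1 + x * A1\<^sup>2)) / \<kappa> =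
     Dtot h / \<kappa> + (x - 1) * (Etot h + x * A2) / \<kappa> + (S2 / \<kappa> - S1\<^sup>2 / (x * \<kappa>))"
    by (simp add: add_divide_distrib diff_divide_distrib)
  also have "(x - 1) * (Etot h + x * A2) / \<kappa> = Etot h / (real p * (x + 2)) + x / (x + 2) * (A2 / real p)"
  proof -
    have c: "(x - 1) * Z / (real p * (x + 2) * (x - 1)) = Z / (real p * (x + 2))" for Z
      using x by simp
    have "x * A2 / (real p * (x + 2)) = x / (x + 2) * (A2 / real p)" by (simp add: mult_ac)
    then show ?thesis unfolding \<kappa>(2) c add_divide_distrib by simp
  qed
  also have "S2 / \<kappa> = (sqrt S2 / sqrt \<kappa>)\<^sup>2" using S2 \<kappa> by (simp add: power_divide)
  also have "S1\<^sup>2 / (x * \<kappa>) = (S1 / sqrt (x * \<kappa>))\<^sup>2" using x \<kappa>(1) by (simp add: power_divide)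
  finally show ?thesis by (simp add: A2_def S1_def S2_def x_def)
qed

end

section \<open>Asymptotics of the components\<close>

text \<open>The exact second moments carry awkward normalizing constants; the bound e replaces them by simple
  expressions with an evident limit.\<close>

lemma tends_in_prob_L2_scaled:
  assumes "\<And>k. Y k \<in> borel_measurable (M k)"
    and "\<And>k. (\<integral>\<^sup>+h. ennreal ((Y k h)\<^sup>2) \<partial>M k) \<le> ennreal (b k)"
    and "\<And>k. (s k)\<^sup>2 * b k \<le> e k" "e \<longlonglongrightarrow> 0"
  shows "tends_in_prob M (\<lambda>k h. s k * Y k h) (0 :: real)"
proof (rule tends_in_prob_L2[OF _ assms(4)], intro always_eventually allI conjI)
  fix k
  show "(\<lambda>h. s k * Y k h) \<in> borel_measurable (M k)" using assms(1)[of k] by measurable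
  have "(\<integral>\<^sup>+h. ennreal ((s k * Y k h)\<^sup>2) \<partial>M k) \<le> ennreal ((s k)\<^sup>2 * b k)"
    by (rule nn_integral_scaled_square[OF assms(1) assms(2)])
  also have "\<dots> \<le> ennreal (e k)" by (rule ennreal_leI[OF assms(3)])
  finally show "(\<integral>\<^sup>+h. ennreal ((s k * Y k h)\<^sup>2) \<partial>M k) \<le> ennreal (e k)" .
qed

text \<open>Along the whole sequence p is positive and smaller than n, which in the intended situation holds
  after finitely many indices have been dropped.\<close>

locale gaussian_sequence =
  fixes p :: "nat \<Rightarrow> nat" and \<Sigma> Q lam and n :: "nat \<Rightarrow> nat" and \<mu> \<mu>0 R
    and c LD LI LS :: real and a :: "nat \<Rightarrow> real"
  assumes sample: "\<And>k. gaussian_sample (p k) (\<Sigma> k) (Q k) (lam k) (n k) (\<mu> k) (\<mu>0 k) (R k)"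
    and dims: "\<And>k. 0 < p k" "\<And>k. p k < n k"
    and growth: "filterlim n at_top sequentially" "filterlim p at_top sequentially"
    and ratio: "(\<lambda>k. real (p k) / real (n k)) \<longlonglongrightarrow> c" "0 < c" "c < 1"
    and moments: "\<And>i. i \<in> {1..4} \<Longrightarrow> (\<lambda>k. (\<Sum>r<p k. lam k r ^ i) / real (p k)) \<longlonglongrightarrow> a i"
    and a_pos: "0 < a 1" "0 < a 2"
    and shifts: "(\<lambda>k. sqrt (real (n k)) * (\<Sum>r<p k. (gaussian_sample.shift (p k) (Q k) (lam k) (\<mu> k) (\<mu>0 k) r)\<^sup>2)) \<longlonglongrightarrow> LD"
      "(\<lambda>k. sqrt (real (n k)) * (\<Sum>r<p k. lam k r * (gaussian_sample.shift (p k) (Q k) (lam k) (\<mu> k) (\<mu>0 k) r)\<^sup>2)) \<longlonglongrightarrow> LI"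
      "(\<lambda>k. sqrt (real (n k)) * (\<Sum>r<p k. (lam k r * gaussian_sample.shift (p k) (Q k) (lam k) (\<mu> k) (\<mu>0 k) r)\<^sup>2)) \<longlonglongrightarrow> LS"
begin

sublocale s: gaussian_sample "p k" "\<Sigma> k" "Q k" "lam k" "n k" "\<mu> k" "\<mu>0 k" "R k" for k
  by (rule sample)

lemma n_gt: "0 < real (n k)" "0 < real (p k)" "p k \<le> n k" "2 \<le> n k"
  using dims[of k] by auto

lemma real_n_at_top: "filterlim (\<lambda>k. real (n k)) at_top sequentially"
  by (rule filterlim_compose[OF filterlim_real_sequentially growth(1)])

lemma real_p_at_top: "filterlim (\<lambda>k. real (p k)) at_top sequentially"
  by (rule filterlim_compose[OF filterlim_real_sequentially growth(2)])

lemma inverse_limits: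
  "(\<lambda>k. 1 / real (n k)) \<longlonglongrightarrow> 0" "(\<lambda>k. 1 / real (p k)) \<longlonglongrightarrow> 0"
  "(\<lambda>k. 1 / sqrt (real (n k))) \<longlonglongrightarrow> 0" "(\<lambda>k. 1 / sqrt (real (p k))) \<longlonglongrightarrow> 0"
  by (rule real_tendsto_divide_at_top[OF tendsto_const] real_n_at_top real_p_at_top
      filterlim_compose[OF sqrt_at_top real_n_at_top] filterlim_compose[OF sqrt_at_top real_p_at_top])+

lemma ratio_limits:
  "(\<lambda>k. sqrt (real (p k) / real (n k))) \<longlonglongrightarrow> sqrt c"
  "(\<lambda>k. sqrt (real (n k) / real (p k))) \<longlonglongrightarrow> 1 / sqrt c"
  "(\<lambda>k. real (Suc (n k)) / real (n k)) \<longlonglongrightarrow> 1"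
  "(\<lambda>k. real (Suc (n k)) / real (p k)) \<longlonglongrightarrow> 1 / c"
  "(\<lambda>k. real (Suc (n k) - p k) / real (n k)) \<longlonglongrightarrow> 1 - c"
  "(\<lambda>k. real (p k) / real (Suc (n k) - p k)) \<longlonglongrightarrow> c / (1 - c)"
  "(\<lambda>k. real (n k) / (real (n k) + 2)) \<longlonglongrightarrow> 1"
proof -
  show "(\<lambda>k. sqrt (real (p k) / real (n k))) \<longlonglongrightarrow> sqrt c" by (intro tendsto_real_sqrt ratio)
  have i: "(\<lambda>k. 1 / (real (p k) / real (n k))) \<longlonglongrightarrow> 1 / c" using ratio by (intro tendsto_intros) auto
  then have np: "(\<lambda>k. real (n k) / real (p k)) \<longlonglongrightarrow> 1 / c" by simp
  show "(\<lambda>k. sqrt (real (n k) / real (p k))) \<longlonglongrightarrow> 1 / sqrt c"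
    using tendsto_real_sqrt[OF np] by (simp add: real_sqrt_divide)
  have "(\<lambda>k. 1 + 1 / real (n k)) \<longlonglongrightarrow> 1 + 0" by (intro tendsto_intros inverse_limits)
  then show sn: "(\<lambda>k. real (Suc (n k)) / real (n k)) \<longlonglongrightarrow> 1"
    using n_gt(1) by (simp add: add_divide_distrib add.commute order_less_imp_not_eq2)
  have "(\<lambda>k. real (n k) / real (p k) + 1 / real (p k)) \<longlonglongrightarrow> 1 / c + 0"
    by (intro tendsto_intros inverse_limits np)
  then show "(\<lambda>k. real (Suc (n k)) / real (p k)) \<longlonglongrightarrow> 1 / c"
    by (simp add: add_divide_distrib add.commute)
  have "(\<lambda>k. real (Suc (n k)) / real (n k) - real (p k) / real (n k)) \<longlonglongrightarrow> 1 - c"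
    by (intro tendsto_diff sn ratio)
  then show d: "(\<lambda>k. real (Suc (n k) - p k) / real (n k)) \<longlonglongrightarrow> 1 - c"
    by (rule Lim_transform_eventually)
      (use dims(2) in \<open>auto intro!: always_eventually simp: diff_divide_distrib[symmetric] of_nat_diff less_imp_le_nat le_SucI\<close>)
  have "(\<lambda>k. (real (p k) / real (n k)) / (real (Suc (n k) - p k) / real (n k))) \<longlonglongrightarrow> c / (1 - c)"
    using ratio by (intro tendsto_divide d) auto
  then show "(\<lambda>k. real (p k) / real (Suc (n k) - p k)) \<longlonglongrightarrow> c / (1 - c)" using n_gt(1) by (simp add: order_less_imp_not_eq2)
  have "(\<lambda>k. 1 / (1 + 2 * (1 / real (n k)))) \<longlonglongrightarrow> 1 / (1 + 2 * 0)"
    by (intro tendsto_intros inverse_limits) auto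
  moreover have "1 / (1 + 2 * (1 / real (n k))) = real (n k) / (real (n k) + 2)" for k
    using n_gt(1)[of k] by (simp add: field_simps)
  ultimately show "(\<lambda>k. real (n k) / (real (n k) + 2)) \<longlonglongrightarrow> 1" by simp
qed

lemma shift_limits:
  "(\<lambda>k. \<Sum>r<p k. (s.shift k r)\<^sup>2) \<longlonglongrightarrow> 0" "(\<lambda>k. \<Sum>r<p k. (lam k r * s.shift k r)\<^sup>2) \<longlonglongrightarrow> 0"
proof -
  have "(\<lambda>k. 1 / sqrt (real (n k)) * (sqrt (real (n k)) * x k)) \<longlonglongrightarrow> 0 * l \<Longrightarrow> x \<longlonglongrightarrow> 0" for x l
    using n_gt(1) by (simp add: order_less_imp_not_eq2)
  note * = this[OF tendsto_mult[OF inverse_limits(3)]]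
  show "(\<lambda>k. \<Sum>r<p k. (s.shift k r)\<^sup>2) \<longlonglongrightarrow> 0" "(\<lambda>k. \<Sum>r<p k. (lam k r * s.shift k r)\<^sup>2) \<longlonglongrightarrow> 0"
    by (rule *, rule shifts)+
qed

lemma moment_2: "(\<lambda>k. (\<Sum>r<p k. (lam k r)\<^sup>2) / real (p k)) \<longlonglongrightarrow> a 2"
  using moments[of 2] by simp

lemma U_bounded: "bounded_in_prob s.G s.U1" "bounded_in_prob s.G s.U2" "bounded_in_prob s.G s.U3"
proof -
  show "bounded_in_prob s.G s.U1"
    by (rule bounded_in_prob_L2[where b=2]) (use s.U1_measurable s.U1_L2 dims in auto)
  show "bounded_in_prob s.G s.U3"
    by (rule bounded_in_prob_L2[where b=2]) (use s.U3_measurable s.U3_L2 dims n_gt in auto)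
  have "\<forall>\<^sub>F k in sequentially. (\<Sum>r<p k. (lam k r)\<^sup>2) / real (p k) < a 2 + 1"
    by (rule order_tendstoD[OF moment_2]) simp
  then have "\<forall>\<^sub>F k in sequentially. s.U2 k \<in> borel_measurable (s.G k) \<and>
     (\<integral>\<^sup>+h. ennreal ((s.U2 k h)\<^sup>2) \<partial>s.G k) \<le> ennreal (2 * (a 2 + 1))"
  proof eventually_elim
    case (elim k)
    then have "ennreal (2 * ((\<Sum>r<p k. (lam k r)\<^sup>2) / real (p k))) \<le> ennreal (2 * (a 2 + 1))"
      by (intro ennreal_leI) auto
    then show ?case using s.U2_L2[of k] s.U2_measurable[of k] by (auto intro: order_trans)
  qed
  then show "bounded_in_prob s.G s.U2" by (rule bounded_in_prob_L2)
qed

lemma err_negligible: "tends_in_prob s.G s.err1 0" "tends_in_prob s.G s.err2 0" "tends_in_prob s.G s.trErr 0"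
proof -
  have "(\<lambda>k. 4 * (real (Suc (n k)) / real (p k) * (\<Sum>r<p k. (s.shift k r)\<^sup>2))) \<longlonglongrightarrow> 4 * (1 / c * 0)"
    "(\<lambda>k. 4 * (real (Suc (n k)) / real (p k) * (\<Sum>r<p k. (lam k r * s.shift k r)\<^sup>2))) \<longlonglongrightarrow> 4 * (1 / c * 0)"
    "(\<lambda>k. 2 * ((\<Sum>r<p k. (lam k r)\<^sup>2) / real (p k)) * (1 / real (p k))) \<longlonglongrightarrow> 2 * a 2 * 0"
    by (intro tendsto_mult tendsto_const ratio_limits shift_limits moment_2 inverse_limits)+
  then have l: "(\<lambda>k. 4 * (real (Suc (n k)) / real (p k) * (\<Sum>r<p k. (s.shift k r)\<^sup>2))) \<longlonglongrightarrow> 0"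
    "(\<lambda>k. 4 * (real (Suc (n k)) / real (p k) * (\<Sum>r<p k. (lam k r * s.shift k r)\<^sup>2))) \<longlonglongrightarrow> 0"
    "(\<lambda>k. 2 * ((\<Sum>r<p k. (lam k r)\<^sup>2) / real (p k)) / real (p k)) \<longlonglongrightarrow> 0" by simp_all
  show "tends_in_prob s.G s.err1 0"
    by (rule tends_in_prob_L2[OF _ l(1)]) (intro always_eventually allI conjI s.err1_measurable s.err1_L2 dims)
  show "tends_in_prob s.G s.err2 0"
    by (rule tends_in_prob_L2[OF _ l(2)]) (intro always_eventually allI conjI s.err2_measurable s.err2_L2 dims)
  show "tends_in_prob s.G s.trErr 0"
    by (rule tends_in_prob_L2[OF _ l(3)]) (intro always_eventually allI conjI s.trErr_measurable s.trErr_L2 dims)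
qed

lemma V_limit: "tends_in_prob s.G (\<lambda>k h. s.V k h / real (n k)) (1 - c)"
proof -
  have "tends_in_prob s.G (\<lambda>k h. 1 / sqrt (real (n k)) * s.U3 k h) 0"
    by (rule tends_in_prob_bounded_mult[OF tends_in_prob_const[OF inverse_limits(3)] U_bounded(3)])
  from tends_in_prob_add[OF this tends_in_prob_const[OF ratio_limits(5)]]
  have t: "tends_in_prob s.G (\<lambda>k h. 1 / sqrt (real (n k)) * s.U3 k h + real (Suc (n k) - p k) / real (n k)) (1 - c)"
    by simp
  have "1 / sqrt (real (n k)) * s.U3 k h + real (Suc (n k) - p k) / real (n k) = s.V k h / real (n k)" for k h
    using n_gt(1)[of k] by (simp add: s.U3_def diff_divide_distrib)
  then show ?thesis using t by simp
qed

lemma tr_limit: "tends_in_prob s.G (\<lambda>k h. s.trS k h / real (p k)) (a 1)"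
proof -
  have m: "(\<lambda>k. (\<Sum>r<p k. lam k r) / real (p k)) \<longlonglongrightarrow> a 1" using moments[of 1] by simp
  have "tends_in_prob s.G (\<lambda>k h. 1 / sqrt (real (n k)) * s.trErr k h) (0 * 0)"
    by (rule tends_in_prob_mult[OF tends_in_prob_const[OF inverse_limits(3)] err_negligible(3)])
  from tends_in_prob_add[OF this tends_in_prob_const[OF m]]
  have t: "tends_in_prob s.G (\<lambda>k h. 1 / sqrt (real (n k)) * s.trErr k h + (\<Sum>r<p k. lam k r) / real (p k)) (a 1)"
    by simp
  have "1 / sqrt (real (n k)) * s.trErr k h + (\<Sum>r<p k. lam k r) / real (p k) = s.trS k h / real (p k)" for k h
    using n_gt(1)[of k] by (simp add: s.trErr_def diff_divide_distrib)
  then show ?thesis using t by simp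
qed

lemma a_hat1_limit: "tends_in_prob s.G (\<lambda>k h. a_hat1 (Suc (n k)) (p k) (s.obs k h)) (a 1)"
  using tr_limit by (simp add: a_hat1_def s.trS_def)

end

section \<open>Limiting power for a consistent weight\<close>

lemma isCont_sigma_T:
  assumes "c' \<noteq> 0" "c' \<noteq> 1" "b1 \<noteq> 0"
  shows "isCont (\<lambda>(\<rho>, c', b1, b2). sigma_T \<rho> c' b1 b2) (r, c', b1, b2)"
  unfolding sigma_T_def case_prod_beta using assms by (auto intro!: continuous_intros)

lemma isCont_rho_star:
  assumes "0 < c'" "c' < 1" "0 < b1" "0 < b2"
  shows "isCont (\<lambda>(c', b1, b2). rho_star c' b1 b2) (c', b1, b2)"
proof -
  have "0 < b1 * c' * sqrt (b2 * (1 - c')) / (b2 * (1 - c')\<^sup>2)" using assms by simp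
  then have nz: "b1 * c' * sqrt (b2 * (1 - c')) / (b2 * (1 - c')\<^sup>2) + 1 \<noteq> 0" by linarith
  show ?thesis
    unfolding rho_star_def case_prod_beta using assms
    by (intro continuous_intros) (use nz in \<open>auto\<close>)
qed

context gaussian_sample
begin

lemma obs_measurable_sample: "measurable_sample G (Suc n) p obs"
proof
  fix i j assume i: "i \<in> {1..Suc n}" and j: "j < p"
  have "(\<lambda>h. \<mu> $ j + (\<Sum>r<p. root j r * (\<Sum>l<Suc n. R (i - 1) l * h (l, r)))) \<in> borel_measurable G"
    by (intro borel_measurable_add borel_measurable_sum borel_measurable_times borel_measurable_const
        gauss_entry_measurable) auto
  then show "(\<lambda>h. obs h i $ j) \<in> borel_measurable G" using j by (simp add: obs_def rot_def)
qed

end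

context gaussian_sequence
begin

lemma a_hat2_limit: "tends_in_prob s.G (\<lambda>k h. a_hat2 (Suc (n k)) (p k) (s.obs k h)) (a 2)"
proof -
  define A2 where "A2 k = (\<Sum>r<p k. (lam k r)\<^sup>2) / real (p k)" for k
  define A4 where "A4 k = (\<Sum>r<p k. (lam k r) ^ 4) / real (p k)" for k
  define \<kappa> where "\<kappa> k = real (p k) * (real (n k) + 2) * (real (n k) - 1)" for k
  have A2: "A2 \<longlonglongrightarrow> a 2" and A4: "A4 \<longlonglongrightarrow> a 4"
    unfolding A2_def A4_def using moments[of 2] moments[of 4] by simp_all
  have A2_nonneg: "0 \<le> A2 k" and A4_nonneg: "0 \<le> A4 k" for k
    unfolding A2_def A4_def by (auto intro!: divide_nonneg_nonneg sum_nonneg)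
  have sums: "(\<Sum>r<p k. (lam k r)\<^sup>2) = real (p k) * A2 k" "(\<Sum>r<p k. (lam k r) ^ 4) = real (p k) * A4 k" for k
    unfolding A2_def A4_def using n_gt(2)[of k] by auto
  have n2: "2 \<le> real (n k)" for k using n_gt(4)[of k] by linarith
  have \<kappa>_ge: "real (p k) * (real (n k))\<^sup>2 \<le> \<kappa> k" for k
  proof -
    have "(real (n k))\<^sup>2 \<le> (real (n k) + 2) * (real (n k) - 1)"
      using n2[of k] by (simp add: power2_eq_square algebra_simps)
    then show ?thesis unfolding \<kappa>_def mult.assoc by (rule mult_left_mono) simp
  qed
  have \<kappa>_pos: "0 < \<kappa> k" for k
    using n2[of k] n_gt(2)[of k] by (simp add: \<kappa>_def)
  have D: "tends_in_prob s.G (\<lambda>k h. 1 / \<kappa> k * s.Dtot k h) 0"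
  proof (rule tends_in_prob_L2_scaled[OF s.Dtot_measurable s.Dtot_L2[OF dims(1)]])
    show "(\<lambda>k. 12 * (A2 k)\<^sup>2 * (1 / real (n k))) \<longlonglongrightarrow> 0"
      using tendsto_mult[OF tendsto_mult[OF tendsto_const[of 12] tendsto_power[OF A2, of 2]] inverse_limits(1)] by simp
    fix k
    have "(real (p k) * (real (n k))\<^sup>2)\<^sup>2 \<le> (\<kappa> k)\<^sup>2" by (intro power_mono \<kappa>_ge) simp
    then have "12 * real (n k) ^ 3 * (real (p k) * A2 k)\<^sup>2 / (\<kappa> k)\<^sup>2 \<le>
        12 * real (n k) ^ 3 * (real (p k) * A2 k)\<^sup>2 / (real (p k) * (real (n k))\<^sup>2)\<^sup>2"
      using n_gt(1,2)[of k] \<kappa>_pos[of k] by (intro divide_left_mono) auto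
    also have "\<dots> = 12 * (A2 k)\<^sup>2 * (1 / real (n k))"
      using n_gt(1,2)[of k] by (simp add: power_mult_distrib field_simps power_numeral_reduce)
    finally show "(1 / \<kappa> k)\<^sup>2 * (12 * real (n k) ^ 3 * (\<Sum>r<p k. (lam k r)\<^sup>2)\<^sup>2) \<le> 12 * (A2 k)\<^sup>2 * (1 / real (n k))"
      by (simp add: sums power_divide)
  qed
  have E: "tends_in_prob s.G (\<lambda>k h. 1 / (real (p k) * (real (n k) + 2)) * s.Etot k h) 0"
  proof (rule tends_in_prob_L2_scaled[OF s.Etot_measurable eq_refl[OF s.Etot_L2]])
    show "(\<lambda>k. 2 * A4 k * (1 / real (p k)) * (1 / real (n k))) \<longlonglongrightarrow> 0"
      using tendsto_mult[OF tendsto_mult[OF tendsto_mult[OF tendsto_const[of 2] A4] inverse_limits(2)] inverse_limits(1)]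
      by simp
    fix k
    have "(real (p k) * real (n k))\<^sup>2 \<le> (real (p k) * (real (n k) + 2))\<^sup>2"
      by (intro power_mono mult_left_mono) auto
    then have "2 * (real (n k) * (real (p k) * A4 k)) / (real (p k) * (real (n k) + 2))\<^sup>2 \<le>
        2 * (real (n k) * (real (p k) * A4 k)) / (real (p k) * real (n k))\<^sup>2"
      using n_gt(1,2)[of k] A4_nonneg[of k] by (intro divide_left_mono mult_nonneg_nonneg mult_pos_pos zero_less_power) auto
    also have "\<dots> = 2 * A4 k * (1 / real (p k)) * (1 / real (n k))"
      using n_gt(1,2)[of k] by (simp add: power2_eq_square)
    finally show "(1 / (real (p k) * (real (n k) + 2)))\<^sup>2 * (2 * (real (n k) * (\<Sum>r<p k. (lam k r) ^ 4))) \<le>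
        2 * A4 k * (1 / real (p k)) * (1 / real (n k))"
      by (simp add: sums power_divide)
  qed
  have Y1: "tends_in_prob s.G (\<lambda>k h. 1 / sqrt (\<kappa> k) * sqrt (\<Sum>j<n k. (s.dev k h j)\<^sup>2)) 0"
  proof (rule tends_in_prob_L2_scaled[OF _ eq_refl[OF s.sqrt_dev_L2]])
    show "(\<lambda>h. sqrt (\<Sum>j<n k. (s.dev k h j)\<^sup>2)) \<in> borel_measurable (s.G k)" for k
      by (intro borel_measurable_sqrt[THEN measurable_compose_rev] borel_measurable_sum borel_measurable_power s.dev_measurable) auto
    show "(\<lambda>k. 2 * A2 k * (1 / real (n k))) \<longlonglongrightarrow> 0"
      using tendsto_mult[OF tendsto_mult[OF tendsto_const[of 2] A2] inverse_limits(1)] by simp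
    fix k
    have "2 * (real (n k) * (real (p k) * A2 k)) / \<kappa> k \<le> 2 * (real (n k) * (real (p k) * A2 k)) / (real (p k) * (real (n k))\<^sup>2)"
      using n_gt(1,2)[of k] A2_nonneg[of k] \<kappa>_ge[of k] \<kappa>_pos[of k]
      by (intro divide_left_mono mult_nonneg_nonneg mult_pos_pos zero_less_power) auto
    also have "\<dots> = 2 * A2 k * (1 / real (n k))"
      using n_gt(1,2)[of k] by (simp add: power2_eq_square)
    finally show "(1 / sqrt (\<kappa> k))\<^sup>2 * (2 * (real (n k) * (\<Sum>r<p k. (lam k r)\<^sup>2))) \<le> 2 * A2 k * (1 / real (n k))"
      using \<kappa>_pos[of k] by (simp add: sums power_divide)
  qed
  have Y2: "tends_in_prob s.G (\<lambda>k h. 1 / sqrt (real (n k) * \<kappa> k) * (\<Sum>j<n k. s.dev k h j)) 0"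
  proof (rule tends_in_prob_L2_scaled[OF s.sum_dev_measurable eq_refl[OF s.sum_dev_L2]])
    show "(\<lambda>k. 2 * A2 k * (1 / real (n k)) * (1 / real (n k))) \<longlonglongrightarrow> 0"
      using tendsto_mult[OF tendsto_mult[OF tendsto_mult[OF tendsto_const[of 2] A2] inverse_limits(1)] inverse_limits(1)] by simp
    fix k
    have "2 * (real (n k) * (real (p k) * A2 k)) / (real (n k) * \<kappa> k) \<le>
        2 * (real (n k) * (real (p k) * A2 k)) / (real (n k) * (real (p k) * (real (n k))\<^sup>2))"
      using n_gt(1,2)[of k] A2_nonneg[of k] \<kappa>_ge[of k] \<kappa>_pos[of k]
      by (intro divide_left_mono mult_left_mono mult_nonneg_nonneg mult_pos_pos zero_less_power) auto
    also have "\<dots> = 2 * A2 k * (1 / real (n k)) * (1 / real (n k))"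
      using n_gt(1,2)[of k] by (simp add: power2_eq_square)
    finally show "(1 / sqrt (real (n k) * \<kappa> k))\<^sup>2 * (2 * (real (n k) * (\<Sum>r<p k. (lam k r)\<^sup>2))) \<le>
        2 * A2 k * (1 / real (n k)) * (1 / real (n k))"
      using \<kappa>_pos[of k] n_gt(1)[of k] by (simp add: sums power_divide)
  qed
  have "tends_in_prob s.G (\<lambda>k h. 1 / \<kappa> k * s.Dtot k h + 1 / (real (p k) * (real (n k) + 2)) * s.Etot k h +
      real (n k) / (real (n k) + 2) * A2 k +
      ((1 / sqrt (\<kappa> k) * sqrt (\<Sum>j<n k. (s.dev k h j)\<^sup>2)) * (1 / sqrt (\<kappa> k) * sqrt (\<Sum>j<n k. (s.dev k h j)\<^sup>2)) -
       (1 / sqrt (real (n k) * \<kappa> k) * (\<Sum>j<n k. s.dev k h j)) * (1 / sqrt (real (n k) * \<kappa> k) * (\<Sum>j<n k. s.dev k h j))))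
      (0 + 0 + 1 * a 2 + (0 * 0 - 0 * 0))"
    by (intro tends_in_prob_add tends_in_prob_diff tends_in_prob_mult tends_in_prob_const[OF tendsto_mult] D E Y1 Y2
        ratio_limits A2)
  moreover have "1 / \<kappa> k * s.Dtot k h + 1 / (real (p k) * (real (n k) + 2)) * s.Etot k h +
      real (n k) / (real (n k) + 2) * A2 k +
      ((1 / sqrt (\<kappa> k) * sqrt (\<Sum>j<n k. (s.dev k h j)\<^sup>2)) * (1 / sqrt (\<kappa> k) * sqrt (\<Sum>j<n k. (s.dev k h j)\<^sup>2)) -
       (1 / sqrt (real (n k) * \<kappa> k) * (\<Sum>j<n k. s.dev k h j)) * (1 / sqrt (real (n k) * \<kappa> k) * (\<Sum>j<n k. s.dev k h j))) =
     a_hat2 (Suc (n k)) (p k) (s.obs k h)" for k h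
    unfolding s.a_hat2_decomposition[OF n_gt(4) dims(1)] A2_def \<kappa>_def power2_eq_square[of "_ / _"] by simp
  ultimately show ?thesis by simp
qed

lemma rho_hat_limit: "tends_in_prob s.G (\<lambda>k h. rho_hat (Suc (n k)) (p k) (s.obs k h)) (rho_star c (a 1) (a 2))"
  using tends_in_prob_isCont[OF tends_in_prob_Pair[OF tends_in_prob_const[OF ratio(1)]
        tends_in_prob_Pair[OF a_hat1_limit a_hat2_limit]] isCont_rho_star] ratio(2,3) a_pos
  by (simp add: rho_hat_def)

lemma sigma_limit:
  assumes "tends_in_prob s.G \<rho> r"
  shows "tends_in_prob s.G (\<lambda>k h. sigma_T (\<rho> k h) (real (p k) / real (n k)) (a_hat1 (Suc (n k)) (p k) (s.obs k h))
     (a_hat2 (Suc (n k)) (p k) (s.obs k h))) (sigma_T r c (a 1) (a 2))"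
  using tends_in_prob_isCont[OF tends_in_prob_Pair[OF assms tends_in_prob_Pair[OF tends_in_prob_const[OF ratio(1)]
        tends_in_prob_Pair[OF a_hat1_limit a_hat2_limit]]] isCont_sigma_T] ratio(2,3) a_pos
  by simp

end

text \<open>The centred chi-squares have variance 2, so a sum of squared weights equal to one half is unit
  variance. The terms in r^2 combine the fluctuations of |z|^2 and of the chi-square
  denominator.\<close>

lemma variance_identity:
  fixes r c b1 b2 s :: real
  assumes c: "0 < c" "c < 1" and b1: "b1 \<noteq> 0" and s: "s \<noteq> 0"
    and s2: "s\<^sup>2 = r\<^sup>2 * (2 * c / (1 - c) ^ 3) + (1 - r)\<^sup>2 * (2 * b2 / (c * b1\<^sup>2)) + 2 * r * (1 - r) * (2 / (1 - c))"
  defines "\<beta>1 \<equiv> r / (1 - c) / s" and "\<beta>2 \<equiv> (1 - r) / b1 / s"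
  shows "\<beta>1\<^sup>2 * c + 2 * \<beta>1 * \<beta>2 * b1 + \<beta>2\<^sup>2 / c * b2 + (1 - c) * (\<beta>1 * c / (1 - c))\<^sup>2 = 1 / 2"
proof -
  define d where "d = 1 - c"
  have d: "d \<noteq> 0" "c = 1 - d" using c by (auto simp: d_def)
  have "\<beta>1\<^sup>2 * c + d * (\<beta>1 * c / d)\<^sup>2 = \<beta>1\<^sup>2 * c * ((d + c) / d)"
    using d(1) by (simp add: power2_eq_square field_simps)
  also have "\<dots> = \<beta>1\<^sup>2 * c / d" using d(2) by simp
  also have "\<dots> = r\<^sup>2 * (c / d ^ 3) / s\<^sup>2"
    unfolding \<beta>1_def d_def[symmetric] by (simp add: power_divide power_numeral_reduce mult_ac)
  finally have 1: "\<beta>1\<^sup>2 * c + d * (\<beta>1 * c / d)\<^sup>2 = r\<^sup>2 * (c / d ^ 3) / s\<^sup>2" .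
  have 2: "2 * \<beta>1 * \<beta>2 * b1 = r * (1 - r) * (2 / d) / s\<^sup>2"
    using b1 unfolding \<beta>1_def \<beta>2_def d_def[symmetric] by (simp add: power2_eq_square mult_ac)
  have 3: "\<beta>2\<^sup>2 / c * b2 = (1 - r)\<^sup>2 * (b2 / (c * b1\<^sup>2)) / s\<^sup>2"
    unfolding \<beta>2_def by (simp add: power_divide power_mult_distrib mult_ac)
  have "\<beta>1\<^sup>2 * c + 2 * \<beta>1 * \<beta>2 * b1 + \<beta>2\<^sup>2 / c * b2 + d * (\<beta>1 * c / d)\<^sup>2 =
     (r\<^sup>2 * (c / d ^ 3) + (1 - r)\<^sup>2 * (b2 / (c * b1\<^sup>2)) + r * (1 - r) * (2 / d)) / s\<^sup>2"
    unfolding add_divide_distrib using 1 2 3 by linarith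
  also have "r\<^sup>2 * (c / d ^ 3) + (1 - r)\<^sup>2 * (b2 / (c * b1\<^sup>2)) + r * (1 - r) * (2 / d) = s\<^sup>2 / 2"
  proof -
    have "2 * r * (1 - r) * (2 / d) / 2 = r * (1 - r) * (2 / d)"
      unfolding mult.assoc by (rule nonzero_mult_div_cancel_left) simp
    then show ?thesis unfolding s2 d_def[symmetric] add_divide_distrib by (simp only:) simp
  qed
  finally show ?thesis using s by (simp add: d_def)
qed

lemma cube_add_le:
  fixes x y :: real
  assumes "0 \<le> x" "0 \<le> y"
  shows "(x + y) ^ 3 \<le> 4 * (x ^ 3 + y ^ 3)"
proof -
  have "4 * (x ^ 3 + y ^ 3) - (x + y) ^ 3 = 3 * ((x + y) * (x - y)\<^sup>2)"
    by (simp add: power2_eq_square power3_eq_cube algebra_simps)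
  moreover have "0 \<le> (x + y) * (x - y)\<^sup>2" using assms by simp
  ultimately show ?thesis by linarith
qed

context gaussian_sequence
begin

text \<open>A deterministic combination of the three fluctuations. U1 and U2 use the same p variables, hence
  the mixed term with \<open>a 1\<close>; U3 is independent of them.\<close>

lemma clt:
  assumes \<alpha>: "0 < \<alpha>" and \<beta>: "0 < \<beta>"
    and var: "\<alpha>\<^sup>2 + 2 * \<alpha> * \<beta> * a 1 + \<beta>\<^sup>2 * a 2 + (1 - c) * \<gamma>\<^sup>2 = 1 / 2"
  shows "(\<lambda>k. measure (s.G k) {h\<in>space (s.G k). \<alpha> * s.U1 k h + \<beta> * s.U2 k h - \<gamma> * s.U3 k h \<le> x}) \<longlonglongrightarrow> Phi x"
proof (rule normal_limit_from_cf)
  note [measurable] = s.U1_measurable s.U2_measurable s.U3_measurable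
  show "prob_space (s.G k)" for k by (rule prob_space_gauss)
  show "(\<lambda>h. \<alpha> * s.U1 k h + \<beta> * s.U2 k h - \<gamma> * s.U3 k h) \<in> borel_measurable (s.G k)" for k
    by measurable
  fix t
  define w where "w k r = (\<alpha> + \<beta> * lam k r) / sqrt (real (p k))" for k r
  define w' where "w' k = - \<gamma> / sqrt (real (n k))" for k
  define A where "A i k = (\<Sum>r<p k. lam k r ^ i) / real (p k)" for i k
  have A: "i \<in> {1..4} \<Longrightarrow> A i \<longlonglongrightarrow> a i" for i unfolding A_def[abs_def] by (rule moments)
  have m: "real (Suc (n k) - p k) = real (n k) * (real (Suc (n k) - p k) / real (n k))" for k
    using n_gt(1)[of k] by simp
  have lam_nonneg: "r < p k \<Longrightarrow> 0 \<le> lam k r" for k r using s.lam_pos[of r k] by simp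
  have "(\<lambda>k. \<alpha>\<^sup>2 + 2 * \<alpha> * \<beta> * A 1 k + \<beta>\<^sup>2 * A 2 k) \<longlonglongrightarrow> \<alpha>\<^sup>2 + 2 * \<alpha> * \<beta> * a 1 + \<beta>\<^sup>2 * a 2"
    by (intro tendsto_intros A) auto
  moreover have "(\<Sum>r<p k. (w k r)\<^sup>2) = \<alpha>\<^sup>2 + 2 * \<alpha> * \<beta> * A 1 k + \<beta>\<^sup>2 * A 2 k" for k
  proof -
    have "(\<Sum>r<p k. (w k r)\<^sup>2) = (\<Sum>r<p k. \<alpha>\<^sup>2 + 2 * \<alpha> * \<beta> * lam k r ^ 1 + \<beta>\<^sup>2 * lam k r ^ 2) / real (p k)"
      unfolding sum_divide_distrib
      by (intro sum.cong refl) (simp add: w_def power_divide power2_sum power_mult_distrib mult_ac)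
    also have "\<dots> = (real (p k) * \<alpha>\<^sup>2 + 2 * \<alpha> * \<beta> * (\<Sum>r<p k. lam k r ^ 1) + \<beta>\<^sup>2 * (\<Sum>r<p k. lam k r ^ 2)) / real (p k)"
      by (simp add: sum.distrib sum_distrib_left)
    finally show ?thesis using n_gt(2)[of k] by (simp add: add_divide_distrib A_def)
  qed
  ultimately have w2: "(\<lambda>k. \<Sum>r<p k. (w k r)\<^sup>2) \<longlonglongrightarrow> \<alpha>\<^sup>2 + 2 * \<alpha> * \<beta> * a 1 + \<beta>\<^sup>2 * a 2" by simp
  have w3: "(\<lambda>k. \<Sum>r<p k. \<bar>w k r\<bar> ^ 3) \<longlonglongrightarrow> 0"
  proof (rule tendsto_sandwich[OF _ _ tendsto_const])
    show "(\<lambda>k. 4 * (\<alpha> ^ 3 + \<beta> ^ 3 * A 3 k) * (1 / sqrt (real (p k)))) \<longlonglongrightarrow> 0"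
      using tendsto_mult[OF tendsto_mult[OF tendsto_const[of 4] tendsto_add[OF tendsto_const[of "\<alpha> ^ 3"]
        tendsto_mult[OF tendsto_const[of "\<beta> ^ 3"] A[of 3]]]] inverse_limits(4)] by simp
    show "\<forall>\<^sub>F k in sequentially. 0 \<le> (\<Sum>r<p k. \<bar>w k r\<bar> ^ 3)"
      by (auto intro!: always_eventually sum_nonneg)
    have "(\<Sum>r<p k. \<bar>w k r\<bar> ^ 3) \<le> 4 * (\<alpha> ^ 3 + \<beta> ^ 3 * A 3 k) * (1 / sqrt (real (p k)))" for k
    proof -
      have q: "sqrt (real (p k)) ^ 3 = real (p k) * sqrt (real (p k))"
        by (simp add: power3_eq_cube)
      have "(\<Sum>r<p k. \<bar>w k r\<bar> ^ 3) \<le> (\<Sum>r<p k. 4 * (\<alpha> ^ 3 + \<beta> ^ 3 * lam k r ^ 3)) / (real (p k) * sqrt (real (p k)))"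
        unfolding sum_divide_distrib
      proof (intro sum_mono)
        fix r assume "r \<in> {..<p k}"
        then have l: "0 \<le> lam k r" using lam_nonneg by auto
        have "\<bar>w k r\<bar> ^ 3 = (\<alpha> + \<beta> * lam k r) ^ 3 / (real (p k) * sqrt (real (p k)))"
          using l \<alpha> \<beta> by (simp add: w_def power_divide q abs_of_nonneg)
        also have "\<dots> \<le> 4 * (\<alpha> ^ 3 + \<beta> ^ 3 * lam k r ^ 3) / (real (p k) * sqrt (real (p k)))"
          using cube_add_le[of \<alpha> "\<beta> * lam k r"] l \<alpha> \<beta> by (intro divide_right_mono) (auto simp: power_mult_distrib)
        finally show "\<bar>w k r\<bar> ^ 3 \<le> 4 * (\<alpha> ^ 3 + \<beta> ^ 3 * lam k r ^ 3) / (real (p k) * sqrt (real (p k)))" .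
      qed
      also have "(\<Sum>r<p k. 4 * (\<alpha> ^ 3 + \<beta> ^ 3 * lam k r ^ 3)) = real (p k) * (4 * (\<alpha> ^ 3 + \<beta> ^ 3 * A 3 k))"
        using n_gt(2)[of k] by (simp add: sum_distrib_left[symmetric] sum.distrib A_def distrib_left)
      also have "real (p k) * (4 * (\<alpha> ^ 3 + \<beta> ^ 3 * A 3 k)) / (real (p k) * sqrt (real (p k))) =
          4 * (\<alpha> ^ 3 + \<beta> ^ 3 * A 3 k) * (1 / sqrt (real (p k)))"
        using n_gt(2)[of k] by simp
      finally show ?thesis .
    qed
    then show "\<forall>\<^sub>F k in sequentially. (\<Sum>r<p k. \<bar>w k r\<bar> ^ 3) \<le> 4 * (\<alpha> ^ 3 + \<beta> ^ 3 * A 3 k) * (1 / sqrt (real (p k)))"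
      by simp
  qed
  have v2: "(\<lambda>k. \<Sum>i<Suc (n k) - p k. (w' k)\<^sup>2) \<longlonglongrightarrow> (1 - c) * \<gamma>\<^sup>2"
  proof -
    have "(\<Sum>i<Suc (n k) - p k. (w' k)\<^sup>2) = real (Suc (n k) - p k) / real (n k) * \<gamma>\<^sup>2" for k
      by (simp add: w'_def power_divide)
    then show ?thesis using tendsto_mult[OF ratio_limits(5) tendsto_const[of "\<gamma>\<^sup>2"]] by simp
  qed
  have v3: "(\<lambda>k. \<Sum>i<Suc (n k) - p k. \<bar>w' k\<bar> ^ 3) \<longlonglongrightarrow> 0"
  proof -
    have "(\<Sum>i<Suc (n k) - p k. \<bar>w' k\<bar> ^ 3) = real (Suc (n k) - p k) / real (n k) * \<bar>\<gamma>\<bar> ^ 3 * (1 / sqrt (real (n k)))" for k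
    proof -
      have "sqrt (real (n k)) ^ 3 = real (n k) * sqrt (real (n k))" by (simp add: power3_eq_cube)
      then have "\<bar>w' k\<bar> ^ 3 = \<bar>\<gamma>\<bar> ^ 3 / (real (n k) * sqrt (real (n k)))"
        by (simp add: w'_def power_divide abs_divide)
      then show ?thesis by simp
    qed
    then show ?thesis
      using tendsto_mult[OF tendsto_mult[OF ratio_limits(5) tendsto_const[of "\<bar>\<gamma>\<bar> ^ 3"]] inverse_limits(3)] by simp
  qed
  have "(CLINT h|s.G k. iexp (t * (\<alpha> * s.U1 k h + \<beta> * s.U2 k h - \<gamma> * s.U3 k h))) =
      (\<Prod>r<p k. chisq_cf (t * w k r)) * (\<Prod>i<Suc (n k) - p k. chisq_cf (t * w' k))" for k
  proof -
    have eq: "t * (\<alpha> * s.U1 k h + \<beta> * s.U2 k h - \<gamma> * s.U3 k h) =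
       (\<Sum>r<p k. t * w k r * ((h (n k, r))\<^sup>2 - 1)) +
       t * w' k * (schur_chi (n k) (p k) (\<lambda>j. s.sqN k * s.shift k j + h (n k, j)) h - real (Suc (n k) - p k))" for h
    proof -
      have "\<alpha> * s.U1 k h + \<beta> * s.U2 k h = (\<Sum>r<p k. w k r * ((h (n k, r))\<^sup>2 - 1))"
        unfolding s.U1_def s.U2_def w_def times_divide_eq_right sum_distrib_left add_divide_distrib[symmetric]
          sum.distrib[symmetric] sum_divide_distrib
        by (intro sum.cong refl) (simp add: algebra_simps)
      then have "t * (\<alpha> * s.U1 k h + \<beta> * s.U2 k h) = (\<Sum>r<p k. t * w k r * ((h (n k, r))\<^sup>2 - 1))"
        by (simp add: sum_distrib_left mult.assoc)
      then show ?thesis unfolding s.U3_def s.V_def s.zvec_def[abs_def] w'_def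
        by (simp add: right_diff_distrib diff_divide_distrib mult_ac)
    qed
    show ?thesis unfolding eq by (rule schur_chi_cf[OF dims(1) n_gt(3)])
  qed
  moreover have "(\<lambda>k. (\<Prod>r<p k. chisq_cf (t * w k r)) * (\<Prod>i<Suc (n k) - p k. chisq_cf (t * w' k))) \<longlonglongrightarrow>
      of_real (exp (- t\<^sup>2 * (\<alpha>\<^sup>2 + 2 * \<alpha> * \<beta> * a 1 + \<beta>\<^sup>2 * a 2))) * of_real (exp (- t\<^sup>2 * ((1 - c) * \<gamma>\<^sup>2)))"
    by (intro tendsto_mult chisq_cf_prod_tendsto[OF _ w2 w3] chisq_cf_prod_tendsto[OF _ v2 v3]) auto
  moreover have "exp (- t\<^sup>2 * (\<alpha>\<^sup>2 + 2 * \<alpha> * \<beta> * a 1 + \<beta>\<^sup>2 * a 2)) * exp (- t\<^sup>2 * ((1 - c) * \<gamma>\<^sup>2)) = exp (- t\<^sup>2 / 2)"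
    unfolding exp_add[symmetric] distrib_left[symmetric] var by simp
  ultimately show "(\<lambda>k. CLINT h|s.G k. iexp (t * (\<alpha> * s.U1 k h + \<beta> * s.U2 k h - \<gamma> * s.U3 k h))) \<longlonglongrightarrow> of_real (exp (- t\<^sup>2 / 2))"
    by (simp add: of_real_mult[symmetric] del: of_real_mult)
qed

text \<open>The random coefficients converge in probability, so they are replaced by their limits in front of
  the tight fluctuations.\<close>

lemma standardized_linearization:
  assumes rho: "tends_in_prob s.G \<rho> r" and s_pos: "0 < sigma_T r c (a 1) (a 2)"
  defines "\<beta>1 \<equiv> r / (1 - c) / sigma_T r c (a 1) (a 2)" and "\<beta>2 \<equiv> (1 - r) / a 1 / sigma_T r c (a 1) (a 2)"
  shows "tends_in_prob s.G (\<lambda>k h. T_standardized (Suc (n k)) (p k) (\<mu>0 k) (\<rho> k h) (s.obs k h) -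
      (\<beta>1 * sqrt c * s.U1 k h + \<beta>2 / sqrt c * s.U2 k h - \<beta>1 * (c / (1 - c)) * s.U3 k h))
    (\<beta>1 * LD + \<beta>2 * (LI / c))"
proof -
  define \<sigma> where "\<sigma> k h = sigma_T (\<rho> k h) (real (p k) / real (n k)) (a_hat1 (Suc (n k)) (p k) (s.obs k h))
     (a_hat2 (Suc (n k)) (p k) (s.obs k h))" for k h
  define B1 where "B1 k h = \<rho> k h / (s.V k h / real (n k)) / \<sigma> k h" for k h
  define B2 where "B2 k h = (1 - \<rho> k h) / (s.trS k h / real (p k)) / \<sigma> k h" for k h
  define x1 where "x1 k = real (Suc (n k)) / real (n k) * (sqrt (real (n k)) * (\<Sum>r<p k. (s.shift k r)\<^sup>2))" for k
  define x2 where "x2 k = real (Suc (n k)) / real (p k) * (sqrt (real (n k)) * (\<Sum>r<p k. lam k r * (s.shift k r)\<^sup>2))" for k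
  define y1 where "y1 k = sqrt (real (p k) / real (n k))" for k
  define y2 where "y2 k = sqrt (real (n k) / real (p k))" for k
  define y3 where "y3 k = real (p k) / real (Suc (n k) - p k)" for k
  have c1: "1 - c \<noteq> 0" using ratio by simp
  have \<sigma>: "tends_in_prob s.G \<sigma> (sigma_T r c (a 1) (a 2))"
    unfolding \<sigma>_def[abs_def] by (rule sigma_limit[OF rho])
  have B1: "tends_in_prob s.G B1 \<beta>1" unfolding B1_def[abs_def] \<beta>1_def
    by (intro tends_in_prob_divide rho V_limit \<sigma>) (use s_pos c1 in auto)
  have "tends_in_prob s.G (\<lambda>k h. 1 - \<rho> k h) (1 - r)"
    by (intro tends_in_prob_diff rho tends_in_prob_const) simp
  then have B2: "tends_in_prob s.G B2 \<beta>2" unfolding B2_def[abs_def] \<beta>2_def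
    by (intro tends_in_prob_divide tr_limit \<sigma>) (use s_pos a_pos in auto)
  have "x1 \<longlonglongrightarrow> 1 * LD" "x2 \<longlonglongrightarrow> 1 / c * LI"
    unfolding x1_def[abs_def] x2_def[abs_def] by (intro tendsto_mult ratio_limits shifts)+
  then have x: "x1 \<longlonglongrightarrow> LD" "x2 \<longlonglongrightarrow> LI / c" by simp_all
  have y: "y1 \<longlonglongrightarrow> sqrt c" "y2 \<longlonglongrightarrow> 1 / sqrt c" "y3 \<longlonglongrightarrow> c / (1 - c)"
    unfolding y1_def[abs_def] y2_def[abs_def] y3_def[abs_def] by (rule ratio_limits)+
  have vanish: "tends_in_prob s.G (\<lambda>k h. (B k h * y k - b * y') * u k h) 0"
    if "tends_in_prob s.G B b" "y \<longlonglongrightarrow> y'" "bounded_in_prob s.G u" for B b y and y' :: real and u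
  proof (rule tends_in_prob_bounded_mult[OF _ that(3)])
    show "tends_in_prob s.G (\<lambda>k h. B k h * y k - b * y') 0"
      using tends_in_prob_diff[OF tends_in_prob_mult[OF that(1) tends_in_prob_const[OF that(2)]]
          tends_in_prob_const[OF tendsto_const[of "b * y'"]]]
      by (simp only: diff_self)
  qed
  note c = tends_in_prob_const
  note terms = tends_in_prob_mult[OF B1 c[OF x(1)]] tends_in_prob_mult[OF B2 c[OF x(2)]]
    vanish[OF B1 y(1) U_bounded(1)] tends_in_prob_mult[OF tends_in_prob_mult[OF B1 c[OF y(1)]] err_negligible(1)]
    vanish[OF B1 y(3) U_bounded(3)] vanish[OF B2 y(2) U_bounded(2)]
    tends_in_prob_mult[OF tends_in_prob_mult[OF B2 c[OF y(2)]] err_negligible(2)]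
    tends_in_prob_mult[OF B2 err_negligible(3)]
  have t: "tends_in_prob s.G (\<lambda>k h. B1 k h * x1 k + B2 k h * x2 k + (B1 k h * y1 k - \<beta>1 * sqrt c) * s.U1 k h
      + B1 k h * y1 k * s.err1 k h - (B1 k h * y3 k - \<beta>1 * (c / (1 - c))) * s.U3 k h
      + (B2 k h * y2 k - \<beta>2 * (1 / sqrt c)) * s.U2 k h + B2 k h * y2 k * s.err2 k h - B2 k h * s.trErr k h)
    (\<beta>1 * LD + \<beta>2 * (LI / c) + 0 + \<beta>1 * sqrt c * 0 - 0 + 0 + \<beta>2 * (1 / sqrt c) * 0 - \<beta>2 * 0)"
    by (rule tends_in_prob_diff[OF tends_in_prob_add[OF tends_in_prob_add[OF tends_in_prob_diff[OF
        tends_in_prob_add[OF tends_in_prob_add[OF tends_in_prob_add[OF terms(1,2)] terms(3)] terms(4)]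
        terms(5)] terms(6)] terms(7)] terms(8)])
  have "tends_in_prob s.G (\<lambda>k h. T_standardized (Suc (n k)) (p k) (\<mu>0 k) (\<rho> k h) (s.obs k h) -
      (\<beta>1 * sqrt c * s.U1 k h + \<beta>2 / sqrt c * s.U2 k h - \<beta>1 * (c / (1 - c)) * s.U3 k h))
     (\<beta>1 * LD + \<beta>2 * (LI / c) + 0 + \<beta>1 * sqrt c * 0 - 0 + 0 + \<beta>2 * (1 / sqrt c) * 0 - \<beta>2 * 0)"
  proof (rule tends_in_prob_AE_cong[OF t], rule always_eventually, rule allI)
    fix k
    show "AE h in s.G k. B1 k h * x1 k + B2 k h * x2 k + (B1 k h * y1 k - \<beta>1 * sqrt c) * s.U1 k h
      + B1 k h * y1 k * s.err1 k h - (B1 k h * y3 k - \<beta>1 * (c / (1 - c))) * s.U3 k h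
      + (B2 k h * y2 k - \<beta>2 * (1 / sqrt c)) * s.U2 k h + B2 k h * y2 k * s.err2 k h - B2 k h * s.trErr k h =
      T_standardized (Suc (n k)) (p k) (\<mu>0 k) (\<rho> k h) (s.obs k h) -
      (\<beta>1 * sqrt c * s.U1 k h + \<beta>2 / sqrt c * s.U2 k h - \<beta>1 * (c / (1 - c)) * s.U3 k h)"
      using s.AE_regular[OF dims(1) n_gt(3)]
    proof eventually_elim
      case (elim h)
      then have dec: "T_stat (Suc (n k)) (p k) (\<mu>0 k) (\<rho> k h) (s.obs k h) =
          \<rho> k h / (s.V k h / real (n k)) * (x1 k + y1 k * (s.U1 k h + s.err1 k h) - y3 k * s.U3 k h) +
          (1 - \<rho> k h) / (s.trS k h / real (p k)) * (x2 k + y2 k * (s.U2 k h + s.err2 k h) - s.trErr k h)"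
        unfolding x1_def x2_def y1_def y2_def y3_def
        by (intro s.T_stat_decomposition dims(1) n_gt(3)) blast+
      have pred: "real (Suc (n k)) - 1 = real (n k)" by simp
      have "T_standardized (Suc (n k)) (p k) (\<mu>0 k) (\<rho> k h) (s.obs k h) =
          (\<rho> k h / (s.V k h / real (n k)) * (x1 k + y1 k * (s.U1 k h + s.err1 k h) - y3 k * s.U3 k h) +
          (1 - \<rho> k h) / (s.trS k h / real (p k)) * (x2 k + y2 k * (s.U2 k h + s.err2 k h) - s.trErr k h)) / \<sigma> k h"
        unfolding T_standardized_def dec pred \<sigma>_def by (rule refl)
      also have "\<dots> = B1 k h * (x1 k + y1 k * (s.U1 k h + s.err1 k h) - y3 k * s.U3 k h) +
          B2 k h * (x2 k + y2 k * (s.U2 k h + s.err2 k h) - s.trErr k h)"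
        unfolding B1_def B2_def add_divide_distrib times_divide_eq_left by simp
      finally show ?case by (simp add: distrib_left right_diff_distrib left_diff_distrib mult.assoc)
    qed
  qed
  then show ?thesis by simp
qed


text \<open>The weight is only required to be consistent: it may depend on the sample in an arbitrary
  measurable way.\<close>

theorem power_limit:
  assumes rho: "tends_in_prob s.G \<rho> r" "0 < r" "r < 1" and [measurable]: "\<And>k. \<rho> k \<in> borel_measurable (s.G k)"
  shows "(\<lambda>k. measure (s.G k) {h\<in>space (s.G k). z \<le> T_standardized (Suc (n k)) (p k) (\<mu>0 k) (\<rho> k h) (s.obs k h)})
    \<longlonglongrightarrow> Phi ((r / (1 - c) * LD + (1 - r) / a 1 * (LI / c)) / sigma_T r c (a 1) (a 2) - z)"
proof -
  define \<sigma> where "\<sigma> = sigma_T r c (a 1) (a 2)"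
  define \<beta>1 where "\<beta>1 = r / (1 - c) / \<sigma>"
  define \<beta>2 where "\<beta>2 = (1 - r) / a 1 / \<sigma>"
  have pos: "0 < r\<^sup>2 * (2 * c / (1 - c) ^ 3) + (1 - r)\<^sup>2 * (2 * a 2 / (c * (a 1)\<^sup>2)) + 2 * r * (1 - r) * (2 / (1 - c))"
    using rho(2,3) ratio(2,3) a_pos by (intro add_pos_pos mult_pos_pos divide_pos_pos zero_less_power) auto
  then have \<sigma>: "0 < \<sigma>" "\<sigma>\<^sup>2 = r\<^sup>2 * (2 * c / (1 - c) ^ 3) + (1 - r)\<^sup>2 * (2 * a 2 / (c * (a 1)\<^sup>2)) + 2 * r * (1 - r) * (2 / (1 - c))"
    unfolding \<sigma>_def sigma_T_def by (simp_all only: real_sqrt_gt_0_iff real_sqrt_pow2 less_imp_le)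
  have \<beta>: "0 < \<beta>1" "0 < \<beta>2" using rho(2,3) ratio(2,3) a_pos \<sigma>(1) by (simp_all add: \<beta>1_def \<beta>2_def)
  have "\<beta>1\<^sup>2 * c + 2 * \<beta>1 * \<beta>2 * a 1 + \<beta>2\<^sup>2 / c * a 2 + (1 - c) * (\<beta>1 * c / (1 - c))\<^sup>2 = 1 / 2"
    unfolding \<beta>1_def \<beta>2_def by (rule variance_identity) (use ratio a_pos \<sigma> in auto)
  then have var: "(\<beta>1 * sqrt c)\<^sup>2 + 2 * (\<beta>1 * sqrt c) * (\<beta>2 / sqrt c) * a 1 + (\<beta>2 / sqrt c)\<^sup>2 * a 2 +
      (1 - c) * (\<beta>1 * (c / (1 - c)))\<^sup>2 = 1 / 2"
    using ratio by (simp add: power_mult_distrib power_divide)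
  have lim: "(\<lambda>k. measure (s.G k) {h\<in>space (s.G k). z \<le> T_standardized (Suc (n k)) (p k) (\<mu>0 k) (\<rho> k h) (s.obs k h)})
     \<longlonglongrightarrow> Phi (\<beta>1 * LD + \<beta>2 * (LI / c) - z)"
  proof (rule slutsky_upper_tail)
    show "prob_space (s.G k)" for k by (rule prob_space_gauss)
    note [measurable] = s.U1_measurable s.U2_measurable s.U3_measurable
    show "\<forall>\<^sub>F k in sequentially. (\<lambda>h. \<beta>1 * sqrt c * s.U1 k h + \<beta>2 / sqrt c * s.U2 k h - \<beta>1 * (c / (1 - c)) * s.U3 k h)
        \<in> borel_measurable (s.G k)"
      by (intro always_eventually allI) measurable
    show "(\<lambda>k. measure (s.G k) {h\<in>space (s.G k). \<beta>1 * sqrt c * s.U1 k h + \<beta>2 / sqrt c * s.U2 k h -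
        \<beta>1 * (c / (1 - c)) * s.U3 k h \<le> x}) \<longlonglongrightarrow> Phi x" for x
      by (rule clt[OF _ _ var]) (use \<beta> ratio in auto)
    show "tends_in_prob s.G (\<lambda>k h. T_standardized (Suc (n k)) (p k) (\<mu>0 k) (\<rho> k h) (s.obs k h) -
      (\<beta>1 * sqrt c * s.U1 k h + \<beta>2 / sqrt c * s.U2 k h - \<beta>1 * (c / (1 - c)) * s.U3 k h))
      (\<beta>1 * LD + \<beta>2 * (LI / c))"
      using standardized_linearization[OF rho(1)] \<sigma>(1) unfolding \<beta>1_def \<beta>2_def \<sigma>_def by simp
    show "\<forall>\<^sub>F k in sequentially. {h\<in>space (s.G k). z \<le> T_standardized (Suc (n k)) (p k) (\<mu>0 k) (\<rho> k h) (s.obs k h)}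
        \<in> sets (s.G k)"
    proof (intro always_eventually allI)
      fix k
      interpret m: measurable_sample "s.G k" "Suc (n k)" "p k" "s.obs k" by (rule s.obs_measurable_sample)
      note [measurable] = m.T_standardized_measurable[OF s.mu_carrier(2) assms(4)]
      show "{h\<in>space (s.G k). z \<le> T_standardized (Suc (n k)) (p k) (\<mu>0 k) (\<rho> k h) (s.obs k h)} \<in> sets (s.G k)"
        by measurable
    qed
  qed
  have "\<beta>1 * LD + \<beta>2 * (LI / c) = (r / (1 - c) * LD + (1 - r) / a 1 * (LI / c)) / \<sigma>"
    unfolding \<beta>1_def \<beta>2_def add_divide_distrib by simp
  then show ?thesis using lim by (simp add: \<sigma>_def)
qed

end

section \<open>The power of the test with estimated weight\<close>

lemma sample_mean_cong:
  assumes "\<And>i. i \<in> {1..N} \<Longrightarrow> x i = y i"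
  shows "sample_mean N p x = sample_mean N p y"
  unfolding sample_mean_def using assms by (intro arg_cong2[where f=vec] refl ext arg_cong2[where f="(/)"] sum.cong) auto

lemma sample_cov_cong:
  assumes "\<And>i. i \<in> {1..N} \<Longrightarrow> x i = y i"
  shows "sample_cov N p x = sample_cov N p y"
proof -
  have "(\<Sum>i=1..N. (x i - sample_mean N p x) $ j * (x i - sample_mean N p x) $ l) =
      (\<Sum>i=1..N. (y i - sample_mean N p y) $ j * (y i - sample_mean N p y) $ l)" for j l
    by (intro sum.cong refl) (simp only: assms sample_mean_cong[of N x y p, OF assms])
  then show ?thesis unfolding sample_cov_def by presburger
qed

lemma rho_hat_cong:
  assumes "\<And>i. i \<in> {1..N} \<Longrightarrow> x i = y i"
  shows "rho_hat N p x = rho_hat N p y"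
  by (simp only: rho_hat_def a_hat1_def a_hat2_def sample_cov_cong[of N x y p, OF assms])

lemma T_standardized_cong:
  assumes "\<And>i. i \<in> {1..N} \<Longrightarrow> x i = y i"
  shows "T_standardized N p \<mu>0 \<rho> x = T_standardized N p \<mu>0 \<rho> y"
  by (simp only: T_standardized_def T_stat_def hotelling_T2_def dempster_D_def a_hat1_def a_hat2_def
      sample_cov_cong[of N x y p, OF assms] sample_mean_cong[of N x y p, OF assms])

lemma emeasure_upper_level:
  assumes "f \<in> borel_measurable M"
  shows "emeasure M {\<omega>\<in>space M. (z::real) \<le> f \<omega>} = (\<integral>\<^sup>+\<omega>. indicator {z..} (f \<omega>) \<partial>M)"
proof -
  have "{\<omega>\<in>space M. z \<le> f \<omega>} \<in> sets M" using assms by measurable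
  then have "emeasure M {\<omega>\<in>space M. z \<le> f \<omega>} = (\<integral>\<^sup>+\<omega>. indicator {\<omega>\<in>space M. z \<le> f \<omega>} \<omega> \<partial>M)" by simp
  also have "\<dots> = (\<integral>\<^sup>+\<omega>. indicator {z..} (f \<omega>) \<partial>M)"
    by (intro nn_integral_cong) (auto simp: indicator_def)
  finally show ?thesis .
qed

context gaussian_sample
begin

text \<open>The two kinds of weight are the ones that occur in the comparison of the tests.\<close>

lemma measure_data_level:
  fixes X :: "nat \<Rightarrow> 'w \<Rightarrow> nat \<Rightarrow> real"
  assumes M: "prob_space M"
    and indep: "prob_space.indep_vars M (\<lambda>_. lborel_vec p) X {1..Suc n}"
    and normal: "\<And>i. i \<in> {1..Suc n} \<Longrightarrow> mvn_distributed M p \<mu> \<Sigma> (X i)"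
    and \<rho>: "\<rho> = rho_hat (Suc n) p \<or> (\<exists>r. \<rho> = (\<lambda>_. r))"
  shows "measure M {\<omega>\<in>space M. z \<le> T_standardized (Suc n) p \<mu>0 (\<rho> (\<lambda>i. vec p (X i \<omega>))) (\<lambda>i. vec p (X i \<omega>))} =
     measure G {h\<in>space G. z \<le> T_standardized (Suc n) p \<mu>0 (\<rho> (obs h)) (obs h)}"
proof -
  define T where "T x = T_standardized (Suc n) p \<mu>0 (\<rho> x) x" for x
  have meas: "(\<lambda>\<omega>. T (x \<omega>)) \<in> borel_measurable Q" if "measurable_sample Q (Suc n) p x" for Q :: "'q measure" and x
  proof -
    interpret measurable_sample Q "Suc n" p x by fact
    have "(\<lambda>\<omega>. \<rho> (x \<omega>)) \<in> borel_measurable Q" using \<rho> rho_hat_measurable by auto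
    from T_standardized_measurable[OF mu_carrier(2) this] show ?thesis by (simp add: T_def)
  qed
  have X_meas: "X i \<in> M \<rightarrow>\<^sub>M lborel_vec p" if "i \<in> {1..Suc n}" for i
    using normal[OF that] unfolding mvn_distributed_def by (rule distributed_measurable)
  have meas_M: "(\<lambda>\<omega>. T (\<lambda>i. vec p (X i \<omega>))) \<in> borel_measurable M"
  proof (rule meas, unfold_locales)
    fix i j assume i: "i \<in> {1..Suc n}" and j: "j < p"
    have "(\<lambda>\<omega>. X i \<omega> j) \<in> M \<rightarrow>\<^sub>M lborel"
      by (rule measurable_compose[OF X_meas[OF i] measurable_component_singleton]) (use j in simp)
    then show "(\<lambda>\<omega>. vec p (X i \<omega>) $ j) \<in> borel_measurable M" using j by simp
  qed
  have meas_P: "(\<lambda>u. T (\<lambda>i. vec p (u i))) \<in> borel_measurable (\<Pi>\<^sub>M i\<in>{1..Suc n}. lborel_on {..<p})"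
  proof (rule meas, unfold_locales)
    fix i j assume i: "i \<in> {1..Suc n}" and j: "j < p"
    have "(\<lambda>u. u i j) \<in> (\<Pi>\<^sub>M i\<in>{1..Suc n}. lborel_on {..<p}) \<rightarrow>\<^sub>M lborel"
      unfolding lborel_on_def
      by (rule measurable_compose[where f="\<lambda>u. u i" and N="\<Pi>\<^sub>M j\<in>{..<p}. lborel"])
        (use i j in \<open>auto intro!: measurable_component_singleton\<close>)
    then show "(\<lambda>u. vec p (u i) $ j) \<in> borel_measurable (\<Pi>\<^sub>M i\<in>{1..Suc n}. lborel_on {..<p})" using j by simp
  qed
  have meas_G: "(\<lambda>h. T (obs h)) \<in> borel_measurable G" by (rule meas[OF obs_measurable_sample])
  have "emeasure M {\<omega>\<in>space M. z \<le> T (\<lambda>i. vec p (X i \<omega>))} =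
      (\<integral>\<^sup>+\<omega>. indicator {z..} (T (\<lambda>i. vec p (X i \<omega>))) \<partial>M)"
    by (rule emeasure_upper_level[OF meas_M])
  also have "\<dots> = (\<integral>\<^sup>+h. indicator {z..} (T (obs h)) \<partial>G)"
  proof (rule nn_integral_data[OF M indep normal])
    fix x x' :: "nat \<Rightarrow> real vec" assume eq: "\<And>i. i \<in> {1..Suc n} \<Longrightarrow> x i = x' i"
    have "\<rho> x = \<rho> x'" using \<rho> rho_hat_cong[of "Suc n" x x', OF eq] by auto
    then have "T x = T x'" unfolding T_def using T_standardized_cong[of "Suc n" x x', OF eq] by simp
    then show "(indicator {z..} (T x) :: ennreal) = indicator {z..} (T x')" by simp
  qed (use meas_P in measurable)
  also have "\<dots> = emeasure G {h\<in>space G. z \<le> T (obs h)}"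
    by (rule emeasure_upper_level[OF meas_G, symmetric])
  finally show ?thesis by (simp add: measure_def T_def)
qed

end

text \<open>With K = (1 - r) / r, the optimal weight makes the two shifts contribute equally and the two
  variances as well. The parametrization by square roots s and u of 1 - c and a2 turns the claim into
  a rational identity.\<close>

lemma optimal_weight:
  fixes c a1 a2 L :: real
  assumes c: "0 < c" "c < 1" and a: "0 < a1" "0 < a2"
  defines "r \<equiv> rho_star c a1 a2"
  shows "0 < r" "r < 1"
    "(r / (1 - c) * L + (1 - r) / a1 * (sqrt ((1 - c) * a2) * L / c)) / sigma_T r c a1 a2 =
      sqrt (1 - c) * L / sqrt (c * (a1 * sqrt ((1 - c) / a2) + 1))"
proof -
  define s where "s = sqrt (1 - c)"
  define u where "u = sqrt a2"
  have s: "s > 0" "1 - c = s\<^sup>2" and u: "u > 0" "a2 = u\<^sup>2" using c a by (auto simp: s_def u_def)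
  define K where "K = a1 * c / (s ^ 3 * u)"
  have K: "K > 0" using c a s u by (simp add: K_def)
  define W where "W = a1 * (s / u) + 1"
  have W: "W > 0" using a s u by (simp add: W_def add_pos_pos)
  have "sqrt (a2 * (1 - c)) = s * u" unfolding s(2) u(2) using s u by (simp add: real_sqrt_mult)
  then have "a1 * c * sqrt (a2 * (1 - c)) / (a2 * (1 - c)\<^sup>2) = a1 * c * (s * u) / (u\<^sup>2 * (s\<^sup>2)\<^sup>2)"
    by (simp only: u(2) s(2))
  also have "\<dots> = K" unfolding K_def using s(1) u(1) by (simp add: field_simps power_numeral_reduce)
  finally have r: "r = 1 / (K + 1)" unfolding r_def rho_star_def by (simp add: inverse_eq_divide)
  then show r01: "0 < r" "r < 1" using K by auto
  have r': "1 - r = K * r" unfolding r using K by (simp add: field_simps)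
  have X: "r\<^sup>2 * (2 * c / (1 - c) ^ 3) + (1 - r)\<^sup>2 * (2 * a2 / (c * a1\<^sup>2)) + 2 * r * (1 - r) * (2 / (1 - c)) =
     (2 * r * sqrt (c * W) / s ^ 3)\<^sup>2"
  proof -
    have k1: "K\<^sup>2 * (2 * u\<^sup>2 / (c * a1\<^sup>2)) = 2 * c / s ^ 6"
      unfolding K_def using s(1) u(1) c a by (simp add: power_divide power_mult_distrib field_simps power_numeral_reduce)
    have k2: "4 * K / s\<^sup>2 = 4 * c / s ^ 6 * (a1 * (s / u))"
      unfolding K_def using s(1) u(1) by (simp add: field_simps power_numeral_reduce)
    have "r\<^sup>2 * (2 * c / (1 - c) ^ 3) + (1 - r)\<^sup>2 * (2 * a2 / (c * a1\<^sup>2)) + 2 * r * (1 - r) * (2 / (1 - c)) =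
       r\<^sup>2 * (2 * c / s ^ 6 + K\<^sup>2 * (2 * u\<^sup>2 / (c * a1\<^sup>2)) + 4 * K / s\<^sup>2)"
      unfolding r' u(2) s(2) by (simp add: power_mult_distrib distrib_left power_mult[symmetric] power2_eq_square mult_ac)
    also have "\<dots> = r\<^sup>2 * (4 * c / s ^ 6 * W)" unfolding k1 k2 W_def by (simp add: distrib_left add_divide_distrib[symmetric])
    also have "\<dots> = (2 * r * sqrt (c * W) / s ^ 3)\<^sup>2"
      using c W by (simp add: power_divide power_mult_distrib power_mult[symmetric])
    finally show ?thesis .
  qed
  have \<sigma>: "sigma_T r c a1 a2 = 2 * r * sqrt (c * W) / s ^ 3"
    unfolding sigma_T_def X using r01 c W s by simp
  have "sqrt ((1 - c) * a2) = s * u" unfolding s(2) u(2) using s u by (simp add: real_sqrt_mult)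
  then have "r / (1 - c) * L + (1 - r) / a1 * (sqrt ((1 - c) * a2) * L / c) = r / s\<^sup>2 * L + K * r / a1 * (s * u * L / c)"
    by (simp only: r' s(2))
  also have "\<dots> = 2 * r * L / s\<^sup>2"
    unfolding K_def using c a s(1) u(1) by (simp add: field_simps power_numeral_reduce)
  also have "\<dots> / sigma_T r c a1 a2 = s * L / sqrt (c * W)"
    unfolding \<sigma> using r01 s(1) c W by (simp add: field_simps power_numeral_reduce)
  also have "sqrt ((1 - c) / a2) = s / u" unfolding s(2) u(2) using s u by (simp add: real_sqrt_divide)
  then have "s * L / sqrt (c * W) = sqrt (1 - c) * L / sqrt (c * (a1 * sqrt ((1 - c) / a2) + 1))"
    unfolding W_def s_def by simp
  finally show "(r / (1 - c) * L + (1 - r) / a1 * (sqrt ((1 - c) * a2) * L / c)) / sigma_T r c a1 a2 =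
      sqrt (1 - c) * L / sqrt (c * (a1 * sqrt ((1 - c) / a2) + 1))" .
qed

theorem mainTheorem2:
  fixes \<alpha> c :: real
    and n N p :: "nat \<Rightarrow> nat"
    and \<mu> \<mu>0 :: "nat \<Rightarrow> real vec"
    and \<Sigma> :: "nat \<Rightarrow> real mat"
    and M :: "nat \<Rightarrow> 'w measure"
    and X :: "nat \<Rightarrow> nat \<Rightarrow> 'w \<Rightarrow> nat \<Rightarrow> real"
    and x :: "nat \<Rightarrow> 'w \<Rightarrow> nat \<Rightarrow> real vec"
    and a :: "nat \<Rightarrow> nat \<Rightarrow> real"
  defines "x \<equiv> \<lambda>k \<omega> i. vec (p k) (X k i \<omega>)"
    and "a \<equiv> \<lambda>i k. a_moment i (p k) (\<Sigma> k)"
  assumes alpha: "0 < \<alpha>" "\<alpha> < 1"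
    and N: "\<And>k. N k = n k + 1"
    and dims: "\<And>k. \<mu> k \<in> carrier_vec (p k)" "\<And>k. \<mu>0 k \<in> carrier_vec (p k)"
    and Sigma: "\<And>k. pos_def (p k) (\<Sigma> k)"
    and prob: "\<And>k. prob_space (M k)"
    and indep: "\<And>k. prob_space.indep_vars (M k) (\<lambda>_. lborel_vec (p k)) (X k) {1..N k}"
    and normal: "\<And>k i. i \<in> {1..N k} \<Longrightarrow> mvn_distributed (M k) (p k) (\<mu> k) (\<Sigma> k) (X k i)"
    and A1: "filterlim n at_top sequentially" "filterlim p at_top sequentially"
      "(\<lambda>k. real (p k) / real (n k)) \<longlonglongrightarrow> c" "0 < c" "c < 1"
    and A2: "\<And>i. i \<in> {1..6} \<Longrightarrow> \<exists>L>0. a i \<longlonglongrightarrow> L"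
    and A3: "\<exists>L>0. (\<lambda>k. sqrt (real (n k)) * Delta_sq (\<mu> k) (\<mu>0 k) (\<Sigma> k)) \<longlonglongrightarrow> L"
      "\<exists>L>0. (\<lambda>k. sqrt (real (n k)) * Delta_I_sq (\<mu> k) (\<mu>0 k)) \<longlonglongrightarrow> L"
      "\<exists>L>0. (\<lambda>k. sqrt (real (n k)) * Delta_Sigma_sq (\<mu> k) (\<mu>0 k) (\<Sigma> k)) \<longlonglongrightarrow> L"
    and Omega0: "\<And>k. (\<mu> k, \<Sigma> k) \<in> Omega0 (p k) c (\<mu>0 k)"
  shows
    "(\<lambda>k. measure (M k) {\<omega> \<in> space (M k).
              T_standardized (N k) (p k) (\<mu>0 k) (rho_hat (N k) (p k) (x k \<omega>)) (x k \<omega>)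
                \<ge> z_upper \<alpha>}
          - Phi (sqrt (real (n k) * (1 - c)) * Delta_sq (\<mu> k) (\<mu>0 k) (\<Sigma> k)
                   / sqrt (c * (a 1 k * sqrt ((1 - c) / a 2 k) + 1))
                 - z_upper \<alpha>)) \<longlonglongrightarrow> 0
     \<and>
     (\<lambda>k. measure (M k) {\<omega> \<in> space (M k).
              T_standardized (N k) (p k) (\<mu>0 k) (rho_hat (N k) (p k) (x k \<omega>)) (x k \<omega>)
                \<ge> z_upper \<alpha>}
          - measure (M k) {\<omega> \<in> space (M k).
              T_standardized (N k) (p k) (\<mu>0 k) (rho_star c (a 1 k) (a 2 k)) (x k \<omega>)
                \<ge> z_upper \<alpha>}) \<longlonglongrightarrow> 0"
proof -
  \<comment> \<open>Nothing is known about the first indices, where p may vanish or exceed n, so they are skipped.\<close>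
  obtain K where K: "\<And>k. k \<ge> K \<Longrightarrow> 0 < p k \<and> p k < n k"
  proof -
    have "\<forall>\<^sub>F k in sequentially. 1 \<le> p k" using A1(2) by (simp add: filterlim_at_top)
    moreover have "\<forall>\<^sub>F k in sequentially. real (p k) / real (n k) < 1" by (rule order_tendstoD(2)[OF A1(3) A1(5)])
    moreover have "\<forall>\<^sub>F k in sequentially. 1 \<le> n k" using A1(1) by (simp add: filterlim_at_top)
    ultimately have "\<forall>\<^sub>F k in sequentially. 0 < p k \<and> p k < n k"
      by eventually_elim (auto simp: divide_less_eq)
    then show thesis using that unfolding eventually_sequentially by blast
  qed
  define p' where "p' k = p (k + K)" for k
  define n' where "n' k = n (k + K)" for k
  have shift: "f \<longlonglongrightarrow> l \<Longrightarrow> (\<lambda>k. f (k + K)) \<longlonglongrightarrow> l" for f :: "nat \<Rightarrow> real" and l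
    by (rule LIMSEQ_ignore_initial_segment)
  have unshift: "(\<lambda>k. f (k + K)) \<longlonglongrightarrow> l \<Longrightarrow> f \<longlonglongrightarrow> l" for f :: "nat \<Rightarrow> real" and l
    by (rule LIMSEQ_offset)
  have "\<exists>QlR. gaussian_sample (p k) (\<Sigma> k) (fst QlR) (fst (snd QlR)) (n k) (\<mu> k) (\<mu>0 k) (snd (snd QlR))" if "k \<ge> K" for k
  proof -
    obtain Q lam where w: "whitening (p k) (\<Sigma> k) Q lam" by (rule pos_def_whitening[OF Sigma])
    obtain R where R: "orth_on {..<Suc (n k)} R"
      "\<And>l. l < Suc (n k) \<Longrightarrow> (\<Sum>i<Suc (n k). R i l) = sqrt (real (Suc (n k))) * of_bool (l = n k)"
      by (rule helmert_exists[of "n k"]) blast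
    have "gaussian_sample (p k) (\<Sigma> k) Q lam (n k) (\<mu> k) (\<mu>0 k) R"
      unfolding gaussian_sample_def gaussian_sample_axioms_def using w R dims K[OF that] by auto
    then show ?thesis by (intro exI[of _ "(Q, lam, R)"]) simp
  qed
  then have "\<forall>k. \<exists>QlR. gaussian_sample (p' k) (\<Sigma> (k + K)) (fst QlR) (fst (snd QlR)) (n' k) (\<mu> (k + K)) (\<mu>0 (k + K)) (snd (snd QlR))"
    unfolding p'_def n'_def by simp
  then obtain QlR where "\<forall>k. gaussian_sample (p' k) (\<Sigma> (k + K)) (fst (QlR k)) (fst (snd (QlR k))) (n' k)
      (\<mu> (k + K)) (\<mu>0 (k + K)) (snd (snd (QlR k)))"
    by (rule choice[THEN exE])
  then obtain Q lam R where sample: "\<And>k. gaussian_sample (p' k) (\<Sigma> (k + K)) (Q k) (lam k) (n' k) (\<mu> (k + K)) (\<mu>0 (k + K)) (R k)"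
    using that[of "\<lambda>k. fst (QlR k)" "\<lambda>k. fst (snd (QlR k))" "\<lambda>k. snd (snd (QlR k))"] by blast
  have "\<forall>i\<in>{1..6}. \<exists>L>0. a i \<longlonglongrightarrow> L" using A2 by blast
  then obtain b where b: "\<And>i. i \<in> {1..6} \<Longrightarrow> 0 < b i \<and> a i \<longlonglongrightarrow> b i" by metis
  have b12: "0 < b 1" "0 < b 2" "a 1 \<longlonglongrightarrow> b 1" "a 2 \<longlonglongrightarrow> b 2" using b[of 1] b[of 2] by auto
  obtain LD where LD: "(\<lambda>k. sqrt (real (n k)) * Delta_sq (\<mu> k) (\<mu>0 k) (\<Sigma> k)) \<longlonglongrightarrow> LD" using A3(1) by blast
  obtain LI where LI: "0 < LI" "(\<lambda>k. sqrt (real (n k)) * Delta_I_sq (\<mu> k) (\<mu>0 k)) \<longlonglongrightarrow> LI" using A3(2) by blast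
  obtain LS where LS: "(\<lambda>k. sqrt (real (n k)) * Delta_Sigma_sq (\<mu> k) (\<mu>0 k) (\<Sigma> k)) \<longlonglongrightarrow> LS" using A3(3) by blast
  \<comment> \<open>The limiting form of the condition that defines the set Omega0.\<close>
  have LI_eq: "LI = sqrt ((1 - c) * b 2) * LD"
  proof -
    have l1: "(\<lambda>k. sqrt (real (n k)) * Delta_sq (\<mu> k) (\<mu>0 k) (\<Sigma> k) / (sqrt (real (n k)) * Delta_I_sq (\<mu> k) (\<mu>0 k))) \<longlonglongrightarrow> LD / LI"
      by (intro tendsto_divide LD LI) (use LI in simp)
    have l2: "(\<lambda>k. 1 / sqrt ((1 - c) * a 2 k)) \<longlonglongrightarrow> 1 / sqrt ((1 - c) * b 2)"
      using b12 A1 by (intro tendsto_intros) auto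
    have ev: "\<forall>\<^sub>F k in sequentially. sqrt (real (n k)) * Delta_sq (\<mu> k) (\<mu>0 k) (\<Sigma> k) / (sqrt (real (n k)) * Delta_I_sq (\<mu> k) (\<mu>0 k)) =
        1 / sqrt ((1 - c) * a 2 k)"
      unfolding eventually_sequentially
    proof (intro exI[of _ K] allI impI)
      fix k assume "K \<le> k"
      then have "n k \<noteq> 0" using K[of k] by simp
      then show "sqrt (real (n k)) * Delta_sq (\<mu> k) (\<mu>0 k) (\<Sigma> k) / (sqrt (real (n k)) * Delta_I_sq (\<mu> k) (\<mu>0 k)) =
        1 / sqrt ((1 - c) * a 2 k)"
        using Omega0[of k] by (simp add: Omega0_def a_def)
    qed
    have "LD / LI = 1 / sqrt ((1 - c) * b 2)"
      by (rule LIMSEQ_unique[OF Lim_transform_eventually[OF l1 ev] l2])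
    then show ?thesis using LI(1) b12 A1 by (simp add: field_simps)
  qed
  have a_eq: "a i (k + K) = (\<Sum>r<p' k. lam k r ^ i) / real (p' k)" for i k
  proof -
    interpret gaussian_sample "p' k" "\<Sigma> (k + K)" "Q k" "lam k" "n' k" "\<mu> (k + K)" "\<mu>0 (k + K)" "R k" by (rule sample)
    show ?thesis unfolding a_def a_moment_def p'_def[symmetric] mat_tr_pow ..
  qed
  interpret S: gaussian_sequence p' "\<lambda>k. \<Sigma> (k + K)" Q lam n' "\<lambda>k. \<mu> (k + K)" "\<lambda>k. \<mu>0 (k + K)" R c LD LI LS b
  proof (rule gaussian_sequence.intro)
    show "gaussian_sample (p' k) (\<Sigma> (k + K)) (Q k) (lam k) (n' k) (\<mu> (k + K)) (\<mu>0 (k + K)) (R k)" for k by (rule sample)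
    show "0 < p' k" "p' k < n' k" for k using K[of "k + K"] by (simp_all add: p'_def n'_def)
    show "filterlim n' at_top sequentially" "filterlim p' at_top sequentially"
      unfolding n'_def[abs_def] p'_def[abs_def]
      by (rule filterlim_compose[OF A1(1) filterlim_add_const_nat_at_top] filterlim_compose[OF A1(2) filterlim_add_const_nat_at_top])+
    show "(\<lambda>k. real (p' k) / real (n' k)) \<longlonglongrightarrow> c" unfolding n'_def p'_def by (rule shift[OF A1(3)])
    show "(\<lambda>k. (\<Sum>r<p' k. lam k r ^ i) / real (p' k)) \<longlonglongrightarrow> b i" if "i \<in> {1..4}" for i
    proof -
      have "a i \<longlonglongrightarrow> b i" using b[of i] that by auto
      from shift[OF this] show ?thesis unfolding a_eq .
    qed
    interpret s: gaussian_sample "p' k" "\<Sigma> (k + K)" "Q k" "lam k" "n' k" "\<mu> (k + K)" "\<mu>0 (k + K)" "R k" for k by (rule sample)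
    show "(\<lambda>k. sqrt (real (n' k)) * (\<Sum>r<p' k. (s.shift k r)\<^sup>2)) \<longlonglongrightarrow> LD"
      "(\<lambda>k. sqrt (real (n' k)) * (\<Sum>r<p' k. lam k r * (s.shift k r)\<^sup>2)) \<longlonglongrightarrow> LI"
      "(\<lambda>k. sqrt (real (n' k)) * (\<Sum>r<p' k. (lam k r * s.shift k r)\<^sup>2)) \<longlonglongrightarrow> LS"
      unfolding s.Delta_sq_eq[symmetric] s.Delta_I_sq_eq[symmetric] s.Delta_Sigma_sq_eq[symmetric] n'_def
      by (rule shift[OF LD] shift[OF LI(2)] shift[OF LS])+
  qed (use A1 b12 in auto)
  define r where "r = rho_star c (b 1) (b 2)"
  note r01 = optimal_weight(1,2)[OF A1(4,5) b12(1,2), folded r_def]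
  note optimal = optimal_weight(3)[OF A1(4,5) b12(1,2), of LD, folded r_def LI_eq]
  define limit where "limit = Phi (sqrt (1 - c) * LD / sqrt (c * (b 1 * sqrt ((1 - c) / b 2) + 1)) - z_upper \<alpha>)"
  define P where "P \<rho> k = measure (M k) {\<omega> \<in> space (M k). T_standardized (N k) (p k) (\<mu>0 k) (\<rho> k (x k \<omega>)) (x k \<omega>) \<ge> z_upper \<alpha>}"
    for \<rho> :: "nat \<Rightarrow> (nat \<Rightarrow> real vec) \<Rightarrow> real" and k
  have P_lim: "P \<rho> \<longlonglongrightarrow> limit"
    if \<rho>: "\<And>k. \<rho> k = rho_hat (N k) (p k) \<or> (\<exists>r. \<rho> k = (\<lambda>_. r))"
      and lim: "tends_in_prob S.s.G (\<lambda>k h. \<rho> (k + K) (S.s.obs k h)) r" for \<rho>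
  proof (rule unshift)
    have N': "N (k + K) = Suc (n' k)" for k by (simp add: N n'_def)
    have meas: "(\<lambda>h. \<rho> (k + K) (S.s.obs k h)) \<in> borel_measurable (S.s.G k)" for k
    proof -
      interpret m: measurable_sample "S.s.G k" "Suc (n' k)" "p' k" "S.s.obs k" by (rule S.s.obs_measurable_sample)
      show ?thesis using \<rho>[of "k + K"] m.rho_hat_measurable by (auto simp: N' p'_def[symmetric])
    qed
    have eq: "P \<rho> (k + K) = measure (S.s.G k) {h\<in>space (S.s.G k). z_upper \<alpha> \<le>
        T_standardized (Suc (n' k)) (p' k) (\<mu>0 (k + K)) (\<rho> (k + K) (S.s.obs k h)) (S.s.obs k h)}" for k
      unfolding P_def x_def N' p'_def[symmetric]
      using prob[of "k + K"] indep[of "k + K"] normal[of _ "k + K"] \<rho>[of "k + K"]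
      unfolding N' p'_def[symmetric]
      by (intro S.s.measure_data_level) auto
    show "(\<lambda>k. P \<rho> (k + K)) \<longlonglongrightarrow> limit"
      unfolding eq limit_def optimal[symmetric] by (rule S.power_limit[OF lim r01 meas])
  qed
  have hat: "P (\<lambda>k. rho_hat (N k) (p k)) \<longlonglongrightarrow> limit"
  proof (rule P_lim)
    show "tends_in_prob S.s.G (\<lambda>k h. rho_hat (N (k + K)) (p (k + K)) (S.s.obs k h)) r"
      using S.rho_hat_limit by (simp add: N r_def n'_def p'_def)
  qed simp
  have star: "P (\<lambda>k _. rho_star c (a 1 k) (a 2 k)) \<longlonglongrightarrow> limit"
  proof (rule P_lim)
    have "(\<lambda>k. (c, a 1 k, a 2 k)) \<longlonglongrightarrow> (c, b 1, b 2)" by (intro tendsto_Pair tendsto_const b12)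
    from isCont_tendsto_compose[OF isCont_rho_star[OF A1(4,5) b12(1,2)] this]
    have "(\<lambda>k. rho_star c (a 1 k) (a 2 k)) \<longlonglongrightarrow> r" by (simp add: r_def)
    from tends_in_prob_const[OF shift[OF this]]
    show "tends_in_prob S.s.G (\<lambda>k h. rho_star c (a 1 (k + K)) (a 2 (k + K))) r" .
  qed blast
  have "(\<lambda>k. Phi (sqrt (real (n k) * (1 - c)) * Delta_sq (\<mu> k) (\<mu>0 k) (\<Sigma> k)
                   / sqrt (c * (a 1 k * sqrt ((1 - c) / a 2 k) + 1)) - z_upper \<alpha>)) \<longlonglongrightarrow> limit"
    unfolding limit_def
  proof (rule isCont_tendsto_compose[OF isCont_Phi], rule tendsto_diff[OF tendsto_divide tendsto_const])
    show "(\<lambda>k. sqrt (real (n k) * (1 - c)) * Delta_sq (\<mu> k) (\<mu>0 k) (\<Sigma> k)) \<longlonglongrightarrow> sqrt (1 - c) * LD"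
      using tendsto_mult[OF tendsto_const[of "sqrt (1 - c)"] LD] by (simp add: real_sqrt_mult mult_ac)
    show "(\<lambda>k. sqrt (c * (a 1 k * sqrt ((1 - c) / a 2 k) + 1))) \<longlonglongrightarrow> sqrt (c * (b 1 * sqrt ((1 - c) / b 2) + 1))"
      using b12 by (intro tendsto_intros) auto
    have "0 < b 1 * sqrt ((1 - c) / b 2) + 1" using b12 A1 by (intro add_nonneg_pos) auto
    then show "sqrt (c * (b 1 * sqrt ((1 - c) / b 2) + 1)) \<noteq> 0" using A1 by simp
  qed
  from tendsto_diff[OF hat this] tendsto_diff[OF hat star] show ?thesis by (simp add: P_def)
qed

end
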